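(* Let $c,f\in C^1(\overline\Omega\times\mathbb R)$ with $c(\mathbf x,\sigma)\ge\kappa_0>0$ for all $(\mathbf x,\sigma)\in\overline\Omega\times\mathbb R$, let $\alpha\in L^\infty(\Omega\times(0,T))$, let $s>d/2+1$, and let $M>0$. For each $\Phi\in B_M$, $\lambda>0$ and $\varepsilon>0$, the functional $J_\Phi^{\lambda,\varepsilon}$ (defined in the context) admits a unique minimizer in $B_M$.
   Context: Setting. $\Omega\subset\mathbb R^d$, $d\ge1$, is a bounded domain with smooth boundary and outward unit normal $\nu$; $T>0$; $N\ge0$ is an integer. $H\in C^1(\overline\Omega;\mathbb R^d)$ is a vector field, $\Gamma_-=\{\mathbf x\in\partial\Omega: H\cdot\nu\le0\}$, $\Gamma_+=\{\mathbf x\in\partial\Omega:H\cdot\nu>0\}$. $\varphi_*\in C^2(\overline\Omega)$ satisfies $H(\mathbf x)\cdot\nabla\varphi_*(\mathbf x)\ge\mu_0>0$ on $\overline\Omega$. For a vector $U=(u_0,\dots,u_N)^\top$ of functions, $H\cdot\nabla U$ is taken componentwise and $|U|^2=\sum_m|u_m|^2$. Temporal basis. With $P_n$ the Legendre polynomial of degree $n$ on $[-1,1]$ ($\int_{-1}^1P_nP_m=\frac{2}{2n+1}\delta_{nm}$), set $\Psi_n(t)=\sqrt{\frac{2n+1}{T}}\,e^tP_n(\frac{2t}{T}-1)$, $t\in[0,T]$. Frozen nonlinearity. For $\Phi=(\phi_0,\dots,\phi_N)^\top$ and $V=(v_0,\dots,v_N)^\top$, put $\phi(\mathbf x,t)=\sum_{j=0}^N\phi_j(\mathbf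 x)\Psi_j(t)$ and define $\mathcal N(\mathbf x;\Phi,V)\in\mathbb R^{N+1}$ by $$[\mathcal N(\mathbf x;\Phi,V)]_m=\sum_{n=0}^N\big(S_{mn}(\mathbf x,\Phi)+M_{mn}(\mathbf x,\Phi)\big)v_n(\mathbf x)+F_m(\mathbf x,\Phi),\quad m=0,\dots,N,$$ $$S_{mn}=\int_0^T\frac{e^{-2t}\Psi_n'(t)\Psi_m(t)}{c(\mathbf x,\phi(\mathbf x,t))}dt,\quad M_{mn}=\int_0^T\frac{e^{-2t}\Psi_m(t)}{c(\mathbf x,\phi(\mathbf x,t))}\Big(\int_0^t\alpha(\mathbf x,t-t')\Psi_n(t')dt'\Big)dt,$$ $$F_m=\int_0^T\frac{e^{-2t}f(\mathbf x,\phi(\mathbf x,t))}{c(\mathbf x,\phi(\mathbf x,t))}\Psi_m(t)\,dt.$$ Data. $g$ on $\Gamma_-\times(0,T)$ and $h$ on $\Gamma_+\times(0,T)$ are given square-integrable boundary data; $G=(g_0,\dots,g_N)^\top$ and $D^{\mathrm{obs}}=(h_0,\dots,h_N)^\top$ with $g_m(\mathbf x)=\int_0^Te^{-2t}g(\mathbf x,t)\Psi_m(t)dt$, $h_m(\mathbf x)=\int_0^Te^{-2t}h(\mathbf x,t)\Psi_m(t)dt$, so $G\in[L^2(\Gamma_-)]^{N+1}$ and $D^{\mathrm{obs}}\in[L^2(\Gamma_+)]^{N+1}$. Admissible set and functional. $B_M=\{V\in[H^s(\Omega)]^{N+1}:\|V\|_{[H^s(\Omega)]^{N+1}}\le M\}$.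 For $\Phi\in B_M$, $\lambda,\varepsilon>0$ and $U\in B_M$, $$J_\Phi^{\lambda,\varepsilon}(U)=\int_\Omega e^{2\lambda\varphi_*}|H\cdot\nabla U+\mathcal N(\mathbf x;\Phi,U)|^2d\mathbf x+\lambda^2\int_{\Gamma_-}e^{2\lambda\varphi_*}|U-G|^2dS+\lambda^2\int_{\Gamma_+}e^{2\lambda\varphi_*}|U-D^{\mathrm{obs}}|^2dS+\varepsilon\|U\|^2_{[H^s(\Omega)]^{N+1}}.$$ *)

theory Defs
  imports "HOL-Analysis.Analysis" "HOL-Computational_Algebra.Polynomial"
begin

section \<open>Classical differentiability\<close>

definition grad :: "('a::euclidean_space \<Rightarrow> real) \<Rightarrow> 'a \<Rightarrow> 'a" where
  "grad f x = (\<Sum>b\<in>Basis. frechet_derivative f (at x) b *\<^sub>R b)"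

primrec C_k :: "nat \<Rightarrow> ('a::euclidean_space \<Rightarrow> real) \<Rightarrow> bool" where
  "C_k 0 f \<longleftrightarrow> continuous_on UNIV f"
| "C_k (Suc k) f \<longleftrightarrow> (\<forall>x. f differentiable (at x)) \<and>
     (\<forall>b\<in>Basis. C_k k (\<lambda>x. frechet_derivative f (at x) b))"

definition smooth :: "('a::euclidean_space \<Rightarrow> real) \<Rightarrow> bool" where
  "smooth f \<longleftrightarrow> (\<forall>k. C_k k f)"

text \<open>For open \<open>S\<close>, the spaces \<open>C\<^sup>1\<close> and \<open>C\<^sup>2\<close> of the closure of \<open>S\<close>: the function and its
  derivatives, which are taken in the open set \<open>S\<close>, extend continuously to the closure.\<close>

definition C1_closure :: "'a::real_normed_vector set \<Rightarrow> ('a \<Rightarrow> 'b::real_normed_vector) \<Rightarrow> bool" where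
  "C1_closure S f \<longleftrightarrow> continuous_on (closure S) f \<and>
     (\<exists>f'. continuous_on (closure S) f' \<and>
           (\<forall>x\<in>S. (f has_derivative blinfun_apply (f' x)) (at x)))"

definition C2_closure :: "'a::real_normed_vector set \<Rightarrow> ('a \<Rightarrow> 'b::real_normed_vector) \<Rightarrow> bool" where
  "C2_closure S f \<longleftrightarrow> continuous_on (closure S) f \<and>
     (\<exists>f'. C1_closure S f' \<and> (\<forall>x\<in>S. (f has_derivative blinfun_apply (f' x)) (at x)))"

text \<open>The gradient on the closure of \<open>\<Omega>\<close>: on the boundary it is the continuous extension of the
  gradient in \<open>\<Omega>\<close>.\<close>

definition grad_closure :: "'a::euclidean_space set \<Rightarrow> ('a \<Rightarrow> real) \<Rightarrow> 'a \<Rightarrow> 'a" where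
  "grad_closure \<Omega> f x = Lim (at x within \<Omega>) (grad f)"

section \<open>Smooth domains\<close>

text \<open>In the ball around \<open>p\<close>, the set \<open>\<Omega>\<close> is the strict subgraph, in the direction of the unit
  vector \<open>e\<close>, of a smooth function; only the values of \<open>\<gamma>\<close> on the hyperplane orthogonal to \<open>e\<close>
  matter.\<close>

definition graph_chart ::
  "'a::euclidean_space set \<Rightarrow> 'a \<Rightarrow> real \<Rightarrow> 'a \<Rightarrow> ('a \<Rightarrow> real) \<Rightarrow> bool" where
  "graph_chart \<Omega> p r e \<gamma> \<longleftrightarrow> r > 0 \<and> norm e = 1 \<and> smooth \<gamma> \<and>
     (\<forall>x\<in>ball p r. x \<in> \<Omega> \<longleftrightarrow> x \<bullet> e < \<gamma> (x - (x \<bullet> e) *\<^sub>R e))"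

definition smooth_bounded_domain :: "'a::euclidean_space set \<Rightarrow> bool" where
  "smooth_bounded_domain \<Omega> \<longleftrightarrow> open \<Omega> \<and> connected \<Omega> \<and> \<Omega> \<noteq> {} \<and> bounded \<Omega> \<and>
     (\<forall>p\<in>frontier \<Omega>. \<exists>r e \<gamma>. graph_chart \<Omega> p r e \<gamma>)"

text \<open>The normalized gradient of the local defining function, which is negative inside \<open>\<Omega>\<close>.\<close>

definition outward_normal :: "'a::euclidean_space set \<Rightarrow> 'a \<Rightarrow> 'a" where
  "outward_normal \<Omega> p = (THE n. \<exists>r e \<gamma>. graph_chart \<Omega> p r e \<gamma> \<and>
     n = sgn (grad (\<lambda>x. x \<bullet> e - \<gamma> (x - (x \<bullet> e) *\<^sub>R e)) p))"

definition Gamma_minus :: "'a::euclidean_space set \<Rightarrow> ('a \<Rightarrow> 'a) \<Rightarrow> 'a set" where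
  "Gamma_minus \<Omega> H = {p \<in> frontier \<Omega>. H p \<bullet> outward_normal \<Omega> p \<le> 0}"

definition Gamma_plus :: "'a::euclidean_space set \<Rightarrow> ('a \<Rightarrow> 'a) \<Rightarrow> 'a set" where
  "Gamma_plus \<Omega> H = {p \<in> frontier \<Omega>. H p \<bullet> outward_normal \<Omega> p > 0}"

section \<open>Surface measure\<close>

text \<open>The surface measure is the \<open>(d - 1)\<close>-dimensional Hausdorff measure, normalized to agree with
  Lebesgue measure on hyperplanes, on all Caratheodory measurable sets.\<close>

definition hausdorff_pre :: "nat \<Rightarrow> real \<Rightarrow> 'a::metric_space set \<Rightarrow> ennreal" where
  "hausdorff_pre n \<delta> A = Inf {(\<Sum>i. if C i = {} then 0 else ennreal (diameter (C i) ^ n)) | C.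
     A \<subseteq> (\<Union>i::nat. C i) \<and> (\<forall>i. bounded (C i) \<and> diameter (C i) \<le> \<delta>)}"

definition hausdorff_outer :: "nat \<Rightarrow> 'a::metric_space set \<Rightarrow> ennreal" where
  "hausdorff_outer n A =
     ennreal (unit_ball_vol (real n) / 2 ^ n) * (SUP \<delta>\<in>{0<..}. hausdorff_pre n \<delta> A)"

definition surface_measure :: "'a::euclidean_space measure" where
  "surface_measure = measure_of UNIV
     (lambda_system UNIV (Pow UNIV) (hausdorff_outer (DIM('a) - 1)))
     (hausdorff_outer (DIM('a) - 1))"

section \<open>Sobolev spaces\<close>

definition square_integrable :: "'a measure \<Rightarrow> ('a \<Rightarrow> 'b::euclidean_space) \<Rightarrow> bool" where
  "square_integrable M f \<longleftrightarrow> f \<in> borel_measurable M \<and> integrable M (\<lambda>x. (norm (f x))\<^sup>2)"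

text \<open>\<open>W\<close> is the Fourier--Plancherel transform of the \<open>L\<^sup>2\<close> function \<open>w\<close>: the \<open>L\<^sup>2\<close> limit of the
  (unitary) Fourier integrals over balls of radius tending to infinity.\<close>

definition fourier_trunc :: "('a::euclidean_space \<Rightarrow> real) \<Rightarrow> real \<Rightarrow> 'a \<Rightarrow> complex" where
  "fourier_trunc w R \<xi> = complex_of_real ((2 * pi) powr (- real DIM('a) / 2)) *
     (LINT x:cball 0 R|lborel. complex_of_real (w x) * cis (- (x \<bullet> \<xi>)))"

definition is_fourier :: "('a::euclidean_space \<Rightarrow> real) \<Rightarrow> ('a \<Rightarrow> complex) \<Rightarrow> bool" where
  "is_fourier w W \<longleftrightarrow> square_integrable lborel w \<and> square_integrable lborel W \<and>
     ((\<lambda>R. \<integral>\<^sup>+\<xi>. ennreal ((norm (W \<xi> - fourier_trunc w R \<xi>))\<^sup>2) \<partial>lborel) \<longlongrightarrow> 0) at_top"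

definition fourier :: "('a::euclidean_space \<Rightarrow> real) \<Rightarrow> 'a \<Rightarrow> complex" where
  "fourier w = (SOME W. is_fourier w W)"

text \<open>\<open>H\<^sup>s\<close> of the whole space, for real \<open>s \<ge> 0\<close>.\<close>

definition Hs_whole :: "real \<Rightarrow> ('a::euclidean_space \<Rightarrow> real) set" where
  "Hs_whole s = {w. square_integrable lborel w \<and>
     integrable lborel (\<lambda>\<xi>. (1 + (norm \<xi>)\<^sup>2) powr s * (norm (fourier w \<xi>))\<^sup>2)}"

definition Hs_whole_norm :: "real \<Rightarrow> ('a::euclidean_space \<Rightarrow> real) \<Rightarrow> real" where
  "Hs_whole_norm s w =
     sqrt (LINT \<xi>|lborel. (1 + (norm \<xi>)\<^sup>2) powr s * (norm (fourier w \<xi>))\<^sup>2)"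

text \<open>\<open>H\<^sup>s(\<Omega>)\<close> consists of the restrictions to \<open>\<Omega>\<close> of functions in \<open>H\<^sup>s\<close> of the whole space, with the
  quotient norm. Its elements are functions whose values outside \<open>\<Omega>\<close>, or on a null set, are
  irrelevant.\<close>

definition Hs_extensions ::
  "'a::euclidean_space set \<Rightarrow> real \<Rightarrow> ('a \<Rightarrow> real) \<Rightarrow> ('a \<Rightarrow> real) set" where
  "Hs_extensions \<Omega> s u = {w \<in> Hs_whole s. AE x in lebesgue_on \<Omega>. w x = u x}"

definition Hs :: "'a::euclidean_space set \<Rightarrow> real \<Rightarrow> ('a \<Rightarrow> real) set" where
  "Hs \<Omega> s = {u. Hs_extensions \<Omega> s u \<noteq> {}}"

definition Hs_norm :: "'a::euclidean_space set \<Rightarrow> real \<Rightarrow> ('a \<Rightarrow> real) \<Rightarrow> real" where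
  "Hs_norm \<Omega> s u = Inf (Hs_whole_norm s ` Hs_extensions \<Omega> s u)"

text \<open>Vectors of \<open>N + 1\<close> functions are indexed by \<open>{..N}\<close>; other indices are irrelevant.\<close>

definition Hs_vec :: "'a::euclidean_space set \<Rightarrow> real \<Rightarrow> nat \<Rightarrow> (nat \<Rightarrow> 'a \<Rightarrow> real) set" where
  "Hs_vec \<Omega> s N = {V. \<forall>m\<le>N. V m \<in> Hs \<Omega> s}"

definition Hs_vec_norm ::
  "'a::euclidean_space set \<Rightarrow> real \<Rightarrow> nat \<Rightarrow> (nat \<Rightarrow> 'a \<Rightarrow> real) \<Rightarrow> real" where
  "Hs_vec_norm \<Omega> s N V = sqrt (\<Sum>m\<le>N. (Hs_norm \<Omega> s (V m))\<^sup>2)"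

definition Hs_ball ::
  "'a::euclidean_space set \<Rightarrow> real \<Rightarrow> nat \<Rightarrow> real \<Rightarrow> (nat \<Rightarrow> 'a \<Rightarrow> real) set" where
  "Hs_ball \<Omega> s N M = {V \<in> Hs_vec \<Omega> s N. Hs_vec_norm \<Omega> s N V \<le> M}"

definition test_function :: "'a::euclidean_space set \<Rightarrow> ('a \<Rightarrow> real) \<Rightarrow> bool" where
  "test_function \<Omega> \<psi> \<longleftrightarrow> smooth \<psi> \<and> compact (closure {x. \<psi> x \<noteq> 0}) \<and>
     closure {x. \<psi> x \<noteq> 0} \<subseteq> \<Omega>"

definition is_weak_grad ::
  "'a::euclidean_space set \<Rightarrow> ('a \<Rightarrow> real) \<Rightarrow> ('a \<Rightarrow> 'a) \<Rightarrow> bool" where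
  "is_weak_grad \<Omega> u v \<longleftrightarrow>
     (\<forall>K. compact K \<and> K \<subseteq> \<Omega> \<longrightarrow> u absolutely_integrable_on K \<and> v absolutely_integrable_on K) \<and>
     (\<forall>\<psi> b. test_function \<Omega> \<psi> \<and> b \<in> Basis \<longrightarrow>
        (LINT x:\<Omega>|lebesgue. u x * frechet_derivative \<psi> (at x) b) =
        - (LINT x:\<Omega>|lebesgue. (v x \<bullet> b) * \<psi> x))"

definition weak_grad :: "'a::euclidean_space set \<Rightarrow> ('a \<Rightarrow> real) \<Rightarrow> 'a \<Rightarrow> 'a" where
  "weak_grad \<Omega> u = (SOME v. is_weak_grad \<Omega> u v)"

text \<open>The boundary values of \<open>u\<close> are those of its representative that is continuous on the closure
  of \<open>\<Omega>\<close>, which exists for \<open>u\<close> in \<open>H\<^sup>s(\<Omega>)\<close> with \<open>s > d / 2\<close> by the Sobolev embedding.\<close>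

definition boundary_value :: "'a::euclidean_space set \<Rightarrow> ('a \<Rightarrow> real) \<Rightarrow> 'a \<Rightarrow> real" where
  "boundary_value \<Omega> u = (SOME v. continuous_on (closure \<Omega>) v \<and> (AE x in lebesgue_on \<Omega>. v x = u x))"

definition Linfty_on :: "'a::euclidean_space set \<Rightarrow> ('a \<Rightarrow> real) \<Rightarrow> bool" where
  "Linfty_on S f \<longleftrightarrow> f \<in> borel_measurable (lebesgue_on S) \<and>
     (\<exists>K. AE x in lebesgue_on S. \<bar>f x\<bar> \<le> K)"

section \<open>Temporal basis\<close>

text \<open>Rodrigues' formula for the Legendre polynomials.\<close>

definition legendre :: "nat \<Rightarrow> real poly" where
  "legendre n = smult (1 / (2 ^ n * fact n)) ((pderiv ^^ n) ([:-1, 0, 1:] ^ n))"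

definition Psi :: "real \<Rightarrow> nat \<Rightarrow> real \<Rightarrow> real" where
  "Psi T n t = sqrt ((2 * real n + 1) / T) * exp t * poly (legendre n) (2 * t / T - 1)"

definition time_coeff :: "real \<Rightarrow> ('a \<Rightarrow> real \<Rightarrow> real) \<Rightarrow> nat \<Rightarrow> 'a \<Rightarrow> real" where
  "time_coeff T g m x = (LINT t:{0<..<T}|lebesgue. exp (-2 * t) * g x t * Psi T m t)"

section \<open>Frozen nonlinearity and functional\<close>

definition time_expansion :: "real \<Rightarrow> nat \<Rightarrow> (nat \<Rightarrow> 'a \<Rightarrow> real) \<Rightarrow> 'a \<Rightarrow> real \<Rightarrow> real" where
  "time_expansion T N \<Phi> x t = (\<Sum>j\<le>N. \<Phi> j x * Psi T j t)"

definition S_coeff :: "real \<Rightarrow> nat \<Rightarrow> ('a \<Rightarrow> real \<Rightarrow> real) \<Rightarrow> (nat \<Rightarrow> 'a \<Rightarrow> real) \<Rightarrow>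
    nat \<Rightarrow> nat \<Rightarrow> 'a \<Rightarrow> real" where
  "S_coeff T N c \<Phi> m n x =
     (LINT t:{0..T}|lebesgue.
        exp (-2 * t) * deriv (Psi T n) t * Psi T m t / c x (time_expansion T N \<Phi> x t))"

definition M_coeff :: "real \<Rightarrow> nat \<Rightarrow> ('a \<Rightarrow> real \<Rightarrow> real) \<Rightarrow> ('a \<Rightarrow> real \<Rightarrow> real) \<Rightarrow>
    (nat \<Rightarrow> 'a \<Rightarrow> real) \<Rightarrow> nat \<Rightarrow> nat \<Rightarrow> 'a \<Rightarrow> real" where
  "M_coeff T N c \<alpha> \<Phi> m n x =
     (LINT t:{0..T}|lebesgue.
        exp (-2 * t) * Psi T m t / c x (time_expansion T N \<Phi> x t) *
        (LINT t':{0..t}|lebesgue. \<alpha> x (t - t') * Psi T n t'))"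

definition F_coeff :: "real \<Rightarrow> nat \<Rightarrow> ('a \<Rightarrow> real \<Rightarrow> real) \<Rightarrow> ('a \<Rightarrow> real \<Rightarrow> real) \<Rightarrow>
    (nat \<Rightarrow> 'a \<Rightarrow> real) \<Rightarrow> nat \<Rightarrow> 'a \<Rightarrow> real" where
  "F_coeff T N c f \<Phi> m x =
     (LINT t:{0..T}|lebesgue.
        exp (-2 * t) * f x (time_expansion T N \<Phi> x t) / c x (time_expansion T N \<Phi> x t) *
        Psi T m t)"

definition frozen :: "real \<Rightarrow> nat \<Rightarrow> ('a \<Rightarrow> real \<Rightarrow> real) \<Rightarrow> ('a \<Rightarrow> real \<Rightarrow> real) \<Rightarrow>
    ('a \<Rightarrow> real \<Rightarrow> real) \<Rightarrow> (nat \<Rightarrow> 'a \<Rightarrow> real) \<Rightarrow> (nat \<Rightarrow> 'a \<Rightarrow> real) \<Rightarrow> nat \<Rightarrow> 'a \<Rightarrow> real" where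
  "frozen T N c f \<alpha> \<Phi> V m x =
     (\<Sum>n\<le>N. (S_coeff T N c \<Phi> m n x + M_coeff T N c \<alpha> \<Phi> m n x) * V n x) + F_coeff T N c f \<Phi> m x"

definition J_functional ::
  "'a::euclidean_space set \<Rightarrow> real \<Rightarrow> nat \<Rightarrow> real \<Rightarrow> ('a \<Rightarrow> 'a) \<Rightarrow> ('a \<Rightarrow> real) \<Rightarrow>
   ('a \<Rightarrow> real \<Rightarrow> real) \<Rightarrow> ('a \<Rightarrow> real \<Rightarrow> real) \<Rightarrow> ('a \<Rightarrow> real \<Rightarrow> real) \<Rightarrow>
   ('a \<Rightarrow> real \<Rightarrow> real) \<Rightarrow> ('a \<Rightarrow> real \<Rightarrow> real) \<Rightarrow>
   (nat \<Rightarrow> 'a \<Rightarrow> real) \<Rightarrow> real \<Rightarrow> real \<Rightarrow> (nat \<Rightarrow> 'a \<Rightarrow> real) \<Rightarrow> real" where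
  "J_functional \<Omega> T N s H phi_star c f \<alpha> g h \<Phi> lam \<epsilon> U =
     (LINT x:\<Omega>|lebesgue. exp (2 * lam * phi_star x) *
        (\<Sum>m\<le>N. (H x \<bullet> weak_grad \<Omega> (U m) x + frozen T N c f \<alpha> \<Phi> U m x)\<^sup>2)) +
     lam\<^sup>2 * (LINT p:Gamma_minus \<Omega> H|surface_measure. exp (2 * lam * phi_star p) *
        (\<Sum>m\<le>N. (boundary_value \<Omega> (U m) p - time_coeff T g m p)\<^sup>2)) +
     lam\<^sup>2 * (LINT p:Gamma_plus \<Omega> H|surface_measure. exp (2 * lam * phi_star p) *
        (\<Sum>m\<le>N. (boundary_value \<Omega> (U m) p - time_coeff T h m p)\<^sup>2)) +
     \<epsilon> * (Hs_vec_norm \<Omega> s N U)\<^sup>2"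

text \<open>Square-integrable data on \<open>\<Gamma> \<times> (0, T)\<close>, with respect to the completed product measure.\<close>

definition boundary_data :: "'a::euclidean_space set \<Rightarrow> real \<Rightarrow> ('a \<Rightarrow> real \<Rightarrow> real) \<Rightarrow> bool" where
  "boundary_data \<Gamma> T g \<longleftrightarrow>
     square_integrable
       (completion (restrict_space surface_measure \<Gamma> \<Otimes>\<^sub>M lebesgue_on {0<..<T}))
       (\<lambda>(p, t). g p t)"

end

theory Submission
  imports Defs "HOL-Probability.Probability"
begin

text \<open>
The functional \<open>J\<close> is a sum of integrals of squares of affine functions of \<open>U\<close>, with bounded nonnegative
weights, plus \<open>\<epsilon>\<close> times the square of a Hilbert norm. The direct method applies: by
the parallelogram identity a minimizing sequence is a Cauchy sequence, \<open>J\<close> is continuous along it,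
and two minimizers have distance zero. The abstract form of this argument is
\<open>midpoint_convex_has_minimizer\<close>; convexity at midpoints is all that it needs.

The norm of \<open>H\<^sup>s(\<Omega>)\<close> is a quotient norm, so the minimization takes place among tuples \<open>W\<close> of functions
in \<open>H\<^sup>s\<close> of the whole space whose norm is at most \<open>M\<close>. There the norm is the \<open>L\<^sup>2\<close> norm of a weighted
Fourier transform; hence the space is complete and satisfies the parallelogram identity
(\<open>Hs_whole_complete\<close>, \<open>Hs_whole_parallelogram\<close>). Let \<open>G W = E W + \<epsilon> |W|\<^sup>2\<close>, where \<open>E\<close> consists of the three
integrals and depends only on the values of \<open>W\<close> on the closure of \<open>\<Omega>\<close>. The extensions of a given
function form a closed convex set, so the quotient norm is attained (\<open>Hs_norm_attained\<close>, by the
same abstract lemma), and every \<open>V\<close> in \<open>B\<^sub>M\<close> has an admissible extension \<open>W\<close> with \<open>G W = J V\<close>. In the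
other direction \<open>J W \<le> G W\<close>. Thus a minimizer \<open>W0\<close> of \<open>G\<close> is also a minimizer of \<open>J\<close>, and if \<open>V\<close> is
another one, its optimal extension minimizes \<open>G\<close> and therefore equals \<open>W0\<close> almost everywhere.

The functional is written in terms of a weak gradient and of boundary values that are only
determined by their properties. Since \<open>s > d/2 + 1\<close>, the Fourier transform of a function in \<open>H\<^sup>s\<close> is
integrable even after multiplication by \<open>|\<xi>|\<close>, and Fourier inversion gives a \<open>C\<^sup>1\<close> representative
\<open>sob_rep\<close> with gradient \<open>sob_grad\<close>, both bounded by a constant times the norm. The weak gradient is
almost everywhere \<open>sob_grad\<close> (integration by parts and the fundamental lemma of the calculus of
variations), and the boundary values are those of \<open>sob_rep\<close>. So the affine functions under the
squares are uniformly bounded on the admissible set and converge pointwise when \<open>W\<close> converges in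
\<open>H\<^sup>s\<close>; dominated convergence makes \<open>E\<close> continuous (\<open>quad_tendsto\<close>).

Dominated convergence needs finite measures and square-integrable data. The coefficients of the
frozen nonlinearity agree almost everywhere with bounded Borel functions
(\<open>frozen_coefficients\<close>). Caratheodory's criterion makes Borel sets measurable for the surface
measure; the boundary of \<open>\<Omega>\<close> has finite measure because a tube of width \<open>\<eta>\<close> around a graph has
volume \<open>O(\<eta>)\<close> (\<open>frontier_surface_measure_finite\<close>); the outward normal is continuous, so the two parts
of the boundary are Borel sets. Finally, the temporal coefficients of square-integrable boundary
data are square integrable by the Cauchy--Schwarz inequality (\<open>time_coeff_square_integrable\<close>).
\<close>

section \<open>Minimizers of midpoint convex functionals\<close>

text \<open>For a minimizing sequence, the midpoints cannot go below the infimum, so the gap \<open>\<delta> * D u v\<close> in the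
convexity inequality tends to zero and the sequence is a Cauchy sequence for \<open>D\<close>. The function \<open>D\<close>
stands for a squared distance. No vector space structure enters, so that \<open>mid\<close> can act
componentwise on tuples and pointwise on functions.\<close>

lemma midpoint_convex_has_minimizer:
  fixes J :: "'b \<Rightarrow> real" and D :: "'b \<Rightarrow> 'b \<Rightarrow> real" and mid :: "'b \<Rightarrow> 'b \<Rightarrow> 'b"
  assumes ne: "K \<noteq> {}"
    and bdd: "\<And>u. u \<in> K \<Longrightarrow> 0 \<le> J u"
    and mid: "\<And>u v. u \<in> K \<Longrightarrow> v \<in> K \<Longrightarrow> mid u v \<in> K"
    and del: "\<delta> > 0"
    and conv: "\<And>u v. u \<in> K \<Longrightarrow> v \<in> K \<Longrightarrow> J (mid u v) + \<delta> * D u v \<le> (J u + J v) / 2"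
    and compl: "\<And>X. (\<And>n::nat. X n \<in> K) \<Longrightarrow> (\<forall>e>0. \<exists>N. \<forall>m\<ge>N. \<forall>n\<ge>N. D (X m) (X n) < e) \<Longrightarrow>
        \<exists>u\<in>K. (\<lambda>n. D (X n) u) \<longlonglongrightarrow> 0"
    and cont: "\<And>X u. (\<And>n::nat. X n \<in> K) \<Longrightarrow> u \<in> K \<Longrightarrow> (\<lambda>n. D (X n) u) \<longlonglongrightarrow> 0 \<Longrightarrow>
        (\<lambda>n. J (X n)) \<longlonglongrightarrow> J u"
  obtains u where "u \<in> K" "\<And>v. v \<in> K \<Longrightarrow> J u \<le> J v"
proof -
  define m where "m = Inf (J ` K)"
  have bb: "bdd_below (J ` K)" using bdd by (auto intro!: bdd_belowI[of _ 0])
  have mle: "m \<le> J v" if "v \<in> K" for v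
    unfolding m_def using bb that by (intro cInf_lower) auto
  have "\<exists>x\<in>K. J x < m + 1 / real (Suc n)" for n :: nat
  proof -
    have "Inf (J ` K) < m + 1 / real (Suc n)" by (simp add: m_def)
    then show ?thesis using ne bb by (subst (asm) cInf_less_iff) auto
  qed
  then obtain X where X: "\<And>n. X n \<in> K" "\<And>n. J (X n) < m + 1 / real (Suc n)" by metis
  have Dle: "\<delta> * D (X i) (X j) \<le> (1 / real (Suc i) + 1 / real (Suc j)) / 2" for i j
  proof -
    have "m + \<delta> * D (X i) (X j) \<le> (J (X i) + J (X j)) / 2"
      using conv[OF X(1)[of i] X(1)[of j]] mle[OF mid[OF X(1)[of i] X(1)[of j]]] by linarith
    then show ?thesis using X(2)[of i] X(2)[of j] by argo
  qed
  have "\<forall>e>0. \<exists>N. \<forall>i\<ge>N. \<forall>j\<ge>N. D (X i) (X j) < e"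
  proof (intro allI impI)
    fix e :: real assume e: "e > 0"
    then have "\<delta> * e > 0" using del by simp
    then obtain N where N: "1 / real (Suc N) < \<delta> * e" by (metis inverse_eq_divide reals_Archimedean)
    show "\<exists>N. \<forall>i\<ge>N. \<forall>j\<ge>N. D (X i) (X j) < e"
    proof (intro exI allI impI)
      fix i j assume "i \<ge> N" "j \<ge> N"
      then have "1 / real (Suc i) \<le> 1 / real (Suc N)" "1 / real (Suc j) \<le> 1 / real (Suc N)"
        by (auto simp: frac_le)
      then have "\<delta> * D (X i) (X j) < \<delta> * e" using Dle[of i j] N by argo
      then show "D (X i) (X j) < e" using del by simp
    qed
  qed
  from compl[OF X(1) this] obtain u where u: "u \<in> K" "(\<lambda>n. D (X n) u) \<longlonglongrightarrow> 0" by auto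
  have lim: "(\<lambda>n. J (X n)) \<longlonglongrightarrow> J u" using cont[OF X(1) u] .
  have "(\<lambda>n. m + 1 / real (Suc n)) \<longlonglongrightarrow> m + 0"
    by (intro tendsto_intros) (use LIMSEQ_inverse_real_of_nat in \<open>simp add: inverse_eq_divide\<close>)
  then have "J u \<le> m + 0"
    using X(2) by (intro LIMSEQ_le[OF lim]) (auto intro: less_imp_le)
  then show thesis using u mle that by force
qed

section \<open>Square-integrable functions\<close>

text \<open>The squared \<open>L\<^sup>2\<close> distance of two functions is \<open>L2sq\<close> of their difference. Values in \<open>ennreal\<close> make
limits and monotone estimates available before integrability is known.\<close>

definition L2sq :: "'a measure \<Rightarrow> ('a \<Rightarrow> 'b::real_normed_vector) \<Rightarrow> ennreal" where
  "L2sq M f = (\<integral>\<^sup>+x. ennreal ((norm (f x))\<^sup>2) \<partial>M)"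

lemma square_integrable_iff_L2sq:
  "square_integrable M f \<longleftrightarrow> f \<in> borel_measurable M \<and> L2sq M f < \<infinity>"
  unfolding square_integrable_def L2sq_def
  by (auto simp: integrable_iff_bounded)

lemma L2sq_eq_integral:
  "square_integrable M f \<Longrightarrow> L2sq M f = ennreal (\<integral>x. (norm (f x))\<^sup>2 \<partial>M)"
  unfolding square_integrable_def L2sq_def by (auto intro: nn_integral_eq_integral)

lemma L2sq_cong_AE: "AE x in M. f x = g x \<Longrightarrow> L2sq M f = L2sq M g"
  unfolding L2sq_def by (intro nn_integral_cong_AE) auto

lemma L2sq_add_le:
  fixes f g :: "'a \<Rightarrow> 'b::euclidean_space"
  assumes [measurable]: "f \<in> borel_measurable M" "g \<in> borel_measurable M"
  shows "L2sq M (\<lambda>x. f x + g x) \<le> 2 * L2sq M f + 2 * L2sq M g"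
proof -
  have "(norm (a + b))\<^sup>2 \<le> 2 * (norm a)\<^sup>2 + 2 * (norm b)\<^sup>2" for a b :: 'b
  proof -
    have "(norm (a + b))\<^sup>2 \<le> (norm a + norm b)\<^sup>2" by (intro power_mono norm_triangle_ineq) auto
    also have "\<dots> \<le> 2 * (norm a)\<^sup>2 + 2 * (norm b)\<^sup>2"
      using sum_squares_bound[of "norm a" "norm b"] by (simp add: power2_sum)
    finally show ?thesis .
  qed
  then have "ennreal ((norm (f x + g x))\<^sup>2) \<le> 2 * ennreal ((norm (f x))\<^sup>2) + 2 * ennreal ((norm (g x))\<^sup>2)" for x
    by (simp add: ennreal_mult'[symmetric] ennreal_plus[symmetric] ennreal_numeral[symmetric]
        del: ennreal_plus ennreal_numeral)
  then have "L2sq M (\<lambda>x. f x + g x) \<le> (\<integral>\<^sup>+x. 2 * ennreal ((norm (f x))\<^sup>2) + 2 * ennreal ((norm (g x))\<^sup>2) \<partial>M)"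
    unfolding L2sq_def by (intro nn_integral_mono)
  also have "\<dots> = 2 * L2sq M f + 2 * L2sq M g"
    unfolding L2sq_def by (subst nn_integral_add) (auto simp: nn_integral_cmult)
  finally show ?thesis .
qed

lemma L2sq_minus_commute: "L2sq M (\<lambda>x. f x - g x) = L2sq M (\<lambda>x. g x - f x)"
  unfolding L2sq_def by (simp add: norm_minus_commute)

lemma L2sq_diff_triangle:
  fixes f g h :: "'a \<Rightarrow> 'b::euclidean_space"
  assumes [measurable]: "f \<in> borel_measurable M" "g \<in> borel_measurable M" "h \<in> borel_measurable M"
  shows "L2sq M (\<lambda>x. f x - h x) \<le> 2 * L2sq M (\<lambda>x. f x - g x) + 2 * L2sq M (\<lambda>x. g x - h x)"
  using L2sq_add_le[of "\<lambda>x. f x - g x" M "\<lambda>x. g x - h x"] by simp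

lemma L2sq_eq_0_imp_AE:
  assumes [measurable]: "f \<in> borel_measurable M" and "L2sq M f = 0"
  shows "AE x in M. f x = 0"
  using assms unfolding L2sq_def by (subst (asm) nn_integral_0_iff_AE) auto

text \<open>A subsequence whose consecutive squared distances are below \<open>(1/8)\<^sup>k\<close> converges almost everywhere:
the weighted series of squares with weights \<open>4\<^sup>k\<close> has a finite integral, hence finite values, so the
increments are below a multiple of \<open>(1/2)\<^sup>k\<close>. Fatou's lemma turns pointwise into \<open>L\<^sup>2\<close> convergence.\<close>

lemma L2_complete:
  fixes f :: "nat \<Rightarrow> 'a \<Rightarrow> 'b::euclidean_space"
  assumes [measurable]: "\<And>n. f n \<in> borel_measurable M"
    and cau: "\<And>e. e > 0 \<Longrightarrow> \<exists>N. \<forall>m\<ge>N. \<forall>n\<ge>N. L2sq M (\<lambda>x. f m x - f n x) \<le> ennreal e"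
  obtains g where "g \<in> borel_measurable M" "(\<lambda>n. L2sq M (\<lambda>x. f n x - g x)) \<longlonglongrightarrow> 0"
proof -
  have "\<exists>N. \<forall>m\<ge>N. \<forall>n\<ge>N. L2sq M (\<lambda>x. f m x - f n x) \<le> ennreal ((1/8)^k)" for k :: nat
    using cau[of "(1/8)^k"] by simp
  then obtain N where N: "\<And>k m n. m \<ge> N k \<Longrightarrow> n \<ge> N k \<Longrightarrow> L2sq M (\<lambda>x. f m x - f n x) \<le> ennreal ((1/8)^k)"
    by metis
  \<comment> \<open>partial sums, so that the indices are monotone and dominate every earlier \<open>N j\<close>\<close>
  define r where "r k = (\<Sum>j\<le>k. N j)" for k
  have rN: "N k \<le> r k" "N k \<le> r (Suc k)" for k
    unfolding r_def by (auto intro!: member_le_sum intro: member_le_sum trans_le_add1)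
  have rge: "N j \<le> r k" if "j \<le> k" for j k
    unfolding r_def using that by (intro member_le_sum) auto
  define d where "d k x = f (r (Suc k)) x - f (r k) x" for k x
  have [measurable]: "d k \<in> borel_measurable M" for k unfolding d_def by measurable
  have "(\<integral>\<^sup>+x. (\<Sum>k. ennreal (4^k * (norm (d k x))\<^sup>2)) \<partial>M) = (\<Sum>k. \<integral>\<^sup>+x. ennreal (4^k * (norm (d k x))\<^sup>2) \<partial>M)"
    by (intro nn_integral_suminf) measurable
  also have "\<dots> \<le> (\<Sum>k. ennreal ((1/2)^k))"
  proof (intro suminf_le allI)
    fix k
    have "(\<integral>\<^sup>+x. ennreal (4^k * (norm (d k x))\<^sup>2) \<partial>M) = ennreal (4^k) * L2sq M (d k)"
      unfolding L2sq_def by (subst nn_integral_cmult[symmetric]) (auto simp: ennreal_mult)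
    also have "\<dots> \<le> ennreal (4^k) * ennreal ((1/8)^k)"
      using N[OF rN(2) rN(1)] unfolding d_def by (intro mult_left_mono) auto
    also have "\<dots> = ennreal ((1/2)^k)"
      by (simp add: ennreal_mult'[symmetric] power_mult_distrib[symmetric])
    finally show "(\<integral>\<^sup>+x. ennreal (4^k * (norm (d k x))\<^sup>2) \<partial>M) \<le> ennreal ((1/2)^k)" .
  qed auto
  also have "\<dots> = ennreal (\<Sum>k. (1/2)^k)"
    by (intro suminf_ennreal2) (auto simp: summable_geometric)
  also have "\<dots> < \<infinity>" by simp
  finally have "AE x in M. (\<Sum>k. ennreal (4^k * (norm (d k x))\<^sup>2)) \<noteq> \<infinity>"
    by (intro nn_integral_PInf_AE) auto
  then have conv: "AE x in M. convergent (\<lambda>k. f (r k) x)"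
  proof eventually_elim
    case (elim x)
    then obtain C where C: "(\<Sum>k. ennreal (4^k * (norm (d k x))\<^sup>2)) = ennreal C" "C \<ge> 0"
      by (metis ennreal_cases infinity_ennreal_def)
    have "norm (d k x) \<le> sqrt C * (1/2)^k" for k
    proof -
      have "ennreal (4^k * (norm (d k x))\<^sup>2) \<le> ennreal C"
        using sum_le_suminf[of "\<lambda>k. ennreal (4^k * (norm (d k x))\<^sup>2)" "{k}"] C(1) by simp
      then have "4^k * (norm (d k x))\<^sup>2 \<le> C" using C by simp
      moreover have "(4::real)^k = 2^k * 2^k" by (simp flip: power_mult_distrib)
      ultimately have "(2^k * norm (d k x))\<^sup>2 \<le> C"
        by (simp add: power2_eq_square algebra_simps)
      then have "2^k * norm (d k x) \<le> sqrt C" by (rule real_le_rsqrt)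
      then show ?thesis by (simp add: field_simps power_one_over)
    qed
    moreover have "summable (\<lambda>k. sqrt C * (1/2)^k)" by (intro summable_mult summable_geometric) simp
    ultimately have "summable (\<lambda>k. d k x)" by (intro summable_comparison_test'[of "\<lambda>k. sqrt C * (1/2)^k" 0 "\<lambda>k. d k x"]) auto
    then have 1: "convergent (\<lambda>n. \<Sum>k<n. d k x)" by (simp add: summable_iff_convergent)
    have 2: "f (r n) x = (\<Sum>k<n. d k x) + f (r 0) x" for n
      unfolding d_def using sum_lessThan_telescope[of "\<lambda>n. f (r n) x" n] by simp
    have "(\<lambda>n. f (r n) x) = (\<lambda>n. (\<Sum>k<n. d k x) + f (r 0) x)" using 2 by (rule ext)
    then show ?case using convergent_add[OF 1 convergent_const[of "f (r 0) x"]] by argo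
  qed
  define g where "g x = lim (\<lambda>k. f (r k) x)" for x
  have g[measurable]: "g \<in> borel_measurable M" unfolding g_def by measurable
  have tail: "L2sq M (\<lambda>x. f n x - g x) \<le> ennreal ((1/8)^k)" if n: "n \<ge> N k" for n k
  proof -
    have "L2sq M (\<lambda>x. f n x - g x) = (\<integral>\<^sup>+x. liminf (\<lambda>j. ennreal ((norm (f n x - f (r j) x))\<^sup>2)) \<partial>M)"
      unfolding L2sq_def
    proof (intro nn_integral_cong_AE, use conv in eventually_elim)
      case (elim x)
      then have "(\<lambda>j. f (r j) x) \<longlonglongrightarrow> g x" unfolding g_def by (simp add: convergent_LIMSEQ_iff)
      then have "(\<lambda>j. ennreal ((norm (f n x - f (r j) x))\<^sup>2)) \<longlonglongrightarrow> ennreal ((norm (f n x - g x))\<^sup>2)"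
        by (intro tendsto_intros)
      then show ?case by (rule lim_imp_Liminf[OF sequentially_bot, symmetric])
    qed
    also have "\<dots> \<le> liminf (\<lambda>j. L2sq M (\<lambda>x. f n x - f (r j) x))"
      unfolding L2sq_def by (intro nn_integral_liminf) measurable
    also have "\<dots> \<le> limsup (\<lambda>j. L2sq M (\<lambda>x. f n x - f (r j) x))"
      by (intro Liminf_le_Limsup) auto
    also have "\<dots> \<le> ennreal ((1/8)^k)"
      by (intro Limsup_bounded eventually_sequentiallyI[of k] N n rge)
    finally show ?thesis .
  qed
  have "(\<lambda>n. L2sq M (\<lambda>x. f n x - g x)) \<longlonglongrightarrow> 0"
  proof (rule order_tendstoI)
    fix a :: ennreal assume "0 < a"
    then obtain e where e: "e > 0" "ennreal e \<le> a"
      by (metis ennreal_cases ennreal_less_zero_iff less_eq_ennreal_def order_refl top_greatest zero_less_one ennreal_1)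
    obtain k where k: "(1/8::real)^k < e" using real_arch_pow_inv[of e "1/8"] e by auto
    show "\<forall>\<^sub>F n in sequentially. L2sq M (\<lambda>x. f n x - g x) < a"
    proof (rule eventually_sequentiallyI[of "N k"])
      fix n assume "n \<ge> N k"
      from tail[OF this] have "L2sq M (\<lambda>x. f n x - g x) \<le> ennreal ((1/8)^k)" .
      also have "\<dots> < ennreal e" using k e by (intro ennreal_lessI) auto
      finally show "L2sq M (\<lambda>x. f n x - g x) < a" using e by simp
    qed
  qed auto
  with g that show thesis by blast
qed

lemma L2sq_dominated_tendsto_0:
  fixes f :: "nat \<Rightarrow> 'a \<Rightarrow> 'b::euclidean_space"
  assumes [measurable]: "\<And>n. f n \<in> borel_measurable M" "k \<in> borel_measurable M"
    and lim: "AE x in M. (\<lambda>n. f n x) \<longlonglongrightarrow> 0"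
    and bound: "\<And>n. AE x in M. norm (f n x) \<le> k x" and fin: "L2sq M k < \<infinity>"
  shows "(\<lambda>n. L2sq M (f n)) \<longlonglongrightarrow> 0"
proof -
  have "(\<lambda>n. \<integral>\<^sup>+x. ennreal ((norm (f n x))\<^sup>2) \<partial>M) \<longlonglongrightarrow> (\<integral>\<^sup>+x. 0 \<partial>M)"
  proof (rule nn_integral_dominated_convergence[where w="\<lambda>x. ennreal ((norm (k x))\<^sup>2)"])
    show "AE x in M. ennreal ((norm (f j x))\<^sup>2) \<le> ennreal ((norm (k x))\<^sup>2)" for j
      using bound[of j] by eventually_elim (auto intro!: power_mono ennreal_leI)
    show "AE x in M. (\<lambda>i. ennreal ((norm (f i x))\<^sup>2)) \<longlonglongrightarrow> 0"
      using lim
    proof eventually_elim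
      case (elim x)
      then have "(\<lambda>i. ennreal ((norm (f i x))\<^sup>2)) \<longlonglongrightarrow> ennreal ((norm (0::'b))\<^sup>2)"
        by (intro tendsto_intros)
      then show ?case by simp
    qed
  qed (use fin in \<open>auto simp: L2sq_def\<close>)
  then show ?thesis by (simp add: L2sq_def)
qed

text \<open>Truncation in the argument and in the value makes \<open>w\<close> bounded with bounded support; such a function
is an almost everywhere limit of continuous functions, which are cut off in the same way.\<close>

lemma L2_dense_continuous_compact_support:
  fixes w :: "'a::euclidean_space \<Rightarrow> real"
  assumes w: "square_integrable lborel w" and e: "e > 0"
  obtains h R where "continuous_on UNIV h" "\<And>x. norm x > R \<Longrightarrow> h x = 0"
    "L2sq lborel (\<lambda>x. w x - h x) < ennreal e"
proof -
  have [measurable]: "w \<in> borel_measurable borel" and wf: "L2sq lborel w < \<infinity>"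
    using w by (auto simp: square_integrable_iff_L2sq)
  define v where "v k x = (if norm x \<le> real k \<and> \<bar>w x\<bar> \<le> real k then w x else 0)" for k x
  have [measurable]: "v k \<in> borel_measurable borel" for k unfolding v_def by measurable
  have "(\<lambda>k. L2sq lborel (\<lambda>x. w x - v k x)) \<longlonglongrightarrow> 0"
  proof (rule L2sq_dominated_tendsto_0[where k="\<lambda>x. \<bar>w x\<bar>"])
    show "AE x in lborel. (\<lambda>k. w x - v k x) \<longlonglongrightarrow> 0"
    proof (intro AE_I2 tendsto_eventually)
      fix x
      obtain n :: nat where "max (norm x) \<bar>w x\<bar> \<le> real n" using real_arch_simple by blast
      then show "\<forall>\<^sub>F k in sequentially. w x - v k x = 0"
        by (intro eventually_sequentiallyI[of n]) (auto simp: v_def)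
    qed
    show "AE x in lborel. norm (w x - v n x) \<le> \<bar>w x\<bar>" for n
      by (auto simp: v_def)
    show "L2sq lborel (\<lambda>x. \<bar>w x\<bar>) < \<infinity>" using wf by (simp add: L2sq_def)
  qed auto
  then have "\<forall>\<^sub>F k in sequentially. L2sq lborel (\<lambda>x. w x - v k x) < ennreal (e/4)"
    using e by (intro order_tendstoD) auto
  then obtain k where k: "L2sq lborel (\<lambda>x. w x - v k x) < ennreal (e/4)"
    by (auto simp: eventually_sequentially)
  have "v k measurable_on UNIV"
    by (intro lebesgue_measurable_imp_measurable_on_real) (auto intro: measurable_completion)
  then obtain N g where N: "negligible N" and g: "\<And>n. continuous_on UNIV (g n)"
    and lim: "\<And>x. x \<notin> N \<Longrightarrow> (\<lambda>n. g n x) \<longlonglongrightarrow> v k x"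
    unfolding measurable_on_def by auto
  \<comment> \<open>a cutoff that is 1 on the ball of radius \<open>k\<close> and 0 outside the ball of radius \<open>k + 1\<close>, times a
    truncation that does not change the limit \<open>v k\<close>, which has values in \<open>[-k, k]\<close>\<close>
  define h where "h n x = max 0 (min 1 (real k + 1 - norm x)) * max (- real k) (min (real k) (g n x))" for n x
  have hc: "continuous_on UNIV (h n)" for n
    unfolding h_def by (intro continuous_intros g)
  then have [measurable]: "h n \<in> borel_measurable borel" for n
    by (rule borel_measurable_continuous_onI)
  have "AE x in lebesgue. x \<notin> N" using N by (simp add: negligible_iff_null_sets AE_not_in)
  then have AEN: "AE x in lborel. x \<notin> N" by (simp add: AE_completion_iff)
  have hz: "h n x = 0" if "norm x > real k + 1" for n x using that by (simp add: h_def)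
  have hb: "\<bar>h n x\<bar> \<le> real k" for n x
  proof -
    have "\<bar>h n x\<bar> \<le> 1 * real k" unfolding h_def abs_mult by (intro mult_mono) auto
    then show ?thesis by simp
  qed
  have "(\<lambda>n. L2sq lborel (\<lambda>x. v k x - h n x)) \<longlonglongrightarrow> 0"
  proof (rule L2sq_dominated_tendsto_0[where k="\<lambda>x. 2 * real k * indicator (cball 0 (real k + 1)) x"])
    show "AE x in lborel. (\<lambda>n. v k x - h n x) \<longlonglongrightarrow> 0"
      using AEN
    proof eventually_elim
      case (elim x)
      have "(\<lambda>n. h n x) \<longlonglongrightarrow> max 0 (min 1 (real k + 1 - norm x)) * max (- real k) (min (real k) (v k x))"
        unfolding h_def by (intro tendsto_intros lim elim)
      also have "max 0 (min 1 (real k + 1 - norm x)) * max (- real k) (min (real k) (v k x)) = v k x"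
        by (auto simp: v_def min_def max_def)
      finally have "(\<lambda>n. h n x) \<longlonglongrightarrow> v k x" .
      from tendsto_diff[OF tendsto_const[of "v k x"] this] show ?case by simp
    qed
    show "AE x in lborel. norm (v k x - h n x) \<le> 2 * real k * indicator (cball 0 (real k + 1)) x" for n
    proof (intro AE_I2)
      fix x
      have "\<bar>v k x\<bar> \<le> real k" by (simp add: v_def)
      moreover have "v k x = 0" if "norm x > real k + 1" using that by (simp add: v_def)
      ultimately show "norm (v k x - h n x) \<le> 2 * real k * indicator (cball 0 (real k + 1)) x"
        using hb[of n x] hz[of x n] by (cases "norm x > real k + 1") auto
    qed
    have "L2sq lborel (\<lambda>x. 2 * real k * (indicator (cball (0::'a) (real k + 1)) x :: real)) =
       (\<integral>\<^sup>+x. ennreal ((2 * real k)\<^sup>2) * indicator (cball (0::'a) (real k + 1)) x \<partial>lborel)"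
      unfolding L2sq_def by (intro nn_integral_cong) (auto simp: indicator_def)
    also have "\<dots> < \<infinity>"
      by (subst nn_integral_cmult_indicator) (use emeasure_bounded_finite[OF bounded_cball] in \<open>auto simp: ennreal_mult_less_top\<close>)
    finally show "L2sq lborel (\<lambda>x. 2 * real k * (indicator (cball (0::'a) (real k + 1)) x :: real)) < \<infinity>" .
    show "(\<lambda>x::'a. 2 * real k * indicator (cball 0 (real k + 1)) x) \<in> borel_measurable lborel"
      by (intro borel_measurable_times borel_measurable_indicator) auto
  qed auto
  then have "\<forall>\<^sub>F n in sequentially. L2sq lborel (\<lambda>x. v k x - h n x) < ennreal (e/4)"
    using e by (intro order_tendstoD) auto
  then obtain n where n: "L2sq lborel (\<lambda>x. v k x - h n x) < ennreal (e/4)"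
    by (auto simp: eventually_sequentially)
  have "L2sq lborel (\<lambda>x. w x - h n x) \<le> 2 * L2sq lborel (\<lambda>x. w x - v k x) + 2 * L2sq lborel (\<lambda>x. v k x - h n x)"
    by (intro L2sq_diff_triangle) auto
  also have "\<dots> < 2 * ennreal (e/4) + 2 * ennreal (e/4)"
    using k n by (intro add_strict_mono ennreal_mult_strict_left_mono) auto
  also have "\<dots> = ennreal e"
    using e by (simp add: ennreal_plus[symmetric] ennreal_mult'[symmetric] ennreal_numeral[symmetric] del: ennreal_plus ennreal_numeral)
  finally show thesis using hc hz by (intro that[of "h n" "real k + 1"]) auto
qed

lemma nn_integral_lborel_translate:
  fixes z :: "'a::euclidean_space"
  assumes [measurable]: "f \<in> borel_measurable borel"
  shows "(\<integral>\<^sup>+x. f (x + z) \<partial>lborel) = (\<integral>\<^sup>+x. f x \<partial>lborel)"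
  by (subst lborel_distr_plus[of z, symmetric]) (simp add: nn_integral_distr add.commute)

lemma integral_lborel_translate:
  fixes z :: "'a::euclidean_space" and f :: "'a \<Rightarrow> 'b::{banach, second_countable_topology}"
  assumes [measurable]: "f \<in> borel_measurable borel"
  shows "(\<integral>x. f (x + z) \<partial>lborel) = (\<integral>x. f x \<partial>lborel)"
  by (subst (2) lborel_distr_plus[of z, symmetric]) (simp add: integral_distr add.commute)

lemma integrable_lborel_translate:
  fixes z :: "'a::euclidean_space" and f :: "'a \<Rightarrow> 'b::{banach, second_countable_topology}"
  assumes "integrable lborel f"
  shows "integrable lborel (\<lambda>x. f (x + z))"
proof -
  have [measurable]: "f \<in> borel_measurable borel" using assms by auto
  have "integrable (distr lborel borel ((+) z)) f" using assms by (simp add: lborel_distr_plus)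
  then show ?thesis by (subst (asm) integrable_distr_eq) (auto simp: add.commute)
qed

lemma L2sq_translate:
  fixes z :: "'a::euclidean_space"
  assumes "f \<in> borel_measurable borel"
  shows "L2sq lborel (\<lambda>x. f (x + z)) = L2sq lborel f"
  unfolding L2sq_def using assms
  by (intro nn_integral_lborel_translate[where f="\<lambda>x. ennreal ((norm (f x))\<^sup>2)"]) auto

text \<open>Clear for continuous functions with compact support; the general case follows by density, since
translations preserve the \<open>L\<^sup>2\<close> norm.\<close>

lemma L2_translation_continuous:
  fixes w :: "'a::euclidean_space \<Rightarrow> real"
  assumes w: "square_integrable lborel w" and z: "z \<longlonglongrightarrow> 0"
  shows "(\<lambda>n. L2sq lborel (\<lambda>x. w (x + z n) - w x)) \<longlonglongrightarrow> 0"
proof (rule order_tendstoI)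
  have [measurable]: "w \<in> borel_measurable borel" using w by (auto simp: square_integrable_iff_L2sq)
  fix a :: ennreal assume "0 < a"
  then obtain e where e: "e > 0" "ennreal e \<le> a"
    by (metis ennreal_cases ennreal_less_zero_iff less_eq_ennreal_def order_refl top_greatest zero_less_one ennreal_1)
  obtain h R where h: "continuous_on UNIV h" and hz: "\<And>x. norm x > R \<Longrightarrow> h x = 0"
    and wh: "L2sq lborel (\<lambda>x. w x - h x) < ennreal (e/10)"
    using L2_dense_continuous_compact_support[OF w, of "e/10"] e by auto
  have [measurable]: "h \<in> borel_measurable borel" using h by (rule borel_measurable_continuous_onI)
  obtain B where B: "\<And>n. norm (z n) \<le> B"
    using z Bseq_def[of z] convergent_imp_Bseq[of z] by (auto simp: convergent_def)
  have "compact (h ` cball 0 R)"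
    by (intro compact_continuous_image continuous_on_subset[OF h]) auto
  then have "bounded (h ` cball 0 R)" by (rule compact_imp_bounded)
  then obtain C where "\<forall>y\<in>h ` cball 0 R. norm y \<le> C" unfolding bounded_iff by blast
  then have C: "\<bar>h x\<bar> \<le> C" if "x \<in> cball 0 R" for x using that by (metis imageI real_norm_def)
  have hb: "\<bar>h x\<bar> \<le> \<bar>C\<bar>" for x using C[of x] hz[of x] by (cases "norm x > R") auto
  have "(\<lambda>n. L2sq lborel (\<lambda>x. h (x + z n) - h x)) \<longlonglongrightarrow> 0"
  proof (rule L2sq_dominated_tendsto_0[where k="\<lambda>x. 2 * \<bar>C\<bar> * indicator (cball 0 (R + B)) x"])
    show "AE x in lborel. (\<lambda>n. h (x + z n) - h x) \<longlonglongrightarrow> 0"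
    proof (intro AE_I2)
      fix x
      have "(\<lambda>n. x + z n) \<longlonglongrightarrow> x + 0" by (intro tendsto_intros z)
      then have "(\<lambda>n. h (x + z n)) \<longlonglongrightarrow> h x"
        using continuous_on_tendsto_compose[OF h] by simp
      from tendsto_diff[OF this tendsto_const[of "h x"]] show "(\<lambda>n. h (x + z n) - h x) \<longlonglongrightarrow> 0" by simp
    qed
    show "AE x in lborel. norm (h (x + z n) - h x) \<le> 2 * \<bar>C\<bar> * indicator (cball 0 (R + B)) x" for n
    proof (intro AE_I2)
      fix x
      show "norm (h (x + z n) - h x) \<le> 2 * \<bar>C\<bar> * indicator (cball 0 (R + B)) x"
      proof (cases "norm x > R + B")
        case True
        have "norm x \<le> norm (x + z n) + norm (z n)" using norm_triangle_ineq4[of "x + z n" "z n"] by simp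
        moreover have "0 \<le> B" using B[of n] norm_ge_zero order_trans by blast
        ultimately have "norm (x + z n) > R" "norm x > R" using B[of n] True by linarith+
        then show ?thesis using hz[of x] hz[of "x + z n"] by simp
      qed (use hb[of x] hb[of "x + z n"] in auto)
    qed
    have "L2sq lborel (\<lambda>x. 2 * \<bar>C\<bar> * (indicator (cball (0::'a) (R + B)) x :: real)) =
       (\<integral>\<^sup>+x. ennreal ((2 * C)\<^sup>2) * indicator (cball (0::'a) (R + B)) x \<partial>lborel)"
      unfolding L2sq_def by (intro nn_integral_cong) (auto simp: indicator_def power_mult_distrib)
    also have "\<dots> < \<infinity>"
      by (subst nn_integral_cmult_indicator) (use emeasure_bounded_finite[OF bounded_cball] in \<open>auto simp: ennreal_mult_less_top\<close>)
    finally show "L2sq lborel (\<lambda>x. 2 * \<bar>C\<bar> * (indicator (cball (0::'a) (R + B)) x :: real)) < \<infinity>" .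
    show "(\<lambda>x::'a. 2 * \<bar>C\<bar> * indicator (cball 0 (R + B)) x) \<in> borel_measurable lborel"
      by (intro borel_measurable_times borel_measurable_indicator) auto
  qed auto
  then have "\<forall>\<^sub>F n in sequentially. L2sq lborel (\<lambda>x. h (x + z n) - h x) < ennreal (e/10)"
    using e by (intro order_tendstoD) auto
  then show "\<forall>\<^sub>F n in sequentially. L2sq lborel (\<lambda>x. w (x + z n) - w x) < a"
  proof eventually_elim
    case (elim n)
    let ?W = "\<lambda>x. w (x + z n)" and ?H = "\<lambda>x. h (x + z n)"
    have "L2sq lborel (\<lambda>x. ?W x - ?H x) = L2sq lborel (\<lambda>x. w x - h x)"
      using L2sq_translate[of "\<lambda>x. w x - h x" "z n"] by simp
    then have 1: "L2sq lborel (\<lambda>x. ?W x - ?H x) < ennreal (e/10)" using wh by simp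
    have 2: "L2sq lborel (\<lambda>x. ?H x - w x) \<le> 2 * L2sq lborel (\<lambda>x. ?H x - h x) + 2 * L2sq lborel (\<lambda>x. h x - w x)"
      by (intro L2sq_diff_triangle) auto
    have "\<dots> < 2 * ennreal (e/10) + 2 * ennreal (e/10)"
      using elim wh by (intro add_strict_mono ennreal_mult_strict_left_mono) (auto simp: L2sq_minus_commute[of _ h])
    also have "\<dots> = ennreal (4 * e/10)"
      using e by (simp add: ennreal_plus[symmetric] ennreal_mult'[symmetric] ennreal_numeral[symmetric] del: ennreal_plus ennreal_numeral)
    finally have 3: "L2sq lborel (\<lambda>x. ?H x - w x) < ennreal (4 * e/10)" using 2 by simp
    have "L2sq lborel (\<lambda>x. ?W x - w x) \<le> 2 * L2sq lborel (\<lambda>x. ?W x - ?H x) + 2 * L2sq lborel (\<lambda>x. ?H x - w x)"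
      by (intro L2sq_diff_triangle) auto
    also have "\<dots> < 2 * ennreal (e/10) + 2 * ennreal (4 * e/10)"
      using 1 3 by (intro add_strict_mono ennreal_mult_strict_left_mono) auto
    also have "\<dots> = ennreal e"
      using e by (simp add: ennreal_plus[symmetric] ennreal_mult'[symmetric] ennreal_numeral[symmetric] del: ennreal_plus ennreal_numeral)
    finally show ?case using e by simp
  qed
qed auto

section \<open>The Fourier--Plancherel transform\<close>

lemma borel_measurable_cis [measurable]: "cis \<in> borel_measurable borel"
  by (intro borel_measurable_continuous_onI continuous_intros)

lemma integrable_product_bounded:
  fixes f :: "'a::euclidean_space \<Rightarrow> real" and g :: "'b::euclidean_space \<Rightarrow> real" and h :: "'a \<times> 'b \<Rightarrow> real"
  assumes f: "integrable lborel f" and g: "integrable lborel g"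
    and [measurable]: "h \<in> borel_measurable borel" and b: "\<And>p. \<bar>h p\<bar> \<le> C"
  shows "integrable (lborel \<Otimes>\<^sub>M lborel) (\<lambda>p. f (fst p) * g (snd p) * h p)"
proof -
  have [measurable]: "f \<in> borel_measurable borel" "g \<in> borel_measurable borel" using f g by auto
  have int: "integrable (lborel \<Otimes>\<^sub>M lborel) (\<lambda>p. f (fst p) * g (snd p))"
  proof (rule lborel_pair.Fubini_integrable)
    show "integrable lborel (\<lambda>x. \<integral>y. norm (f (fst (x, y)) * g (snd (x, y))) \<partial>lborel)"
      using f g by (simp add: abs_mult)
    show "AE x in lborel. integrable lborel (\<lambda>y. f (fst (x, y)) * g (snd (x, y)))"
      using g by auto
  qed measurable
  have hm[measurable]: "h \<in> borel_measurable (lborel \<Otimes>\<^sub>M lborel)" by (simp add: lborel_prod)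
  from int have "integrable (lborel \<Otimes>\<^sub>M lborel) (\<lambda>p. C * \<bar>f (fst p) * g (snd p)\<bar>)" by auto
  then show ?thesis
  proof (rule Bochner_Integration.integrable_bound)
    show "(\<lambda>p. f (fst p) * g (snd p) * h p) \<in> borel_measurable (lborel \<Otimes>\<^sub>M lborel)"
      using hm by measurable
    show "AE p in lborel \<Otimes>\<^sub>M lborel. norm (f (fst p) * g (snd p) * h p) \<le> norm (C * \<bar>f (fst p) * g (snd p)\<bar>)"
    proof (intro AE_I2)
      fix p
      have "0 \<le> C" using b[of p] by linarith
      then show "norm (f (fst p) * g (snd p) * h p) \<le> norm (C * \<bar>f (fst p) * g (snd p)\<bar>)"
        using mult_right_mono[OF b[of p], of "\<bar>f (fst p) * g (snd p)\<bar>"] by (simp add: abs_mult mult_ac)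
    qed
  qed
qed

subsection \<open>Gaussians\<close>

text \<open>The characteristic function of the standard normal distribution.\<close>

lemma gaussian_cis_integral:
  shows "integrable lborel (\<lambda>x. complex_of_real (exp (- x\<^sup>2 / 2)) * cis (t * x))"
    and "(\<integral>x. complex_of_real (exp (- x\<^sup>2 / 2)) * cis (t * x) \<partial>lborel) = complex_of_real (sqrt (2 * pi) * exp (- t\<^sup>2 / 2))"
proof -
  have i: "integrable lborel (\<lambda>x. std_normal_density x *\<^sub>R cis (t * x))"
    by (rule Bochner_Integration.integrable_bound[of _ std_normal_density])
       (auto simp: normal_density_nonneg integrable_std_normal_moment[of 0, simplified])
  have eq: "complex_of_real (exp (- x\<^sup>2 / 2)) * cis (t * x) = sqrt (2 * pi) *\<^sub>R (std_normal_density x *\<^sub>R cis (t * x))" for x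
    by (simp add: std_normal_density_def scaleR_conv_of_real field_simps)
  show "integrable lborel (\<lambda>x. complex_of_real (exp (- x\<^sup>2 / 2)) * cis (t * x))"
    unfolding eq using i by (rule integrable_scaleR_right)
  have "(\<integral>x. std_normal_density x *\<^sub>R cis (t * x) \<partial>lborel) = char std_normal_distribution t"
    unfolding char_def by (subst integral_density) (auto simp: cis_conv_exp normal_density_nonneg)
  then show "(\<integral>x. complex_of_real (exp (- x\<^sup>2 / 2)) * cis (t * x) \<partial>lborel) = complex_of_real (sqrt (2 * pi) * exp (- t\<^sup>2 / 2))"
    unfolding eq by (simp add: char_std_normal_distribution scaleR_conv_of_real)
qed

text \<open>Lebesgue measure is the image of the product of one-dimensional Lebesgue measures under the
coordinate map. Applied below to Gaussians and to powers of \<open>1 + |x|\<^sup>2\<close>.\<close>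

lemma integral_lborel_prod:
  fixes f :: "'a::euclidean_space \<Rightarrow> real \<Rightarrow> 'b::{real_normed_field,banach,second_countable_topology}"
  assumes f: "\<And>b. b \<in> Basis \<Longrightarrow> integrable lborel (f b)"
  shows "integrable lborel (\<lambda>x::'a. \<Prod>b\<in>Basis. f b (x \<bullet> b))"
    and "integral\<^sup>L lborel (\<lambda>x::'a. \<Prod>b\<in>Basis. f b (x \<bullet> b)) = (\<Prod>b\<in>Basis. \<integral>x. f b x \<partial>lborel)"
proof -
  interpret product_sigma_finite "\<lambda>_::'a. lborel :: real measure" by standard
  have [measurable]: "f b \<in> borel_measurable borel" if "b \<in> Basis" for b using f[OF that] by auto
  have coord: "(\<Sum>b\<in>Basis. g b *\<^sub>R b) \<bullet> c = g c" if "c \<in> Basis" for g :: "'a \<Rightarrow> real" and c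
    using that by (simp add: inner_sum_left_Basis)
  have eq: "(\<Prod>b\<in>Basis. f b ((\<Sum>b\<in>Basis. g b *\<^sub>R b) \<bullet> b)) = (\<Prod>b\<in>Basis. f b (g b))" for g :: "'a \<Rightarrow> real"
    by (intro prod.cong refl) (simp add: coord)
  have m: "(\<lambda>g::'a \<Rightarrow> real. \<Sum>b\<in>Basis. g b *\<^sub>R b) \<in> (\<Pi>\<^sub>M b\<in>Basis. lborel) \<rightarrow>\<^sub>M borel"
    by measurable
  show "integrable lborel (\<lambda>x::'a. \<Prod>b\<in>Basis. f b (x \<bullet> b))"
    by (subst lborel_eq, subst integrable_distr_eq[OF m])
       (auto simp: eq intro!: product_integrable_prod f)
  show "integral\<^sup>L lborel (\<lambda>x::'a. \<Prod>b\<in>Basis. f b (x \<bullet> b)) = (\<Prod>b\<in>Basis. \<integral>x. f b x \<partial>lborel)"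
    by (subst lborel_eq, subst integral_distr[OF m])
       (auto simp: eq intro!: product_integral_prod f)
qed

lemma norm_sq_eq_sum_Basis: "(norm (x::'a::euclidean_space))\<^sup>2 = (\<Sum>b\<in>Basis. (x \<bullet> b)\<^sup>2)"
  unfolding power2_norm_eq_inner by (subst euclidean_inner) (simp add: power2_eq_square)

lemma cis_sum: "finite A \<Longrightarrow> cis (sum f A) = (\<Prod>a\<in>A. cis (f a))"
  by (induction A rule: finite_induct) (auto simp: cis_mult[symmetric])

lemma gaussian_fourier:
  fixes z :: "'a::euclidean_space"
  shows "integrable lborel (\<lambda>x. complex_of_real (exp (- (norm x)\<^sup>2 / 2)) * cis (z \<bullet> x))"
    and "(\<integral>x. complex_of_real (exp (- (norm x)\<^sup>2 / 2)) * cis (z \<bullet> x) \<partial>lborel) =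
      complex_of_real (sqrt (2 * pi) ^ DIM('a) * exp (- (norm z)\<^sup>2 / 2))"
proof -
  have eq: "complex_of_real (exp (- (norm x)\<^sup>2 / 2)) * cis (z \<bullet> x) =
      (\<Prod>b\<in>Basis. complex_of_real (exp (- (x \<bullet> b)\<^sup>2 / 2)) * cis ((z \<bullet> b) * (x \<bullet> b)))" for x :: 'a
    unfolding norm_sq_eq_sum_Basis prod.distrib
    by (subst euclidean_inner)
       (simp add: cis_sum exp_sum sum_negf[symmetric] sum_divide_distrib of_real_prod[symmetric] del: of_real_prod)
  have eq2: "complex_of_real (sqrt (2 * pi) ^ DIM('a) * exp (- (norm z)\<^sup>2 / 2)) =
      (\<Prod>b\<in>(Basis::'a set). complex_of_real (sqrt (2 * pi) * exp (- (z \<bullet> b)\<^sup>2 / 2)))"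
    unfolding norm_sq_eq_sum_Basis of_real_mult prod.distrib
    by (simp add: exp_sum sum_negf[symmetric] sum_divide_distrib of_real_prod[symmetric] del: of_real_prod)
  show "integrable lborel (\<lambda>x. complex_of_real (exp (- (norm x)\<^sup>2 / 2)) * cis (z \<bullet> x))"
    unfolding eq by (intro integral_lborel_prod gaussian_cis_integral)
  show "(\<integral>x. complex_of_real (exp (- (norm x)\<^sup>2 / 2)) * cis (z \<bullet> x) \<partial>lborel) =
      complex_of_real (sqrt (2 * pi) ^ DIM('a) * exp (- (norm z)\<^sup>2 / 2))"
    unfolding eq eq2 by (subst integral_lborel_prod(2), rule gaussian_cis_integral(1), intro prod.cong refl gaussian_cis_integral(2))
qed

lemma gaussian_cos:
  fixes z :: "'a::euclidean_space"
  shows "integrable lborel (\<lambda>x::'a. exp (- (norm x)\<^sup>2 / 2))"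
    and "(\<integral>x. exp (- (norm x)\<^sup>2 / 2) * cos (z \<bullet> x) \<partial>lborel) = sqrt (2 * pi) ^ DIM('a) * exp (- (norm z)\<^sup>2 / 2)"
proof -
  show "integrable lborel (\<lambda>x::'a. exp (- (norm x)\<^sup>2 / 2))"
    using integrable_Re[OF gaussian_fourier(1)[of 0]] by simp
  show "(\<integral>x. exp (- (norm x)\<^sup>2 / 2) * cos (z \<bullet> x) \<partial>lborel) = sqrt (2 * pi) ^ DIM('a) * exp (- (norm z)\<^sup>2 / 2)"
    using integral_Re[OF gaussian_fourier(1)[of z]] gaussian_fourier(2)[of z] by simp
qed

lemma lborel_scale:
  fixes f :: "'a::euclidean_space \<Rightarrow> real"
  assumes c: "c > 0" and [measurable]: "f \<in> borel_measurable borel"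
  shows "integrable lborel f \<longleftrightarrow> integrable lborel (\<lambda>x. f (c *\<^sub>R x))"
    and "(\<integral>x. f x \<partial>lborel) = c ^ DIM('a) * (\<integral>x. f (c *\<^sub>R x) \<partial>lborel)"
proof -
  have eq: "lborel = density (distr lborel borel (\<lambda>x::'a. c *\<^sub>R x)) (\<lambda>_. ennreal (c ^ DIM('a)))"
    using lborel_affine[of c "0::'a"] c by (simp add: ennreal_power)
  show "integrable lborel f \<longleftrightarrow> integrable lborel (\<lambda>x. f (c *\<^sub>R x))"
    by (subst eq, subst integrable_density) (use c in \<open>auto simp: integrable_distr_eq\<close>)
  show "(\<integral>x. f x \<partial>lborel) = c ^ DIM('a) * (\<integral>x. f (c *\<^sub>R x) \<partial>lborel)"
    by (subst eq, subst integral_density) (use c in \<open>auto simp: integral_distr\<close>)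
qed

subsection \<open>Plancherel's identity for integrable functions\<close>

text \<open>The squared modulus of the Fourier transform of \<open>f\<close> is the Fourier transform of the
autocorrelation of \<open>f\<close>.\<close>

definition autocorr :: "('a::euclidean_space \<Rightarrow> real) \<Rightarrow> 'a \<Rightarrow> real" where
  "autocorr f z = (\<integral>x. f x * f (x + z) \<partial>lborel)"

lemma
  fixes f :: "'a::euclidean_space \<Rightarrow> real"
  assumes f: "square_integrable lborel f"
  shows autocorr_integrable: "integrable lborel (\<lambda>x. f x * f (x + z))"
    and autocorr_0: "autocorr f 0 = (\<integral>x. (f x)\<^sup>2 \<partial>lborel)"
    and autocorr_bound: "\<bar>autocorr f z\<bar> \<le> autocorr f 0"
    and autocorr_eq: "autocorr f z = autocorr f 0 - (\<integral>x. (f (x + z) - f x)\<^sup>2 \<partial>lborel) / 2"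
proof -
  have [measurable]: "f \<in> borel_measurable borel" and i: "integrable lborel (\<lambda>x. (f x)\<^sup>2)"
    using f by (auto simp: square_integrable_def)
  have iz: "integrable lborel (\<lambda>x. (f (x + z))\<^sup>2)" using integrable_lborel_translate[OF i] .
  have ez: "(\<integral>x. (f (x + z))\<^sup>2 \<partial>lborel) = (\<integral>x. (f x)\<^sup>2 \<partial>lborel)"
    by (rule integral_lborel_translate) measurable
  have i2: "integrable lborel (\<lambda>x. ((f x)\<^sup>2 + (f (x + z))\<^sup>2) / 2)" using i iz by auto
  have b: "\<bar>f x * f (x + z)\<bar> \<le> ((f x)\<^sup>2 + (f (x + z))\<^sup>2) / 2" for x
    using sum_squares_bound[of "f x" "f (x + z)"] sum_squares_bound[of "f x" "- f (x + z)"] by (auto simp: abs_le_iff)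
  show ip: "integrable lborel (\<lambda>x. f x * f (x + z))"
  proof (rule Bochner_Integration.integrable_bound[OF i2])
    show "AE x in lborel. norm (f x * f (x + z)) \<le> norm (((f x)\<^sup>2 + (f (x + z))\<^sup>2) / 2)"
      using b by (intro AE_I2) (metis abs_ge_self order_trans real_norm_def)
  qed measurable
  show 0: "autocorr f 0 = (\<integral>x. (f x)\<^sup>2 \<partial>lborel)" by (simp add: autocorr_def power2_eq_square)
  have "\<bar>autocorr f z\<bar> \<le> (\<integral>x. \<bar>f x * f (x + z)\<bar> \<partial>lborel)"
    unfolding autocorr_def by (rule integral_abs_bound)
  also have "\<dots> \<le> (\<integral>x. ((f x)\<^sup>2 + (f (x + z))\<^sup>2) / 2 \<partial>lborel)"
    using ip i2 b by (intro integral_mono) auto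
  also have "\<dots> = (\<integral>x. (f x)\<^sup>2 \<partial>lborel)" using i iz ez by simp
  finally show "\<bar>autocorr f z\<bar> \<le> autocorr f 0" unfolding 0 .
  have "(\<integral>x. (f (x + z) - f x)\<^sup>2 \<partial>lborel) = (\<integral>x. (f (x + z))\<^sup>2 + (f x)\<^sup>2 - 2 * (f x * f (x + z)) \<partial>lborel)"
    by (simp add: power2_diff mult_ac)
  also have "\<dots> = 2 * autocorr f 0 - 2 * autocorr f z"
    using i iz ip ez by (simp add: 0) (simp add: autocorr_def)
  finally show "autocorr f z = autocorr f 0 - (\<integral>x. (f (x + z) - f x)\<^sup>2 \<partial>lborel) / 2" by linarith
qed

text \<open>The autocorrelation differs from its value at zero by half the squared \<open>L\<^sup>2\<close> distance of \<open>f\<close> and its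
translate.\<close>

lemma autocorr_tendsto:
  fixes f :: "'a::euclidean_space \<Rightarrow> real"
  assumes f: "square_integrable lborel f" and z: "z \<longlonglongrightarrow> 0"
  shows "(\<lambda>n. autocorr f (z n)) \<longlonglongrightarrow> autocorr f 0"
proof -
  have [measurable]: "f \<in> borel_measurable borel" and i: "integrable lborel (\<lambda>x. (f x)\<^sup>2)"
    using f by (auto simp: square_integrable_def)
  have "(\<lambda>n. L2sq lborel (\<lambda>x. f (x + z n) - f x)) \<longlonglongrightarrow> 0"
    by (rule L2_translation_continuous[OF f z])
  moreover have "L2sq lborel (\<lambda>x. f (x + z n) - f x) = ennreal (\<integral>x. (f (x + z n) - f x)\<^sup>2 \<partial>lborel)" for n
  proof -
    have "integrable lborel (\<lambda>x. (f (x + z n))\<^sup>2 + (f x)\<^sup>2 - 2 * (f x * f (x + z n)))"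
      using i integrable_lborel_translate[OF i] autocorr_integrable[OF f] by auto
    then show ?thesis
      by (subst L2sq_eq_integral) (auto simp: square_integrable_def power2_diff mult_ac)
  qed
  ultimately have "(\<lambda>n. ennreal (\<integral>x. (f (x + z n) - f x)\<^sup>2 \<partial>lborel)) \<longlonglongrightarrow> ennreal 0" by simp
  then have "(\<lambda>n. \<integral>x. (f (x + z n) - f x)\<^sup>2 \<partial>lborel) \<longlonglongrightarrow> 0"
    by (subst (asm) tendsto_ennreal_iff) auto
  then have "(\<lambda>n. autocorr f 0 - (\<integral>x. (f (x + z n) - f x)\<^sup>2 \<partial>lborel) / 2) \<longlonglongrightarrow> autocorr f 0 - 0 / 2"
    by (intro tendsto_intros) auto
  then show ?thesis by (simp add: autocorr_eq[OF f, symmetric])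
qed

text \<open>Up to normalization, \<open>E\<close> is the squared modulus of the Fourier transform of the real function \<open>f\<close>.
Written as a double integral over \<open>x\<close> and \<open>y\<close>, it involves only \<open>cos ((y - x) \<bullet> \<xi>)\<close>, and with the
Gaussian weight all integrals converge absolutely. Fubini's theorem integrates over \<open>\<xi>\<close> first, which
gives a Gaussian in \<open>y - x\<close>; the substitution \<open>z = y - x\<close> then produces the autocorrelation.\<close>

lemma gaussian_energy_eq:
  fixes f :: "'a::euclidean_space \<Rightarrow> real"
  assumes fi: "integrable lborel f" and f: "square_integrable lborel f" and c: "c > 0"
  defines "E \<equiv> \<lambda>\<xi>. (\<integral>x. f x * cos (x \<bullet> \<xi>) \<partial>lborel)\<^sup>2 + (\<integral>x. f x * sin (x \<bullet> \<xi>) \<partial>lborel)\<^sup>2"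
  shows "integrable lborel (\<lambda>\<xi>. exp (- (norm (c *\<^sub>R \<xi>))\<^sup>2 / 2) * E \<xi>)"
    and "(\<integral>\<xi>. exp (- (norm (c *\<^sub>R \<xi>))\<^sup>2 / 2) * E \<xi> \<partial>lborel) =
      sqrt (2 * pi) ^ DIM('a) * (\<integral>u. exp (- (norm u)\<^sup>2 / 2) * autocorr f (c *\<^sub>R u) \<partial>lborel)"
proof -
  have [measurable]: "f \<in> borel_measurable borel" using fi by auto
  let ?d = "DIM('a)"
  define \<gamma> where "\<gamma> \<xi> = exp (- (norm (c *\<^sub>R \<xi>))\<^sup>2 / 2)" for \<xi> :: 'a
  have [measurable]: "\<gamma> \<in> borel_measurable borel" unfolding \<gamma>_def by measurable
  have \<gamma>i: "integrable lborel \<gamma>"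
    using lborel_scale(1)[of c "\<lambda>x::'a. exp (- (norm x)\<^sup>2 / 2)"] gaussian_cos(1)[where 'a='a] c
    unfolding \<gamma>_def by simp
  \<comment> \<open>the Fourier transform of the Gaussian weight \<open>\<gamma>\<close>\<close>
  define \<Gamma> where "\<Gamma> z = (\<integral>\<xi>. \<gamma> \<xi> * cos (z \<bullet> \<xi>) \<partial>lborel)" for z
  have \<Gamma>: "\<Gamma> z = (1/c) ^ ?d * (sqrt (2 * pi) ^ ?d * exp (- (norm (z /\<^sub>R c))\<^sup>2 / 2))" for z
  proof -
    have "\<Gamma> z = (1/c) ^ ?d * (\<integral>\<xi>. \<gamma> ((1/c) *\<^sub>R \<xi>) * cos (z \<bullet> ((1/c) *\<^sub>R \<xi>)) \<partial>lborel)"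
      unfolding \<Gamma>_def using c by (intro lborel_scale(2)) auto
    also have "(\<lambda>\<xi>. \<gamma> ((1/c) *\<^sub>R \<xi>) * cos (z \<bullet> ((1/c) *\<^sub>R \<xi>))) = (\<lambda>\<xi>. exp (- (norm \<xi>)\<^sup>2 / 2) * cos ((z /\<^sub>R c) \<bullet> \<xi>))"
    proof
      fix \<xi> :: 'a
      have 1: "c *\<^sub>R (1/c) *\<^sub>R \<xi> = \<xi>" using c by simp
      have 2: "z \<bullet> ((1/c) *\<^sub>R \<xi>) = (z /\<^sub>R c) \<bullet> \<xi>" by (simp add: inverse_eq_divide)
      show "\<gamma> ((1/c) *\<^sub>R \<xi>) * cos (z \<bullet> ((1/c) *\<^sub>R \<xi>)) = exp (- (norm \<xi>)\<^sup>2 / 2) * cos ((z /\<^sub>R c) \<bullet> \<xi>)"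
        unfolding \<gamma>_def 1 2 ..
    qed
    finally show ?thesis by (simp only: gaussian_cos(2))
  qed
  have [measurable]: "\<Gamma> \<in> borel_measurable borel" unfolding \<Gamma> by measurable
  have \<Gamma>b: "\<bar>\<Gamma> z\<bar> \<le> (1/c) ^ ?d * sqrt (2 * pi) ^ ?d" for z
    unfolding \<Gamma> using c by (simp add: abs_mult mult_left_le)
  \<comment> \<open>\<open>f x * f y\<close> on the product space; it is integrable there, and so are its products with bounded functions\<close>
  define k where "k p = f (fst p) * f (snd p)" for p :: "'a \<times> 'a"
  have [measurable]: "k \<in> borel_measurable borel" unfolding k_def by (simp flip: borel_prod)
  have kint: "integrable lborel (\<lambda>p. k p * h p)" if "h \<in> borel_measurable borel" "\<And>p. \<bar>h p\<bar> \<le> C" for h C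
    unfolding k_def using integrable_product_bounded[OF fi fi that] by (simp add: lborel_prod)
  have E: "E \<xi> = (\<integral>p. k p * cos ((snd p - fst p) \<bullet> \<xi>) \<partial>lborel)" for \<xi>
  proof -
    have ic: "integrable lborel (\<lambda>x. f x * cos (x \<bullet> \<xi>))" "integrable lborel (\<lambda>x. f x * sin (x \<bullet> \<xi>))"
      by (rule Bochner_Integration.integrable_bound[OF fi], measurable, simp add: abs_mult mult_left_le)+
    have "(\<integral>p. k p * cos ((snd p - fst p) \<bullet> \<xi>) \<partial>lborel) = (\<integral>x. \<integral>y. f x * f y * cos ((y - x) \<bullet> \<xi>) \<partial>lborel \<partial>lborel)"
    proof -
      have "integrable (lborel \<Otimes>\<^sub>M lborel) (\<lambda>p. k p * cos ((snd p - fst p) \<bullet> \<xi>))"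
        unfolding lborel_prod by (rule kint[of _ 1]) (auto simp flip: borel_prod)
      from lborel_pair.integral_fst'[OF this] show ?thesis by (simp add: k_def lborel_prod)
    qed
    also have "\<dots> = (\<integral>x. f x * cos (x \<bullet> \<xi>) * (\<integral>y. f y * cos (y \<bullet> \<xi>) \<partial>lborel) + f x * sin (x \<bullet> \<xi>) * (\<integral>y. f y * sin (y \<bullet> \<xi>) \<partial>lborel) \<partial>lborel)"
    proof (intro Bochner_Integration.integral_cong refl)
      fix x
      have "(\<integral>y. f x * f y * cos ((y - x) \<bullet> \<xi>) \<partial>lborel) = (\<integral>y. f x * cos (x \<bullet> \<xi>) * (f y * cos (y \<bullet> \<xi>)) + f x * sin (x \<bullet> \<xi>) * (f y * sin (y \<bullet> \<xi>)) \<partial>lborel)"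
        by (intro Bochner_Integration.integral_cong refl) (simp add: inner_diff_left cos_diff algebra_simps)
      then show "(\<integral>y. f x * f y * cos ((y - x) \<bullet> \<xi>) \<partial>lborel) = f x * cos (x \<bullet> \<xi>) * (\<integral>y. f y * cos (y \<bullet> \<xi>) \<partial>lborel) + f x * sin (x \<bullet> \<xi>) * (\<integral>y. f y * sin (y \<bullet> \<xi>) \<partial>lborel)"
        using ic by simp
    qed
    also have "\<dots> = E \<xi>" using ic by (simp add: E_def power2_eq_square)
    finally show ?thesis ..
  qed
  have full: "integrable (lborel \<Otimes>\<^sub>M lborel) (\<lambda>(\<xi>, p). \<gamma> \<xi> * k p * cos ((snd p - fst p) \<bullet> \<xi>))"
  proof -
    have "integrable (lborel \<Otimes>\<^sub>M lborel) (\<lambda>q. \<gamma> (fst q) * k (snd q) * cos ((snd (snd q) - fst (snd q)) \<bullet> fst q))"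
      using kint[of "\<lambda>_. 1" 1] by (intro integrable_product_bounded[where C=1] \<gamma>i) (auto simp flip: borel_prod)
    then show ?thesis unfolding case_prod_unfold .
  qed
  have "integrable lborel (\<lambda>\<xi>. \<integral>p. \<gamma> \<xi> * k p * cos ((snd p - fst p) \<bullet> \<xi>) \<partial>lborel)"
    using lborel_pair.integrable_fst'[OF full] by simp
  then show "integrable lborel (\<lambda>\<xi>. exp (- (norm (c *\<^sub>R \<xi>))\<^sup>2 / 2) * E \<xi>)"
    unfolding E \<gamma>_def[symmetric] by (simp add: mult.assoc)
  have "(\<integral>\<xi>. exp (- (norm (c *\<^sub>R \<xi>))\<^sup>2 / 2) * E \<xi> \<partial>lborel) = (\<integral>\<xi>. \<integral>p. \<gamma> \<xi> * k p * cos ((snd p - fst p) \<bullet> \<xi>) \<partial>lborel \<partial>lborel)"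
    unfolding E \<gamma>_def[symmetric] by (simp add: mult.assoc)
  also have "\<dots> = (\<integral>p. \<integral>\<xi>. \<gamma> \<xi> * k p * cos ((snd p - fst p) \<bullet> \<xi>) \<partial>lborel \<partial>lborel)"
    using lborel_pair.Fubini_integral[OF full] by simp
  also have "\<dots> = (\<integral>p. k p * \<Gamma> (snd p - fst p) \<partial>lborel)"
    by (simp add: \<Gamma>_def mult_ac flip: Bochner_Integration.integral_mult_right_zero)
  also have "\<dots> = (\<integral>x. \<integral>y. f x * f y * \<Gamma> (y - x) \<partial>lborel \<partial>lborel)"
  proof -
    have "integrable (lborel \<Otimes>\<^sub>M lborel) (\<lambda>p. k p * \<Gamma> (snd p - fst p))"
      unfolding lborel_prod using \<Gamma>b by (intro kint) (auto simp flip: borel_prod)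
    from lborel_pair.integral_fst'[OF this] show ?thesis by (simp add: k_def lborel_prod)
  qed
  also have "\<dots> = (\<integral>x. \<integral>z. f x * f (x + z) * \<Gamma> z \<partial>lborel \<partial>lborel)"
  proof (rule Bochner_Integration.integral_cong[OF refl])
    fix x
    show "(\<integral>y. f x * f y * \<Gamma> (y - x) \<partial>lborel) = (\<integral>z. f x * f (x + z) * \<Gamma> z \<partial>lborel)"
      using integral_lborel_translate[of "\<lambda>y. f x * f y * \<Gamma> (y - x)" x] by (simp add: add.commute)
  qed
  also have "\<dots> = (\<integral>z. \<integral>x. f x * f (x + z) * \<Gamma> z \<partial>lborel \<partial>lborel)"
  proof -
    have m: "(\<lambda>(x, z). f x * f (x + z) * \<Gamma> z) \<in> borel_measurable (lborel \<Otimes>\<^sub>M lborel)"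
      by measurable
    have "integrable (lborel \<Otimes>\<^sub>M lborel) (\<lambda>(x, z). f x * f (x + z) * \<Gamma> z)"
    proof (rule lborel_pair.Fubini_integrable[OF m])
      have fz: "integrable lborel (\<lambda>z. f (x + z))" for x
        using integrable_lborel_translate[OF fi, of x] by (simp add: add.commute)
      have i: "integrable lborel (\<lambda>z. f (x + z) * \<Gamma> z)" for x
      proof (rule Bochner_Integration.integrable_bound[of _ "\<lambda>z. ((1/c) ^ ?d * sqrt (2 * pi) ^ ?d) * f (x + z)"])
        show "AE z in lborel. norm (f (x + z) * \<Gamma> z) \<le> norm (((1/c) ^ ?d * sqrt (2 * pi) ^ ?d) * f (x + z))"
        proof (intro AE_I2)
          fix z
          have "\<bar>\<Gamma> z\<bar> * \<bar>f (x + z)\<bar> \<le> \<bar>(1/c) ^ ?d * sqrt (2 * pi) ^ ?d\<bar> * \<bar>f (x + z)\<bar>"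
            using \<Gamma>b[of z] by (intro mult_right_mono) auto
          then show "norm (f (x + z) * \<Gamma> z) \<le> norm (((1/c) ^ ?d * sqrt (2 * pi) ^ ?d) * f (x + z))"
            by (simp add: abs_mult mult_ac)
        qed
      qed (use fz in auto)
      show "AE x in lborel. integrable lborel (\<lambda>y. case (x, y) of (x, z) \<Rightarrow> f x * f (x + z) * \<Gamma> z)"
        using i by (simp add: mult.assoc)
      define B where "B = (1/c) ^ ?d * sqrt (2 * pi) ^ ?d"
      show "integrable lborel (\<lambda>x. \<integral>y. norm (case (x, y) of (x, z) \<Rightarrow> f x * f (x + z) * \<Gamma> z) \<partial>lborel)"
      proof (rule Bochner_Integration.integrable_bound[of _ "\<lambda>x. f x * (B * (\<integral>y. \<bar>f y\<bar> \<partial>lborel))"])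
        show "integrable lborel (\<lambda>x. f x * (B * (\<integral>y. \<bar>f y\<bar> \<partial>lborel)))" using fi by simp
        show "(\<lambda>x. \<integral>y. norm (case (x, y) of (x, z) \<Rightarrow> f x * f (x + z) * \<Gamma> z) \<partial>lborel) \<in> borel_measurable lborel"
          by measurable
        show "AE x in lborel. norm (\<integral>y. norm (case (x, y) of (x, z) \<Rightarrow> f x * f (x + z) * \<Gamma> z) \<partial>lborel) \<le> norm (f x * (B * (\<integral>y. \<bar>f y\<bar> \<partial>lborel)))"
        proof (intro AE_I2)
          fix x
          have B0: "B \<ge> 0" unfolding B_def using c by simp
          have "(\<integral>y. \<bar>f (x + y) * \<Gamma> y\<bar> \<partial>lborel) \<le> (\<integral>y. B * \<bar>f (x + y)\<bar> \<partial>lborel)"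
          proof (rule integral_mono)
            fix z
            have "\<bar>\<Gamma> z\<bar> * \<bar>f (x + z)\<bar> \<le> B * \<bar>f (x + z)\<bar>"
              using \<Gamma>b[of z] unfolding B_def by (intro mult_right_mono) auto
            then show "\<bar>f (x + z) * \<Gamma> z\<bar> \<le> B * \<bar>f (x + z)\<bar>" by (simp add: abs_mult mult_ac)
          qed (use i fz in auto)
          also have "\<dots> = B * (\<integral>y. \<bar>f y\<bar> \<partial>lborel)"
            using integral_lborel_translate[of "\<lambda>y. \<bar>f y\<bar>" x] by (simp add: add.commute)
          finally have "(\<integral>y. \<bar>f (x + y) * \<Gamma> y\<bar> \<partial>lborel) \<le> B * (\<integral>y. \<bar>f y\<bar> \<partial>lborel)" .
          then have "\<bar>f x\<bar> * (\<integral>y. \<bar>f (x + y) * \<Gamma> y\<bar> \<partial>lborel) \<le> \<bar>f x\<bar> * (B * (\<integral>y. \<bar>f y\<bar> \<partial>lborel))"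
            by (intro mult_left_mono) auto
          then show "norm (\<integral>y. norm (case (x, y) of (x, z) \<Rightarrow> f x * f (x + z) * \<Gamma> z) \<partial>lborel) \<le> norm (f x * (B * (\<integral>y. \<bar>f y\<bar> \<partial>lborel)))"
            using B0 by (simp add: abs_mult mult.assoc)
        qed
      qed
    qed
    from lborel_pair.Fubini_integral[OF this] show ?thesis by simp
  qed
  also have "\<dots> = (\<integral>z. \<Gamma> z * autocorr f z \<partial>lborel)"
    by (simp add: autocorr_def mult_ac)
  also have "\<dots> = c ^ ?d * (\<integral>u. \<Gamma> (c *\<^sub>R u) * autocorr f (c *\<^sub>R u) \<partial>lborel)"
    unfolding autocorr_def using c by (intro lborel_scale(2)) measurable
  also have "(\<integral>u. \<Gamma> (c *\<^sub>R u) * autocorr f (c *\<^sub>R u) \<partial>lborel) =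
     (1/c) ^ ?d * sqrt (2 * pi) ^ ?d * (\<integral>u. exp (- (norm u)\<^sup>2 / 2) * autocorr f (c *\<^sub>R u) \<partial>lborel)"
    unfolding \<Gamma> using c by (simp add: mult.assoc)
  also have "c ^ ?d * ((1/c) ^ ?d * sqrt (2 * pi) ^ ?d * (\<integral>u. exp (- (norm u)\<^sup>2 / 2) * autocorr f (c *\<^sub>R u) \<partial>lborel)) =
     sqrt (2 * pi) ^ ?d * (\<integral>u. exp (- (norm u)\<^sup>2 / 2) * autocorr f (c *\<^sub>R u) \<partial>lborel)"
    using c by (simp add: power_one_over)
  finally show "(\<integral>\<xi>. exp (- (norm (c *\<^sub>R \<xi>))\<^sup>2 / 2) * E \<xi> \<partial>lborel) =
      sqrt (2 * pi) ^ DIM('a) * (\<integral>u. exp (- (norm u)\<^sup>2 / 2) * autocorr f (c *\<^sub>R u) \<partial>lborel)" .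
qed

text \<open>In the limit \<open>c \<rightarrow> 0\<close> the Gaussian weight increases to 1 on the left of \<open>gaussian_energy_eq\<close>
(monotone convergence), and on the right the autocorrelation tends to its value at zero, which is
the squared \<open>L\<^sup>2\<close> norm (dominated convergence).\<close>

lemma L2sq_plancherel_energy:
  fixes f :: "'a::euclidean_space \<Rightarrow> real"
  assumes fi: "integrable lborel f" and f: "square_integrable lborel f"
  shows "(\<integral>\<^sup>+\<xi>. ennreal ((\<integral>x. f x * cos (x \<bullet> \<xi>) \<partial>lborel)\<^sup>2 + (\<integral>x. f x * sin (x \<bullet> \<xi>) \<partial>lborel)\<^sup>2) \<partial>lborel)
    = ennreal ((2 * pi) ^ DIM('a) * (\<integral>x. (f x)\<^sup>2 \<partial>lborel))"
proof -
  let ?d = "DIM('a)"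
  have [measurable]: "f \<in> borel_measurable borel" using fi by auto
  define E where "E \<xi> = (\<integral>x. f x * cos (x \<bullet> \<xi>) \<partial>lborel)\<^sup>2 + (\<integral>x. f x * sin (x \<bullet> \<xi>) \<partial>lborel)\<^sup>2" for \<xi>
  have [measurable]: "E \<in> borel_measurable borel" unfolding E_def by measurable
  have E0: "E \<xi> \<ge> 0" for \<xi> unfolding E_def by simp
  define c where "c n = 1 / real (Suc n)" for n
  have c: "c n > 0" for n by (simp add: c_def)
  have c0: "c \<longlonglongrightarrow> 0" unfolding c_def using LIMSEQ_inverse_real_of_nat by (simp add: inverse_eq_divide)
  have cdec: "c n \<le> c m" if "m \<le> n" for m n using that by (simp add: c_def frac_le)
  define g where "g n \<xi> = exp (- (norm (c n *\<^sub>R \<xi>))\<^sup>2 / 2) * E \<xi>" for n \<xi>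
  have "(\<lambda>n. \<integral>\<^sup>+\<xi>. ennreal (g n \<xi>) \<partial>lborel) \<longlonglongrightarrow> (\<integral>\<^sup>+\<xi>. ennreal (E \<xi>) \<partial>lborel)"
  proof (rule nn_integral_LIMSEQ)
    show "incseq (\<lambda>n \<xi>. ennreal (g n \<xi>))"
    proof (intro incseq_SucI le_funI ennreal_leI)
      fix n and \<xi> :: 'a
      have "(c (Suc n) * norm \<xi>)\<^sup>2 \<le> (c n * norm \<xi>)\<^sup>2"
        using c[of "Suc n"] cdec[of n "Suc n"] by (intro power_mono mult_right_mono mult_nonneg_nonneg) auto
      then show "g n \<xi> \<le> g (Suc n) \<xi>"
        unfolding g_def using E0[of \<xi>] c[of n] c[of "Suc n"] by (intro mult_right_mono) auto
    qed
    show "(\<lambda>n. ennreal (g n \<xi>)) \<longlonglongrightarrow> ennreal (E \<xi>)" for \<xi>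
    proof -
      have "(\<lambda>n. g n \<xi>) \<longlonglongrightarrow> exp (- (norm (0 *\<^sub>R \<xi>))\<^sup>2 / 2) * E \<xi>"
        unfolding g_def by (intro tendsto_intros c0) auto
      then show ?thesis by (intro tendsto_ennrealI) simp
    qed
  qed (simp add: g_def)
  moreover have "(\<lambda>n. \<integral>\<^sup>+\<xi>. ennreal (g n \<xi>) \<partial>lborel) \<longlonglongrightarrow> ennreal (sqrt (2 * pi) ^ ?d * (sqrt (2 * pi) ^ ?d * autocorr f 0))"
  proof -
    have "(\<integral>\<^sup>+\<xi>. ennreal (g n \<xi>) \<partial>lborel) = ennreal (sqrt (2 * pi) ^ ?d * (\<integral>u. exp (- (norm u)\<^sup>2 / 2) * autocorr f (c n *\<^sub>R u) \<partial>lborel))" for n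
      using gaussian_energy_eq[OF fi f c[of n]] E0 unfolding g_def E_def[symmetric]
      by (subst nn_integral_eq_integral) auto
    moreover have "(\<lambda>n. \<integral>u. exp (- (norm u)\<^sup>2 / 2) * autocorr f (c n *\<^sub>R u) \<partial>lborel) \<longlonglongrightarrow> (integral\<^sup>L lborel (\<lambda>u::'a. exp (- (norm u)\<^sup>2 / 2) * autocorr f 0))"
    proof (rule integral_dominated_convergence[where w="\<lambda>u::'a. exp (- (norm u)\<^sup>2 / 2) * autocorr f 0"])
      show "integrable lborel (\<lambda>u::'a. exp (- (norm u)\<^sup>2 / 2) * autocorr f 0)"
        using gaussian_cos(1) by (rule integrable_mult_left)
      show "AE u in lborel. (\<lambda>n. exp (- (norm u)\<^sup>2 / 2) * autocorr f (c n *\<^sub>R u)) \<longlonglongrightarrow> exp (- (norm u)\<^sup>2 / 2) * autocorr f 0"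
      proof (intro AE_I2 tendsto_intros autocorr_tendsto[OF f])
        fix u :: 'a
        show "(\<lambda>n. c n *\<^sub>R u) \<longlonglongrightarrow> 0" using tendsto_scaleR[OF c0 tendsto_const[of u]] by simp
      qed
      show "AE u in lborel. norm (exp (- (norm u)\<^sup>2 / 2) * autocorr f (c n *\<^sub>R u)) \<le> exp (- (norm u)\<^sup>2 / 2) * autocorr f 0" for n
        using autocorr_bound[OF f] by (intro AE_I2) (simp add: abs_mult)
    qed (unfold autocorr_def, measurable)
    moreover have "(integral\<^sup>L lborel (\<lambda>u::'a. exp (- (norm u)\<^sup>2 / 2) * autocorr f 0)) = sqrt (2 * pi) ^ ?d * autocorr f 0"
      using gaussian_cos(2)[of "0::'a"] by simp
    ultimately show ?thesis by (simp only:) (intro tendsto_ennrealI tendsto_mult tendsto_const)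
  qed
  ultimately have "(\<integral>\<^sup>+\<xi>. ennreal (E \<xi>) \<partial>lborel) = ennreal (sqrt (2 * pi) ^ ?d * (sqrt (2 * pi) ^ ?d * autocorr f 0))"
    by (rule LIMSEQ_unique)
  also have "sqrt (2 * pi) ^ ?d * (sqrt (2 * pi) ^ ?d * autocorr f 0) = (2 * pi) ^ ?d * (\<integral>x. (f x)\<^sup>2 \<partial>lborel)"
  proof -
    have "sqrt (2 * pi) ^ ?d * sqrt (2 * pi) ^ ?d = (sqrt (2 * pi) * sqrt (2 * pi)) ^ ?d"
      by (simp only: power_mult_distrib)
    also have "sqrt (2 * pi) * sqrt (2 * pi) = 2 * pi" by (rule real_sqrt_mult_self[THEN trans]) simp
    finally show ?thesis unfolding autocorr_0[OF f] mult.assoc[symmetric] by (simp only:)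
  qed
  finally show ?thesis by (simp add: E_def)
qed

text \<open>The factor that makes the Fourier transform unitary.\<close>

definition fconst :: "'a::euclidean_space itself \<Rightarrow> real" where
  "fconst _ = (2 * pi) powr (- real DIM('a) / 2)"

lemma fconst_pos: "fconst TYPE('a::euclidean_space) > 0"
  by (simp add: fconst_def)

lemma fconst_sq: "(fconst TYPE('a::euclidean_space))\<^sup>2 * (2 * pi) ^ DIM('a) = 1"
proof -
  have "(fconst TYPE('a))\<^sup>2 = (2 * pi) powr (- real DIM('a))"
    by (simp add: fconst_def power2_eq_square powr_add[symmetric])
  also have "\<dots> = inverse ((2 * pi) ^ DIM('a))"
    by (simp add: powr_minus powr_realpow del: power_mult_distrib)
  finally have eq: "(fconst TYPE('a))\<^sup>2 = inverse ((2 * pi) ^ DIM('a))" .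
  have "(2 * pi) ^ DIM('a) \<noteq> 0" by simp
  then show ?thesis unfolding eq by (rule left_inverse)
qed

text \<open>The unitary Fourier transform of an integrable function. The truncated transforms that define the
Fourier--Plancherel transform are of this form (\<open>fourier_trunc_eq_ft\<close>).\<close>

definition ft :: "('a::euclidean_space \<Rightarrow> real) \<Rightarrow> 'a \<Rightarrow> complex" where
  "ft f \<xi> = complex_of_real (fconst TYPE('a)) * (\<integral>x. complex_of_real (f x) * cis (- (x \<bullet> \<xi>)) \<partial>lborel)"

lemma fourier_trunc_eq_ft: "fourier_trunc w R = ft (\<lambda>x. indicator (cball 0 R) x * w x)"
  by (rule ext) (simp add: fourier_trunc_def ft_def fconst_def set_lebesgue_integral_def scaleR_conv_of_real mult.assoc)

lemma ft_integrand_integrable: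
  assumes "integrable lborel f"
  shows "integrable lborel (\<lambda>x. complex_of_real (f x) * cis (- (x \<bullet> \<xi>)))"
proof -
  have [measurable]: "f \<in> borel_measurable borel" using assms by auto
  show ?thesis by (rule Bochner_Integration.integrable_bound[OF assms]) (auto simp: norm_mult)
qed

lemma ft_measurable [measurable]:
  assumes [measurable]: "f \<in> borel_measurable borel"
  shows "ft f \<in> borel_measurable borel"
  unfolding ft_def[abs_def] by measurable

lemma ft_diff:
  assumes "integrable lborel f" "integrable lborel g"
  shows "ft (\<lambda>x. f x - g x) \<xi> = ft f \<xi> - ft g \<xi>"
  using ft_integrand_integrable[OF assms(1), of \<xi>] ft_integrand_integrable[OF assms(2), of \<xi>]
  by (simp add: ft_def left_diff_distrib right_diff_distrib)

lemma ft_plancherel: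
  fixes f :: "'a::euclidean_space \<Rightarrow> real"
  assumes fi: "integrable lborel f" and f: "square_integrable lborel f"
  shows "L2sq lborel (ft f) = L2sq lborel f"
proof -
  have [measurable]: "f \<in> borel_measurable borel" using fi by auto
  let ?\<kappa> = "fconst TYPE('a)"
  have "(norm (ft f \<xi>))\<^sup>2 = ?\<kappa>\<^sup>2 * ((\<integral>x. f x * cos (x \<bullet> \<xi>) \<partial>lborel)\<^sup>2 + (\<integral>x. f x * sin (x \<bullet> \<xi>) \<partial>lborel)\<^sup>2)" for \<xi>
  proof -
    let ?I = "\<integral>x. complex_of_real (f x) * cis (- (x \<bullet> \<xi>)) \<partial>lborel"
    have "Re ?I = (\<integral>x. f x * cos (x \<bullet> \<xi>) \<partial>lborel)" "Im ?I = - (\<integral>x. f x * sin (x \<bullet> \<xi>) \<partial>lborel)"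
      using integral_Re[OF ft_integrand_integrable[OF fi, of \<xi>]] integral_Im[OF ft_integrand_integrable[OF fi, of \<xi>]] by simp_all
    then have "(norm ?I)\<^sup>2 = (\<integral>x. f x * cos (x \<bullet> \<xi>) \<partial>lborel)\<^sup>2 + (\<integral>x. f x * sin (x \<bullet> \<xi>) \<partial>lborel)\<^sup>2"
      by (simp add: cmod_power2)
    then show ?thesis by (simp add: ft_def norm_mult power_mult_distrib)
  qed
  then have "L2sq lborel (ft f) = (\<integral>\<^sup>+\<xi>. ennreal (?\<kappa>\<^sup>2) * ennreal ((\<integral>x. f x * cos (x \<bullet> \<xi>) \<partial>lborel)\<^sup>2 + (\<integral>x. f x * sin (x \<bullet> \<xi>) \<partial>lborel)\<^sup>2) \<partial>lborel)"
    unfolding L2sq_def by (simp add: ennreal_mult)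
  also have "\<dots> = ennreal (?\<kappa>\<^sup>2) * ennreal ((2 * pi) ^ DIM('a) * (\<integral>x. (f x)\<^sup>2 \<partial>lborel))"
    by (subst nn_integral_cmult, measurable) (simp only: L2sq_plancherel_energy[OF fi f])
  also have "\<dots> = ennreal (?\<kappa>\<^sup>2 * (2 * pi) ^ DIM('a) * (\<integral>x. (f x)\<^sup>2 \<partial>lborel))"
    by (simp add: ennreal_mult[symmetric] mult.assoc)
  also have "\<dots> = L2sq lborel f"
    unfolding fconst_sq using L2sq_eq_integral[OF f] by simp
  finally show ?thesis .
qed

subsection \<open>The transform of a square-integrable function\<close>

lemma square_integrable_mult_indicator:
  fixes w :: "'a::euclidean_space \<Rightarrow> real"
  assumes w: "square_integrable lborel w" and [measurable]: "A \<in> sets borel"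
  shows "square_integrable lborel (\<lambda>x. indicator A x * w x)"
proof -
  have [measurable]: "w \<in> borel_measurable borel" and "L2sq lborel w < \<infinity>"
    using w by (auto simp: square_integrable_iff_L2sq)
  moreover have "L2sq lborel (\<lambda>x. indicator A x * w x) \<le> L2sq lborel w"
    unfolding L2sq_def by (intro nn_integral_mono) (auto simp: indicator_def)
  ultimately show ?thesis by (auto simp: square_integrable_iff_L2sq)
qed

lemma integrable_trunc:
  fixes w :: "'a::euclidean_space \<Rightarrow> real"
  assumes w: "square_integrable lborel w" and [measurable]: "A \<in> sets borel" and A: "bounded A"
  shows "integrable lborel (\<lambda>x. indicator A x * w x)"
proof (rule Bochner_Integration.integrable_bound)
  have [measurable]: "w \<in> borel_measurable borel" and i: "integrable lborel (\<lambda>x. (w x)\<^sup>2)"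
    using w by (auto simp: square_integrable_def)
  have "integrable lborel (\<lambda>x. indicator A x :: real)"
    using emeasure_bounded_finite[OF A] by auto
  then show "integrable lborel (\<lambda>x. indicator A x + (w x)\<^sup>2)" using i by auto
  show "(\<lambda>x. indicator A x * w x) \<in> borel_measurable lborel" by measurable
  show "AE x in lborel. norm (indicator A x * w x) \<le> norm (indicator A x + (w x)\<^sup>2)"
  proof (intro AE_I2)
    fix x
    have "\<bar>w x\<bar> \<le> 1 + (w x)\<^sup>2"
      using sum_squares_bound[of 1 "\<bar>w x\<bar>"] by (simp add: power2_eq_square)
    then show "norm (indicator A x * w x) \<le> norm (indicator A x + (w x)\<^sup>2)"
      by (auto simp: indicator_def)
  qed
qed

lemma cball_borel [measurable]: "cball a r \<in> sets borel"
  by simp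

lemma fourier_trunc_measurable [measurable]:
  assumes [measurable]: "w \<in> borel_measurable borel"
  shows "fourier_trunc w R \<in> borel_measurable borel"
  unfolding fourier_trunc_eq_ft by measurable

lemma fourier_trunc_diff_L2sq:
  fixes w :: "'a::euclidean_space \<Rightarrow> real"
  assumes w: "square_integrable lborel w"
  shows "L2sq lborel (\<lambda>\<xi>. fourier_trunc w R \<xi> - fourier_trunc w R' \<xi>)
    = L2sq lborel (\<lambda>x. indicator (cball 0 R) x * w x - indicator (cball 0 R') x * w x)"
proof -
  have [measurable]: "w \<in> borel_measurable borel" using w by (auto simp: square_integrable_iff_L2sq)
  have i: "integrable lborel (\<lambda>x. indicator (cball 0 R) x * w x)" for R
    using w by (intro integrable_trunc) auto
  have s: "square_integrable lborel (\<lambda>x. indicator (cball 0 R) x * w x)" for R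
    using w by (intro square_integrable_mult_indicator) auto
  have "square_integrable lborel (\<lambda>x. indicator (cball 0 R) x * w x - indicator (cball 0 R') x * w x)"
    unfolding square_integrable_iff_L2sq
  proof
    have "L2sq lborel (\<lambda>x. indicator (cball 0 R) x * w x + - (indicator (cball 0 R') x * w x)) \<le>
      2 * L2sq lborel (\<lambda>x. indicator (cball 0 R) x * w x) + 2 * L2sq lborel (\<lambda>x. - (indicator (cball 0 R') x * w x))"
      by (intro L2sq_add_le) measurable
    also have "\<dots> < \<infinity>"
      using s[of R] s[of R'] unfolding square_integrable_iff_L2sq by (simp add: L2sq_def ennreal_mult_less_top)
    finally show "L2sq lborel (\<lambda>x. indicator (cball 0 R) x * w x - indicator (cball 0 R') x * w x) < \<infinity>" by simp
  qed measurable
  from ft_plancherel[OF Bochner_Integration.integrable_diff[OF i[of R] i[of R']] this]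
  moreover have "ft (\<lambda>x. indicator (cball 0 R) x * w x - indicator (cball 0 R') x * w x) =
    (\<lambda>\<xi>. fourier_trunc w R \<xi> - fourier_trunc w R' \<xi>)"
    unfolding fourier_trunc_eq_ft by (intro ext ft_diff i)
  ultimately show ?thesis by simp
qed

text \<open>By Plancherel's identity the transforms of two truncations of \<open>w\<close> to balls of radius at least \<open>K\<close>
have squared distance at most \<open>L2tail w K\<close>.\<close>

definition L2tail :: "('a::euclidean_space \<Rightarrow> real) \<Rightarrow> real \<Rightarrow> ennreal" where
  "L2tail w K = L2sq lborel (\<lambda>x. indicator (- cball 0 K) x * w x)"

lemma L2tail_tendsto:
  fixes w :: "'a::euclidean_space \<Rightarrow> real"
  assumes w: "square_integrable lborel w"
  shows "(\<lambda>n. L2tail w (real n)) \<longlonglongrightarrow> 0"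
  unfolding L2tail_def
proof (rule L2sq_dominated_tendsto_0[where k="\<lambda>x. \<bar>w x\<bar>"])
  have [measurable]: "w \<in> borel_measurable borel" and wf: "L2sq lborel w < \<infinity>"
    using w by (auto simp: square_integrable_iff_L2sq)
  show "(\<lambda>x. indicator (- cball 0 (real n)) x * w x) \<in> borel_measurable lborel" for n by measurable
  show "(\<lambda>x. \<bar>w x\<bar>) \<in> borel_measurable lborel" by measurable
  show "AE x in lborel. (\<lambda>n. indicator (- cball 0 (real n)) x * w x) \<longlonglongrightarrow> 0"
  proof (intro AE_I2 tendsto_eventually)
    fix x :: 'a
    obtain n :: nat where "norm x \<le> real n" using real_arch_simple by blast
    then show "\<forall>\<^sub>F k in sequentially. indicator (- cball 0 (real k)) x * w x = 0"
      by (intro eventually_sequentiallyI[of n]) auto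
  qed
  show "AE x in lborel. norm (indicator (- cball 0 (real n)) x * w x) \<le> \<bar>w x\<bar>" for n
    by (auto simp: indicator_def)
  show "L2sq lborel (\<lambda>x. \<bar>w x\<bar>) < \<infinity>" using wf by (simp add: L2sq_def)
qed

lemma fourier_trunc_diff_le:
  fixes w :: "'a::euclidean_space \<Rightarrow> real"
  assumes w: "square_integrable lborel w" and "K \<le> R" "K \<le> R'"
  shows "L2sq lborel (\<lambda>\<xi>. fourier_trunc w R \<xi> - fourier_trunc w R' \<xi>) \<le> L2tail w K"
  unfolding fourier_trunc_diff_L2sq[OF w] L2tail_def unfolding L2sq_def
  using assms(2,3) by (intro nn_integral_mono) (auto simp: indicator_def)

text \<open>The truncated transforms at integer radii form a Cauchy sequence. The limit is attained along real
radii as well, since the tails control all radii simultaneously.\<close>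

lemma fourier_exists:
  fixes w :: "'a::euclidean_space \<Rightarrow> real"
  assumes w: "square_integrable lborel w"
  obtains W where "is_fourier w W"
proof -
  have [measurable]: "w \<in> borel_measurable borel" and wf: "L2sq lborel w < \<infinity>"
    using w by (auto simp: square_integrable_iff_L2sq)
  have tail: "\<exists>N. L2tail w (real N) < e" if "e > 0" for e
    using order_tendstoD(2)[OF L2tail_tendsto[OF w] that] by (auto simp: eventually_sequentially)
  obtain W where [measurable]: "W \<in> borel_measurable lborel"
    and W: "(\<lambda>n. L2sq lborel (\<lambda>\<xi>. fourier_trunc w (real n) \<xi> - W \<xi>)) \<longlonglongrightarrow> 0"
  proof (rule L2_complete[of "\<lambda>n. fourier_trunc w (real n)" lborel])
    fix e :: real assume "e > 0"
    then obtain N where N: "L2tail w (real N) < ennreal e" using tail[of "ennreal e"] by auto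
    show "\<exists>N. \<forall>m\<ge>N. \<forall>n\<ge>N. L2sq lborel (\<lambda>x. fourier_trunc w (real m) x - fourier_trunc w (real n) x) \<le> ennreal e"
    proof (intro exI[of _ N] allI impI)
      fix m n assume "N \<le> m" "N \<le> n"
      then show "L2sq lborel (\<lambda>x. fourier_trunc w (real m) x - fourier_trunc w (real n) x) \<le> ennreal e"
        using fourier_trunc_diff_le[OF w, of "real N" "real m" "real n"] N by auto
    qed
  qed auto
  have bound: "L2sq lborel (\<lambda>\<xi>. W \<xi> - fourier_trunc w R \<xi>) \<le> 2 * L2tail w (real K)" if "real K \<le> R" for K R
  proof (rule tendsto_lowerbound)
    have "(\<lambda>n. 2 * L2sq lborel (\<lambda>\<xi>. fourier_trunc w (real n) \<xi> - W \<xi>) + 2 * L2tail w (real K)) \<longlonglongrightarrow> 2 * 0 + 2 * L2tail w (real K)"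
      by (intro tendsto_add ennreal_tendsto_cmult tendsto_const W) auto
    then show "(\<lambda>n. 2 * L2sq lborel (\<lambda>\<xi>. fourier_trunc w (real n) \<xi> - W \<xi>) + 2 * L2tail w (real K)) \<longlonglongrightarrow> 2 * L2tail w (real K)" by simp
    show "\<forall>\<^sub>F n in sequentially. L2sq lborel (\<lambda>\<xi>. W \<xi> - fourier_trunc w R \<xi>)
        \<le> 2 * L2sq lborel (\<lambda>\<xi>. fourier_trunc w (real n) \<xi> - W \<xi>) + 2 * L2tail w (real K)"
    proof (rule eventually_sequentiallyI[of K])
      fix n assume n: "K \<le> n"
      have "L2sq lborel (\<lambda>\<xi>. W \<xi> - fourier_trunc w R \<xi>) \<le> 2 * L2sq lborel (\<lambda>\<xi>. W \<xi> - fourier_trunc w (real n) \<xi>)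
          + 2 * L2sq lborel (\<lambda>\<xi>. fourier_trunc w (real n) \<xi> - fourier_trunc w R \<xi>)"
        by (intro L2sq_diff_triangle) auto
      also have "\<dots> \<le> 2 * L2sq lborel (\<lambda>\<xi>. fourier_trunc w (real n) \<xi> - W \<xi>) + 2 * L2tail w (real K)"
        using fourier_trunc_diff_le[OF w, of "real K" "real n" R] n that
        by (intro add_mono mult_left_mono) (auto simp: L2sq_minus_commute[of _ W])
      finally show "L2sq lborel (\<lambda>\<xi>. W \<xi> - fourier_trunc w R \<xi>)
        \<le> 2 * L2sq lborel (\<lambda>\<xi>. fourier_trunc w (real n) \<xi> - W \<xi>) + 2 * L2tail w (real K)" .
    qed
  qed auto
  have lim: "((\<lambda>R. L2sq lborel (\<lambda>\<xi>. W \<xi> - fourier_trunc w R \<xi>)) \<longlongrightarrow> 0) at_top"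
  proof (rule order_tendstoI)
    fix a :: ennreal assume a: "0 < a"
    have "(\<lambda>n. 2 * L2tail w (real n)) \<longlonglongrightarrow> 2 * 0"
      by (intro ennreal_tendsto_cmult L2tail_tendsto[OF w]) auto
    then have "\<forall>\<^sub>F n in sequentially. 2 * L2tail w (real n) < a"
      using a by (intro order_tendstoD) auto
    then obtain K where K: "2 * L2tail w (real K) < a" by (auto simp: eventually_sequentially)
    show "\<forall>\<^sub>F R in at_top. L2sq lborel (\<lambda>\<xi>. W \<xi> - fourier_trunc w R \<xi>) < a"
      using bound K by (intro eventually_at_top_linorderI[of "real K"]) (metis le_less_trans)
  qed auto
  \<comment> \<open>comparison with the transform of the truncation to radius 0, which is zero\<close>
  have "L2sq lborel W < \<infinity>"
  proof -
    have "L2sq lborel (\<lambda>\<xi>. (W \<xi> - fourier_trunc w 0 \<xi>) + fourier_trunc w 0 \<xi>) \<le>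
        2 * L2sq lborel (\<lambda>\<xi>. W \<xi> - fourier_trunc w 0 \<xi>) + 2 * L2sq lborel (fourier_trunc w 0)"
      by (intro L2sq_add_le) auto
    also have "L2sq lborel (fourier_trunc w 0) = L2sq lborel (\<lambda>x. indicator (cball 0 0) x * w x)"
      unfolding fourier_trunc_eq_ft using w
      by (intro ft_plancherel integrable_trunc square_integrable_mult_indicator) auto
    also have "2 * L2sq lborel (\<lambda>\<xi>. W \<xi> - fourier_trunc w 0 \<xi>) + 2 * L2sq lborel (\<lambda>x. indicator (cball 0 0) x * w x) < \<infinity>"
    proof -
      have "L2tail w 0 < \<infinity>" unfolding L2tail_def
        using square_integrable_mult_indicator[OF w, of "- cball 0 0"] by (auto simp: square_integrable_iff_L2sq)
      moreover have "L2sq lborel (\<lambda>x. indicator (cball 0 0) x * w x) < \<infinity>"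
        using square_integrable_mult_indicator[OF w, of "cball 0 0"] by (auto simp: square_integrable_iff_L2sq)
      ultimately show ?thesis using bound[of 0 0]
        by (auto simp: ennreal_mult_less_top intro: le_less_trans)
    qed
    finally show ?thesis by simp
  qed
  then have "is_fourier w W"
    using lim w by (auto simp: is_fourier_def square_integrable_iff_L2sq) (simp add: L2sq_def)
  then show thesis by (rule that)
qed

lemma is_fourier_iff:
  "is_fourier w W \<longleftrightarrow> square_integrable lborel w \<and> square_integrable lborel W \<and>
    ((\<lambda>R. L2sq lborel (\<lambda>\<xi>. W \<xi> - fourier_trunc w R \<xi>)) \<longlongrightarrow> 0) at_top"
  by (simp add: is_fourier_def L2sq_def)

lemma L2sq_scaleR:
  fixes f :: "'a \<Rightarrow> 'b::euclidean_space"
  assumes [measurable]: "f \<in> borel_measurable M"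
  shows "L2sq M (\<lambda>x. c *\<^sub>R f x) = ennreal (c\<^sup>2) * L2sq M f"
  unfolding L2sq_def by (subst nn_integral_cmult[symmetric]) (auto simp: power_mult_distrib ennreal_mult)

lemma square_integrable_lincomb:
  fixes f g :: "'a \<Rightarrow> 'b::euclidean_space"
  assumes "square_integrable M f" "square_integrable M g"
  shows "square_integrable M (\<lambda>x. a *\<^sub>R f x + b *\<^sub>R g x)"
proof -
  have [measurable]: "f \<in> borel_measurable M" "g \<in> borel_measurable M" and fin: "L2sq M f < \<infinity>" "L2sq M g < \<infinity>"
    using assms by (auto simp: square_integrable_iff_L2sq)
  have "L2sq M (\<lambda>x. a *\<^sub>R f x + b *\<^sub>R g x) \<le> 2 * L2sq M (\<lambda>x. a *\<^sub>R f x) + 2 * L2sq M (\<lambda>x. b *\<^sub>R g x)"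
    by (intro L2sq_add_le) measurable
  also have "\<dots> < \<infinity>"
    using fin by (simp add: L2sq_scaleR ennreal_mult_less_top)
  finally show ?thesis by (simp add: square_integrable_iff_L2sq)
qed

lemma square_integrable_diff:
  fixes f g :: "'a \<Rightarrow> 'b::euclidean_space"
  assumes "square_integrable M f" "square_integrable M g"
  shows "square_integrable M (\<lambda>x. f x - g x)"
  using square_integrable_lincomb[OF assms, of 1 "-1"] by simp

lemma is_fourier_unique:
  fixes w :: "'a::euclidean_space \<Rightarrow> real"
  assumes W: "is_fourier w W" and V: "is_fourier w V"
  shows "AE \<xi> in lborel. W \<xi> = V \<xi>"
proof -
  have [measurable]: "w \<in> borel_measurable borel" "W \<in> borel_measurable borel" "V \<in> borel_measurable borel"
    using W V by (auto simp: is_fourier_iff square_integrable_iff_L2sq)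
  have lim: "((\<lambda>R. 2 * L2sq lborel (\<lambda>\<xi>. W \<xi> - fourier_trunc w R \<xi>) + 2 * L2sq lborel (\<lambda>\<xi>. V \<xi> - fourier_trunc w R \<xi>)) \<longlongrightarrow> 2 * 0 + 2 * 0) at_top"
    using W V unfolding is_fourier_iff by (intro tendsto_add ennreal_tendsto_cmult) auto
  have "L2sq lborel (\<lambda>\<xi>. W \<xi> - V \<xi>) \<le> 2 * 0 + 2 * 0"
  proof (rule tendsto_lowerbound[OF lim])
    show "\<forall>\<^sub>F R in at_top. L2sq lborel (\<lambda>\<xi>. W \<xi> - V \<xi>) \<le> 2 * L2sq lborel (\<lambda>\<xi>. W \<xi> - fourier_trunc w R \<xi>) + 2 * L2sq lborel (\<lambda>\<xi>. V \<xi> - fourier_trunc w R \<xi>)"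
    proof (intro always_eventually allI)
      fix R
      have "L2sq lborel (\<lambda>\<xi>. W \<xi> - V \<xi>) \<le> 2 * L2sq lborel (\<lambda>\<xi>. W \<xi> - fourier_trunc w R \<xi>) + 2 * L2sq lborel (\<lambda>\<xi>. fourier_trunc w R \<xi> - V \<xi>)"
        by (intro L2sq_diff_triangle) auto
      then show "L2sq lborel (\<lambda>\<xi>. W \<xi> - V \<xi>) \<le> 2 * L2sq lborel (\<lambda>\<xi>. W \<xi> - fourier_trunc w R \<xi>) + 2 * L2sq lborel (\<lambda>\<xi>. V \<xi> - fourier_trunc w R \<xi>)"
        by (simp only: L2sq_minus_commute[of lborel V])
    qed
  qed auto
  then have "AE \<xi> in lborel. W \<xi> - V \<xi> = 0" by (intro L2sq_eq_0_imp_AE) auto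
  then show ?thesis by simp
qed

lemma fourier_trunc_lincomb:
  fixes w v :: "'a::euclidean_space \<Rightarrow> real"
  assumes "square_integrable lborel w" "square_integrable lborel v"
  shows "fourier_trunc (\<lambda>x. a * w x + b * v x) R \<xi> = a *\<^sub>R fourier_trunc w R \<xi> + b *\<^sub>R fourier_trunc v R \<xi>"
proof -
  let ?f = "\<lambda>x. indicator (cball 0 R) x * w x" and ?g = "\<lambda>x. indicator (cball 0 R) x * v x"
  have "integrable lborel ?f" "integrable lborel ?g" by (intro integrable_trunc assms; simp)+
  note i = this[THEN ft_integrand_integrable, of \<xi>]
  have "(\<integral>x. complex_of_real (indicator (cball 0 R) x * (a * w x + b * v x)) * cis (- (x \<bullet> \<xi>)) \<partial>lborel) =
    (\<integral>x. of_real a * (complex_of_real (?f x) * cis (- (x \<bullet> \<xi>))) + of_real b * (complex_of_real (?g x) * cis (- (x \<bullet> \<xi>))) \<partial>lborel)"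
    by (intro Bochner_Integration.integral_cong refl) (simp add: algebra_simps)
  also have "\<dots> = of_real a * (\<integral>x. complex_of_real (?f x) * cis (- (x \<bullet> \<xi>)) \<partial>lborel) + of_real b * (\<integral>x. complex_of_real (?g x) * cis (- (x \<bullet> \<xi>)) \<partial>lborel)"
    using i by (subst Bochner_Integration.integral_add) auto
  finally show ?thesis unfolding fourier_trunc_eq_ft ft_def
    by (simp only: scaleR_conv_of_real) (simp only: algebra_simps)
qed

lemma is_fourier_lincomb:
  fixes w v :: "'a::euclidean_space \<Rightarrow> real"
  assumes W: "is_fourier w W" and V: "is_fourier v V"
  shows "is_fourier (\<lambda>x. a * w x + b * v x) (\<lambda>\<xi>. a *\<^sub>R W \<xi> + b *\<^sub>R V \<xi>)"
proof -
  have wv: "square_integrable lborel w" "square_integrable lborel v" "square_integrable lborel W" "square_integrable lborel V"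
    using W V by (auto simp: is_fourier_iff)
  have [measurable]: "w \<in> borel_measurable borel" "v \<in> borel_measurable borel" "W \<in> borel_measurable borel" "V \<in> borel_measurable borel"
    using W V by (auto simp: is_fourier_iff square_integrable_iff_L2sq)
  have "((\<lambda>R. 2 * (ennreal (a\<^sup>2) * L2sq lborel (\<lambda>\<xi>. W \<xi> - fourier_trunc w R \<xi>)) + 2 * (ennreal (b\<^sup>2) * L2sq lborel (\<lambda>\<xi>. V \<xi> - fourier_trunc v R \<xi>)))
       \<longlongrightarrow> 2 * (ennreal (a\<^sup>2) * 0) + 2 * (ennreal (b\<^sup>2) * 0)) at_top"
    using W V unfolding is_fourier_iff by (intro tendsto_add ennreal_tendsto_cmult) auto
  then have lim: "((\<lambda>R. 2 * (ennreal (a\<^sup>2) * L2sq lborel (\<lambda>\<xi>. W \<xi> - fourier_trunc w R \<xi>)) + 2 * (ennreal (b\<^sup>2) * L2sq lborel (\<lambda>\<xi>. V \<xi> - fourier_trunc v R \<xi>)))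
       \<longlongrightarrow> 0) at_top" by simp
  have "((\<lambda>R. L2sq lborel (\<lambda>\<xi>. a *\<^sub>R W \<xi> + b *\<^sub>R V \<xi> - fourier_trunc (\<lambda>x. a * w x + b * v x) R \<xi>)) \<longlongrightarrow> 0) at_top"
  proof (rule tendsto_sandwich[OF _ _ tendsto_const lim])
    show "\<forall>\<^sub>F R in at_top. L2sq lborel (\<lambda>\<xi>. a *\<^sub>R W \<xi> + b *\<^sub>R V \<xi> - fourier_trunc (\<lambda>x. a * w x + b * v x) R \<xi>)
      \<le> 2 * (ennreal (a\<^sup>2) * L2sq lborel (\<lambda>\<xi>. W \<xi> - fourier_trunc w R \<xi>)) + 2 * (ennreal (b\<^sup>2) * L2sq lborel (\<lambda>\<xi>. V \<xi> - fourier_trunc v R \<xi>))"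
    proof (intro always_eventually allI)
      fix R
      have "(\<lambda>\<xi>. a *\<^sub>R W \<xi> + b *\<^sub>R V \<xi> - fourier_trunc (\<lambda>x. a * w x + b * v x) R \<xi>) =
        (\<lambda>\<xi>. a *\<^sub>R (W \<xi> - fourier_trunc w R \<xi>) + b *\<^sub>R (V \<xi> - fourier_trunc v R \<xi>))"
        by (simp only: fourier_trunc_lincomb[OF wv(1,2)]) (simp only: algebra_simps)
      moreover have "L2sq lborel (\<lambda>\<xi>. a *\<^sub>R (W \<xi> - fourier_trunc w R \<xi>) + b *\<^sub>R (V \<xi> - fourier_trunc v R \<xi>))
        \<le> 2 * L2sq lborel (\<lambda>\<xi>. a *\<^sub>R (W \<xi> - fourier_trunc w R \<xi>)) + 2 * L2sq lborel (\<lambda>\<xi>. b *\<^sub>R (V \<xi> - fourier_trunc v R \<xi>))"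
        by (intro L2sq_add_le) auto
      moreover have "L2sq lborel (\<lambda>\<xi>. a *\<^sub>R (W \<xi> - fourier_trunc w R \<xi>)) = ennreal (a\<^sup>2) * L2sq lborel (\<lambda>\<xi>. W \<xi> - fourier_trunc w R \<xi>)"
        by (intro L2sq_scaleR) auto
      moreover have "L2sq lborel (\<lambda>\<xi>. b *\<^sub>R (V \<xi> - fourier_trunc v R \<xi>)) = ennreal (b\<^sup>2) * L2sq lborel (\<lambda>\<xi>. V \<xi> - fourier_trunc v R \<xi>)"
        by (intro L2sq_scaleR) auto
      ultimately show "L2sq lborel (\<lambda>\<xi>. a *\<^sub>R W \<xi> + b *\<^sub>R V \<xi> - fourier_trunc (\<lambda>x. a * w x + b * v x) R \<xi>)
      \<le> 2 * (ennreal (a\<^sup>2) * L2sq lborel (\<lambda>\<xi>. W \<xi> - fourier_trunc w R \<xi>)) + 2 * (ennreal (b\<^sup>2) * L2sq lborel (\<lambda>\<xi>. V \<xi> - fourier_trunc v R \<xi>))"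
        by simp
    qed
  qed auto
  then show ?thesis
    using square_integrable_lincomb[OF wv(1,2), of a b] square_integrable_lincomb[OF wv(3,4), of a b]
    by (simp add: is_fourier_iff)
qed

text \<open>Continuity of the squared norm, from \<open>| |a|\<^sup>2 - |b|\<^sup>2 | \<le> (1 + 1/\<delta>) |a - b|\<^sup>2 + \<delta> |b|\<^sup>2\<close> with small \<open>\<delta>\<close>.\<close>

lemma L2_norm_tendsto:
  fixes f :: "nat \<Rightarrow> 'a \<Rightarrow> 'b::euclidean_space"
  assumes f: "\<And>n. square_integrable M (f n)" and g: "square_integrable M g"
    and lim: "(\<lambda>n. L2sq M (\<lambda>x. f n x - g x)) \<longlonglongrightarrow> 0"
  shows "(\<lambda>n. \<integral>x. (norm (f n x))\<^sup>2 \<partial>M) \<longlonglongrightarrow> (\<integral>x. (norm (g x))\<^sup>2 \<partial>M)"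
proof -
  define D where "D n = (\<integral>x. (norm (f n x - g x))\<^sup>2 \<partial>M)" for n
  define G where "G = (\<integral>x. (norm (g x))\<^sup>2 \<partial>M)"
  have d: "square_integrable M (\<lambda>x. f n x - g x)" for n by (intro square_integrable_diff f g)
  have G0: "G \<ge> 0" unfolding G_def by simp
  have "(\<lambda>n. ennreal (D n)) \<longlonglongrightarrow> ennreal 0"
    using lim by (simp add: L2sq_eq_integral[OF d] D_def)
  then have D: "D \<longlonglongrightarrow> 0" by (subst (asm) tendsto_ennreal_iff) (auto simp: D_def)
  have ifg: "integrable M (\<lambda>x. (norm (f n x))\<^sup>2)" "integrable M (\<lambda>x. (norm (g x))\<^sup>2)" "integrable M (\<lambda>x. (norm (f n x - g x))\<^sup>2)" for n
    using f g d[of n] by (auto simp: square_integrable_def)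
  have pt: "\<bar>(norm a)\<^sup>2 - (norm b)\<^sup>2\<bar> \<le> (1 + 1 / \<delta>) * (norm (a - b))\<^sup>2 + \<delta> * (norm b)\<^sup>2" if "\<delta> > 0" for a b :: 'b and \<delta> :: real
  proof -
    let ?x = "norm (a - b)" and ?y = "norm b"
    have "(sqrt (1 / \<delta>) * ?x - sqrt \<delta> * ?y)\<^sup>2 \<ge> 0" by simp
    then have "2 * (sqrt (1 / \<delta>) * sqrt \<delta>) * (?x * ?y) \<le> 1 / \<delta> * ?x\<^sup>2 + \<delta> * ?y\<^sup>2"
      using that by (simp add: power2_diff power_mult_distrib mult_ac)
    then have xy: "2 * (?x * ?y) \<le> 1 / \<delta> * ?x\<^sup>2 + \<delta> * ?y\<^sup>2"
      using that by (simp add: real_sqrt_mult[symmetric])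
    have "(norm a)\<^sup>2 = ?x\<^sup>2 + 2 * ((a - b) \<bullet> b) + ?y\<^sup>2"
      by (simp add: power2_norm_eq_inner algebra_simps inner_commute)
    moreover have "(a - b) \<bullet> b \<le> ?x * ?y" "- ((a - b) \<bullet> b) \<le> ?x * ?y"
      using Cauchy_Schwarz_ineq2[of "a - b" b] by (auto simp: abs_le_iff)
    ultimately have "\<bar>(norm a)\<^sup>2 - (norm b)\<^sup>2\<bar> \<le> ?x\<^sup>2 + 2 * (?x * ?y)"
      using zero_le_power2[of ?x] by linarith
    with xy show ?thesis by (simp add: distrib_right)
  qed
  have bound: "\<bar>(\<integral>x. (norm (f n x))\<^sup>2 \<partial>M) - G\<bar> \<le> (1 + 1 / \<delta>) * D n + \<delta> * G" if "\<delta> > 0" for n \<delta>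
  proof -
    have "\<bar>(\<integral>x. (norm (f n x))\<^sup>2 \<partial>M) - G\<bar> = \<bar>\<integral>x. (norm (f n x))\<^sup>2 - (norm (g x))\<^sup>2 \<partial>M\<bar>"
      unfolding G_def using ifg by simp
    also have "\<dots> \<le> (\<integral>x. \<bar>(norm (f n x))\<^sup>2 - (norm (g x))\<^sup>2\<bar> \<partial>M)" by (rule integral_abs_bound)
    also have "\<dots> \<le> (\<integral>x. (1 + 1 / \<delta>) * (norm (f n x - g x))\<^sup>2 + \<delta> * (norm (g x))\<^sup>2 \<partial>M)"
      using ifg pt[OF that] by (intro integral_mono) auto
    also have "\<dots> = (1 + 1 / \<delta>) * D n + \<delta> * G" unfolding D_def G_def using ifg by simp
    finally show ?thesis .
  qed
  have "(\<lambda>n. (\<integral>x. (norm (f n x))\<^sup>2 \<partial>M)) \<longlonglongrightarrow> G"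
  proof (rule LIMSEQ_I)
    fix e :: real assume e: "e > 0"
    \<comment> \<open>\<open>G + 1\<close> instead of \<open>G\<close> because \<open>G\<close> may be zero\<close>
    define \<delta> where "\<delta> = e / (2 * (G + 1))"
    have \<delta>: "\<delta> > 0" "\<delta> * G < e / 2"
      using e G0 by (auto simp: \<delta>_def field_simps add_pos_nonneg)
    have "(\<lambda>n. (1 + 1 / \<delta>) * D n) \<longlonglongrightarrow> (1 + 1 / \<delta>) * 0" by (intro tendsto_intros D)
    then have "\<forall>\<^sub>F n in sequentially. (1 + 1 / \<delta>) * D n < e / 2" using e by (intro order_tendstoD) auto
    then obtain N where N: "\<And>n. n \<ge> N \<Longrightarrow> (1 + 1 / \<delta>) * D n < e / 2" by (auto simp: eventually_sequentially)
    show "\<exists>no. \<forall>n\<ge>no. norm ((\<integral>x. (norm (f n x))\<^sup>2 \<partial>M) - G) < e"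
    proof (intro exI[of _ N] allI impI)
      fix n assume "N \<le> n"
      then show "norm ((\<integral>x. (norm (f n x))\<^sup>2 \<partial>M) - G) < e"
        using bound[OF \<delta>(1), of n] N[of n] \<delta>(2) unfolding real_norm_def by linarith
    qed
  qed
  then show ?thesis by (simp add: G_def)
qed

lemma fourier_isometry:
  fixes w :: "'a::euclidean_space \<Rightarrow> real"
  assumes W: "is_fourier w W"
  shows "(\<integral>\<xi>. (norm (W \<xi>))\<^sup>2 \<partial>lborel) = (\<integral>x. (w x)\<^sup>2 \<partial>lborel)"
proof -
  have w: "square_integrable lborel w" and Ws: "square_integrable lborel W" using W by (auto simp: is_fourier_iff)
  have [measurable]: "w \<in> borel_measurable borel" "W \<in> borel_measurable borel"
    using w Ws by (auto simp: square_integrable_iff_L2sq)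
  let ?w = "\<lambda>n x. indicator (cball 0 (real n)) x * w x"
  have wi: "square_integrable lborel (?w n)" for n using w by (intro square_integrable_mult_indicator) auto
  have eq: "L2sq lborel (fourier_trunc w (real n)) = L2sq lborel (?w n)" for n
    unfolding fourier_trunc_eq_ft using w by (intro ft_plancherel wi integrable_trunc) auto
  have Fi: "square_integrable lborel (fourier_trunc w (real n))" for n
    using wi[of n] eq[of n] by (simp add: square_integrable_iff_L2sq)
  have eq': "(\<integral>\<xi>. (norm (fourier_trunc w (real n) \<xi>))\<^sup>2 \<partial>lborel) = (\<integral>x. (norm (?w n x))\<^sup>2 \<partial>lborel)" for n
    using eq[of n] unfolding L2sq_eq_integral[OF Fi] L2sq_eq_integral[OF wi] by (simp add: integral_nonneg_AE)
  have "((\<lambda>R. L2sq lborel (\<lambda>\<xi>. W \<xi> - fourier_trunc w R \<xi>)) \<longlongrightarrow> 0) at_top" using W by (simp add: is_fourier_iff)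
  then have "(\<lambda>n. L2sq lborel (\<lambda>\<xi>. W \<xi> - fourier_trunc w (real n) \<xi>)) \<longlonglongrightarrow> 0"
    using filterlim_real_sequentially by (rule filterlim_compose)
  then have "(\<lambda>n. L2sq lborel (\<lambda>\<xi>. fourier_trunc w (real n) \<xi> - W \<xi>)) \<longlonglongrightarrow> 0"
    by (simp only: L2sq_minus_commute[of lborel W])
  from L2_norm_tendsto[OF Fi Ws this]
  have 1: "(\<lambda>n. \<integral>x. (norm (?w n x))\<^sup>2 \<partial>lborel) \<longlonglongrightarrow> (\<integral>\<xi>. (norm (W \<xi>))\<^sup>2 \<partial>lborel)" by (simp only: eq')
  have "L2sq lborel (\<lambda>x. ?w n x - w x) = L2tail w (real n)" for n
    unfolding L2tail_def L2sq_def by (intro nn_integral_cong) (auto simp: indicator_def)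
  then have "(\<lambda>n. L2sq lborel (\<lambda>x. ?w n x - w x)) \<longlonglongrightarrow> 0" using L2tail_tendsto[OF w] by simp
  from L2_norm_tendsto[OF wi w this]
  have 2: "(\<lambda>n. \<integral>x. (norm (?w n x))\<^sup>2 \<partial>lborel) \<longlonglongrightarrow> (\<integral>x. (norm (w x))\<^sup>2 \<partial>lborel)" .
  show ?thesis using LIMSEQ_unique[OF 1 2] by simp
qed

lemma integrable_inner_square_integrable:
  fixes f g :: "'a \<Rightarrow> 'b::euclidean_space"
  assumes f: "square_integrable M f" and g: "square_integrable M g"
  shows "integrable M (\<lambda>x. f x \<bullet> g x)"
    and "(\<integral>x. f x \<bullet> g x \<partial>M) = ((\<integral>x. (norm (1 *\<^sub>R f x + 1 *\<^sub>R g x))\<^sup>2 \<partial>M) - (\<integral>x. (norm (1 *\<^sub>R f x + (-1) *\<^sub>R g x))\<^sup>2 \<partial>M)) / 4"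
proof -
  have i: "integrable M (\<lambda>x. (norm (a *\<^sub>R f x + b *\<^sub>R g x))\<^sup>2)" for a b
    using square_integrable_lincomb[OF f g, of a b] by (simp add: square_integrable_def)
  have eq: "f x \<bullet> g x = ((norm (1 *\<^sub>R f x + 1 *\<^sub>R g x))\<^sup>2 - (norm (1 *\<^sub>R f x + (-1) *\<^sub>R g x))\<^sup>2) / 4" for x
    by (simp add: power2_norm_eq_inner algebra_simps inner_commute)
  show "integrable M (\<lambda>x. f x \<bullet> g x)" unfolding eq
    by (intro Bochner_Integration.integrable_diff i integrable_divide)
  show "(\<integral>x. f x \<bullet> g x \<partial>M) = ((\<integral>x. (norm (1 *\<^sub>R f x + 1 *\<^sub>R g x))\<^sup>2 \<partial>M) - (\<integral>x. (norm (1 *\<^sub>R f x + (-1) *\<^sub>R g x))\<^sup>2 \<partial>M)) / 4"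
    unfolding eq by (simp only: integral_divide_zero Bochner_Integration.integral_diff[OF i i])
qed

text \<open>Polarization of the isometry.\<close>

lemma parseval:
  fixes w v :: "'a::euclidean_space \<Rightarrow> real"
  assumes W: "is_fourier w W" and V: "is_fourier v V"
  shows "(\<integral>x. w x * v x \<partial>lborel) = (\<integral>\<xi>. W \<xi> \<bullet> V \<xi> \<partial>lborel)"
proof -
  have s: "square_integrable lborel w" "square_integrable lborel v" "square_integrable lborel W" "square_integrable lborel V"
    using W V by (auto simp: is_fourier_iff)
  have "(\<integral>x. w x \<bullet> v x \<partial>lborel) = (\<integral>\<xi>. W \<xi> \<bullet> V \<xi> \<partial>lborel)"
    unfolding integrable_inner_square_integrable(2)[OF s(1,2)] integrable_inner_square_integrable(2)[OF s(3,4)]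
    unfolding fourier_isometry[OF is_fourier_lincomb[OF W V]] by simp
  then show ?thesis by simp
qed

lemma is_fourier_indicator:
  fixes B :: "'a::euclidean_space set"
  assumes [measurable]: "B \<in> sets borel" and B: "bounded B"
  shows "is_fourier (indicator B) (ft (indicator B))"
proof -
  have i: "integrable lborel (indicator B :: 'a \<Rightarrow> real)"
    using emeasure_bounded_finite[OF B] by auto
  have sq: "(norm (indicator B x :: real))\<^sup>2 = indicator B x" for x :: 'a by (simp add: indicator_def)
  have s: "square_integrable lborel (indicator B :: 'a \<Rightarrow> real)"
    using i unfolding square_integrable_def sq by auto
  have "square_integrable lborel (ft (indicator B))"
    using s ft_plancherel[OF i s] by (simp add: square_integrable_iff_L2sq)
  moreover have "((\<lambda>R. L2sq lborel (\<lambda>\<xi>. ft (indicator B) \<xi> - fourier_trunc (indicator B) R \<xi>)) \<longlongrightarrow> 0) at_top"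
  proof (rule tendsto_eventually)
    obtain r where r: "B \<subseteq> cball 0 r" using B by (auto simp: bounded_iff subset_iff)
    show "\<forall>\<^sub>F R in at_top. L2sq lborel (\<lambda>\<xi>. ft (indicator B) \<xi> - fourier_trunc (indicator B) R \<xi>) = 0"
    proof (rule eventually_at_top_linorderI[of r])
      fix R assume "r \<le> R"
      then have "(\<lambda>x. indicator (cball 0 R) x * indicator B x :: real) = indicator B"
        using r by (fastforce simp: indicator_def fun_eq_iff)
      then show "L2sq lborel (\<lambda>\<xi>. ft (indicator B) \<xi> - fourier_trunc (indicator B) R \<xi>) = 0"
        by (simp add: fourier_trunc_eq_ft L2sq_def)
    qed
  qed
  ultimately show ?thesis using s by (simp add: is_fourier_iff)
qed

text \<open>The real part of the inverse Fourier integral; it recovers a real function.\<close>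

definition finv :: "('a::euclidean_space \<Rightarrow> complex) \<Rightarrow> 'a \<Rightarrow> real" where
  "finv W x = fconst TYPE('a) * (\<integral>\<xi>. Re (W \<xi> * cis (x \<bullet> \<xi>)) \<partial>lborel)"

lemma abs_Re_mult_cis_le: "\<bar>Re (z * cis t)\<bar> \<le> norm z"
  by (metis abs_Re_le_cmod norm_cis norm_mult mult.right_neutral)

lemma finv_measurable [measurable]:
  assumes [measurable]: "W \<in> borel_measurable borel"
  shows "finv W \<in> borel_measurable borel"
  unfolding finv_def[abs_def] by measurable

lemma finv_bound:
  fixes W :: "'a::euclidean_space \<Rightarrow> complex"
  assumes W: "integrable lborel W"
  shows "\<bar>finv W x\<bar> \<le> fconst TYPE('a) * (\<integral>\<xi>. norm (W \<xi>) \<partial>lborel)"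
proof -
  have [measurable]: "W \<in> borel_measurable borel" using W by auto
  have i: "integrable lborel (\<lambda>\<xi>. Re (W \<xi> * cis (x \<bullet> \<xi>)))"
    by (rule Bochner_Integration.integrable_bound[OF W]) (auto simp: abs_Re_mult_cis_le simp del: times_complex.sel)
  have "\<bar>\<integral>\<xi>. Re (W \<xi> * cis (x \<bullet> \<xi>)) \<partial>lborel\<bar> \<le> (\<integral>\<xi>. \<bar>Re (W \<xi> * cis (x \<bullet> \<xi>))\<bar> \<partial>lborel)"
    by (rule integral_abs_bound)
  also have "\<dots> \<le> (\<integral>\<xi>. norm (W \<xi>) \<partial>lborel)"
    using i W by (intro integral_mono abs_Re_mult_cis_le) auto
  finally show ?thesis unfolding finv_def abs_mult using fconst_pos[where 'a='a]
    by (simp add: mult_left_mono)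
qed

text \<open>Apply the hypothesis to the bounded pieces of \<open>{u > 0}\<close> and of \<open>{u < 0}\<close>.\<close>

lemma AE_zero_if_integral_zero_on_bounded:
  fixes u :: "'a::euclidean_space \<Rightarrow> real"
  assumes [measurable]: "u \<in> borel_measurable borel"
    and i: "\<And>B. B \<in> sets borel \<Longrightarrow> bounded B \<Longrightarrow> integrable lborel (\<lambda>x. indicator B x * u x)"
    and z: "\<And>B. B \<in> sets borel \<Longrightarrow> bounded B \<Longrightarrow> (\<integral>x. indicator B x * u x \<partial>lborel) = 0"
  shows "AE x in lborel. u x = 0"
proof -
  have pos: "AE x in lborel. v x \<le> 0" if v: "v = u \<or> v = (\<lambda>x. - u x)" for v
  proof -
    have [measurable]: "v \<in> borel_measurable borel" using v by auto
    have "AE x in lborel. \<forall>n::nat. x \<in> cball 0 (real n) \<longrightarrow> v x \<le> 0"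
    proof (subst AE_all_countable, intro allI)
      fix n :: nat
      let ?B = "cball 0 (real n) \<inter> {x. v x > 0}"
      have B: "?B \<in> sets borel" "bounded ?B" by (auto intro: bounded_subset[OF bounded_cball])
      have ib: "integrable lborel (\<lambda>x. indicator ?B x * v x)" "(\<integral>x. indicator ?B x * v x \<partial>lborel) = 0"
        using v i[OF B] z[OF B] by auto
      then have "AE x in lborel. indicator ?B x * v x = 0"
        by (subst (asm) integral_nonneg_eq_0_iff_AE) (auto simp: indicator_def)
      then show "AE x in lborel. x \<in> cball 0 (real n) \<longrightarrow> v x \<le> 0"
        by eventually_elim (auto simp: indicator_def split: if_splits)
    qed
    then show ?thesis
    proof eventually_elim
      case (elim x)
      obtain n :: nat where "norm x \<le> real n" using real_arch_simple by blast
      then show ?case using elim by auto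
    qed
  qed
  show ?thesis using pos[of u, simplified] pos[of "\<lambda>x. - u x", simplified] by eventually_elim auto
qed

text \<open>By Parseval's identity with the indicator function of a bounded set \<open>B\<close>, whose transform is an
honest integral, and by Fubini's theorem, \<open>w\<close> and \<open>finv W\<close> have the same integral over \<open>B\<close>.\<close>

lemma fourier_inversion:
  fixes w :: "'a::euclidean_space \<Rightarrow> real"
  assumes W: "is_fourier w W" and Wi: "integrable lborel W"
  shows "AE x in lborel. w x = finv W x"
proof -
  let ?\<kappa> = "fconst TYPE('a)"
  have w: "square_integrable lborel w" using W by (simp add: is_fourier_iff)
  have [measurable]: "w \<in> borel_measurable borel" "W \<in> borel_measurable borel"
    using w Wi by (auto simp: square_integrable_iff_L2sq)
  have ifinv: "integrable lborel (\<lambda>x. indicator B x * finv W x)" if [measurable]: "B \<in> sets borel" and B: "bounded B" for B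
  proof (rule Bochner_Integration.integrable_bound)
    show "integrable lborel (\<lambda>x. indicator B x * (?\<kappa> * (\<integral>\<xi>. norm (W \<xi>) \<partial>lborel)))"
      using emeasure_bounded_finite[OF B] by (intro integrable_mult_left) auto
    show "AE x in lborel. norm (indicator B x * finv W x) \<le> norm (indicator B x * (?\<kappa> * (\<integral>\<xi>. norm (W \<xi>) \<partial>lborel)))"
      using finv_bound[OF Wi] fconst_pos[where 'a='a] by (intro AE_I2) (auto simp: indicator_def abs_mult intro: order_trans)
  qed measurable
  have "AE x in lborel. w x - finv W x = 0"
  proof (rule AE_zero_if_integral_zero_on_bounded)
    fix B :: "'a set" assume B[measurable]: "B \<in> sets borel" and Bb: "bounded B"
    have i1: "integrable lborel (\<lambda>x. indicator B x * w x)" using w Bb by (intro integrable_trunc) auto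
    have eq: "indicator B x * (w x - finv W x) = indicator B x * w x - indicator B x * finv W x" for x
      by (simp add: algebra_simps)
    show "integrable lborel (\<lambda>x. indicator B x * (w x - finv W x))"
      unfolding eq using i1 ifinv[OF B Bb] by auto
    have iB: "integrable lborel (indicator B :: 'a \<Rightarrow> real)"
      using emeasure_bounded_finite[OF Bb] by auto
    define k where "k \<xi> x = indicator B x * Re (W \<xi> * cis (x \<bullet> \<xi>))" for \<xi> x
    have inner: "W \<xi> \<bullet> ft (indicator B) \<xi> = ?\<kappa> * (\<integral>x. k \<xi> x \<partial>lborel)" for \<xi>
    proof -
      have ii: "integrable lborel (\<lambda>x. complex_of_real (indicator B x) * cis (- (x \<bullet> \<xi>)))"
        by (rule ft_integrand_integrable[OF iB])
      have "W \<xi> \<bullet> ft (indicator B) \<xi> = ?\<kappa> * (W \<xi> \<bullet> (\<integral>x. complex_of_real (indicator B x) * cis (- (x \<bullet> \<xi>)) \<partial>lborel))"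
        unfolding ft_def by (simp add: inner_complex_def distrib_left mult_ac)
      also have "W \<xi> \<bullet> (\<integral>x. complex_of_real (indicator B x) * cis (- (x \<bullet> \<xi>)) \<partial>lborel) =
          (\<integral>x. W \<xi> \<bullet> (complex_of_real (indicator B x) * cis (- (x \<bullet> \<xi>))) \<partial>lborel)"
        using ii by (simp only: integral_inner_right)
      also have "(\<lambda>x. W \<xi> \<bullet> (complex_of_real (indicator B x) * cis (- (x \<bullet> \<xi>)))) = k \<xi>"
        by (intro ext) (simp add: k_def inner_complex_def algebra_simps)
      finally show ?thesis .
    qed
    have full: "integrable (lborel \<Otimes>\<^sub>M lborel) (\<lambda>(\<xi>, x). k \<xi> x)"
    proof (rule Bochner_Integration.integrable_bound)
      have "integrable lborel (\<lambda>\<xi>. norm (W \<xi>))" using Wi by simp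
      from integrable_product_bounded[OF this iB, of "\<lambda>_. 1" 1]
      show "integrable (lborel \<Otimes>\<^sub>M lborel) (\<lambda>p. norm (W (fst p)) * indicator B (snd p))" by simp
      show "(\<lambda>(\<xi>, x). k \<xi> x) \<in> borel_measurable (lborel \<Otimes>\<^sub>M lborel)"
        unfolding k_def by measurable
      show "AE p in lborel \<Otimes>\<^sub>M lborel. norm (case p of (\<xi>, x) \<Rightarrow> k \<xi> x) \<le> norm (norm (W (fst p)) * indicator B (snd p) :: real)"
        by (intro AE_I2) (auto simp: k_def indicator_def abs_Re_mult_cis_le simp del: times_complex.sel split: prod.splits)
    qed
    have "(\<integral>x. w x * indicator B x \<partial>lborel) = (\<integral>\<xi>. W \<xi> \<bullet> ft (indicator B) \<xi> \<partial>lborel)"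
      by (rule parseval[OF W is_fourier_indicator[OF B Bb]])
    also have "\<dots> = ?\<kappa> * (\<integral>\<xi>. \<integral>x. k \<xi> x \<partial>lborel \<partial>lborel)" by (simp add: inner)
    also have "(\<integral>\<xi>. \<integral>x. k \<xi> x \<partial>lborel \<partial>lborel) = (\<integral>x. \<integral>\<xi>. k \<xi> x \<partial>lborel \<partial>lborel)"
      using lborel_pair.Fubini_integral[OF full] by simp
    also have "?\<kappa> * (\<integral>x. \<integral>\<xi>. k \<xi> x \<partial>lborel \<partial>lborel) = (\<integral>x. indicator B x * finv W x \<partial>lborel)"
      unfolding k_def finv_def by (simp add: mult_ac del: times_complex.sel)
    finally have "(\<integral>x. indicator B x * w x \<partial>lborel) = (\<integral>x. indicator B x * finv W x \<partial>lborel)" by (simp add: mult.commute)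
    then show "(\<integral>x. indicator B x * (w x - finv W x) \<partial>lborel) = 0"
      unfolding eq using i1 ifinv[OF B Bb] by simp
  qed measurable
  then show ?thesis by simp
qed

section \<open>Sobolev spaces of the whole space\<close>

lemma is_fourier_fourier:
  fixes w :: "'a::euclidean_space \<Rightarrow> real"
  shows "square_integrable lborel w \<Longrightarrow> is_fourier w (fourier w)"
  unfolding fourier_def using fourier_exists someI[of "is_fourier w"] by metis

lemma fourier_measurable:
  fixes w :: "'a::euclidean_space \<Rightarrow> real"
  shows "square_integrable lborel w \<Longrightarrow> fourier w \<in> borel_measurable borel"
  using is_fourier_fourier[of w] by (auto simp: is_fourier_iff square_integrable_iff_L2sq)

text \<open>The Fourier transform of the Bessel potential of order \<open>- s\<close> of \<open>w\<close>. It identifies \<open>H\<^sup>s\<close> isometrically with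
a subspace of \<open>L\<^sup>2\<close>, so that the parallelogram identity and completeness carry over.\<close>

definition bessel :: "real \<Rightarrow> ('a::euclidean_space \<Rightarrow> real) \<Rightarrow> 'a \<Rightarrow> complex" where
  "bessel s w \<xi> = (1 + (norm \<xi>)\<^sup>2) powr (s / 2) *\<^sub>R fourier w \<xi>"

lemma one_plus_norm_pos: "0 < 1 + (norm x)\<^sup>2"
  by (simp add: add_pos_nonneg)

lemma norm_bessel_sq: "(norm (bessel s w \<xi>))\<^sup>2 = (1 + (norm \<xi>)\<^sup>2) powr s * (norm (fourier w \<xi>))\<^sup>2"
  unfolding bessel_def by (simp add: power_mult_distrib power2_eq_square powr_add[symmetric])

lemma bessel_measurable:
  fixes w :: "'a::euclidean_space \<Rightarrow> real"
  assumes "square_integrable lborel w" shows "bessel s w \<in> borel_measurable borel"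
proof -
  have [measurable]: "fourier w \<in> borel_measurable borel" using fourier_measurable[OF assms] .
  show ?thesis unfolding bessel_def[abs_def] by measurable
qed

lemma Hs_whole_iff:
  "w \<in> Hs_whole s \<longleftrightarrow> square_integrable lborel w \<and> square_integrable lborel (bessel s w)"
  unfolding Hs_whole_def square_integrable_def[of _ "bessel s w"] norm_bessel_sq
  using bessel_measurable[of w s] by auto

lemma Hs_whole_norm_sq: "(Hs_whole_norm s w)\<^sup>2 = (\<integral>\<xi>. (norm (bessel s w \<xi>))\<^sup>2 \<partial>lborel)"
  unfolding Hs_whole_norm_def norm_bessel_sq by (simp add: integral_nonneg_AE)

lemma Hs_whole_norm_nonneg: "0 \<le> Hs_whole_norm s w"
  unfolding Hs_whole_norm_def by (simp add: integral_nonneg_AE)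

lemma fourier_lincomb_AE:
  fixes w v :: "'a::euclidean_space \<Rightarrow> real"
  assumes w: "square_integrable lborel w" and v: "square_integrable lborel v"
  shows "AE \<xi> in lborel. fourier (\<lambda>x. a * w x + b * v x) \<xi> = a *\<^sub>R fourier w \<xi> + b *\<^sub>R fourier v \<xi>"
proof -
  have "square_integrable lborel (\<lambda>x. a * w x + b * v x)"
    using square_integrable_lincomb[OF w v, of a b] by simp
  from is_fourier_unique[OF is_fourier_fourier[OF this] is_fourier_lincomb[OF is_fourier_fourier[OF w] is_fourier_fourier[OF v]]]
  show ?thesis .
qed

lemma bessel_lincomb_AE:
  fixes w v :: "'a::euclidean_space \<Rightarrow> real"
  assumes w: "square_integrable lborel w" and v: "square_integrable lborel v"
  shows "AE \<xi> in lborel. bessel s (\<lambda>x. a * w x + b * v x) \<xi> = a *\<^sub>R bessel s w \<xi> + b *\<^sub>R bessel s v \<xi>"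
  using fourier_lincomb_AE[OF w v, of a b]
  by eventually_elim (simp add: bessel_def scaleR_add_right mult.commute)

lemma square_integrable_cong_AE:
  assumes "f \<in> borel_measurable M" "g \<in> borel_measurable M" "AE x in M. f x = g x"
  shows "square_integrable M f \<longleftrightarrow> square_integrable M g"
  using assms L2sq_cong_AE[OF assms(3)] by (simp add: square_integrable_iff_L2sq)

lemma Hs_whole_lincomb:
  fixes w v :: "'a::euclidean_space \<Rightarrow> real"
  assumes w: "w \<in> Hs_whole s" and v: "v \<in> Hs_whole s"
  shows "(\<lambda>x. a * w x + b * v x) \<in> Hs_whole s"
    and "(Hs_whole_norm s (\<lambda>x. a * w x + b * v x))\<^sup>2 = (\<integral>\<xi>. (norm (a *\<^sub>R bessel s w \<xi> + b *\<^sub>R bessel s v \<xi>))\<^sup>2 \<partial>lborel)"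
proof -
  have s: "square_integrable lborel w" "square_integrable lborel v" "square_integrable lborel (bessel s w)" "square_integrable lborel (bessel s v)"
    using w v by (auto simp: Hs_whole_iff)
  have [measurable]: "bessel s w \<in> borel_measurable borel" "bessel s v \<in> borel_measurable borel"
    using s bessel_measurable by auto
  have c: "square_integrable lborel (\<lambda>x. a * w x + b * v x)"
    using square_integrable_lincomb[OF s(1,2), of a b] by simp
  have m[measurable]: "bessel s (\<lambda>x. a * w x + b * v x) \<in> borel_measurable borel" by (rule bessel_measurable[OF c])
  note ae = bessel_lincomb_AE[OF s(1,2), of s a b]
  have "square_integrable lborel (bessel s (\<lambda>x. a * w x + b * v x))"
    using square_integrable_lincomb[OF s(3,4), of a b]
    by (subst square_integrable_cong_AE[OF _ _ ae]) auto
  then show "(\<lambda>x. a * w x + b * v x) \<in> Hs_whole s" using c by (simp add: Hs_whole_iff)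
  show "(Hs_whole_norm s (\<lambda>x. a * w x + b * v x))\<^sup>2 = (\<integral>\<xi>. (norm (a *\<^sub>R bessel s w \<xi> + b *\<^sub>R bessel s v \<xi>))\<^sup>2 \<partial>lborel)"
    unfolding Hs_whole_norm_sq using ae by (intro integral_cong_AE) auto
qed

definition Hs_dist2 :: "real \<Rightarrow> ('a::euclidean_space \<Rightarrow> real) \<Rightarrow> ('a \<Rightarrow> real) \<Rightarrow> real" where
  "Hs_dist2 s w v = (Hs_whole_norm s (\<lambda>x. w x - v x))\<^sup>2"

lemma Hs_whole_diff:
  assumes "w \<in> Hs_whole s" "v \<in> Hs_whole s" shows "(\<lambda>x. w x - v x) \<in> Hs_whole s"
  using Hs_whole_lincomb(1)[OF assms, of 1 "-1"] by simp

lemma Hs_whole_mid: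
  assumes "w \<in> Hs_whole s" "v \<in> Hs_whole s" shows "(\<lambda>x. (w x + v x) / 2) \<in> Hs_whole s"
  using Hs_whole_lincomb(1)[OF assms, of "1/2" "1/2"] by (simp add: add_divide_distrib)

lemma Hs_dist2_eq:
  fixes w v :: "'a::euclidean_space \<Rightarrow> real"
  assumes "w \<in> Hs_whole s" "v \<in> Hs_whole s"
  shows "Hs_dist2 s w v = (\<integral>\<xi>. (norm (bessel s w \<xi> - bessel s v \<xi>))\<^sup>2 \<partial>lborel)"
    and "ennreal (Hs_dist2 s w v) = L2sq lborel (\<lambda>\<xi>. bessel s w \<xi> - bessel s v \<xi>)"
proof -
  show 1: "Hs_dist2 s w v = (\<integral>\<xi>. (norm (bessel s w \<xi> - bessel s v \<xi>))\<^sup>2 \<partial>lborel)"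
    unfolding Hs_dist2_def using Hs_whole_lincomb(2)[OF assms, of 1 "-1"] by simp
  have "square_integrable lborel (\<lambda>\<xi>. bessel s w \<xi> - bessel s v \<xi>)"
    using assms by (intro square_integrable_diff) (auto simp: Hs_whole_iff)
  from L2sq_eq_integral[OF this] show "ennreal (Hs_dist2 s w v) = L2sq lborel (\<lambda>\<xi>. bessel s w \<xi> - bessel s v \<xi>)"
    by (simp add: 1)
qed

lemma Hs_whole_parallelogram:
  fixes w v :: "'a::euclidean_space \<Rightarrow> real"
  assumes w: "w \<in> Hs_whole s" and v: "v \<in> Hs_whole s"
  shows "(Hs_whole_norm s (\<lambda>x. (w x + v x) / 2))\<^sup>2 + 1/4 * Hs_dist2 s w v = ((Hs_whole_norm s w)\<^sup>2 + (Hs_whole_norm s v)\<^sup>2) / 2"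
proof -
  let ?P = "bessel s w" and ?Q = "bessel s v"
  have s: "square_integrable lborel ?P" "square_integrable lborel ?Q" using w v by (auto simp: Hs_whole_iff)
  have i: "integrable lborel (\<lambda>\<xi>. (norm (a *\<^sub>R ?P \<xi> + b *\<^sub>R ?Q \<xi>))\<^sup>2)" for a b
    using square_integrable_lincomb[OF s, of a b] by (simp add: square_integrable_def)
  have "(Hs_whole_norm s (\<lambda>x. (w x + v x) / 2))\<^sup>2 = (\<integral>\<xi>. (norm ((1/2) *\<^sub>R ?P \<xi> + (1/2) *\<^sub>R ?Q \<xi>))\<^sup>2 \<partial>lborel)"
    using Hs_whole_lincomb(2)[OF w v, of "1/2" "1/2"] by (simp add: add_divide_distrib)
  moreover have "Hs_dist2 s w v = (\<integral>\<xi>. (norm (1 *\<^sub>R ?P \<xi> + (-1) *\<^sub>R ?Q \<xi>))\<^sup>2 \<partial>lborel)"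
    using Hs_dist2_eq(1)[OF w v] by simp
  moreover have "(Hs_whole_norm s w)\<^sup>2 = (\<integral>\<xi>. (norm (1 *\<^sub>R ?P \<xi> + 0 *\<^sub>R ?Q \<xi>))\<^sup>2 \<partial>lborel)"
    by (simp add: Hs_whole_norm_sq)
  moreover have "(Hs_whole_norm s v)\<^sup>2 = (\<integral>\<xi>. (norm (0 *\<^sub>R ?P \<xi> + 1 *\<^sub>R ?Q \<xi>))\<^sup>2 \<partial>lborel)"
    by (simp add: Hs_whole_norm_sq)
  moreover have "(\<integral>\<xi>. (norm ((1/2) *\<^sub>R ?P \<xi> + (1/2) *\<^sub>R ?Q \<xi>))\<^sup>2 \<partial>lborel) + 1/4 * (\<integral>\<xi>. (norm (1 *\<^sub>R ?P \<xi> + (-1) *\<^sub>R ?Q \<xi>))\<^sup>2 \<partial>lborel)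
    = ((\<integral>\<xi>. (norm (1 *\<^sub>R ?P \<xi> + 0 *\<^sub>R ?Q \<xi>))\<^sup>2 \<partial>lborel) + (\<integral>\<xi>. (norm (0 *\<^sub>R ?P \<xi> + 1 *\<^sub>R ?Q \<xi>))\<^sup>2 \<partial>lborel)) / 2"
  proof -
    have eq: "(norm ((1/2) *\<^sub>R a + (1/2) *\<^sub>R b))\<^sup>2 + 1/4 * (norm (1 *\<^sub>R a + (-1) *\<^sub>R b))\<^sup>2 = ((norm (1 *\<^sub>R a + 0 *\<^sub>R b))\<^sup>2 + (norm (0 *\<^sub>R a + 1 *\<^sub>R b))\<^sup>2) / 2" for a b :: complex
      by (simp add: power2_norm_eq_inner inner_simps inner_commute field_simps)
    have "(\<integral>\<xi>. (norm ((1/2) *\<^sub>R ?P \<xi> + (1/2) *\<^sub>R ?Q \<xi>))\<^sup>2 + 1/4 * (norm (1 *\<^sub>R ?P \<xi> + (-1) *\<^sub>R ?Q \<xi>))\<^sup>2 \<partial>lborel) =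
      (\<integral>\<xi>. ((norm (1 *\<^sub>R ?P \<xi> + 0 *\<^sub>R ?Q \<xi>))\<^sup>2 + (norm (0 *\<^sub>R ?P \<xi> + 1 *\<^sub>R ?Q \<xi>))\<^sup>2) / 2 \<partial>lborel)"
      by (simp only: eq)
    then show ?thesis
      by (simp only: Bochner_Integration.integral_add[OF i integrable_mult_right[OF i]] integral_mult_right_zero
          integral_divide_zero Bochner_Integration.integral_add[OF i i])
  qed
  ultimately show ?thesis by (simp only:)
qed

text \<open>For \<open>s \<ge> 0\<close> a Cauchy sequence in \<open>H\<^sup>s\<close> is one in \<open>L\<^sup>2\<close>, with limit \<open>u\<close>, and the weighted transforms have an
\<open>L\<^sup>2\<close> limit \<open>V\<close>. The two limits are compatible: dividing by the weight, which is at least 1, shows that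
the transform of \<open>u\<close> is \<open>V\<close> divided by the weight. A limit \<open>u\<close> in physical space is needed because
the transform is only considered for real functions, and not every \<open>V\<close> comes from one.\<close>

lemma Hs_whole_complete:
  fixes X :: "nat \<Rightarrow> 'a::euclidean_space \<Rightarrow> real"
  assumes s: "s \<ge> 0" and X: "\<And>n. X n \<in> Hs_whole s"
    and cau: "\<forall>e>0. \<exists>N. \<forall>m\<ge>N. \<forall>n\<ge>N. Hs_dist2 s (X m) (X n) < e"
  obtains u where "u \<in> Hs_whole s" "(\<lambda>n. Hs_dist2 s (X n) u) \<longlonglongrightarrow> 0"
proof -
  have sq: "square_integrable lborel (X n)" "square_integrable lborel (bessel s (X n))" for n
    using X[of n] by (auto simp: Hs_whole_iff)
  have [measurable]: "X n \<in> borel_measurable borel" "bessel s (X n) \<in> borel_measurable borel" "fourier (X n) \<in> borel_measurable borel" for n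
    using sq(1)[of n] bessel_measurable[OF sq(1)[of n]] fourier_measurable[OF sq(1)[of n]] by (auto simp: square_integrable_iff_L2sq)
  have w1: "1 \<le> (1 + (norm \<xi>)\<^sup>2) powr (s / 2)" for \<xi> :: 'a using s by (intro ge_one_powr_ge_zero) auto
  have cauB: "\<exists>N. \<forall>m\<ge>N. \<forall>n\<ge>N. L2sq lborel (\<lambda>x. bessel s (X m) x - bessel s (X n) x) \<le> ennreal e" if e: "e > 0" for e
  proof -
    obtain N where N: "\<forall>m\<ge>N. \<forall>n\<ge>N. Hs_dist2 s (X m) (X n) < e" using cau e by blast
    show ?thesis unfolding Hs_dist2_eq(2)[OF X X, symmetric]
      using N by (intro exI[of _ N] allI impI ennreal_leI less_imp_le) blast
  qed
  obtain V where [measurable]: "V \<in> borel_measurable lborel" and V: "(\<lambda>n. L2sq lborel (\<lambda>x. bessel s (X n) x - V x)) \<longlonglongrightarrow> 0"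
    by (rule L2_complete[of "\<lambda>n. bessel s (X n)" lborel, OF _ cauB]) auto
  \<comment> \<open>the Fourier--Plancherel transform preserves \<open>L\<^sup>2\<close> distances\<close>
  have iso: "L2sq lborel (\<lambda>x. f x - g x) = L2sq lborel (\<lambda>\<xi>. fourier f \<xi> - fourier g \<xi>)"
    if f: "square_integrable lborel f" and g: "square_integrable lborel g" for f g :: "'a \<Rightarrow> real"
  proof -
    have F: "is_fourier (\<lambda>x. 1 * f x + (-1) * g x) (\<lambda>\<xi>. 1 *\<^sub>R fourier f \<xi> + (-1) *\<^sub>R fourier g \<xi>)"
      by (intro is_fourier_lincomb is_fourier_fourier f g)
    then show ?thesis using fourier_isometry[OF F] L2sq_eq_integral[of lborel "\<lambda>x. f x - g x"] L2sq_eq_integral[of lborel "\<lambda>\<xi>. fourier f \<xi> - fourier g \<xi>"]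
      by (simp add: is_fourier_iff)
  qed
  have le: "L2sq lborel (\<lambda>\<xi>. fourier (X m) \<xi> - fourier (X n) \<xi>) \<le> L2sq lborel (\<lambda>x. bessel s (X m) x - bessel s (X n) x)" for m n
    unfolding L2sq_def
  proof (intro nn_integral_mono ennreal_leI power_mono)
    fix \<xi>
    have "norm (bessel s (X m) \<xi> - bessel s (X n) \<xi>) = (1 + (norm \<xi>)\<^sup>2) powr (s / 2) * norm (fourier (X m) \<xi> - fourier (X n) \<xi>)"
      by (simp add: bessel_def scaleR_diff_right[symmetric])
    then show "norm (fourier (X m) \<xi> - fourier (X n) \<xi>) \<le> norm (bessel s (X m) \<xi> - bessel s (X n) \<xi>)"
      using mult_right_mono[OF w1[of \<xi>] norm_ge_zero[of "fourier (X m) \<xi> - fourier (X n) \<xi>"]] by simp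
  qed simp
  have cauX: "\<exists>N. \<forall>m\<ge>N. \<forall>n\<ge>N. L2sq lborel (\<lambda>x. X m x - X n x) \<le> ennreal e" if "e > 0" for e
    using cauB[OF that] le unfolding iso[OF sq(1) sq(1)] by (meson order_trans)
  obtain u where [measurable]: "u \<in> borel_measurable lborel" and u: "(\<lambda>n. L2sq lborel (\<lambda>x. X n x - u x)) \<longlonglongrightarrow> 0"
    by (rule L2_complete[of X lborel, OF _ cauX]) auto
  have us: "square_integrable lborel u"
  proof -
    have "\<forall>\<^sub>F n in sequentially. L2sq lborel (\<lambda>x. X n x - u x) < 1" using u by (intro order_tendstoD) auto
    then obtain n where n: "L2sq lborel (\<lambda>x. X n x - u x) < 1" by (auto simp: eventually_sequentially)
    have "L2sq lborel (\<lambda>x. (u x - X n x) + X n x) \<le> 2 * L2sq lborel (\<lambda>x. u x - X n x) + 2 * L2sq lborel (X n)"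
      by (intro L2sq_add_le) auto
    also have "\<dots> < \<infinity>" using n sq(1)[of n] unfolding L2sq_minus_commute[of lborel u]
      by (auto simp: ennreal_mult_less_top square_integrable_iff_L2sq intro: less_trans)
    finally show ?thesis by (simp add: square_integrable_iff_L2sq)
  qed
  have [measurable]: "fourier u \<in> borel_measurable borel" "bessel s u \<in> borel_measurable borel"
    using us fourier_measurable bessel_measurable by auto
  \<comment> \<open>the reciprocal of the weight\<close>
  define c where "c \<xi> = (1 + (norm \<xi>)\<^sup>2) powr (- s / 2)" for \<xi> :: 'a
  have c1: "c \<xi> * (1 + (norm \<xi>)\<^sup>2) powr (s / 2) = 1" for \<xi>
    unfolding c_def powr_add[symmetric] using one_plus_norm_pos[of \<xi>] by simp
  have c01: "0 < c \<xi>" "c \<xi> \<le> 1" for \<xi>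
  proof -
    show c0: "0 < c \<xi>" using one_plus_norm_pos[of \<xi>] by (simp add: c_def)
    show "c \<xi> \<le> 1" using mult_left_mono[OF w1[of \<xi>] less_imp_le[OF c0]] c1[of \<xi>] by simp
  qed
  have cb: "c \<xi> *\<^sub>R bessel s f \<xi> = fourier f \<xi>" for f \<xi> unfolding bessel_def using c1[of \<xi>] by simp
  have [measurable]: "c \<in> borel_measurable borel" unfolding c_def[abs_def] by measurable
  have le2: "L2sq lborel (\<lambda>\<xi>. fourier (X n) \<xi> - c \<xi> *\<^sub>R V \<xi>) \<le> L2sq lborel (\<lambda>\<xi>. bessel s (X n) \<xi> - V \<xi>)" for n
    unfolding L2sq_def
  proof (intro nn_integral_mono ennreal_leI power_mono)
    fix \<xi>
    have "norm (fourier (X n) \<xi> - c \<xi> *\<^sub>R V \<xi>) = c \<xi> * norm (bessel s (X n) \<xi> - V \<xi>)"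
      using c01[of \<xi>] by (simp add: cb[symmetric] scaleR_diff_right[symmetric])
    also have "\<dots> \<le> 1 * norm (bessel s (X n) \<xi> - V \<xi>)" using c01[of \<xi>] by (intro mult_right_mono) auto
    finally show "norm (fourier (X n) \<xi> - c \<xi> *\<^sub>R V \<xi>) \<le> norm (bessel s (X n) \<xi> - V \<xi>)" by simp
  qed simp
  have "L2sq lborel (\<lambda>\<xi>. fourier u \<xi> - c \<xi> *\<^sub>R V \<xi>) \<le> 2 * 0 + 2 * 0"
  proof (rule tendsto_lowerbound)
    show "(\<lambda>n. 2 * L2sq lborel (\<lambda>x. X n x - u x) + 2 * L2sq lborel (\<lambda>x. bessel s (X n) x - V x)) \<longlonglongrightarrow> 2 * 0 + 2 * 0"
      by (intro tendsto_add ennreal_tendsto_cmult u V) auto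
    show "\<forall>\<^sub>F n in sequentially. L2sq lborel (\<lambda>\<xi>. fourier u \<xi> - c \<xi> *\<^sub>R V \<xi>) \<le> 2 * L2sq lborel (\<lambda>x. X n x - u x) + 2 * L2sq lborel (\<lambda>x. bessel s (X n) x - V x)"
    proof (intro always_eventually allI)
      fix n
      have "L2sq lborel (\<lambda>\<xi>. fourier u \<xi> - c \<xi> *\<^sub>R V \<xi>) \<le> 2 * L2sq lborel (\<lambda>\<xi>. fourier u \<xi> - fourier (X n) \<xi>) + 2 * L2sq lborel (\<lambda>\<xi>. fourier (X n) \<xi> - c \<xi> *\<^sub>R V \<xi>)"
        by (intro L2sq_diff_triangle) auto
      also have "\<dots> \<le> 2 * L2sq lborel (\<lambda>x. X n x - u x) + 2 * L2sq lborel (\<lambda>x. bessel s (X n) x - V x)"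
        using le2[of n] unfolding L2sq_minus_commute[of lborel "fourier u"] iso[OF sq(1) us]
        by (intro add_mono mult_left_mono) auto
      finally show "L2sq lborel (\<lambda>\<xi>. fourier u \<xi> - c \<xi> *\<^sub>R V \<xi>) \<le> 2 * L2sq lborel (\<lambda>x. X n x - u x) + 2 * L2sq lborel (\<lambda>x. bessel s (X n) x - V x)" .
    qed
  qed auto
  then have "AE \<xi> in lborel. fourier u \<xi> - c \<xi> *\<^sub>R V \<xi> = 0" by (intro L2sq_eq_0_imp_AE) auto
  then have uV: "AE \<xi> in lborel. bessel s u \<xi> = V \<xi>"
  proof eventually_elim
    case (elim \<xi>)
    then have "fourier u \<xi> = c \<xi> *\<^sub>R V \<xi>" by simp
    then show ?case unfolding bessel_def using c1[of \<xi>] by (simp add: mult.commute)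
  qed
  have "(\<lambda>n. L2sq lborel (\<lambda>\<xi>. bessel s (X n) \<xi> - bessel s u \<xi>)) = (\<lambda>n. L2sq lborel (\<lambda>x. bessel s (X n) x - V x))"
    using uV by (intro ext L2sq_cong_AE) auto
  then have limB: "(\<lambda>n. L2sq lborel (\<lambda>\<xi>. bessel s (X n) \<xi> - bessel s u \<xi>)) \<longlonglongrightarrow> 0" using V by simp
  have "square_integrable lborel (bessel s u)"
  proof -
    have "\<forall>\<^sub>F n in sequentially. L2sq lborel (\<lambda>\<xi>. bessel s (X n) \<xi> - bessel s u \<xi>) < 1" using limB by (intro order_tendstoD) auto
    then obtain n where n: "L2sq lborel (\<lambda>\<xi>. bessel s (X n) \<xi> - bessel s u \<xi>) < 1" by (auto simp: eventually_sequentially)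
    have "L2sq lborel (\<lambda>x. (bessel s u x - bessel s (X n) x) + bessel s (X n) x) \<le> 2 * L2sq lborel (\<lambda>x. bessel s u x - bessel s (X n) x) + 2 * L2sq lborel (bessel s (X n))"
      by (intro L2sq_add_le) auto
    also have "\<dots> < \<infinity>" using n sq(2)[of n] unfolding L2sq_minus_commute[of lborel "bessel s u"]
      by (auto simp: ennreal_mult_less_top square_integrable_iff_L2sq intro: less_trans)
    finally show ?thesis by (simp add: square_integrable_iff_L2sq)
  qed
  then have uH: "u \<in> Hs_whole s" using us by (simp add: Hs_whole_iff)
  have "(\<lambda>n. ennreal (Hs_dist2 s (X n) u)) \<longlonglongrightarrow> ennreal 0" unfolding Hs_dist2_eq(2)[OF X uH] using limB by simp
  then have "(\<lambda>n. Hs_dist2 s (X n) u) \<longlonglongrightarrow> 0"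
    by (subst (asm) tendsto_ennreal_iff) (auto simp: Hs_dist2_def)
  with uH that show thesis by blast
qed

lemma Hs_whole_norm_tendsto:
  fixes X :: "nat \<Rightarrow> 'a::euclidean_space \<Rightarrow> real"
  assumes X: "\<And>n. X n \<in> Hs_whole s" and u: "u \<in> Hs_whole s" and lim: "(\<lambda>n. Hs_dist2 s (X n) u) \<longlonglongrightarrow> 0"
  shows "(\<lambda>n. (Hs_whole_norm s (X n))\<^sup>2) \<longlonglongrightarrow> (Hs_whole_norm s u)\<^sup>2"
  unfolding Hs_whole_norm_sq
proof (rule L2_norm_tendsto)
  show "(\<lambda>n. L2sq lborel (\<lambda>x. bessel s (X n) x - bessel s u x)) \<longlonglongrightarrow> 0"
    unfolding Hs_dist2_eq(2)[OF X u, symmetric] using tendsto_ennrealI[OF lim] by simp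
qed (use X u in \<open>auto simp: Hs_whole_iff\<close>)

subsection \<open>Sobolev embedding\<close>

lemma integrable_japanese_bracket_1d:
  assumes \<sigma>: "\<sigma> > 1/2"
  shows "integrable lborel (\<lambda>x::real. (1 + x\<^sup>2) powr (- \<sigma>))"
proof -
  define f where "f x = (x powr (- 2 * \<sigma>))" for x :: real
  have tail: "(\<integral>\<^sup>+x. ennreal (f x) * indicator {1..} x \<partial>lborel) = ennreal (0 - 1 powr (1 - 2 * \<sigma>) / (1 - 2 * \<sigma>))"
  proof (rule nn_integral_FTC_atLeast[where F="\<lambda>x. x powr (1 - 2 * \<sigma>) / (1 - 2 * \<sigma>)" and T=0])
    show "f \<in> borel_measurable borel" unfolding f_def by measurable
    fix x :: real assume x: "1 \<le> x"
    show "DERIV (\<lambda>x. x powr (1 - 2 * \<sigma>) / (1 - 2 * \<sigma>)) x :> f x"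
      using x \<sigma> by (auto intro!: derivative_eq_intros simp: f_def)
    show "0 \<le> f x" by (simp add: f_def)
  next
    have "((\<lambda>x::real. x powr (1 - 2 * \<sigma>)) \<longlongrightarrow> 0) at_top"
      using \<sigma> by (intro tendsto_neg_powr filterlim_ident) auto
    from tendsto_divide[OF this tendsto_const, of "1 - 2 * \<sigma>"]
    show "((\<lambda>x. x powr (1 - 2 * \<sigma>) / (1 - 2 * \<sigma>)) \<longlongrightarrow> 0) at_top" using \<sigma> by simp
  qed
  have fm[measurable]: "f \<in> borel_measurable borel" unfolding f_def by measurable
  have tail2: "(\<integral>\<^sup>+x. ennreal (f (- x)) * indicator {1..} (- x) \<partial>lborel) = (\<integral>\<^sup>+x. ennreal (f x) * indicator {1..} x \<partial>lborel)"
    by (subst (2) nn_integral_real_affine[where c="-1" and t=0]) auto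
  have bound: "ennreal ((1 + x\<^sup>2) powr (- \<sigma>)) \<le> indicator {-1..1} x + (ennreal (f x) * indicator {1..} x + ennreal (f (- x)) * indicator {1..} (- x))" for x :: real
  proof -
    have 1: "(1 + x\<^sup>2) powr (- \<sigma>) \<le> 1"
    proof -
      have "(1 + x\<^sup>2) powr (- \<sigma>) \<le> 1 powr (- \<sigma>)" using \<sigma> by (intro powr_mono2') auto
      then show ?thesis by simp
    qed
    have 2: "(1 + y\<^sup>2) powr (- \<sigma>) \<le> f y" if "y \<ge> 1" for y :: real
    proof -
      have "(1 + y\<^sup>2) powr (- \<sigma>) \<le> (y\<^sup>2) powr (- \<sigma>)" using \<sigma> that by (intro powr_mono2') auto
      also have "\<dots> = f y" using that by (simp add: f_def powr_powr flip: powr_numeral)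
      finally show ?thesis .
    qed
    show ?thesis
      using 1 2[of x] 2[of "-x"] by (auto simp: indicator_def ennreal_leI intro: order_trans add_increasing add_increasing2)
  qed
  have "(\<integral>\<^sup>+x. ennreal ((1 + x\<^sup>2) powr (- \<sigma>)) \<partial>lborel) \<le> (\<integral>\<^sup>+x. indicator {-1..1} x + (ennreal (f x) * indicator {1..} x + ennreal (f (- x)) * indicator {1..} (- x)) \<partial>lborel)"
    by (intro nn_integral_mono bound)
  also have "\<dots> = (\<integral>\<^sup>+x. indicator {-1..1::real} x \<partial>lborel) + ((\<integral>\<^sup>+x. ennreal (f x) * indicator {1..} x \<partial>lborel) + (\<integral>\<^sup>+x. ennreal (f (- x)) * indicator {1..} (- x) \<partial>lborel))"
    by (simp add: nn_integral_add)
  also have "\<dots> < \<infinity>" unfolding tail2 tail by simp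
  finally show ?thesis by (simp add: integrable_iff_bounded)
qed

text \<open>\<open>1 + |x|\<^sup>2\<close> dominates each factor \<open>1 + (x \<bullet> b)\<^sup>2\<close>, so the function is bounded by a product of
one-dimensional integrable functions with exponent \<open>\<sigma> = \<tau> / d > 1/2\<close>.\<close>

lemma integrable_japanese_bracket:
  assumes \<tau>: "\<tau> > real DIM('a::euclidean_space) / 2"
  shows "integrable lborel (\<lambda>x::'a. (1 + (norm x)\<^sup>2) powr (- \<tau>))"
proof -
  define \<sigma> where "\<sigma> = \<tau> / real DIM('a)"
  have d: "real DIM('a) > 0" by simp
  have \<sigma>: "\<sigma> > 1/2" using \<tau> d by (simp add: \<sigma>_def field_simps)
  have i: "integrable lborel (\<lambda>x::'a. \<Prod>b\<in>Basis. (1 + (x \<bullet> b)\<^sup>2) powr (- \<sigma>))"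
    by (rule integral_lborel_prod(1)[of "\<lambda>b x. (1 + x\<^sup>2) powr (- \<sigma>)"]) (rule integrable_japanese_bracket_1d[OF \<sigma>])
  show ?thesis
  proof (rule Bochner_Integration.integrable_bound[OF i])
    show "AE x::'a in lborel. norm ((1 + (norm x)\<^sup>2) powr (- \<tau>)) \<le> norm (\<Prod>b\<in>Basis. (1 + (x \<bullet> b)\<^sup>2) powr (- \<sigma>))"
    proof (intro AE_I2)
      fix x :: 'a
      have "(1 + (norm x)\<^sup>2) powr (- \<tau>) = ((1 + (norm x)\<^sup>2) powr (- \<sigma>)) ^ DIM('a)"
        using d one_plus_norm_pos[of x] by (simp add: \<sigma>_def powr_powr flip: powr_realpow)
      also have "\<dots> = (\<Prod>b\<in>(Basis::'a set). (1 + (norm x)\<^sup>2) powr (- \<sigma>))" by simp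
      also have "\<dots> \<le> (\<Prod>b\<in>Basis. (1 + (x \<bullet> b)\<^sup>2) powr (- \<sigma>))"
      proof (intro prod_mono conjI)
        fix b :: 'a assume "b \<in> Basis"
        then have "(x \<bullet> b)\<^sup>2 \<le> (norm x)\<^sup>2" using Basis_le_norm[of b x] by (metis abs_le_square_iff abs_norm_cancel)
        then show "(1 + (norm x)\<^sup>2) powr (- \<sigma>) \<le> (1 + (x \<bullet> b)\<^sup>2) powr (- \<sigma>)"
          using \<sigma> by (intro powr_mono2') (auto simp: add_pos_nonneg)
      qed simp
      finally show "norm ((1 + (norm x)\<^sup>2) powr (- \<tau>)) \<le> norm (\<Prod>b\<in>Basis. (1 + (x \<bullet> b)\<^sup>2) powr (- \<sigma>))"
        by (simp add: prod_nonneg)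
    qed
  qed measurable
qed

lemma L2_cauchy_schwarz:
  fixes f g :: "'a \<Rightarrow> real"
  assumes f: "square_integrable M f" and g: "square_integrable M g"
  shows "integrable M (\<lambda>x. f x * g x)" "(\<integral>x. f x * g x \<partial>M)\<^sup>2 \<le> (\<integral>x. (f x)\<^sup>2 \<partial>M) * (\<integral>x. (g x)\<^sup>2 \<partial>M)"
proof -
  have i: "integrable M (\<lambda>x. (f x)\<^sup>2)" "integrable M (\<lambda>x. (g x)\<^sup>2)" using f g by (auto simp: square_integrable_def)
  show p: "integrable M (\<lambda>x. f x * g x)" using integrable_inner_square_integrable(1)[OF f g] by simp
  let ?F = "\<integral>x. (f x)\<^sup>2 \<partial>M" and ?G = "\<integral>x. (g x)\<^sup>2 \<partial>M" and ?P = "\<integral>x. f x * g x \<partial>M"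
  have G0: "?G \<ge> 0" by simp
  have q: "0 \<le> ?F - 2 * t * ?P + t\<^sup>2 * ?G" for t
  proof -
    have "0 \<le> (\<integral>x. (f x - t * g x)\<^sup>2 \<partial>M)" by simp
    also have "(\<lambda>x. (f x - t * g x)\<^sup>2) = (\<lambda>x. (f x)\<^sup>2 - (2 * t) * (f x * g x) + t\<^sup>2 * (g x)\<^sup>2)"
      by (simp add: power2_diff power_mult_distrib algebra_simps)
    also have "(\<integral>x. (f x)\<^sup>2 - (2 * t) * (f x * g x) + t\<^sup>2 * (g x)\<^sup>2 \<partial>M) = ?F - 2 * t * ?P + t\<^sup>2 * ?G"
      using i p by simp
    finally show ?thesis .
  qed
  show "?P\<^sup>2 \<le> ?F * ?G"
  proof (cases "?G = 0")
    case True
    have "?P = 0"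
    proof (rule ccontr)
      assume n: "?P \<noteq> 0"
      \<comment> \<open>a value of \<open>t\<close> at which the affine function \<open>?F - 2 * t * ?P\<close> equals \<open>-1\<close>\<close>
      have "0 \<le> ?F - 2 * ((?F + 1) / (2 * ?P)) * ?P" using q[of "(?F + 1) / (2 * ?P)"] True by simp
      also have "2 * ((?F + 1) / (2 * ?P)) * ?P = ?F + 1" using n by simp
      finally show False by simp
    qed
    then show ?thesis using True by simp
  next
    case False
    then have Gp: "?G > 0" using G0 by (metis order_le_less)
    have "0 \<le> (?F - 2 * (?P / ?G) * ?P + (?P / ?G)\<^sup>2 * ?G) * ?G" using q[of "?P / ?G"] Gp by (intro mult_nonneg_nonneg) auto
    also have "\<dots> = ?F * ?G - ?P\<^sup>2" using Gp by (simp add: field_simps power2_eq_square)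
    finally show ?thesis by simp
  qed
qed

text \<open>The constant in the bounds of \<open>sob_rep\<close> and \<open>sob_grad\<close> by the \<open>H\<^sup>s\<close> norm: one power of
\<open>(1 + |\<xi>|\<^sup>2) powr (1/2)\<close> is spent on the derivative, and the Cauchy--Schwarz inequality leaves the
square root of the integral of \<open>(1 + |\<xi>|\<^sup>2) powr (1 - s)\<close>, which is finite for \<open>s - 1 > d/2\<close>.\<close>

definition sob_const :: "real \<Rightarrow> 'a::euclidean_space itself \<Rightarrow> real" where
  "sob_const s T = fconst T * sqrt (integral\<^sup>L lborel (\<lambda>\<xi>::'a. (1 + (norm \<xi>)\<^sup>2) powr (- (s - 1))))"

lemma AE_lebesgue_on_iff:
  assumes "\<Omega> \<in> sets lebesgue"
  shows "(AE x in lebesgue_on \<Omega>. P x) \<longleftrightarrow> (AE x in lebesgue. x \<in> \<Omega> \<longrightarrow> P x)"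
  using assms by (subst AE_restrict_space_iff) auto

text \<open>Cauchy--Schwarz for the factors \<open>(1 + |\<xi>|\<^sup>2) powr ((1 - s) / 2)\<close> and \<open>(1 + |\<xi>|\<^sup>2) powr (s / 2) * |fourier w|\<close>.\<close>

lemma Hs_whole_weighted_L1:
  fixes w :: "'a::euclidean_space \<Rightarrow> real"
  assumes s: "s > real DIM('a) / 2 + 1" and w: "w \<in> Hs_whole s"
  shows "integrable lborel (\<lambda>\<xi>. (1 + (norm \<xi>)\<^sup>2) powr (1/2) * norm (fourier w \<xi>))"
    and "fconst TYPE('a) * (\<integral>\<xi>. (1 + (norm \<xi>)\<^sup>2) powr (1/2) * norm (fourier w \<xi>) \<partial>lborel) \<le> sob_const s TYPE('a) * Hs_whole_norm s w"
proof -
  define f where "f \<xi> = (1 + (norm \<xi>)\<^sup>2) powr ((1 - s) / 2)" for \<xi> :: 'a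
  define g where "g \<xi> = norm (bessel s w \<xi>)" for \<xi>
  have B: "square_integrable lborel (bessel s w)" using w by (simp add: Hs_whole_iff)
  have [measurable]: "bessel s w \<in> borel_measurable borel" using B by (simp add: square_integrable_iff_L2sq)
  have fsq: "(f \<xi>)\<^sup>2 = (1 + (norm \<xi>)\<^sup>2) powr (- (s - 1))" for \<xi>
    unfolding f_def by (simp add: power2_eq_square powr_add[symmetric])
  have f: "square_integrable lborel f"
    unfolding square_integrable_def using integrable_japanese_bracket[of "s - 1", where 'a='a] s
    by (simp add: fsq) (simp add: f_def[abs_def])
  have g: "square_integrable lborel g"
    using B unfolding square_integrable_def g_def by simp
  have fg: "f \<xi> * g \<xi> = (1 + (norm \<xi>)\<^sup>2) powr (1/2) * norm (fourier w \<xi>)" for \<xi>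
  proof -
    have "f \<xi> * g \<xi> = ((1 + (norm \<xi>)\<^sup>2) powr ((1 - s) / 2) * (1 + (norm \<xi>)\<^sup>2) powr (s / 2)) * norm (fourier w \<xi>)"
      by (simp add: f_def g_def bessel_def)
    also have "(1 + (norm \<xi>)\<^sup>2) powr ((1 - s) / 2) * (1 + (norm \<xi>)\<^sup>2) powr (s / 2) = (1 + (norm \<xi>)\<^sup>2) powr (1/2)"
      unfolding powr_add[symmetric] by (simp add: add_divide_distrib[symmetric])
    finally show ?thesis .
  qed
  show "integrable lborel (\<lambda>\<xi>. (1 + (norm \<xi>)\<^sup>2) powr (1/2) * norm (fourier w \<xi>))"
    using L2_cauchy_schwarz(1)[OF f g] unfolding fg .
  have "(\<integral>\<xi>. (1 + (norm \<xi>)\<^sup>2) powr (1/2) * norm (fourier w \<xi>) \<partial>lborel)\<^sup>2 \<le> (\<integral>\<xi>. (f \<xi>)\<^sup>2 \<partial>lborel) * (Hs_whole_norm s w)\<^sup>2"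
    using L2_cauchy_schwarz(2)[OF f g] unfolding fg unfolding Hs_whole_norm_sq g_def .
  then have "(\<integral>\<xi>. (1 + (norm \<xi>)\<^sup>2) powr (1/2) * norm (fourier w \<xi>) \<partial>lborel) \<le> sqrt ((\<integral>\<xi>. (f \<xi>)\<^sup>2 \<partial>lborel) * (Hs_whole_norm s w)\<^sup>2)"
    by (rule real_le_rsqrt)
  also have "\<dots> = sqrt (\<integral>\<xi>. (f \<xi>)\<^sup>2 \<partial>lborel) * Hs_whole_norm s w"
    using Hs_whole_norm_nonneg[of s w] by (simp add: real_sqrt_mult)
  finally have "fconst TYPE('a) * (\<integral>\<xi>. (1 + (norm \<xi>)\<^sup>2) powr (1/2) * norm (fourier w \<xi>) \<partial>lborel) \<le>
    fconst TYPE('a) * (sqrt (\<integral>\<xi>. (f \<xi>)\<^sup>2 \<partial>lborel) * Hs_whole_norm s w)"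
    using fconst_pos[where 'a='a] by (intro mult_left_mono) auto
  then show "fconst TYPE('a) * (\<integral>\<xi>. (1 + (norm \<xi>)\<^sup>2) powr (1/2) * norm (fourier w \<xi>) \<partial>lborel) \<le> sob_const s TYPE('a) * Hs_whole_norm s w"
    unfolding sob_const_def fsq by (simp add: mult.assoc)
qed

lemma bracket_ge:
  shows "1 \<le> (1 + (norm \<xi>)\<^sup>2) powr (1/2)" "norm \<xi> \<le> (1 + (norm \<xi>)\<^sup>2) powr (1/2)"
proof -
  have eq: "(1 + (norm \<xi>)\<^sup>2) powr (1/2) = sqrt (1 + (norm \<xi>)\<^sup>2)"
    using one_plus_norm_pos[of \<xi>] by (simp add: powr_half_sqrt less_imp_le)
  show "1 \<le> (1 + (norm \<xi>)\<^sup>2) powr (1/2)" unfolding eq by simp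
  show "norm \<xi> \<le> (1 + (norm \<xi>)\<^sup>2) powr (1/2)" unfolding eq by (intro real_le_rsqrt) simp
qed

lemma continuous_on_parameter_integral:
  fixes k :: "'a::metric_space \<Rightarrow> 'c \<Rightarrow> 'b::{banach, second_countable_topology}"
  assumes m: "\<And>x. k x \<in> borel_measurable M" and g: "integrable M g"
    and b: "\<And>x \<xi>. norm (k x \<xi>) \<le> g \<xi>" and c: "\<And>\<xi>. continuous_on UNIV (\<lambda>x. k x \<xi>)"
  shows "continuous_on UNIV (\<lambda>x. \<integral>\<xi>. k x \<xi> \<partial>M)"
  unfolding continuous_on_sequentially
proof (intro allI impI ballI)
  fix X :: "nat \<Rightarrow> 'a" and a assume X: "(\<forall>n. X n \<in> UNIV) \<and> X \<longlonglongrightarrow> a"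
  show "((\<lambda>x. \<integral>\<xi>. k x \<xi> \<partial>M) \<circ> X) \<longlonglongrightarrow> (\<integral>\<xi>. k a \<xi> \<partial>M)"
    unfolding comp_def
  proof (rule integral_dominated_convergence[OF m m g])
    show "AE \<xi> in M. (\<lambda>n. k (X n) \<xi>) \<longlonglongrightarrow> k a \<xi>"
      using X continuous_on_tendsto_compose[OF c, of X a] by (intro AE_I2) auto
  qed (use b in auto)
qed

text \<open>The continuous representative of a function in \<open>H\<^sup>s\<close>.\<close>

definition sob_rep :: "('a::euclidean_space \<Rightarrow> real) \<Rightarrow> 'a \<Rightarrow> real" where
  "sob_rep w = finv (fourier w)"

text \<open>Differentiation under the inverse Fourier integral: the derivative of \<open>Re (z * cis (x \<bullet> \<xi>))\<close> in \<open>x\<close> is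
\<open>- Im (z * cis (x \<bullet> \<xi>))\<close> times \<open>\<xi>\<close>.\<close>

definition sob_grad :: "('a::euclidean_space \<Rightarrow> real) \<Rightarrow> 'a \<Rightarrow> 'a" where
  "sob_grad w x = fconst TYPE('a) *\<^sub>R (\<integral>\<xi>. (- Im (fourier w \<xi> * cis (x \<bullet> \<xi>))) *\<^sub>R \<xi> \<partial>lborel)"

lemma abs_Im_mult_cis_le: "\<bar>Im (z * cis t)\<bar> \<le> norm z"
  by (metis abs_Im_le_cmod norm_cis norm_mult mult.right_neutral)

lemma cis_diff_le: "norm (cis a - cis b) \<le> \<bar>a - b\<bar>"
proof -
  have "cis a - cis b = cis b * (cis (a - b) - 1)" by (simp add: right_diff_distrib cis_mult)
  then have "norm (cis a - cis b) = norm (cis (a - b) - 1)" by (simp add: norm_mult)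
  also have "\<dots> \<le> \<bar>a - b\<bar>" using iexp_approx1[of "a - b" 0] by (simp add: cis_conv_exp)
  finally show ?thesis .
qed

context
  fixes s :: real and w :: "'a::euclidean_space \<Rightarrow> real"
  assumes s: "s > real DIM('a) / 2 + 1" and w: "w \<in> Hs_whole s"
begin

lemma fourier_L1:
  shows "fourier w \<in> borel_measurable borel"
    and "integrable lborel (fourier w)" "integrable lborel (\<lambda>\<xi>. norm (fourier w \<xi>))"
    and "integrable lborel (\<lambda>\<xi>. norm \<xi> * norm (fourier w \<xi>))"
    and "fconst TYPE('a) * (\<integral>\<xi>. norm (fourier w \<xi>) \<partial>lborel) \<le> sob_const s TYPE('a) * Hs_whole_norm s w"
    and "fconst TYPE('a) * (\<integral>\<xi>. norm \<xi> * norm (fourier w \<xi>) \<partial>lborel) \<le> sob_const s TYPE('a) * Hs_whole_norm s w"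
proof -
  let ?k = "\<lambda>\<xi>. (1 + (norm \<xi>)\<^sup>2) powr (1/2) * norm (fourier w \<xi>)"
  show m[measurable]: "fourier w \<in> borel_measurable borel" using w fourier_measurable by (auto simp: Hs_whole_iff)
  note k = Hs_whole_weighted_L1[OF s w]
  have le1: "norm (fourier w \<xi>) \<le> ?k \<xi>" for \<xi>
    using mult_right_mono[OF bracket_ge(1)[of \<xi>] norm_ge_zero[of "fourier w \<xi>"]] by simp
  have le2: "norm \<xi> * norm (fourier w \<xi>) \<le> ?k \<xi>" for \<xi>
    by (intro mult_right_mono bracket_ge) auto
  have k0: "norm (?k \<xi>) = ?k \<xi>" for \<xi> by simp
  show i0: "integrable lborel (fourier w)"
    by (rule Bochner_Integration.integrable_bound[OF k(1)]) (use le1 k0 in auto)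
  then show i1: "integrable lborel (\<lambda>\<xi>. norm (fourier w \<xi>))" by simp
  show i2: "integrable lborel (\<lambda>\<xi>. norm \<xi> * norm (fourier w \<xi>))"
    by (rule Bochner_Integration.integrable_bound[OF k(1)]) (use le2 k0 in auto)
  have "(\<integral>\<xi>. norm (fourier w \<xi>) \<partial>lborel) \<le> (\<integral>\<xi>. ?k \<xi> \<partial>lborel)" using i1 k(1) le1 by (intro integral_mono) auto
  then show "fconst TYPE('a) * (\<integral>\<xi>. norm (fourier w \<xi>) \<partial>lborel) \<le> sob_const s TYPE('a) * Hs_whole_norm s w"
    using k(2) fconst_pos[where 'a='a] by (meson mult_left_mono less_imp_le order_trans)
  have "(\<integral>\<xi>. norm \<xi> * norm (fourier w \<xi>) \<partial>lborel) \<le> (\<integral>\<xi>. ?k \<xi> \<partial>lborel)" using i2 k(1) le2 by (intro integral_mono) auto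
  then show "fconst TYPE('a) * (\<integral>\<xi>. norm \<xi> * norm (fourier w \<xi>) \<partial>lborel) \<le> sob_const s TYPE('a) * Hs_whole_norm s w"
    using k(2) fconst_pos[where 'a='a] by (meson mult_left_mono less_imp_le order_trans)
qed

lemma sob_rep_AE: "AE x in lborel. w x = sob_rep w x"
  unfolding sob_rep_def using w fourier_L1(2) by (intro fourier_inversion is_fourier_fourier) (auto simp: Hs_whole_iff)

lemma sob_rep_bound: "\<bar>sob_rep w x\<bar> \<le> sob_const s TYPE('a) * Hs_whole_norm s w"
  unfolding sob_rep_def using finv_bound[OF fourier_L1(2), of x] fourier_L1(5) by linarith

lemma sob_grad_integrand_bound: "norm ((- Im (fourier w \<xi> * cis (x \<bullet> \<xi>))) *\<^sub>R \<xi>) \<le> norm \<xi> * norm (fourier w \<xi>)"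
proof -
  have "norm ((- Im (fourier w \<xi> * cis (x \<bullet> \<xi>))) *\<^sub>R \<xi>) = \<bar>Im (fourier w \<xi> * cis (x \<bullet> \<xi>))\<bar> * norm \<xi>"
    by (simp del: times_complex.sel)
  also have "\<dots> \<le> norm (fourier w \<xi>) * norm \<xi>" by (intro mult_right_mono abs_Im_mult_cis_le) simp
  finally show ?thesis by (simp add: mult.commute)
qed

lemma sob_grad_integrand_integrable: "integrable lborel (\<lambda>\<xi>. (- Im (fourier w \<xi> * cis (x \<bullet> \<xi>))) *\<^sub>R \<xi>)"
proof -
  note [measurable] = fourier_L1(1)
  show ?thesis
    by (rule Bochner_Integration.integrable_bound[OF fourier_L1(4)])
       (measurable, use sob_grad_integrand_bound in \<open>auto simp del: times_complex.sel norm_scaleR\<close>)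
qed

lemma sob_grad_bound: "norm (sob_grad w x) \<le> sob_const s TYPE('a) * Hs_whole_norm s w"
proof -
  have "norm (\<integral>\<xi>. (- Im (fourier w \<xi> * cis (x \<bullet> \<xi>))) *\<^sub>R \<xi> \<partial>lborel) \<le> (\<integral>\<xi>. norm ((- Im (fourier w \<xi> * cis (x \<bullet> \<xi>))) *\<^sub>R \<xi>) \<partial>lborel)"
    by (rule integral_norm_bound)
  also have "\<dots> \<le> (\<integral>\<xi>. norm \<xi> * norm (fourier w \<xi>) \<partial>lborel)"
    by (intro integral_mono sob_grad_integrand_bound integrable_norm sob_grad_integrand_integrable fourier_L1(4))
  finally have "fconst TYPE('a) * norm (\<integral>\<xi>. (- Im (fourier w \<xi> * cis (x \<bullet> \<xi>))) *\<^sub>R \<xi> \<partial>lborel)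
     \<le> fconst TYPE('a) * (\<integral>\<xi>. norm \<xi> * norm (fourier w \<xi>) \<partial>lborel)"
    using fconst_pos[where 'a='a] by (intro mult_left_mono) auto
  then show ?thesis unfolding sob_grad_def norm_scaleR using fourier_L1(6) fconst_pos[where 'a='a] by linarith
qed

lemma continuous_sob_rep: "continuous_on UNIV (sob_rep w)"
proof -
  note [measurable] = fourier_L1(1)
  have "continuous_on UNIV (\<lambda>x. \<integral>\<xi>. Re (fourier w \<xi> * cis (x \<bullet> \<xi>)) \<partial>lborel)"
  proof (rule continuous_on_parameter_integral[OF _ fourier_L1(3)])
    show "continuous_on UNIV (\<lambda>x. Re (fourier w \<xi> * cis (x \<bullet> \<xi>)))" for \<xi>
      by (intro continuous_intros)
    show "norm (Re (fourier w \<xi> * cis (x \<bullet> \<xi>))) \<le> norm (fourier w \<xi>)" for x \<xi>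
      unfolding real_norm_def by (rule abs_Re_mult_cis_le)
  qed measurable
  then show ?thesis unfolding sob_rep_def finv_def[abs_def] by (intro continuous_intros)
qed

lemma continuous_sob_grad: "continuous_on UNIV (sob_grad w)"
proof -
  note [measurable] = fourier_L1(1)
  have "continuous_on UNIV (\<lambda>x. \<integral>\<xi>. (- Im (fourier w \<xi> * cis (x \<bullet> \<xi>))) *\<^sub>R \<xi> \<partial>lborel)"
  proof (rule continuous_on_parameter_integral[OF _ fourier_L1(4)])
    show "continuous_on UNIV (\<lambda>x. (- Im (fourier w \<xi> * cis (x \<bullet> \<xi>))) *\<^sub>R \<xi>)" for \<xi>
      by (intro continuous_intros)
  qed (measurable, rule sob_grad_integrand_bound)
  then show ?thesis unfolding sob_grad_def[abs_def] by (intro continuous_intros)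
qed

text \<open>Dominated convergence for the difference quotients of \<open>cis (x \<bullet> \<xi>)\<close>, which are bounded by \<open>|b| |\<xi>|\<close>. The
uniform bound on the difference quotients of \<open>sob_rep w\<close> serves as a dominating function in
\<open>sob_integration_by_parts\<close>.\<close>

lemma sob_rep_directional_derivative:
  assumes h: "h \<longlonglongrightarrow> 0" and hn: "\<And>n. h n \<noteq> 0"
  shows "(\<lambda>n. (sob_rep w (x + h n *\<^sub>R b) - sob_rep w x) / h n) \<longlonglongrightarrow> sob_grad w x \<bullet> b"
    and "\<bar>(sob_rep w (x + h n *\<^sub>R b) - sob_rep w x) / h n\<bar> \<le> sob_const s TYPE('a) * Hs_whole_norm s w * norm b"
proof -
  note [measurable] = fourier_L1(1)
  let ?W = "fourier w" and ?\<kappa> = "fconst TYPE('a)"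
  define q where "q n \<xi> = (Re (?W \<xi> * cis ((x + h n *\<^sub>R b) \<bullet> \<xi>)) - Re (?W \<xi> * cis (x \<bullet> \<xi>))) / h n" for n \<xi>
  have iRe: "integrable lborel (\<lambda>\<xi>. Re (?W \<xi> * cis (y \<bullet> \<xi>)))" for y
    by (rule Bochner_Integration.integrable_bound[OF fourier_L1(3)])
       (measurable, simp add: abs_Re_mult_cis_le del: times_complex.sel)
  have eq: "(sob_rep w (x + h n *\<^sub>R b) - sob_rep w x) / h n = ?\<kappa> * (\<integral>\<xi>. q n \<xi> \<partial>lborel)" for n
    unfolding sob_rep_def finv_def q_def integral_divide_zero Bochner_Integration.integral_diff[OF iRe iRe]
    by (simp add: right_diff_distrib del: times_complex.sel)
  have bound: "\<bar>q n \<xi>\<bar> \<le> norm b * (norm \<xi> * norm (?W \<xi>))" for n \<xi>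
  proof -
    have "\<bar>Re (?W \<xi> * cis ((x + h n *\<^sub>R b) \<bullet> \<xi>)) - Re (?W \<xi> * cis (x \<bullet> \<xi>))\<bar> = \<bar>Re (?W \<xi> * (cis ((x + h n *\<^sub>R b) \<bullet> \<xi>) - cis (x \<bullet> \<xi>)))\<bar>"
      by (simp only: right_diff_distrib minus_complex.sel)
    also have "\<dots> \<le> norm (?W \<xi>) * norm (cis ((x + h n *\<^sub>R b) \<bullet> \<xi>) - cis (x \<bullet> \<xi>))"
      by (metis abs_Re_le_cmod norm_mult)
    also have "\<dots> \<le> norm (?W \<xi>) * \<bar>(x + h n *\<^sub>R b) \<bullet> \<xi> - x \<bullet> \<xi>\<bar>"
      by (intro mult_left_mono cis_diff_le) simp
    also have "\<bar>(x + h n *\<^sub>R b) \<bullet> \<xi> - x \<bullet> \<xi>\<bar> = \<bar>h n\<bar> * \<bar>b \<bullet> \<xi>\<bar>" by (simp add: inner_add_left abs_mult)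
    also have "\<dots> \<le> \<bar>h n\<bar> * (norm b * norm \<xi>)" by (intro mult_left_mono Cauchy_Schwarz_ineq2) simp
    finally have le: "\<bar>Re (?W \<xi> * cis ((x + h n *\<^sub>R b) \<bullet> \<xi>)) - Re (?W \<xi> * cis (x \<bullet> \<xi>))\<bar> \<le> norm (?W \<xi>) * (\<bar>h n\<bar> * (norm b * norm \<xi>))"
      by (simp add: mult_left_mono)
    have "\<bar>q n \<xi>\<bar> \<le> (norm (?W \<xi>) * (\<bar>h n\<bar> * (norm b * norm \<xi>))) / \<bar>h n\<bar>"
      unfolding q_def abs_divide by (rule divide_right_mono[OF le]) simp
    then show ?thesis using hn[of n] by (simp add: mult_ac)
  qed
  have qm: "q n \<in> borel_measurable lborel" for n unfolding q_def by measurable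
  have gi: "integrable lborel (\<lambda>\<xi>. norm b * (norm \<xi> * norm (?W \<xi>)))" using fourier_L1(4) by simp
  have lim: "(\<lambda>n. \<integral>\<xi>. q n \<xi> \<partial>lborel) \<longlonglongrightarrow> (\<integral>\<xi>. ((- Im (?W \<xi> * cis (x \<bullet> \<xi>))) *\<^sub>R \<xi>) \<bullet> b \<partial>lborel)"
  proof (rule integral_dominated_convergence[OF _ qm gi])
    show "AE \<xi> in lborel. (\<lambda>n. q n \<xi>) \<longlonglongrightarrow> ((- Im (?W \<xi> * cis (x \<bullet> \<xi>))) *\<^sub>R \<xi>) \<bullet> b"
    proof (intro AE_I2)
      fix \<xi>
      \<comment> \<open>\<open>P t = Re (fourier w \<xi> * cis ((x + t *\<^sub>R b) \<bullet> \<xi>))\<close> in real terms\<close>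
      define P where "P t = Re (?W \<xi>) * cos (x \<bullet> \<xi> + t * (b \<bullet> \<xi>)) - Im (?W \<xi>) * sin (x \<bullet> \<xi> + t * (b \<bullet> \<xi>))" for t
      have "(P has_real_derivative ((- Im (?W \<xi> * cis (x \<bullet> \<xi>))) *\<^sub>R \<xi>) \<bullet> b) (at 0)"
        unfolding P_def by (auto intro!: derivative_eq_intros simp: inner_commute algebra_simps)
      then have "(\<lambda>t. (P (0 + t) - P 0) / t) \<midarrow>0\<rightarrow> ((- Im (?W \<xi> * cis (x \<bullet> \<xi>))) *\<^sub>R \<xi>) \<bullet> b"
        by (simp add: DERIV_def)
      moreover have "filterlim h (at 0) sequentially" using h hn by (simp add: filterlim_at)
      ultimately have "(\<lambda>n. (P (0 + h n) - P 0) / h n) \<longlonglongrightarrow> ((- Im (?W \<xi> * cis (x \<bullet> \<xi>))) *\<^sub>R \<xi>) \<bullet> b"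
        by (rule filterlim_compose)
      moreover have "(P (0 + h n) - P 0) / h n = q n \<xi>" for n
        unfolding P_def q_def by (simp add: inner_add_left)
      ultimately show "(\<lambda>n. q n \<xi>) \<longlonglongrightarrow> ((- Im (?W \<xi> * cis (x \<bullet> \<xi>))) *\<^sub>R \<xi>) \<bullet> b" by simp
    qed
    show "(\<lambda>\<xi>. ((- Im (?W \<xi> * cis (x \<bullet> \<xi>))) *\<^sub>R \<xi>) \<bullet> b) \<in> borel_measurable lborel" by measurable
    show "AE \<xi> in lborel. norm (q n \<xi>) \<le> norm b * (norm \<xi> * norm (?W \<xi>))" for n
      using bound by auto
  qed
  have "(\<integral>\<xi>. ((- Im (?W \<xi> * cis (x \<bullet> \<xi>))) *\<^sub>R \<xi>) \<bullet> b \<partial>lborel) = (\<integral>\<xi>. (- Im (?W \<xi> * cis (x \<bullet> \<xi>))) *\<^sub>R \<xi> \<partial>lborel) \<bullet> b"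
    using sob_grad_integrand_integrable by (rule integral_inner_left)
  then have "?\<kappa> * (\<integral>\<xi>. ((- Im (?W \<xi> * cis (x \<bullet> \<xi>))) *\<^sub>R \<xi>) \<bullet> b \<partial>lborel) = sob_grad w x \<bullet> b"
    unfolding sob_grad_def by (simp only: inner_scaleR_left)
  then show "(\<lambda>n. (sob_rep w (x + h n *\<^sub>R b) - sob_rep w x) / h n) \<longlonglongrightarrow> sob_grad w x \<bullet> b"
    unfolding eq using tendsto_mult[OF tendsto_const lim, of ?\<kappa>] by simp
  have "\<bar>\<integral>\<xi>. q n \<xi> \<partial>lborel\<bar> \<le> (\<integral>\<xi>. \<bar>q n \<xi>\<bar> \<partial>lborel)" by (rule integral_abs_bound)
  also have "\<dots> \<le> (\<integral>\<xi>. norm b * (norm \<xi> * norm (?W \<xi>)) \<partial>lborel)"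
  proof (rule integral_mono[OF _ gi bound])
    show "integrable lborel (\<lambda>\<xi>. \<bar>q n \<xi>\<bar>)"
      using bound qm[of n] by (intro Bochner_Integration.integrable_bound[OF gi]) auto
  qed
  also have "\<dots> = norm b * (\<integral>\<xi>. norm \<xi> * norm (?W \<xi>) \<partial>lborel)" by simp
  finally have "?\<kappa> * \<bar>\<integral>\<xi>. q n \<xi> \<partial>lborel\<bar> \<le> ?\<kappa> * (norm b * (\<integral>\<xi>. norm \<xi> * norm (?W \<xi>) \<partial>lborel))"
    using fconst_pos[where 'a='a] by (intro mult_left_mono) auto
  also have "\<dots> = norm b * (?\<kappa> * (\<integral>\<xi>. norm \<xi> * norm (?W \<xi>) \<partial>lborel))" by simp
  also have "\<dots> \<le> norm b * (sob_const s TYPE('a) * Hs_whole_norm s w)" by (intro mult_left_mono fourier_L1(6)) simp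
  finally show "\<bar>(sob_rep w (x + h n *\<^sub>R b) - sob_rep w x) / h n\<bar> \<le> sob_const s TYPE('a) * Hs_whole_norm s w * norm b"
    unfolding eq abs_mult using fconst_pos[where 'a='a] by (simp add: mult_ac)
qed

end

text \<open>The Fourier transform is chosen up to null sets, so it is linear only almost everywhere; \<open>sob_rep\<close>
and \<open>sob_grad\<close> are integrals of it and therefore linear at every point.\<close>

lemma sob_lincomb:
  fixes w v :: "'a::euclidean_space \<Rightarrow> real"
  assumes s: "s > real DIM('a) / 2 + 1" and w: "w \<in> Hs_whole s" and v: "v \<in> Hs_whole s"
  shows "sob_rep (\<lambda>x. a * w x + b * v x) x = a * sob_rep w x + b * sob_rep v x"
    and "sob_grad (\<lambda>x. a * w x + b * v x) x = a *\<^sub>R sob_grad w x + b *\<^sub>R sob_grad v x"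
proof -
  note L = fourier_L1[OF s w] fourier_L1[OF s v] fourier_L1[OF s Hs_whole_lincomb(1)[OF w v, of a b]]
  note [measurable] = L(1) L(7) L(13)
  have ae: "AE \<xi> in lborel. fourier (\<lambda>x. a * w x + b * v x) \<xi> = a *\<^sub>R fourier w \<xi> + b *\<^sub>R fourier v \<xi>"
    using w v by (intro fourier_lincomb_AE) (auto simp: Hs_whole_iff)
  have iRe: "integrable lborel (\<lambda>\<xi>. Re (W \<xi> * cis (x \<bullet> \<xi>)))" if [measurable]: "W \<in> borel_measurable borel" and W: "integrable lborel W" for W :: "'a \<Rightarrow> complex"
    by (rule Bochner_Integration.integrable_bound[OF W]) (measurable, simp add: abs_Re_mult_cis_le del: times_complex.sel)
  have "(\<integral>\<xi>. Re (fourier (\<lambda>x. a * w x + b * v x) \<xi> * cis (x \<bullet> \<xi>)) \<partial>lborel) =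
    (\<integral>\<xi>. a * Re (fourier w \<xi> * cis (x \<bullet> \<xi>)) + b * Re (fourier v \<xi> * cis (x \<bullet> \<xi>)) \<partial>lborel)"
    by (rule integral_cong_AE) (measurable, use ae in eventually_elim, simp add: algebra_simps)
  also have "\<dots> = a * (\<integral>\<xi>. Re (fourier w \<xi> * cis (x \<bullet> \<xi>)) \<partial>lborel) + b * (\<integral>\<xi>. Re (fourier v \<xi> * cis (x \<bullet> \<xi>)) \<partial>lborel)"
    using iRe[OF L(1,2)] iRe[OF L(7,8)] by (simp del: times_complex.sel)
  finally show "sob_rep (\<lambda>x. a * w x + b * v x) x = a * sob_rep w x + b * sob_rep v x"
    unfolding sob_rep_def finv_def by (simp only: distrib_left mult.left_commute)
  have "(\<integral>\<xi>. (- Im (fourier (\<lambda>x. a * w x + b * v x) \<xi> * cis (x \<bullet> \<xi>))) *\<^sub>R \<xi> \<partial>lborel) =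
    (\<integral>\<xi>. a *\<^sub>R ((- Im (fourier w \<xi> * cis (x \<bullet> \<xi>))) *\<^sub>R \<xi>) + b *\<^sub>R ((- Im (fourier v \<xi> * cis (x \<bullet> \<xi>))) *\<^sub>R \<xi>) \<partial>lborel)"
    by (rule integral_cong_AE) (measurable, use ae in eventually_elim, simp add: algebra_simps)
  also have "\<dots> = a *\<^sub>R (\<integral>\<xi>. (- Im (fourier w \<xi> * cis (x \<bullet> \<xi>))) *\<^sub>R \<xi> \<partial>lborel) + b *\<^sub>R (\<integral>\<xi>. (- Im (fourier v \<xi> * cis (x \<bullet> \<xi>))) *\<^sub>R \<xi> \<partial>lborel)"
    by (simp only: integral_scaleR_right Bochner_Integration.integral_add[OF
          integrable_scaleR_right[OF sob_grad_integrand_integrable[OF s w]]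
          integrable_scaleR_right[OF sob_grad_integrand_integrable[OF s v]]])
  finally show "sob_grad (\<lambda>x. a * w x + b * v x) x = a *\<^sub>R sob_grad w x + b *\<^sub>R sob_grad v x"
    unfolding sob_grad_def by (simp only: scaleR_add_right scaleR_left_commute)
qed

lemma sob_dist_bound:
  fixes w v :: "'a::euclidean_space \<Rightarrow> real"
  assumes s: "s > real DIM('a) / 2 + 1" and w: "w \<in> Hs_whole s" and v: "v \<in> Hs_whole s"
  shows "\<bar>sob_rep w x - sob_rep v x\<bar> \<le> sob_const s TYPE('a) * sqrt (Hs_dist2 s w v)"
    and "norm (sob_grad w x - sob_grad v x) \<le> sob_const s TYPE('a) * sqrt (Hs_dist2 s w v)"
proof -
  have d: "(\<lambda>x. w x - v x) \<in> Hs_whole s" by (rule Hs_whole_diff[OF w v])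
  have n: "sqrt (Hs_dist2 s w v) = Hs_whole_norm s (\<lambda>x. w x - v x)"
    unfolding Hs_dist2_def by (simp add: Hs_whole_norm_nonneg)
  show "\<bar>sob_rep w x - sob_rep v x\<bar> \<le> sob_const s TYPE('a) * sqrt (Hs_dist2 s w v)"
    using sob_rep_bound[OF s d, of x] sob_lincomb(1)[OF s w v, of 1 "-1" x] unfolding n by simp
  show "norm (sob_grad w x - sob_grad v x) \<le> sob_const s TYPE('a) * sqrt (Hs_dist2 s w v)"
    using sob_grad_bound[OF s d, of x] sob_lincomb(2)[OF s w v, of 1 "-1" x] unfolding n by simp
qed

lemma sob_tendsto:
  fixes X :: "nat \<Rightarrow> 'a::euclidean_space \<Rightarrow> real"
  assumes s: "s > real DIM('a) / 2 + 1" and X: "\<And>n. X n \<in> Hs_whole s" and u: "u \<in> Hs_whole s"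
    and lim: "(\<lambda>n. Hs_dist2 s (X n) u) \<longlonglongrightarrow> 0"
  shows "(\<lambda>n. sob_rep (X n) x) \<longlonglongrightarrow> sob_rep u x" "(\<lambda>n. sob_grad (X n) x) \<longlonglongrightarrow> sob_grad u x"
proof -
  have "(\<lambda>n. sob_const s TYPE('a) * sqrt (Hs_dist2 s (X n) u)) \<longlonglongrightarrow> sob_const s TYPE('a) * sqrt 0"
    by (intro tendsto_intros lim)
  then have g0: "(\<lambda>n. sob_const s TYPE('a) * sqrt (Hs_dist2 s (X n) u)) \<longlonglongrightarrow> 0" by simp
  have "\<forall>\<^sub>F n in sequentially. norm (sob_rep (X n) x - sob_rep u x) \<le> sob_const s TYPE('a) * sqrt (Hs_dist2 s (X n) u)"
    unfolding real_norm_def by (intro always_eventually allI sob_dist_bound(1)[OF s X u])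
  then have "(\<lambda>n. sob_rep (X n) x - sob_rep u x) \<longlonglongrightarrow> 0" using g0 by (rule Lim_null_comparison)
  then show "(\<lambda>n. sob_rep (X n) x) \<longlonglongrightarrow> sob_rep u x" by (simp only: LIM_zero_iff)
  have "\<forall>\<^sub>F n in sequentially. norm (sob_grad (X n) x - sob_grad u x) \<le> sob_const s TYPE('a) * sqrt (Hs_dist2 s (X n) u)"
    by (intro always_eventually allI sob_dist_bound(2)[OF s X u])
  then have "(\<lambda>n. sob_grad (X n) x - sob_grad u x) \<longlonglongrightarrow> 0" using g0 by (rule Lim_null_comparison)
  then show "(\<lambda>n. sob_grad (X n) x) \<longlonglongrightarrow> sob_grad u x" by (simp only: LIM_zero_iff)
qed

subsection \<open>The quotient norm is attained\<close>

text \<open>Convergence in \<open>H\<^sup>s\<close> implies pointwise convergence of the continuous representatives, so the limit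
takes the prescribed values almost everywhere.\<close>

lemma Hs_extensions_closed:
  fixes X :: "nat \<Rightarrow> 'a::euclidean_space \<Rightarrow> real"
  assumes s: "s > real DIM('a) / 2 + 1" and X: "\<And>n. X n \<in> Hs_extensions \<Omega> s U"
    and u: "u \<in> Hs_whole s" and lim: "(\<lambda>n. Hs_dist2 s (X n) u) \<longlonglongrightarrow> 0"
    and \<Omega>: "\<Omega> \<in> sets lebesgue"
  shows "u \<in> Hs_extensions \<Omega> s U"
proof -
  have XH: "X n \<in> Hs_whole s" and XU: "AE x in lebesgue_on \<Omega>. X n x = U x" for n
    using X[of n] by (auto simp: Hs_extensions_def)
  have lb: "AE x in lebesgue_on \<Omega>. P x" if "AE x in lborel. P x" for P
    using AE_completion[OF that] unfolding AE_lebesgue_on_iff[OF \<Omega>] by eventually_elim simp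
  have "AE x in lebesgue_on \<Omega>. \<forall>n. X n x = U x \<and> X n x = sob_rep (X n) x"
    unfolding AE_all_countable by (intro allI AE_conjI XU lb[OF sob_rep_AE[OF s XH]])
  moreover have "AE x in lebesgue_on \<Omega>. u x = sob_rep u x" by (rule lb[OF sob_rep_AE[OF s u]])
  ultimately have "AE x in lebesgue_on \<Omega>. u x = U x"
  proof eventually_elim
    case (elim x)
    have "(\<lambda>n. sob_rep (X n) x - sob_rep u x) \<longlonglongrightarrow> 0"
      using sob_tendsto(1)[OF s XH u lim, of x] by (simp only: LIM_zero_iff)
    moreover have "sob_rep (X n) x - sob_rep u x = U x - u x" for n using elim by metis
    ultimately have "(\<lambda>n. U x - u x) \<longlonglongrightarrow> 0" by simp
    then show ?case by (simp add: LIMSEQ_const_iff)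
  qed
  then show ?thesis using u by (simp add: Hs_extensions_def)
qed

text \<open>The squared norm is midpoint convex with gap \<open>1/4\<close> of the squared distance, by the parallelogram
identity, and the extensions of \<open>U\<close> form a closed convex set.\<close>

lemma Hs_norm_attained:
  fixes U :: "'a::euclidean_space \<Rightarrow> real"
  assumes s: "s > real DIM('a) / 2 + 1" and U: "U \<in> Hs \<Omega> s" and \<Omega>: "\<Omega> \<in> sets lebesgue"
  obtains w where "w \<in> Hs_extensions \<Omega> s U" "Hs_norm \<Omega> s U = Hs_whole_norm s w"
proof -
  let ?K = "Hs_extensions \<Omega> s U"
  have s0: "s \<ge> 0" using s by (smt (verit) divide_nonneg_nonneg of_nat_0_le_iff)
  have KH: "w \<in> Hs_whole s" if "w \<in> ?K" for w using that by (simp add: Hs_extensions_def)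
  obtain w where w: "w \<in> ?K" "\<And>v. v \<in> ?K \<Longrightarrow> (Hs_whole_norm s w)\<^sup>2 \<le> (Hs_whole_norm s v)\<^sup>2"
  proof (rule midpoint_convex_has_minimizer[of ?K "\<lambda>w. (Hs_whole_norm s w)\<^sup>2" "\<lambda>w v x. (w x + v x) / 2" "1/4" "Hs_dist2 s"])
    show "?K \<noteq> {}" using U by (simp add: Hs_def)
    show "(\<lambda>x. (w x + v x) / 2) \<in> ?K" if "w \<in> ?K" "v \<in> ?K" for w v
    proof -
      have "AE x in lebesgue_on \<Omega>. w x = U x" "AE x in lebesgue_on \<Omega>. v x = U x"
        using that by (auto simp: Hs_extensions_def)
      then have "AE x in lebesgue_on \<Omega>. (w x + v x) / 2 = U x" by eventually_elim simp
      then show ?thesis using Hs_whole_mid[OF KH[OF that(1)] KH[OF that(2)]] by (simp add: Hs_extensions_def)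
    qed
    show "(Hs_whole_norm s (\<lambda>x. (w x + v x) / 2))\<^sup>2 + 1/4 * Hs_dist2 s w v \<le> ((Hs_whole_norm s w)\<^sup>2 + (Hs_whole_norm s v)\<^sup>2) / 2"
      if "w \<in> ?K" "v \<in> ?K" for w v
      using Hs_whole_parallelogram[OF KH[OF that(1)] KH[OF that(2)]] by simp
    show "\<exists>u\<in>?K. (\<lambda>n. Hs_dist2 s (X n) u) \<longlonglongrightarrow> 0"
      if X: "\<And>n::nat. X n \<in> ?K" and c: "\<forall>e>0. \<exists>N. \<forall>m\<ge>N. \<forall>n\<ge>N. Hs_dist2 s (X m) (X n) < e" for X
    proof -
      obtain u where u: "u \<in> Hs_whole s" "(\<lambda>n. Hs_dist2 s (X n) u) \<longlonglongrightarrow> 0"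
        using Hs_whole_complete[OF s0 KH[OF X] c] by blast
      from Hs_extensions_closed[OF s X u \<Omega>] u(2) show ?thesis by blast
    qed
    show "(\<lambda>n. (Hs_whole_norm s (X n))\<^sup>2) \<longlonglongrightarrow> (Hs_whole_norm s u)\<^sup>2"
      if X: "\<And>n::nat. X n \<in> ?K" and u: "u \<in> ?K" and l: "(\<lambda>n. Hs_dist2 s (X n) u) \<longlonglongrightarrow> 0" for X u
      by (rule Hs_whole_norm_tendsto[OF KH[OF X] KH[OF u] l])
  qed auto
  have le: "Hs_whole_norm s w \<le> Hs_whole_norm s v" if "v \<in> ?K" for v
    using w(2)[OF that] Hs_whole_norm_nonneg by (rule power2_le_imp_le)
  have "Hs_norm \<Omega> s U = Hs_whole_norm s w"
    unfolding Hs_norm_def using w(1) le by (intro cInf_eq_minimum) auto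
  with w(1) that show thesis by blast
qed

lemma Hs_norm_le:
  fixes w :: "'a::euclidean_space \<Rightarrow> real"
  assumes "w \<in> Hs_extensions \<Omega> s U"
  shows "0 \<le> Hs_norm \<Omega> s U" "Hs_norm \<Omega> s U \<le> Hs_whole_norm s w"
proof -
  have b: "bdd_below (Hs_whole_norm s ` Hs_extensions \<Omega> s U)"
  proof (rule bdd_belowI)
    fix x assume "x \<in> Hs_whole_norm s ` Hs_extensions \<Omega> s U"
    then obtain v :: "'a \<Rightarrow> real" where "x = Hs_whole_norm s v" by blast
    then show "0 \<le> x" using Hs_whole_norm_nonneg[of s v] by (simp only:)
  qed
  show "Hs_norm \<Omega> s U \<le> Hs_whole_norm s w" unfolding Hs_norm_def
    by (rule cInf_lower[OF imageI[OF assms] b])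
  show "0 \<le> Hs_norm \<Omega> s U" unfolding Hs_norm_def
  proof (rule cInf_greatest)
    show "Hs_whole_norm s ` Hs_extensions \<Omega> s U \<noteq> {}" using assms by (metis empty_iff imageI)
    fix x assume "x \<in> Hs_whole_norm s ` Hs_extensions \<Omega> s U"
    then obtain v :: "'a \<Rightarrow> real" where "x = Hs_whole_norm s v" by blast
    then show "0 \<le> x" using Hs_whole_norm_nonneg[of s v] by (simp only:)
  qed
qed

section \<open>Weak gradients\<close>

text \<open>For a complete measure, measurability and integrals depend only on the almost everywhere class.
This matters because weak gradients and the given data are arbitrary on null sets.\<close>

lemma complete_measurable_cong_AE:
  assumes M: "complete_measure M" and f: "f \<in> measurable M N" and ae: "AE x in M. f x = g x"
    and g: "\<And>x. x \<in> space M \<Longrightarrow> g x \<in> space N"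
  shows "g \<in> measurable M N"
proof (rule measurableI)
  interpret complete_measure M by fact
  fix A assume A: "A \<in> sets N"
  define Z where "Z = {x\<in>space M. \<not> f x = g x}"
  have Z: "Z \<in> null_sets M" using ae unfolding Z_def AE_iff_null_sets .
  have 1: "g -` A \<inter> space M \<inter> Z \<in> sets M" by (rule complete[OF _ Z]) auto
  have 2: "f -` A \<inter> space M - Z \<in> sets M" using measurable_sets[OF f A] Z by auto
  have "g -` A \<inter> space M = (f -` A \<inter> space M - Z) \<union> (g -` A \<inter> space M \<inter> Z)"
    by (auto simp: Z_def)
  then show "g -` A \<inter> space M \<in> sets M" using sets.Un[OF 2 1] by argo
qed (use g in auto)

lemma complete_integral_cong_AE:
  fixes f g :: "'a \<Rightarrow> 'b::{banach, second_countable_topology}"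
  assumes M: "complete_measure M" and ae: "AE x in M. f x = g x"
  shows "integral\<^sup>L M f = integral\<^sup>L M g" "integrable M f \<longleftrightarrow> integrable M g"
proof -
  have ae': "AE x in M. g x = f x" using ae by eventually_elim simp
  have m: "f \<in> borel_measurable M \<longleftrightarrow> g \<in> borel_measurable M"
    using complete_measurable_cong_AE[OF M _ ae, of borel] complete_measurable_cong_AE[OF M _ ae', of borel]
    by (metis UNIV_I space_borel)
  show i: "integrable M f \<longleftrightarrow> integrable M g"
  proof (cases "f \<in> borel_measurable M")
    case True then show ?thesis using m ae by (intro integrable_cong_AE) auto
  next
    case False then show ?thesis using m by auto
  qed
  show "integral\<^sup>L M f = integral\<^sup>L M g"
  proof (cases "f \<in> borel_measurable M")
    case True then show ?thesis using m ae by (intro integral_cong_AE) auto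
  next
    case False
    then have "\<not> integrable M f" "\<not> integrable M g" using m by auto
    then show ?thesis by (simp add: not_integrable_integral_eq)
  qed
qed

lemma complete_lebesgue: "complete_measure lebesgue"
  by (rule completion.complete_measure_axioms)

subsection \<open>Smooth bump functions\<close>

lemma C_k_Suc_imp: "C_k (Suc k) f \<Longrightarrow> C_k k f"
proof (induction k arbitrary: f)
  case 0
  then have "\<forall>x. f differentiable (at x)" by simp
  then show ?case by (simp add: continuous_at_imp_continuous_on differentiable_imp_continuous_within)
next
  case (Suc k)
  have d: "\<forall>x. f differentiable (at x)" and e: "\<forall>b\<in>Basis. C_k (Suc k) (\<lambda>x. frechet_derivative f (at x) b)"
    using Suc.prems unfolding C_k.simps(2)[of "Suc k"] by (blast, blast)
  then have "\<forall>b\<in>Basis. C_k k (\<lambda>x. frechet_derivative f (at x) b)" using Suc.IH by blast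
  with d show ?case unfolding C_k.simps(2)[of k] by blast
qed

lemma C_k_SucI:
  assumes "\<And>x. (f has_derivative f' x) (at x)" "\<And>b. b \<in> Basis \<Longrightarrow> C_k k (\<lambda>x. f' x b)"
  shows "C_k (Suc k) f"
proof -
  have "frechet_derivative f (at x) = f' x" for x using frechet_derivative_at[OF assms(1)] by simp
  then show ?thesis using assms by (auto simp: differentiable_def)
qed

lemma C_k_SucD:
  assumes "C_k (Suc k) f"
  shows "(f has_derivative frechet_derivative f (at x)) (at x)" "b \<in> Basis \<Longrightarrow> C_k k (\<lambda>x. frechet_derivative f (at x) b)"
  using assms frechet_derivative_works[of f "at x"] by auto

lemma C_k_const: "C_k k (\<lambda>x. c)"
proof (induction k arbitrary: c)
  case (Suc k)
  show ?case by (rule C_k_SucI[of _ "\<lambda>x h. 0"]) (use Suc in auto)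
qed simp

lemma C_k_add: "C_k k f \<Longrightarrow> C_k k g \<Longrightarrow> C_k k (\<lambda>x. f x + g x)"
proof (induction k arbitrary: f g)
  case (Suc k)
  note f = C_k_SucD[OF Suc.prems(1)] and g = C_k_SucD[OF Suc.prems(2)]
  show ?case
    by (rule C_k_SucI[OF has_derivative_add[OF f(1) g(1)]]) (intro Suc.IH f(2) g(2))
qed (auto intro: continuous_intros)

lemma C_k_mult: "C_k k f \<Longrightarrow> C_k k g \<Longrightarrow> C_k k (\<lambda>x. f x * g x)"
proof (induction k arbitrary: f g)
  case (Suc k)
  note f = C_k_SucD[OF Suc.prems(1)] and g = C_k_SucD[OF Suc.prems(2)]
  show ?case
    by (rule C_k_SucI[OF has_derivative_mult[OF f(1) g(1)]])
       (intro C_k_add Suc.IH f(2) g(2) C_k_Suc_imp[OF Suc.prems(1)] C_k_Suc_imp[OF Suc.prems(2)])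
qed (auto intro: continuous_intros)

lemma smooth_prod: "finite A \<Longrightarrow> (\<And>a. a \<in> A \<Longrightarrow> smooth (f a)) \<Longrightarrow> smooth (\<lambda>x. \<Prod>a\<in>A. f a x)"
  by (induction A rule: finite_induct) (auto simp: smooth_def C_k_const intro: C_k_mult)

text \<open>For every polynomial \<open>p\<close>, the function \<open>p (1/t) exp (- 1/t)\<close>, extended by 0 to \<open>t \<le> 0\<close>, is
differentiable, and its derivative has the same form; hence the family is closed under
differentiation and consists of smooth functions.\<close>

definition flat_exp :: "real poly \<Rightarrow> real \<Rightarrow> real" where
  "flat_exp p t = (if 0 < t then poly p (1 / t) * exp (- (1 / t)) else 0)"

lemma poly_exp_decay: "((\<lambda>y. poly p y * exp (- y)) \<longlongrightarrow> 0) at_top" for p :: "real poly"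
proof -
  have "((\<lambda>y. \<Sum>i\<le>degree p. coeff p i * (y ^ i / exp y)) \<longlongrightarrow> (\<Sum>i\<le>degree p. coeff p i * 0)) at_top"
    by (intro tendsto_sum tendsto_mult tendsto_const tendsto_power_div_exp_0)
  moreover have "poly p y * exp (- y) = (\<Sum>i\<le>degree p. coeff p i * (y ^ i / exp y))" for y
    by (simp add: poly_altdef exp_minus sum_distrib_right divide_inverse mult.assoc)
  ultimately show ?thesis by simp
qed

lemma flat_exp_tendsto_0: "flat_exp p \<midarrow>0\<rightarrow> 0"
proof (rule filterlim_split_at)
  show "filterlim (flat_exp p) (nhds 0) (at_left 0)"
    by (rule tendsto_eventually) (auto simp: flat_exp_def eventually_at_filter)
  have "((\<lambda>t. poly p (inverse t) * exp (- inverse t)) \<longlongrightarrow> 0) (at_right 0)"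
    by (rule filterlim_compose[OF poly_exp_decay filterlim_inverse_at_top_right])
  then show "filterlim (flat_exp p) (nhds 0) (at_right 0)"
    by (rule Lim_transform_eventually) (auto simp: flat_exp_def eventually_at_filter inverse_eq_divide)
qed

lemma flat_exp_deriv:
  "(flat_exp p has_real_derivative flat_exp ([:0, 0, 1:] * (p - pderiv p)) t) (at t)"
proof (rule linorder_cases[of t 0])
  assume t: "t < 0"
  have "((\<lambda>_. 0) has_real_derivative 0) (at t)" by simp
  then have "(flat_exp p has_real_derivative 0) (at t)"
    by (rule DERIV_cong_ev[THEN iffD1, OF refl _ refl, rotated])
       (use t in \<open>auto simp: flat_exp_def eventually_nhds intro!: exI[of _ "{..<0}"]\<close>)
  then show ?thesis using t by (simp add: flat_exp_def)
next
  assume t: "t = 0"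
  have "(\<lambda>h. (flat_exp p (0 + h) - flat_exp p 0) / h) = flat_exp (pCons 0 p)"
    by (auto simp: flat_exp_def fun_eq_iff)
  then show ?thesis unfolding DERIV_def t using flat_exp_tendsto_0[of "pCons 0 p"] by (simp add: flat_exp_def)
next
  assume t: "t > 0"
  have "((\<lambda>t. poly p (1 / t) * exp (- (1 / t))) has_real_derivative
      poly (pderiv p) (1 / t) * (- (1 / t\<^sup>2)) * exp (- (1 / t)) + exp (- (1 / t)) * (1 / t\<^sup>2) * poly p (1 / t)) (at t)"
    using t by (auto intro!: derivative_eq_intros DERIV_chain2[OF poly_DERIV] simp: power2_eq_square)
  then have "(flat_exp p has_real_derivative
      poly (pderiv p) (1 / t) * (- (1 / t\<^sup>2)) * exp (- (1 / t)) + exp (- (1 / t)) * (1 / t\<^sup>2) * poly p (1 / t)) (at t)"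
    by (rule DERIV_cong_ev[THEN iffD1, OF refl _ refl, rotated])
       (use t in \<open>auto simp: flat_exp_def eventually_nhds intro!: exI[of _ "{0<..}"]\<close>)
  then show ?thesis using t by (simp add: flat_exp_def power2_eq_square algebra_simps)
qed

lemma smooth_flat_exp:
  fixes v :: "'a::euclidean_space"
  shows "smooth (\<lambda>x. flat_exp p (x \<bullet> v + c))"
  unfolding smooth_def
proof
  fix k
  have D: "((\<lambda>x. flat_exp p (x \<bullet> v + c)) has_derivative
      (\<lambda>h. flat_exp ([:0, 0, 1:] * (p - pderiv p)) (x \<bullet> v + c) * (h \<bullet> v))) (at x)" for p and x :: 'a
  proof -
    have 1: "((\<lambda>x. x \<bullet> v + c) has_derivative (\<lambda>h. h \<bullet> v)) (at x)"
      by (auto intro!: derivative_eq_intros)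
    show ?thesis
      using has_derivative_compose[OF 1 flat_exp_deriv[of p "x \<bullet> v + c", unfolded has_field_derivative_def]] by simp
  qed
  show "C_k k (\<lambda>x::'a. flat_exp p (x \<bullet> v + c))"
  proof (induction k arbitrary: p)
    case 0
    show ?case using has_derivative_continuous[OF D] by (auto intro: continuous_at_imp_continuous_on)
  next
    case (Suc k)
    show ?case by (rule C_k_SucI[OF D]) (intro C_k_mult Suc C_k_const)
  qed
qed

text \<open>A smooth function that is positive exactly on the box with corners \<open>a\<close> and \<open>c\<close> shrunk by \<open>1/n\<close> on all
sides: in every coordinate, \<open>n (x - a) - 1\<close> and \<open>n (c - x) - 1\<close> must be positive. Since these
quantities tend to infinity inside the box, the bumps tend to its indicator function.\<close>

definition box_bump :: "'a::euclidean_space \<Rightarrow> 'a \<Rightarrow> nat \<Rightarrow> 'a \<Rightarrow> real" where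
  "box_bump a c n x = (\<Prod>b\<in>Basis. flat_exp 1 (x \<bullet> (real n *\<^sub>R b) + (- real n * (a \<bullet> b) - 1))
      * flat_exp 1 (x \<bullet> (- real n *\<^sub>R b) + (real n * (c \<bullet> b) - 1)))"

lemma flat_exp_1_bounds: "0 \<le> flat_exp 1 t" "flat_exp 1 t \<le> 1" "flat_exp 1 t \<noteq> 0 \<longleftrightarrow> 0 < t"
  by (auto simp: flat_exp_def)

lemma box_bump_bounds: "0 \<le> box_bump a c n x" "box_bump a c n x \<le> 1"
  unfolding box_bump_def by (auto intro!: prod_nonneg prod_le_1 mult_nonneg_nonneg mult_le_one simp: flat_exp_1_bounds)

lemma box_bump_nonzero:
  assumes "box_bump a c n x \<noteq> 0"
  shows "x \<in> cbox (a + (1 / real n) *\<^sub>R One) (c - (1 / real n) *\<^sub>R One)" and "x \<in> box a c"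
proof -
  have pos: "0 < x \<bullet> (real n *\<^sub>R b) + (- real n * (a \<bullet> b) - 1)" "0 < x \<bullet> (- real n *\<^sub>R b) + (real n * (c \<bullet> b) - 1)"
    if "b \<in> Basis" for b
    using assms that unfolding box_bump_def by (auto simp: flat_exp_1_bounds)
  \<comment> \<open>for \<open>n = 0\<close> the arguments of \<open>flat_exp\<close> are \<open>-1\<close>, so the bump vanishes\<close>
  obtain b :: 'a where "b \<in> Basis" using nonempty_Basis by blast
  have n: "n > 0" using pos[OF \<open>b \<in> Basis\<close>] by (cases "n = 0") auto
  have lt: "a \<bullet> b + 1 / real n < x \<bullet> b" "x \<bullet> b < c \<bullet> b - 1 / real n" if "b \<in> Basis" for b
  proof -
    have "real n * (a \<bullet> b) + 1 < real n * (x \<bullet> b)" "real n * (x \<bullet> b) < real n * (c \<bullet> b) - 1"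
      using pos[OF that] by (auto simp: algebra_simps)
    then show "a \<bullet> b + 1 / real n < x \<bullet> b" "x \<bullet> b < c \<bullet> b - 1 / real n"
      using n by (auto simp: field_simps)
  qed
  show "x \<in> cbox (a + (1 / real n) *\<^sub>R One) (c - (1 / real n) *\<^sub>R One)"
    unfolding mem_box using lt by (auto simp: inner_simps intro: less_imp_le)
  show "x \<in> box a c"
    unfolding mem_box
  proof (intro ballI)
    fix b :: 'a assume "b \<in> Basis"
    moreover have "0 < 1 / real n" using n by simp
    ultimately show "a \<bullet> b < x \<bullet> b \<and> x \<bullet> b < c \<bullet> b" using lt[of b] by linarith
  qed
qed

lemma test_function_box_bump:
  assumes "cbox a c \<subseteq> \<Omega>"
  shows "test_function \<Omega> (box_bump a c n)"
proof -
  have sm: "smooth (box_bump a c n)"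
  proof -
    have "smooth (\<lambda>x. flat_exp 1 (x \<bullet> (real n *\<^sub>R b) + (- real n * (a \<bullet> b) - 1)) * flat_exp 1 (x \<bullet> (- real n *\<^sub>R b) + (real n * (c \<bullet> b) - 1)))" for b
      unfolding smooth_def by (intro allI C_k_mult smooth_flat_exp[unfolded smooth_def, rule_format])
    then show ?thesis unfolding box_bump_def[abs_def] by (intro smooth_prod) auto
  qed
  have sub: "closure {x. box_bump a c n x \<noteq> 0} \<subseteq> cbox (a + (1 / real n) *\<^sub>R One) (c - (1 / real n) *\<^sub>R One)"
    using box_bump_nonzero(1) by (intro closure_minimal) auto
  have "cbox (a + (1 / real n) *\<^sub>R One) (c - (1 / real n) *\<^sub>R One) \<subseteq> cbox a c"
  proof
    fix x assume "x \<in> cbox (a + (1 / real n) *\<^sub>R One) (c - (1 / real n) *\<^sub>R One)"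
    then have "a \<bullet> b + 1 / real n \<le> x \<bullet> b \<and> x \<bullet> b \<le> c \<bullet> b - 1 / real n" if "b \<in> Basis" for b
      using that unfolding mem_box by (auto simp: inner_simps)
    moreover have "0 \<le> 1 / real n" by simp
    ultimately show "x \<in> cbox a c" unfolding mem_box by (smt (verit))
  qed
  then have "closure {x. box_bump a c n x \<noteq> 0} \<subseteq> \<Omega>" using sub assms by blast
  moreover have "compact (closure {x. box_bump a c n x \<noteq> 0})"
    using sub bounded_subset[OF bounded_cbox sub] by (simp add: compact_eq_bounded_closed)
  ultimately show ?thesis using sm by (simp add: test_function_def)
qed

lemma box_bump_tendsto: "(\<lambda>n. box_bump a c n x) \<longlonglongrightarrow> indicator (box a c) x"
proof (cases "x \<in> box a c")
  case True
  have lim: "(\<lambda>n. flat_exp 1 (real n * t - 1)) \<longlonglongrightarrow> 1" if "t > 0" for t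
  proof -
    have top: "filterlim (\<lambda>n. real n * t - 1) at_top sequentially" using that by real_asymp
    have "((\<lambda>y::real. exp (- (1 / y))) \<longlongrightarrow> 1) at_top" by real_asymp
    then have "((\<lambda>y. flat_exp 1 y) \<longlongrightarrow> 1) at_top"
      by (rule Lim_transform_eventually) (auto simp: flat_exp_def eventually_at_top_dense intro!: exI[of _ 0])
    from filterlim_compose[OF this top] show ?thesis .
  qed
  have "(\<lambda>n. box_bump a c n x) \<longlonglongrightarrow> (\<Prod>b\<in>(Basis::'a set). 1 * 1)"
    unfolding box_bump_def
  proof (intro tendsto_prod tendsto_mult)
    fix b :: 'a assume b: "b \<in> Basis"
    then have "x \<bullet> b - a \<bullet> b > 0" "c \<bullet> b - x \<bullet> b > 0" using True by (auto simp: mem_box)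
    note L = this[THEN lim]
    show "(\<lambda>n. flat_exp 1 (x \<bullet> (real n *\<^sub>R b) + (- real n * (a \<bullet> b) - 1))) \<longlonglongrightarrow> 1"
      using L(1) by (simp add: algebra_simps)
    show "(\<lambda>n. flat_exp 1 (x \<bullet> (- real n *\<^sub>R b) + (real n * (c \<bullet> b) - 1))) \<longlonglongrightarrow> 1"
      using L(2) by (simp add: algebra_simps)
  qed
  then show ?thesis using True by simp
next
  case False
  then have "box_bump a c n x = 0" for n using box_bump_nonzero(2) by blast
  then show ?thesis using False by simp
qed

subsection \<open>The fundamental lemma of the calculus of variations\<close>

text \<open>The sets over which \<open>f\<close> has integral zero form a Dynkin system that contains the boxes.\<close>

lemma integrable_zero_on_boxes:
  fixes f :: "'a::euclidean_space \<Rightarrow> real"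
  assumes f: "integrable lborel f" and z: "\<And>a c. (\<integral>x. indicator (box a c) x * f x \<partial>lborel) = 0"
    and t: "(\<integral>x. f x \<partial>lborel) = 0"
  shows "AE x in lborel. f x = 0"
proof -
  have [measurable]: "f \<in> borel_measurable borel" using f by auto
  have ib: "integrable lborel (\<lambda>x. indicator A x * f x)" if [measurable]: "A \<in> sets borel" for A
    by (rule Bochner_Integration.integrable_bound[OF f]) (auto simp: indicator_def)
  have main: "(\<integral>x. indicator A x * f x \<partial>lborel) = 0" if "A \<in> sets borel" for A
  proof -
    let ?G = "range (\<lambda>(a, b). box a b :: 'a set)"
    have G: "Int_stable ?G" by (auto simp: Int_stable_def box_Int_box)
    have A: "A \<in> sigma_sets UNIV ?G" using that unfolding borel_eq_box by simp
    have "?G \<subseteq> Pow UNIV" by simp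
    from G this A show ?thesis
    proof (induction rule: sigma_sets_induct_disjoint)
      case (basic A) then show ?case using z by auto
    next
      case (compl A)
      then have [measurable]: "A \<in> sets borel" unfolding borel_eq_box by simp
      have "(\<integral>x. indicator (UNIV - A) x * f x \<partial>lborel) = (\<integral>x. f x - indicator A x * f x \<partial>lborel)"
        by (intro Bochner_Integration.integral_cong refl) (auto simp: indicator_def)
      also have "\<dots> = 0" using f ib[of A] t compl by simp
      finally show ?case .
    next
      case (union A)
      then have [measurable]: "A i \<in> sets borel" for i unfolding borel_eq_box by auto
      have "(\<integral>x\<in>(\<Union>i. A i). f x \<partial>lborel) = (\<Sum>i. \<integral>x\<in>A i. f x \<partial>lborel)"
      proof (rule lebesgue_integral_countable_add)
        show "set_integrable lborel (\<Union>i. A i) f" unfolding set_integrable_def using ib[of "\<Union>i. A i"] by simp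
      qed (use union(1) in \<open>auto simp: disjoint_family_on_def\<close>)
      then show ?case using union by (simp add: set_lebesgue_integral_def)
    qed auto
  qed
  show ?thesis by (rule AE_zero_if_integral_zero_on_bounded) (use ib main in auto)
qed

text \<open>Testing with bumps that tend to the indicator function of a box shows that \<open>u\<close> has integral zero
over every box in \<open>\<Omega>\<close>, hence vanishes almost everywhere on each of them. Countably many boxes
cover \<open>\<Omega>\<close>. Only integrability over compact subsets is available, so the integrals are localized to
one closed box at a time.\<close>

lemma fundamental_lemma:
  fixes u :: "'a::euclidean_space \<Rightarrow> real"
  assumes op: "open \<Omega>"
    and loc: "\<And>K. compact K \<Longrightarrow> K \<subseteq> \<Omega> \<Longrightarrow> u absolutely_integrable_on K"
    and z: "\<And>\<psi>. test_function \<Omega> \<psi> \<Longrightarrow> (LINT x:\<Omega>|lebesgue. u x * \<psi> x) = 0"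
  shows "AE x in lebesgue. x \<in> \<Omega> \<longrightarrow> u x = 0"
proof -
  have bx: "(\<integral>x. indicator (box a c) x * u x \<partial>lebesgue) = 0" if ac: "cbox a c \<subseteq> \<Omega>" for a c
  proof -
    have i: "integrable lebesgue (\<lambda>x. indicator (cbox a c) x * u x)"
      using loc[of "cbox a c"] ac by (simp add: set_integrable_def)
    have bm: "box_bump a c n \<in> borel_measurable borel" for n
      using test_function_box_bump[OF ac, of n] unfolding test_function_def smooth_def
      by (auto dest!: spec[of _ 0] intro: borel_measurable_continuous_onI)
    have bml: "box_bump a c n \<in> borel_measurable lebesgue" for n
      by (rule measurable_completion) (use bm in simp)
    have eq: "indicator \<Omega> x *\<^sub>R (u x * box_bump a c n x) = (indicator (cbox a c) x * u x) * box_bump a c n x" for n x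
      using box_bump_nonzero(2)[of a c n x] ac box_subset_cbox[of a c] by (cases "box_bump a c n x = 0") (auto simp: indicator_def)
    have "(\<lambda>n. \<integral>x. (indicator (cbox a c) x * u x) * box_bump a c n x \<partial>lebesgue) \<longlonglongrightarrow> (\<integral>x. (indicator (cbox a c) x * u x) * indicator (box a c) x \<partial>lebesgue)"
    proof (rule integral_dominated_convergence[where w="\<lambda>x. \<bar>indicator (cbox a c) x * u x\<bar>"])
      show "AE x in lebesgue. (\<lambda>n. (indicator (cbox a c) x * u x) * box_bump a c n x) \<longlonglongrightarrow> (indicator (cbox a c) x * u x) * indicator (box a c) x"
        by (intro AE_I2 tendsto_mult tendsto_const box_bump_tendsto)
      show "AE x in lebesgue. norm ((indicator (cbox a c) x * u x) * box_bump a c n x) \<le> \<bar>indicator (cbox a c) x * u x\<bar>" for n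
        using box_bump_bounds[of a c n] by (intro AE_I2) (auto simp: abs_mult intro!: mult_left_le)
      have im: "(\<lambda>x. indicator (cbox a c) x * u x) \<in> borel_measurable lebesgue" using i by auto
      have bx: "(indicator (box a c) :: 'a \<Rightarrow> real) \<in> borel_measurable lebesgue" by (intro borel_measurable_indicator) auto
      show "(\<lambda>x. (indicator (cbox a c) x * u x) * indicator (box a c) x) \<in> borel_measurable lebesgue"
        by (rule borel_measurable_times[OF im bx])
      show "(\<lambda>x. (indicator (cbox a c) x * u x) * box_bump a c n x) \<in> borel_measurable lebesgue" for n
        by (rule borel_measurable_times[OF im bml])
    qed (use i in auto)
    moreover have "(\<integral>x. (indicator (cbox a c) x * u x) * box_bump a c n x \<partial>lebesgue) = 0" for n
      using z[OF test_function_box_bump[OF ac, of n]] by (simp only: set_lebesgue_integral_def eq)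
    ultimately have "(\<integral>x. (indicator (cbox a c) x * u x) * indicator (box a c) x \<partial>lebesgue) = 0"
      by (simp add: LIMSEQ_const_iff)
    moreover have "(indicator (cbox a c) x * u x) * indicator (box a c) x = indicator (box a c) x * u x" for x
      using box_subset_cbox[of a c] by (auto simp: indicator_def)
    ultimately show ?thesis by simp
  qed
  have local: "AE x in lebesgue. x \<in> box a c \<longrightarrow> u x = 0" if ac: "cbox a c \<subseteq> \<Omega>" for a c
  proof -
    have i0: "integrable lebesgue (\<lambda>x. indicator (cbox a c) x * u x)"
      using loc[of "cbox a c"] ac by (simp add: set_integrable_def)
    define v where "v x = indicator (box a c) x * u x" for x
    have veq: "v x = indicator (box a c) x * (indicator (cbox a c) x * u x)" for x
      unfolding v_def using box_subset_cbox[of a c] by (auto simp: indicator_def)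
    have vi: "integrable lebesgue v"
      unfolding veq[abs_def]
    proof (rule Bochner_Integration.integrable_bound[OF i0])
      have im: "(\<lambda>x. indicator (cbox a c) x * u x) \<in> borel_measurable lebesgue" using i0 by auto
      have "(indicator (box a c) :: 'a \<Rightarrow> real) \<in> borel_measurable lebesgue" by (intro borel_measurable_indicator) auto
      then show "(\<lambda>x. indicator (box a c) x * (indicator (cbox a c) x * u x)) \<in> borel_measurable lebesgue"
        using im by (rule borel_measurable_times)
    qed (auto simp: indicator_def)
    \<comment> \<open>a Borel version, because boxes generate the Borel sets only\<close>
    obtain v' where v'm: "v' \<in> borel_measurable lborel" and ae: "AE x in lborel. v x = v' x"
      using completion_ex_borel_measurable_real[of v lborel] vi by auto
    have aeL: "AE x in lebesgue. v x = v' x" using ae by (simp add: AE_completion)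
    have v'mL: "v' \<in> borel_measurable lebesgue" using v'm by (rule measurable_completion)
    have v'i: "integrable lborel v'"
      using vi integrable_completion[OF v'm] integrable_cong_AE[of v lebesgue v'] aeL v'mL by auto
    have key: "(\<integral>x. indicator A x * v' x \<partial>lborel) = (\<integral>x. indicator A x * v x \<partial>lebesgue)" if [measurable]: "A \<in> sets borel" for A
    proof -
      have [measurable]: "v' \<in> borel_measurable borel" using v'm by simp
      have m: "(\<lambda>x. indicator A x * v' x) \<in> borel_measurable lborel" by measurable
      have "(\<integral>x. indicator A x * v' x \<partial>lborel) = (\<integral>x. indicator A x * v' x \<partial>lebesgue)"
        using integral_completion[OF m] by simp
      also have "\<dots> = (\<integral>x. indicator A x * v x \<partial>lebesgue)"
        by (rule complete_integral_cong_AE(1)[OF complete_lebesgue]) (use aeL in eventually_elim, simp)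
      finally show ?thesis .
    qed
    have "AE x in lborel. v' x = 0"
    proof (rule integrable_zero_on_boxes[OF v'i])
      fix p q :: 'a
      obtain p' q' where pq: "box p q \<inter> box a c = box p' q'" using box_Int_box[of p q a c] by blast
      have "(\<integral>x. indicator (box p q) x * v' x \<partial>lborel) = (\<integral>x. indicator (box p q) x * v x \<partial>lebesgue)"
        by (rule key) simp
      also have "\<dots> = (\<integral>x. indicator (box p' q') x * u x \<partial>lebesgue)"
        unfolding pq[symmetric] v_def by (intro Bochner_Integration.integral_cong refl) (auto simp: indicator_def)
      also have "\<dots> = 0"
      proof (cases "box p' q' = {}")
        case False
        then have "cbox p' q' = closure (box p' q')" by simp
        also have "\<dots> \<subseteq> cbox a c" using pq box_subset_cbox[of a c] by (intro closure_minimal) auto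
        finally show ?thesis using ac by (intro bx) auto
      qed simp
      finally show "(\<integral>x. indicator (box p q) x * v' x \<partial>lborel) = 0" .
    next
      have "(\<integral>x. v' x \<partial>lborel) = (\<integral>x. v x \<partial>lebesgue)" using key[of UNIV] by simp
      also have "\<dots> = 0" unfolding v_def using bx[OF ac] .
      finally show "(\<integral>x. v' x \<partial>lborel) = 0" .
    qed
    then have "AE x in lebesgue. v' x = 0" by (simp add: AE_completion)
    with aeL show ?thesis by eventually_elim (auto simp: v_def)
  qed
  obtain D where D: "countable D" "\<And>X. X \<in> D \<Longrightarrow> X \<subseteq> \<Omega>" "\<And>X. X \<in> D \<Longrightarrow> \<exists>a b. X = cbox a b" "\<Union>D = \<Omega>"
    using open_countable_Union_open_cbox[OF op] by (metis PowD subsetD)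
  have "AE x in lebesgue. \<forall>X\<in>D. x \<in> X \<longrightarrow> u x = 0"
  proof (subst AE_ball_countable[OF D(1)], intro ballI)
    fix X assume X: "X \<in> D"
    then obtain a b where ab: "X = cbox a b" using D(3) by blast
    have "cbox a b - box a b \<in> null_sets lebesgue"
      using negligible_frontier_interval[of a b] by (simp only: negligible_iff_null_sets)
    then have "AE x in lebesgue. x \<notin> cbox a b - box a b" by (rule AE_not_in)
    moreover have "AE x in lebesgue. x \<in> box a b \<longrightarrow> u x = 0" using local X D(2) ab by auto
    ultimately show "AE x in lebesgue. x \<in> X \<longrightarrow> u x = 0" unfolding ab by eventually_elim auto
  qed
  then show ?thesis by eventually_elim (use D(4) in blast)
qed

text \<open>The fundamental lemma for every component of the difference.\<close>

lemma weak_grad_unique: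
  fixes u :: "'a::euclidean_space \<Rightarrow> real"
  assumes op: "open \<Omega>" and v: "is_weak_grad \<Omega> u v" and w: "is_weak_grad \<Omega> u w"
  shows "AE x in lebesgue. x \<in> \<Omega> \<longrightarrow> v x = w x"
proof -
  have comp: "AE x in lebesgue. x \<in> \<Omega> \<longrightarrow> (v x - w x) \<bullet> b = 0" if b: "b \<in> Basis" for b
  proof (rule fundamental_lemma[OF op])
    show li: "(\<lambda>x. (v x - w x) \<bullet> b) absolutely_integrable_on K" if "compact K" "K \<subseteq> \<Omega>" for K
    proof -
      have "(\<lambda>x. v x - w x) absolutely_integrable_on K"
        using v w that by (intro set_integral_diff(1)) (auto simp: is_weak_grad_def)
      then show ?thesis by (rule absolutely_integrable_component)
    qed
    fix \<psi> assume \<psi>: "test_function \<Omega> \<psi>"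
    let ?S = "closure {x. \<psi> x \<noteq> 0}"
    have S: "compact ?S" "?S \<subseteq> \<Omega>" and sm: "smooth \<psi>" using \<psi> by (auto simp: test_function_def)
    have cont: "continuous_on UNIV \<psi>" using sm unfolding smooth_def by (auto dest: spec[of _ 0])
    have z: "\<psi> x = 0" if "x \<notin> ?S" for x using that closure_subset[of "{x. \<psi> x \<noteq> 0}"] by auto
    have int: "set_integrable lebesgue \<Omega> (\<lambda>x. (f x \<bullet> b) * \<psi> x)" if f: "f absolutely_integrable_on ?S" for f :: "'a \<Rightarrow> 'a"
    proof -
      have "compact (\<psi> ` ?S)" using S(1) continuous_on_subset[OF cont] by (intro compact_continuous_image) auto
      then obtain B where B: "\<And>x. x \<in> ?S \<Longrightarrow> \<bar>\<psi> x\<bar> \<le> B" by (metis compact_imp_bounded bounded_iff imageI real_norm_def)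
      have i: "integrable lebesgue (\<lambda>x. indicator ?S x *\<^sub>R (f x \<bullet> b))"
        using absolutely_integrable_component[OF f] by (simp add: set_integrable_def)
      have \<psi>m: "\<psi> \<in> borel_measurable lebesgue" using borel_measurable_continuous_onI[OF cont] by (simp add: measurable_completion)
      have eq: "indicator \<Omega> x *\<^sub>R ((f x \<bullet> b) * \<psi> x) = (indicator ?S x *\<^sub>R (f x \<bullet> b)) * \<psi> x" for x
        using z[of x] S(2) by (auto simp: indicator_def)
      show ?thesis unfolding set_integrable_def eq
      proof (rule Bochner_Integration.integrable_bound)
        show "integrable lebesgue (\<lambda>x. B * (indicator ?S x *\<^sub>R (f x \<bullet> b)))" using i by simp
        show "(\<lambda>x. (indicator ?S x *\<^sub>R (f x \<bullet> b)) * \<psi> x) \<in> borel_measurable lebesgue"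
          using i \<psi>m by (intro borel_measurable_times) auto
        show "AE x in lebesgue. norm ((indicator ?S x *\<^sub>R (f x \<bullet> b)) * \<psi> x) \<le> norm (B * (indicator ?S x *\<^sub>R (f x \<bullet> b)))"
        proof (intro AE_I2)
          fix x
          show "norm ((indicator ?S x *\<^sub>R (f x \<bullet> b)) * \<psi> x) \<le> norm (B * (indicator ?S x *\<^sub>R (f x \<bullet> b)))"
          proof (cases "x \<in> ?S")
            case True
            have "\<bar>\<psi> x\<bar> * \<bar>f x \<bullet> b\<bar> \<le> \<bar>B\<bar> * \<bar>f x \<bullet> b\<bar>" using B[OF True] by (intro mult_right_mono) auto
            then show ?thesis using True by (simp add: abs_mult mult.commute)
          qed simp
        qed
      qed
    qed
    have iv: "set_integrable lebesgue \<Omega> (\<lambda>x. (v x \<bullet> b) * \<psi> x)" and iw: "set_integrable lebesgue \<Omega> (\<lambda>x. (w x \<bullet> b) * \<psi> x)"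
      using v w S by (auto simp: is_weak_grad_def intro!: int)
    have "(LINT x:\<Omega>|lebesgue. ((v x - w x) \<bullet> b) * \<psi> x) = (LINT x:\<Omega>|lebesgue. (v x \<bullet> b) * \<psi> x) - (LINT x:\<Omega>|lebesgue. (w x \<bullet> b) * \<psi> x)"
      using set_integral_diff(2)[OF iv iw] by (simp add: inner_diff_left left_diff_distrib)
    also have "\<dots> = 0" using v w \<psi> b unfolding is_weak_grad_def by simp
    finally show "(LINT x:\<Omega>|lebesgue. ((v x - w x) \<bullet> b) * \<psi> x) = 0" .
  qed
  have "AE x in lebesgue. \<forall>b\<in>Basis. x \<in> \<Omega> \<longrightarrow> (v x - w x) \<bullet> b = 0"
    using comp by (subst AE_ball_countable) (auto intro: countable_finite)
  then show ?thesis
  proof eventually_elim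
    case (elim x)
    show ?case
    proof
      assume "x \<in> \<Omega>"
      then have "v x - w x = 0" using elim by (intro euclidean_eqI[of "v x - w x" 0]) auto
      then show "v x = w x" by simp
    qed
  qed
qed

subsection \<open>Weak gradients of Sobolev functions\<close>

lemma smooth_continuous:
  assumes "smooth \<psi>" shows "continuous_on S \<psi>"
proof -
  have "C_k 0 \<psi>" using assms by (simp add: smooth_def del: C_k.simps)
  then show ?thesis by (auto intro: continuous_on_subset)
qed

lemma smooth_derivative:
  fixes \<psi> :: "'a::euclidean_space \<Rightarrow> real"
  assumes "smooth \<psi>"
  shows "(\<psi> has_derivative frechet_derivative \<psi> (at x)) (at x)"
    and "b \<in> Basis \<Longrightarrow> continuous_on UNIV (\<lambda>x. frechet_derivative \<psi> (at x) b)"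
proof -
  have 1: "C_k (Suc 0) \<psi>" using assms unfolding smooth_def by blast
  show "(\<psi> has_derivative frechet_derivative \<psi> (at x)) (at x)" by (rule C_k_SucD(1)[OF 1])
  show "b \<in> Basis \<Longrightarrow> continuous_on UNIV (\<lambda>x. frechet_derivative \<psi> (at x) b)" using C_k_SucD(2)[OF 1] by simp
qed

lemma smooth_line_derivative:
  fixes \<psi> :: "'a::euclidean_space \<Rightarrow> real"
  assumes \<psi>: "smooth \<psi>" and b: "b \<in> Basis"
  shows "((\<lambda>t. \<psi> (x + t *\<^sub>R b)) has_real_derivative frechet_derivative \<psi> (at (x + t *\<^sub>R b)) b) (at t)"
proof -
  have 1: "((\<lambda>t. x + t *\<^sub>R b) has_derivative (\<lambda>s. s *\<^sub>R b)) (at t)" by (auto intro!: derivative_eq_intros)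
  note 2 = smooth_derivative(1)[OF \<psi>, of "x + t *\<^sub>R b"]
  have "((\<lambda>t. \<psi> (x + t *\<^sub>R b)) has_derivative (\<lambda>s. frechet_derivative \<psi> (at (x + t *\<^sub>R b)) (s *\<^sub>R b))) (at t)"
    by (rule has_derivative_compose[OF 1 2])
  moreover have "frechet_derivative \<psi> (at (x + t *\<^sub>R b)) (s *\<^sub>R b) = frechet_derivative \<psi> (at (x + t *\<^sub>R b)) b * s" for s
    using linear_scale[OF has_derivative_linear[OF 2], of s b] by simp
  ultimately show ?thesis by (simp add: has_field_derivative_def)
qed

lemma compact_support_integrable:
  fixes f :: "'a::euclidean_space \<Rightarrow> real"
  assumes f: "continuous_on UNIV f" and S: "compact S" and z: "\<And>x. x \<notin> S \<Longrightarrow> f x = 0"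
  shows "integrable lborel f" and "\<exists>B\<ge>0. \<forall>x. \<bar>f x\<bar> \<le> B"
proof -
  have "integrable lborel (\<lambda>x. indicator S x *\<^sub>R f x)"
    by (rule borel_integrable_compact[OF S continuous_on_subset[OF f]]) simp
  moreover have "(\<lambda>x. indicator S x *\<^sub>R f x) = f"
  proof
    show "indicator S x *\<^sub>R f x = f x" for x using z[of x] by (cases "x \<in> S") auto
  qed
  ultimately show "integrable lborel f" by simp
  have "compact (f ` S)" using f S by (intro compact_continuous_image) (auto intro: continuous_on_subset)
  then have "bounded (f ` S)" by (rule compact_imp_bounded)
  then obtain B where B: "\<forall>y\<in>f ` S. norm y \<le> B" unfolding bounded_iff by blast
  have "\<bar>f x\<bar> \<le> \<bar>B\<bar>" for x
  proof (cases "x \<in> S")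
    case True
    then have "norm (f x) \<le> B" using B by blast
    then show ?thesis by simp
  qed (simp add: z)
  then show "\<exists>B\<ge>0. \<forall>x. \<bar>f x\<bar> \<le> B" by (intro exI[of _ "\<bar>B\<bar>"]) auto
qed

text \<open>Translation invariance gives the summation by parts formula for the difference quotients of \<open>\<psi>\<close> and
\<open>sob_rep w\<close> with step \<open>h\<close> and \<open>- h\<close>. Both sides converge as \<open>h \<rightarrow> 0\<close> by dominated convergence: the
quotients of \<open>\<psi>\<close> are bounded by a bound of its derivative and supported in a fixed ball, those of
\<open>sob_rep w\<close> are uniformly bounded.\<close>

lemma sob_integration_by_parts:
  fixes w :: "'a::euclidean_space \<Rightarrow> real"
  assumes s: "s > real DIM('a) / 2 + 1" and w: "w \<in> Hs_whole s"
    and \<psi>: "smooth \<psi>" and S: "compact S" and z: "\<And>x. x \<notin> S \<Longrightarrow> \<psi> x = 0" and b: "b \<in> Basis"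
  shows "(\<integral>x. sob_rep w x * frechet_derivative \<psi> (at x) b \<partial>lborel) = - (\<integral>x. (sob_grad w x \<bullet> b) * \<psi> x \<partial>lborel)"
    and "x \<notin> S \<Longrightarrow> frechet_derivative \<psi> (at x) b = 0"
proof -
  define d where "d x = frechet_derivative \<psi> (at x) b" for x
  have dc: "continuous_on UNIV d" unfolding d_def by (rule smooth_derivative(2)[OF \<psi> b])
  have \<psi>c: "continuous_on UNIV \<psi>" by (rule smooth_continuous[OF \<psi>])
  have dz: "d x = 0" if "x \<notin> S" for x
  proof -
    have "open (- S)" using compact_imp_closed[OF S] by auto
    have "((\<lambda>_. 0) has_derivative (\<lambda>_. 0)) (at x)" by simp
    then have "(\<psi> has_derivative (\<lambda>_. 0)) (at x)"
      by (rule has_derivative_transform_within_open[OF _ \<open>open (- S)\<close>]) (use that z in auto)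
    from frechet_derivative_at[OF this] show ?thesis unfolding d_def by metis
  qed
  then show "x \<notin> S \<Longrightarrow> frechet_derivative \<psi> (at x) b = 0" by (simp add: d_def)
  obtain L where L: "L \<ge> 0" "\<And>x. \<bar>d x\<bar> \<le> L" using compact_support_integrable(2)[OF dc S dz] by blast
  have [measurable]: "\<psi> \<in> borel_measurable borel" "d \<in> borel_measurable borel"
    by (intro borel_measurable_continuous_onI \<psi>c dc)+
  note [measurable] = borel_measurable_continuous_onI[OF continuous_sob_rep[OF s w]] borel_measurable_continuous_onI[OF continuous_sob_grad[OF s w]]
  define C where "C = sob_const s TYPE('a) * Hs_whole_norm s w"
  have rb: "\<bar>sob_rep w x\<bar> \<le> C" for x unfolding C_def by (rule sob_rep_bound[OF s w])
  have C0: "C \<ge> 0" using rb[of 0] by linarith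
  have nb: "norm b = 1" using b by simp
  define h where "h n = 1 / real (Suc n)" for n
  have h: "h n > 0" "h n \<le> 1" for n by (auto simp: h_def)
  have h0: "h \<longlonglongrightarrow> 0" unfolding h_def using LIMSEQ_inverse_real_of_nat by (simp add: inverse_eq_divide)
  \<comment> \<open>difference quotients of \<open>\<psi>\<close>; since \<open>h n \<le> 1\<close>, they vanish outside the ball of radius \<open>R + 1\<close>\<close>
  define p where "p n x = (\<psi> (x + h n *\<^sub>R b) - \<psi> x) / h n" for n x
  have pz: "p n x \<noteq> 0 \<Longrightarrow> x \<in> S \<or> x + h n *\<^sub>R b \<in> S" for n x by (cases "x \<in> S \<or> x + h n *\<^sub>R b \<in> S") (auto simp: p_def z)
  have pb: "\<bar>p n x\<bar> \<le> L" for n x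
  proof -
    have "\<exists>t. 0 < t \<and> t < h n \<and> \<psi> (x + h n *\<^sub>R b) - \<psi> (x + 0 *\<^sub>R b) = (h n - 0) * d (x + t *\<^sub>R b)"
      by (rule MVT2[OF h(1)]) (unfold d_def, rule smooth_line_derivative[OF \<psi> b])
    then obtain t where "\<psi> (x + h n *\<^sub>R b) - \<psi> x = h n * d (x + t *\<^sub>R b)" by auto
    then have "p n x = d (x + t *\<^sub>R b)" using h(1)[of n] by (simp add: p_def)
    then show ?thesis using L(2) by simp
  qed
  obtain R where R: "S \<subseteq> cball 0 R" using compact_imp_bounded[OF S] by (auto simp: bounded_iff subset_iff)
  have pR: "\<bar>p n x\<bar> \<le> L * indicator (cball 0 (R + 1)) x" for n x
  proof (cases "p n x = 0")
    case False
    from pz[OF this] have "norm x \<le> R + 1"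
    proof
      assume "x \<in> S" then have "norm x \<le> R" using R by auto
      then show ?thesis by simp
    next
      assume "x + h n *\<^sub>R b \<in> S" then have "norm (x + h n *\<^sub>R b) \<le> R" using R by auto
      moreover have "norm x \<le> norm (x + h n *\<^sub>R b) + norm (h n *\<^sub>R b)" using norm_triangle_ineq4[of "x + h n *\<^sub>R b" "h n *\<^sub>R b"] by simp
      ultimately show ?thesis using nb h[of n] by simp
    qed
    then show ?thesis using pb[of n x] by simp
  qed (use L(1) in simp)
  have lim1: "(\<lambda>n. \<integral>x. sob_rep w x * p n x \<partial>lborel) \<longlonglongrightarrow> (\<integral>x. sob_rep w x * d x \<partial>lborel)"
  proof (rule integral_dominated_convergence[where w="\<lambda>x. C * (L * indicator (cball 0 (R + 1)) x)"])
    show "integrable lborel (\<lambda>x::'a. C * (L * indicator (cball 0 (R + 1)) x) :: real)"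
      by (intro integrable_mult_right integrable_real_indicator) (use emeasure_bounded_finite[OF bounded_cball] in auto)
    show "AE x in lborel. norm (sob_rep w x * p n x) \<le> C * (L * indicator (cball 0 (R + 1)) x)" for n
      unfolding real_norm_def abs_mult by (intro AE_I2 mult_mono rb pR) (use C0 in auto)
    show "AE x in lborel. (\<lambda>n. sob_rep w x * p n x) \<longlonglongrightarrow> sob_rep w x * d x"
    proof (intro AE_I2 tendsto_mult tendsto_const)
      fix x
      have "((\<lambda>t. \<psi> (x + t *\<^sub>R b)) has_real_derivative d x) (at 0)"
        using smooth_line_derivative[OF \<psi> b, of x 0] by (simp add: d_def)
      then have "(\<lambda>t. (\<psi> (x + (0 + t) *\<^sub>R b) - \<psi> (x + 0 *\<^sub>R b)) / t) \<midarrow>0\<rightarrow> d x" unfolding DERIV_def .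
      moreover have "filterlim h (at 0) sequentially" using h0 h(1) by (simp add: filterlim_at less_imp_neq[symmetric])
      ultimately have "(\<lambda>n. (\<psi> (x + (0 + h n) *\<^sub>R b) - \<psi> (x + 0 *\<^sub>R b)) / h n) \<longlonglongrightarrow> d x" by (rule filterlim_compose)
      then show "(\<lambda>n. p n x) \<longlonglongrightarrow> d x" by (simp add: p_def)
    qed
  qed (unfold p_def, measurable)
  \<comment> \<open>difference quotients of \<open>sob_rep w\<close> in the opposite direction\<close>
  define q where "q n x = (sob_rep w (x + (- h n) *\<^sub>R b) - sob_rep w x) / (- h n)" for n x
  have hm: "(\<lambda>n. - h n) \<longlonglongrightarrow> 0" using tendsto_minus[OF h0] by simp
  have hm0: "- h n \<noteq> 0" for n using h(1)[of n] by simp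
  have \<psi>i: "integrable lborel \<psi>" by (rule compact_support_integrable(1)[OF \<psi>c S z])
  have lim2: "(\<lambda>n. \<integral>x. q n x * \<psi> x \<partial>lborel) \<longlonglongrightarrow> (\<integral>x. (sob_grad w x \<bullet> b) * \<psi> x \<partial>lborel)"
  proof (rule integral_dominated_convergence[where w="\<lambda>x. C * norm b * \<bar>\<psi> x\<bar>"])
    show "integrable lborel (\<lambda>x. C * norm b * \<bar>\<psi> x\<bar>)" using \<psi>i by simp
    show "AE x in lborel. norm (q n x * \<psi> x) \<le> C * norm b * \<bar>\<psi> x\<bar>" for n
      unfolding real_norm_def abs_mult q_def C_def
      by (intro AE_I2 mult_right_mono sob_rep_directional_derivative(2)[OF s w hm hm0]) simp
    show "AE x in lborel. (\<lambda>n. q n x * \<psi> x) \<longlonglongrightarrow> (sob_grad w x \<bullet> b) * \<psi> x"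
      unfolding q_def by (intro AE_I2 tendsto_mult tendsto_const sob_rep_directional_derivative(1)[OF s w hm hm0])
  qed (unfold q_def, measurable)
  have eq: "(\<integral>x. sob_rep w x * p n x \<partial>lborel) = - (\<integral>x. q n x * \<psi> x \<partial>lborel)" for n
  proof -
    have ri: "integrable lborel (\<lambda>x. sob_rep w (x + c) * \<psi> x)" for c
    proof (rule Bochner_Integration.integrable_bound)
      show "integrable lborel (\<lambda>x. C * \<psi> x)" using \<psi>i by simp
      show "AE x in lborel. norm (sob_rep w (x + c) * \<psi> x) \<le> norm (C * \<psi> x)"
        unfolding real_norm_def abs_mult using rb C0 by (intro AE_I2 mult_right_mono) auto
    qed measurable
    have tr: "(\<integral>x. sob_rep w x * \<psi> (x + h n *\<^sub>R b) \<partial>lborel) = (\<integral>x. sob_rep w (x + (- h n) *\<^sub>R b) * \<psi> x \<partial>lborel)"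
      using integral_lborel_translate[of "\<lambda>x. sob_rep w (x + (- h n) *\<^sub>R b) * \<psi> x" "h n *\<^sub>R b"] by (simp add: add.assoc)
    have tri: "integrable lborel (\<lambda>x. sob_rep w x * \<psi> (x + h n *\<^sub>R b))"
      using integrable_lborel_translate[OF ri[of "(- h n) *\<^sub>R b"], of "h n *\<^sub>R b"] by (simp add: add.assoc)
    have r0: "integrable lborel (\<lambda>x. sob_rep w x * \<psi> x)" using ri[of 0] by simp
    have "(\<integral>x. sob_rep w x * p n x \<partial>lborel) = (\<integral>x. (sob_rep w x * \<psi> (x + h n *\<^sub>R b) - sob_rep w x * \<psi> x) / h n \<partial>lborel)"
      by (simp add: p_def right_diff_distrib)
    also have "\<dots> = ((\<integral>x. sob_rep w (x + (- h n) *\<^sub>R b) * \<psi> x \<partial>lborel) - (\<integral>x. sob_rep w x * \<psi> x \<partial>lborel)) / h n"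
      using tri r0 tr by simp
    also have "\<dots> = - (\<integral>x. (sob_rep w (x + (- h n) *\<^sub>R b) * \<psi> x - sob_rep w x * \<psi> x) / (- h n) \<partial>lborel)"
      using ri[of "(- h n) *\<^sub>R b"] r0 by simp
    also have "\<dots> = - (\<integral>x. q n x * \<psi> x \<partial>lborel)"
      by (simp add: q_def left_diff_distrib diff_divide_distrib)
    finally show ?thesis .
  qed
  have "(\<lambda>n. - (\<integral>x. q n x * \<psi> x \<partial>lborel)) \<longlonglongrightarrow> - (\<integral>x. (sob_grad w x \<bullet> b) * \<psi> x \<partial>lborel)"
    by (rule tendsto_minus[OF lim2])
  from LIMSEQ_unique[OF lim1[unfolded eq] this]
  show "(\<integral>x. sob_rep w x * frechet_derivative \<psi> (at x) b \<partial>lborel) = - (\<integral>x. (sob_grad w x \<bullet> b) * \<psi> x \<partial>lborel)"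
    by (simp add: d_def)
qed

lemma Hs_extension_AE_sob_rep:
  fixes U :: "'a::euclidean_space \<Rightarrow> real"
  assumes s: "s > real DIM('a) / 2 + 1" and w: "w \<in> Hs_extensions \<Omega> s U" and \<Omega>: "\<Omega> \<in> sets lebesgue"
  shows "AE x in lebesgue. x \<in> \<Omega> \<longrightarrow> U x = sob_rep w x"
proof -
  have wH: "w \<in> Hs_whole s" and wU: "AE x in lebesgue. x \<in> \<Omega> \<longrightarrow> w x = U x"
    using w by (auto simp: Hs_extensions_def AE_lebesgue_on_iff[OF \<Omega>])
  have "AE x in lebesgue. w x = sob_rep w x" by (rule AE_completion[OF sob_rep_AE[OF s wH]])
  with wU show ?thesis by eventually_elim auto
qed

lemma continuous_absolutely_integrable_compact:
  fixes f :: "'a::euclidean_space \<Rightarrow> 'b::euclidean_space"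
  assumes "continuous_on UNIV f" "compact K"
  shows "f absolutely_integrable_on K"
proof -
  have i: "integrable lborel (\<lambda>x. indicator K x *\<^sub>R f x)"
    by (rule borel_integrable_compact[OF assms(2) continuous_on_subset[OF assms(1)]]) simp
  then show ?thesis unfolding set_integrable_def
    by (subst integrable_completion) auto
qed

text \<open>A test function on \<open>\<Omega>\<close> is also one on the whole space, where integration by parts is available.\<close>

lemma is_weak_grad_sob_grad:
  fixes U :: "'a::euclidean_space \<Rightarrow> real"
  assumes s: "s > real DIM('a) / 2 + 1" and w: "w \<in> Hs_extensions \<Omega> s U" and op: "open \<Omega>"
  shows "is_weak_grad \<Omega> U (sob_grad w)"
  unfolding is_weak_grad_def
proof (intro conjI allI impI)
  have \<Omega>: "\<Omega> \<in> sets lebesgue" using op by auto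
  have wH: "w \<in> Hs_whole s" using w by (simp add: Hs_extensions_def)
  note ae = Hs_extension_AE_sob_rep[OF s w \<Omega>]
  note rc = continuous_sob_rep[OF s wH] and gc = continuous_sob_grad[OF s wH]
  fix K assume K: "compact K \<and> K \<subseteq> \<Omega>"
  show "sob_grad w absolutely_integrable_on K" using gc K by (intro continuous_absolutely_integrable_compact) auto
  have "sob_rep w absolutely_integrable_on K" using rc K by (intro continuous_absolutely_integrable_compact) auto
  then have i: "integrable lebesgue (\<lambda>x. indicator K x *\<^sub>R sob_rep w x)" unfolding set_integrable_def .
  have "AE x in lebesgue. indicator K x *\<^sub>R U x = indicator K x *\<^sub>R sob_rep w x"
    using ae
  proof eventually_elim
    case (elim x)
    then show ?case using K by (auto simp: indicator_def)
  qed
  from iffD2[OF complete_integral_cong_AE(2)[OF complete_lebesgue this] i]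
  show "U absolutely_integrable_on K" unfolding set_integrable_def .
next
  have \<Omega>: "\<Omega> \<in> sets lebesgue" using op by auto
  have wH: "w \<in> Hs_whole s" using w by (simp add: Hs_extensions_def)
  note ae = Hs_extension_AE_sob_rep[OF s w \<Omega>]
  note [measurable] = borel_measurable_continuous_onI[OF continuous_sob_rep[OF s wH]] borel_measurable_continuous_onI[OF continuous_sob_grad[OF s wH]]
  fix \<psi> :: "'a \<Rightarrow> real" and b :: 'a assume "test_function \<Omega> \<psi> \<and> b \<in> Basis"
  then have \<psi>: "smooth \<psi>" and b: "b \<in> Basis" and S: "compact (closure {x. \<psi> x \<noteq> 0})" "closure {x. \<psi> x \<noteq> 0} \<subseteq> \<Omega>"
    by (auto simp: test_function_def)
  have z: "\<psi> x = 0" if "x \<notin> closure {x. \<psi> x \<noteq> 0}" for x using that closure_subset[of "{x. \<psi> x \<noteq> 0}"] by auto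
  note ibp = sob_integration_by_parts[OF s wH \<psi> S(1) z b]
  have [measurable]: "\<psi> \<in> borel_measurable borel" "(\<lambda>x. frechet_derivative \<psi> (at x) b) \<in> borel_measurable borel"
    using smooth_continuous[OF \<psi>] smooth_derivative(2)[OF \<psi> b] by (auto intro: borel_measurable_continuous_onI)
  have "(LINT x:\<Omega>|lebesgue. U x * frechet_derivative \<psi> (at x) b) = (\<integral>x. sob_rep w x * frechet_derivative \<psi> (at x) b \<partial>lebesgue)"
    unfolding set_lebesgue_integral_def
  proof (rule complete_integral_cong_AE(1)[OF complete_lebesgue])
    show "AE x in lebesgue. indicator \<Omega> x *\<^sub>R (U x * frechet_derivative \<psi> (at x) b) = sob_rep w x * frechet_derivative \<psi> (at x) b"
      using ae
    proof eventually_elim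
      case (elim x)
      show ?case using elim ibp(2)[of x] S(2) by (cases "x \<in> \<Omega>") auto
    qed
  qed
  also have "\<dots> = (\<integral>x. sob_rep w x * frechet_derivative \<psi> (at x) b \<partial>lborel)"
    by (rule integral_completion) measurable
  also have "\<dots> = - (\<integral>x. (sob_grad w x \<bullet> b) * \<psi> x \<partial>lborel)" by (rule ibp(1))
  also have "(\<integral>x. (sob_grad w x \<bullet> b) * \<psi> x \<partial>lborel) = (\<integral>x. (sob_grad w x \<bullet> b) * \<psi> x \<partial>lebesgue)"
    by (rule integral_completion[symmetric]) measurable
  also have "\<dots> = (LINT x:\<Omega>|lebesgue. (sob_grad w x \<bullet> b) * \<psi> x)"
    unfolding set_lebesgue_integral_def
  proof (intro Bochner_Integration.integral_cong refl)
    fix x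
    show "(sob_grad w x \<bullet> b) * \<psi> x = indicator \<Omega> x *\<^sub>R ((sob_grad w x \<bullet> b) * \<psi> x)"
      using z[of x] S(2) by (cases "x \<in> \<Omega>") auto
  qed
  finally show "(LINT x:\<Omega>|lebesgue. U x * frechet_derivative \<psi> (at x) b) = - (LINT x:\<Omega>|lebesgue. (sob_grad w x \<bullet> b) * \<psi> x)" .
qed

text \<open>The weak gradient is a choice among all functions with the defining property; any two of them agree
almost everywhere, and \<open>sob_grad\<close> is one of them.\<close>

lemma weak_grad_AE_sob_grad:
  fixes U :: "'a::euclidean_space \<Rightarrow> real"
  assumes s: "s > real DIM('a) / 2 + 1" and w: "w \<in> Hs_extensions \<Omega> s U" and op: "open \<Omega>"
  shows "AE x in lebesgue. x \<in> \<Omega> \<longrightarrow> weak_grad \<Omega> U x = sob_grad w x"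
proof -
  note g = is_weak_grad_sob_grad[OF s w op]
  have "is_weak_grad \<Omega> U (weak_grad \<Omega> U)" unfolding weak_grad_def by (rule someI[of "is_weak_grad \<Omega> U" "sob_grad w", OF g])
  then show ?thesis using g by (rule weak_grad_unique[OF op])
qed

text \<open>The open subset of \<open>\<Omega>\<close> where \<open>f\<close> and \<open>g\<close> differ is a null set, hence empty.\<close>

lemma continuous_AE_eq_on_closure:
  fixes f g :: "'a::euclidean_space \<Rightarrow> real"
  assumes op: "open \<Omega>" and f: "continuous_on (closure \<Omega>) f" and g: "continuous_on (closure \<Omega>) g"
    and ae: "AE x in lebesgue. x \<in> \<Omega> \<longrightarrow> f x = g x" and p: "p \<in> closure \<Omega>"
  shows "f p = g p"
proof -
  have eq: "f x = g x" if x: "x \<in> \<Omega>" for x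
  proof (rule ccontr)
    assume ne: "f x \<noteq> g x"
    have "continuous_on \<Omega> (\<lambda>x. f x - g x)"
      using closure_subset f g by (intro continuous_intros) (auto intro: continuous_on_subset)
    then have "\<forall>B. open B \<longrightarrow> open ((\<lambda>x. f x - g x) -` B \<inter> \<Omega>)"
      unfolding continuous_on_open_vimage[OF op] .
    moreover have "open (- {0::real})" by auto
    ultimately have "open (\<Omega> \<inter> (\<lambda>x. f x - g x) -` (- {0}))" by (metis Int_commute)
    moreover have "x \<in> \<Omega> \<inter> (\<lambda>x. f x - g x) -` (- {0})" using x ne by simp
    ultimately have "\<not> negligible (\<Omega> \<inter> (\<lambda>x. f x - g x) -` (- {0}))" using open_not_negligible by blast
    moreover have "negligible (\<Omega> \<inter> (\<lambda>x. f x - g x) -` (- {0}))"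
    proof -
      have "{x \<in> space lebesgue. \<not> (x \<in> \<Omega> \<longrightarrow> f x = g x)} \<in> null_sets lebesgue"
        using ae by (subst (asm) complete_measure.AE_iff_null_sets[OF complete_lebesgue])
      moreover have "{x \<in> space lebesgue. \<not> (x \<in> \<Omega> \<longrightarrow> f x = g x)} = \<Omega> \<inter> (\<lambda>x. f x - g x) -` (- {0})" by auto
      ultimately show ?thesis by (simp only: negligible_iff_null_sets)
    qed
    ultimately show False by blast
  qed
  have "continuous_on (closure \<Omega>) (\<lambda>x. f x - g x)" using f g by (intro continuous_intros)
  then have "f p - g p = 0" by (rule continuous_constant_on_closure[OF _ _ p]) (use eq in simp)
  then show ?thesis by simp
qed

lemma boundary_value_eq_sob_rep:
  fixes U :: "'a::euclidean_space \<Rightarrow> real"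
  assumes s: "s > real DIM('a) / 2 + 1" and w: "w \<in> Hs_extensions \<Omega> s U" and op: "open \<Omega>" and p: "p \<in> closure \<Omega>"
  shows "boundary_value \<Omega> U p = sob_rep w p"
proof -
  have \<Omega>: "\<Omega> \<in> sets lebesgue" using op by auto
  have wH: "w \<in> Hs_whole s" using w by (simp add: Hs_extensions_def)
  note ae = Hs_extension_AE_sob_rep[OF s w \<Omega>]
  let ?P = "\<lambda>v. continuous_on (closure \<Omega>) v \<and> (AE x in lebesgue_on \<Omega>. v x = U x)"
  have rc: "continuous_on (closure \<Omega>) (sob_rep w)" using continuous_sob_rep[OF s wH] by (rule continuous_on_subset) simp
  have "?P (sob_rep w)" using rc ae unfolding AE_lebesgue_on_iff[OF \<Omega>] by (auto elim: eventually_mono)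
  then have bv: "?P (boundary_value \<Omega> U)" unfolding boundary_value_def by (rule someI[of ?P])
  then have "AE x in lebesgue. x \<in> \<Omega> \<longrightarrow> boundary_value \<Omega> U x = U x" unfolding AE_lebesgue_on_iff[OF \<Omega>] by simp
  with ae have "AE x in lebesgue. x \<in> \<Omega> \<longrightarrow> boundary_value \<Omega> U x = sob_rep w x" by eventually_elim simp
  with op conjunct1[OF bv] rc show ?thesis using p by (rule continuous_AE_eq_on_closure)
qed

section \<open>Quadratic functionals\<close>

text \<open>The common form of the three integrals: the weighted sum of squares of functions \<open>a m\<close>, which depend
linearly on the unknown, shifted by fixed data \<open>k m\<close>.\<close>

definition quad_functional ::
  "'x measure \<Rightarrow> ('x \<Rightarrow> real) \<Rightarrow> nat \<Rightarrow> (nat \<Rightarrow> 'x \<Rightarrow> real) \<Rightarrow> (nat \<Rightarrow> 'x \<Rightarrow> real) \<Rightarrow> real" where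
  "quad_functional M \<omega> N k a = (\<integral>x. \<omega> x * (\<Sum>m\<le>N. (a m x + k m x)\<^sup>2) \<partial>M)"

context
  fixes M :: "'x measure" and \<omega> :: "'x \<Rightarrow> real" and N :: nat and k :: "nat \<Rightarrow> 'x \<Rightarrow> real" and B :: real
  assumes fin: "finite_measure M" and \<omega>m: "\<omega> \<in> borel_measurable M"
    and \<omega>b: "\<And>x. x \<in> space M \<Longrightarrow> 0 \<le> \<omega> x \<and> \<omega> x \<le> B"
    and k: "\<And>m. m \<le> N \<Longrightarrow> square_integrable M (k m)"
begin

lemma quad_dominating_integrable:
  "integrable M (\<lambda>x. B * (\<Sum>m\<le>N. 2 * C\<^sup>2 + 2 * (k m x)\<^sup>2))"
proof -
  interpret finite_measure M by (rule fin)
  have "integrable M (\<lambda>x. (k m x)\<^sup>2)" if "m \<le> N" for m using k[OF that] by (simp add: square_integrable_def)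
  then show ?thesis by (intro integrable_mult_right Bochner_Integration.integrable_sum Bochner_Integration.integrable_add) auto
qed

lemma quad_integrand_le:
  assumes x: "x \<in> space M" and a: "\<And>m. m \<le> N \<Longrightarrow> \<bar>a m x\<bar> \<le> C"
  shows "0 \<le> \<omega> x * (\<Sum>m\<le>N. (a m x + k m x)\<^sup>2)" "\<omega> x * (\<Sum>m\<le>N. (a m x + k m x)\<^sup>2) \<le> B * (\<Sum>m\<le>N. 2 * C\<^sup>2 + 2 * (k m x)\<^sup>2)"
proof -
  show "0 \<le> \<omega> x * (\<Sum>m\<le>N. (a m x + k m x)\<^sup>2)" using \<omega>b[OF x] by (intro mult_nonneg_nonneg sum_nonneg) auto
  have "(a m x + k m x)\<^sup>2 \<le> 2 * C\<^sup>2 + 2 * (k m x)\<^sup>2" if "m \<le> N" for m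
  proof -
    have "(a m x)\<^sup>2 \<le> C\<^sup>2" using a[OF that] by (intro abs_le_square_iff[THEN iffD1]) auto
    moreover have "(a m x + k m x)\<^sup>2 \<le> 2 * (a m x)\<^sup>2 + 2 * (k m x)\<^sup>2"
      using sum_squares_bound[of "a m x" "k m x"] by (simp add: power2_sum)
    ultimately show ?thesis by linarith
  qed
  then have "(\<Sum>m\<le>N. (a m x + k m x)\<^sup>2) \<le> (\<Sum>m\<le>N. 2 * C\<^sup>2 + 2 * (k m x)\<^sup>2)" by (intro sum_mono) auto
  then show "\<omega> x * (\<Sum>m\<le>N. (a m x + k m x)\<^sup>2) \<le> B * (\<Sum>m\<le>N. 2 * C\<^sup>2 + 2 * (k m x)\<^sup>2)"
    using \<omega>b[OF x] by (intro mult_mono) (auto intro: sum_nonneg)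
qed

lemma quad_integrand_measurable:
  assumes "\<And>m. m \<le> N \<Longrightarrow> a m \<in> borel_measurable M"
  shows "(\<lambda>x. \<omega> x * (\<Sum>m\<le>N. (a m x + k m x)\<^sup>2)) \<in> borel_measurable M"
  using assms k \<omega>m by (intro borel_measurable_times borel_measurable_sum borel_measurable_power borel_measurable_add) (auto simp: square_integrable_def)

lemma quad_integrable:
  assumes m: "\<And>m. m \<le> N \<Longrightarrow> a m \<in> borel_measurable M"
    and b: "\<And>m x. m \<le> N \<Longrightarrow> x \<in> space M \<Longrightarrow> \<bar>a m x\<bar> \<le> C"
  shows "integrable M (\<lambda>x. \<omega> x * (\<Sum>m\<le>N. (a m x + k m x)\<^sup>2))"
proof (rule Bochner_Integration.integrable_bound[OF quad_dominating_integrable[of C] quad_integrand_measurable[OF m]])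
  show "AE x in M. norm (\<omega> x * (\<Sum>m\<le>N. (a m x + k m x)\<^sup>2)) \<le> norm (B * (\<Sum>m\<le>N. 2 * C\<^sup>2 + 2 * (k m x)\<^sup>2))"
    using quad_integrand_le[of _ a C] b by (intro AE_I2) (smt (verit) real_norm_def)
qed

lemma quad_nonneg: "0 \<le> quad_functional M \<omega> N k a"
  unfolding quad_functional_def using \<omega>b by (intro integral_nonneg_AE AE_I2 mult_nonneg_nonneg sum_nonneg) auto

text \<open>Midpoint convexity of the square. Integrability of the integrands is essential: otherwise the
integral on the right could be zero by convention.\<close>

lemma quad_midpoint:
  assumes "\<And>m. m \<le> N \<Longrightarrow> a m \<in> borel_measurable M" "\<And>m. m \<le> N \<Longrightarrow> b m \<in> borel_measurable M"
    and "\<And>m x. m \<le> N \<Longrightarrow> x \<in> space M \<Longrightarrow> \<bar>a m x\<bar> \<le> C" "\<And>m x. m \<le> N \<Longrightarrow> x \<in> space M \<Longrightarrow> \<bar>b m x\<bar> \<le> C'"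
  shows "quad_functional M \<omega> N k (\<lambda>m x. (a m x + b m x) / 2) \<le> (quad_functional M \<omega> N k a + quad_functional M \<omega> N k b) / 2"
proof -
  have ia: "integrable M (\<lambda>x. \<omega> x * (\<Sum>m\<le>N. (a m x + k m x)\<^sup>2))" by (rule quad_integrable[OF assms(1) assms(3)])
  have ib: "integrable M (\<lambda>x. \<omega> x * (\<Sum>m\<le>N. (b m x + k m x)\<^sup>2))" by (rule quad_integrable[OF assms(2) assms(4)])
  have pt: "\<omega> x * (\<Sum>m\<le>N. ((a m x + b m x) / 2 + k m x)\<^sup>2) \<le> (\<omega> x * (\<Sum>m\<le>N. (a m x + k m x)\<^sup>2) + \<omega> x * (\<Sum>m\<le>N. (b m x + k m x)\<^sup>2)) / 2"
    if x: "x \<in> space M" for x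
  proof -
    have sq: "((p + q) / 2 + r)\<^sup>2 \<le> ((p + r)\<^sup>2 + (q + r)\<^sup>2) / 2" for p q r :: real
    proof -
      have "((p + r)\<^sup>2 + (q + r)\<^sup>2) / 2 - ((p + q) / 2 + r)\<^sup>2 = ((p - q) / 2)\<^sup>2" by (simp add: power2_eq_square field_simps)
      then show ?thesis by (metis diff_ge_0_iff_ge zero_le_power2)
    qed
    have "(\<Sum>m\<le>N. ((a m x + b m x) / 2 + k m x)\<^sup>2) \<le> (\<Sum>m\<le>N. ((a m x + k m x)\<^sup>2 + (b m x + k m x)\<^sup>2) / 2)" by (intro sum_mono sq)
    also have "\<dots> = ((\<Sum>m\<le>N. (a m x + k m x)\<^sup>2) + (\<Sum>m\<le>N. (b m x + k m x)\<^sup>2)) / 2"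
      by (simp only: sum_divide_distrib[symmetric] sum.distrib)
    finally have "\<omega> x * (\<Sum>m\<le>N. ((a m x + b m x) / 2 + k m x)\<^sup>2) \<le> \<omega> x * (((\<Sum>m\<le>N. (a m x + k m x)\<^sup>2) + (\<Sum>m\<le>N. (b m x + k m x)\<^sup>2)) / 2)"
      using \<omega>b[OF x] by (intro mult_left_mono) auto
    then show ?thesis by (simp add: distrib_left)
  qed
  have "quad_functional M \<omega> N k (\<lambda>m x. (a m x + b m x) / 2) \<le> (\<integral>x. (\<omega> x * (\<Sum>m\<le>N. (a m x + k m x)\<^sup>2) + \<omega> x * (\<Sum>m\<le>N. (b m x + k m x)\<^sup>2)) / 2 \<partial>M)"
    unfolding quad_functional_def
  proof (rule integral_mono)
    show "integrable M (\<lambda>x. \<omega> x * (\<Sum>m\<le>N. ((a m x + b m x) / 2 + k m x)\<^sup>2))"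
    proof (rule quad_integrable[of "\<lambda>m x. (a m x + b m x) / 2" "(C + C') / 2"])
      show "(\<lambda>x. (a m x + b m x) / 2) \<in> borel_measurable M" if "m \<le> N" for m
        using assms(1,2)[OF that] by (intro borel_measurable_divide borel_measurable_add) auto
      show "\<bar>(a m x + b m x) / 2\<bar> \<le> (C + C') / 2" if "m \<le> N" "x \<in> space M" for m x
        using assms(3,4)[OF that] by (auto simp: abs_le_iff)
    qed
  qed (use ia ib pt in auto)
  also have "\<dots> = (quad_functional M \<omega> N k a + quad_functional M \<omega> N k b) / 2"
    unfolding quad_functional_def using ia ib by simp
  finally show ?thesis .
qed

text \<open>The integrand is dominated by a constant plus the squares of the data, which is integrable over a
finite measure space.\<close>

lemma quad_tendsto:
  assumes am: "\<And>n m. m \<le> N \<Longrightarrow> a n m \<in> borel_measurable M" and bm: "\<And>m. m \<le> N \<Longrightarrow> b m \<in> borel_measurable M"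
    and bd: "\<And>n m x. m \<le> N \<Longrightarrow> x \<in> space M \<Longrightarrow> \<bar>a n m x\<bar> \<le> C"
    and lim: "\<And>m x. m \<le> N \<Longrightarrow> x \<in> space M \<Longrightarrow> (\<lambda>n. a n m x) \<longlonglongrightarrow> b m x"
  shows "(\<lambda>n. quad_functional M \<omega> N k (a n)) \<longlonglongrightarrow> quad_functional M \<omega> N k b"
  unfolding quad_functional_def
proof (rule integral_dominated_convergence[OF quad_integrand_measurable[OF bm] quad_integrand_measurable[OF am] quad_dominating_integrable[of C]])
  show "AE x in M. (\<lambda>n. \<omega> x * (\<Sum>m\<le>N. (a n m x + k m x)\<^sup>2)) \<longlonglongrightarrow> \<omega> x * (\<Sum>m\<le>N. (b m x + k m x)\<^sup>2)"
    by (intro AE_I2 tendsto_intros lim) auto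
  show "AE x in M. norm (\<omega> x * (\<Sum>m\<le>N. (a n m x + k m x)\<^sup>2)) \<le> B * (\<Sum>m\<le>N. 2 * C\<^sup>2 + 2 * (k m x)\<^sup>2)" for n
    using quad_integrand_le[of _ "a n" C] bd by (intro AE_I2) (smt (verit) real_norm_def)
qed

end

section \<open>Temporal coefficients\<close>

lemma Psi_has_derivative:
  "(Psi T n has_real_derivative
     sqrt ((2 * real n + 1) / T) * (exp t * poly (legendre n) (2 * t / T - 1)
       + exp t * (poly (pderiv (legendre n)) (2 * t / T - 1) * (2 / T)))) (at t)"
proof -
  have "((\<lambda>t. poly (legendre n) (2 * t / T - 1)) has_real_derivative poly (pderiv (legendre n)) (2 * t / T - 1) * (2 / T)) (at t)"
  proof (rule DERIV_chain2[OF poly_DERIV])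
    have "((\<lambda>t. (2 / T) * t - 1) has_real_derivative (2 / T)) (at t)"
      by (rule DERIV_cong[OF DERIV_diff[OF DERIV_cmult[OF DERIV_ident] DERIV_const]]) simp
    then show "((\<lambda>t. 2 * t / T - 1) has_real_derivative (2 / T)) (at t)" by simp
  qed
  from DERIV_cmult[OF DERIV_mult[OF DERIV_exp this], of "sqrt ((2 * real n + 1) / T)"]
  show ?thesis unfolding Psi_def[abs_def] by (simp add: mult_ac add_ac)
qed

lemma continuous_on_Psi: "continuous_on S (Psi T n)"
  by (intro continuous_at_imp_continuous_on ballI DERIV_isCont[OF Psi_has_derivative])

lemma continuous_on_deriv_Psi: "continuous_on S (deriv (Psi T n))"
proof -
  have eq: "deriv (Psi T n) = (\<lambda>t. sqrt ((2 * real n + 1) / T) * (exp t * poly (legendre n) (2 * t / T - 1)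
       + exp t * (poly (pderiv (legendre n)) (2 * t / T - 1) * (2 / T))))"
    using DERIV_imp_deriv[OF Psi_has_derivative] by blast
  have "continuous_on S (\<lambda>t. (2 / T) * t - 1)" by (intro continuous_intros)
  then have c: "continuous_on S (\<lambda>t. 2 * t / T - 1)" by simp
  show ?thesis unfolding eq by (intro continuous_intros c continuous_on_poly)
qed

lemma bounded_on_interval:
  fixes f :: "real \<Rightarrow> real"
  assumes "continuous_on UNIV f"
  obtains B where "B \<ge> 0" "\<And>t. t \<in> {a..b} \<Longrightarrow> \<bar>f t\<bar> \<le> B"
proof -
  have "compact (f ` {a..b})" using continuous_on_subset[OF assms] by (intro compact_continuous_image) auto
  then have "bounded (f ` {a..b})" by (rule compact_imp_bounded)
  then obtain B where B: "\<forall>y\<in>f ` {a..b}. norm y \<le> B" unfolding bounded_iff by blast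
  show thesis
  proof (rule that[of "\<bar>B\<bar>"])
    fix t assume "t \<in> {a..b}"
    then have "norm (f t) \<le> B" using B by blast
    then show "\<bar>f t\<bar> \<le> \<bar>B\<bar>" by simp
  qed simp
qed

subsection \<open>Boundary data\<close>

text \<open>The data are measurable for the completed product measure only, so they are first replaced by a
version that is measurable for the product; by Fubini's theorem the coefficients change on a null
set only. The Cauchy--Schwarz inequality in \<open>t\<close> bounds the squared coefficient by a multiple of the
integral of the squared data.\<close>

lemma time_coeff_square_integrable:
  fixes \<mu> :: "'p measure" and g :: "'p \<Rightarrow> real \<Rightarrow> real"
  assumes fin: "finite_measure \<mu>" and T: "T > 0"
    and g: "square_integrable (completion (\<mu> \<Otimes>\<^sub>M lebesgue_on {0<..<T})) (\<lambda>(p, t). g p t)"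
  obtains g' where "square_integrable \<mu> g'" "AE p in \<mu>. time_coeff T g m p = g' p"
proof -
  let ?\<nu> = "lebesgue_on {0<..<T}"
  have fin\<nu>: "finite_measure ?\<nu>"
    by (rule finite_measureI) (use T in \<open>simp add: emeasure_restrict_space space_restrict_space\<close>)
  interpret \<mu>: finite_measure \<mu> by (rule fin)
  interpret \<nu>: finite_measure ?\<nu> by (rule fin\<nu>)
  interpret P: pair_sigma_finite \<mu> ?\<nu> by standard
  let ?P = "\<mu> \<Otimes>\<^sub>M ?\<nu>"
  define G where "G = (\<lambda>(p, t). g p t)"
  have Gm: "G \<in> borel_measurable (completion ?P)" and Gi: "integrable (completion ?P) (\<lambda>q. (G q)\<^sup>2)"
    using g by (auto simp: square_integrable_def G_def)
  obtain G' where G'm[measurable]: "G' \<in> borel_measurable ?P" and ae: "AE q in ?P. G q = G' q"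
    using completion_ex_borel_measurable_real[OF Gm] by blast
  have "integrable (completion ?P) (\<lambda>q. (G' q)\<^sup>2)"
  proof (subst integrable_cong_AE[of _ _ "\<lambda>q. (G q)\<^sup>2"])
    show "AE q in completion ?P. (G' q)\<^sup>2 = (G q)\<^sup>2"
      using AE_completion[OF ae] by eventually_elim simp
    show "(\<lambda>q. (G' q)\<^sup>2) \<in> borel_measurable (completion ?P)"
      using G'm by (intro borel_measurable_power measurable_completion)
  qed (use Gm Gi in auto)
  then have i2: "integrable ?P (\<lambda>q. (G' q)\<^sup>2)" by (subst (asm) integrable_completion) auto
  define e where "e t = exp (-2 * t) * Psi T m t" for t :: real
  have ec: "continuous_on UNIV e" unfolding e_def by (intro continuous_intros continuous_on_Psi)
  then have em0: "e \<in> borel_measurable borel" by (rule borel_measurable_continuous_onI)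
  have em[measurable]: "e \<in> borel_measurable ?\<nu>"
    by (intro measurable_restrict_space1 measurable_completion) (use em0 in simp)
  obtain B where B: "B \<ge> 0" "\<And>t. t \<in> {0..T} \<Longrightarrow> \<bar>e t\<bar> \<le> B" using bounded_on_interval[OF ec] by blast
  have es: "square_integrable ?\<nu> e"
    unfolding square_integrable_def
  proof
    show "integrable ?\<nu> (\<lambda>t. (norm (e t))\<^sup>2)"
    proof (rule \<nu>.integrable_const_bound[of _ "B\<^sup>2"])
      show "AE t in ?\<nu>. norm ((norm (e t))\<^sup>2) \<le> B\<^sup>2"
        using B by (intro AE_I2) (auto simp: space_restrict_space intro!: abs_le_square_iff[THEN iffD1, of _ B, simplified])
    qed measurable
  qed (rule em)
  define g' where "g' p = (\<integral>t. e t * G' (p, t) \<partial>?\<nu>)" for p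
  have g'm[measurable]: "g' \<in> borel_measurable \<mu>"
    unfolding g'_def by (rule \<nu>.borel_measurable_lebesgue_integral) measurable
  have "AE p in \<mu>. integrable ?\<nu> (\<lambda>t. (G' (p, t))\<^sup>2)" by (rule P.AE_integrable_fst'[OF i2])
  then have le: "AE p in \<mu>. (g' p)\<^sup>2 \<le> (\<integral>t. (e t)\<^sup>2 \<partial>?\<nu>) * (\<integral>t. (G' (p, t))\<^sup>2 \<partial>?\<nu>)"
  proof (rule AE_mp, intro AE_I2 impI)
    fix p assume p: "p \<in> space \<mu>" and ip: "integrable ?\<nu> (\<lambda>t. (G' (p, t))\<^sup>2)"
    have "(\<lambda>t. G' (p, t)) \<in> borel_measurable ?\<nu>" using p by measurable
    then have "square_integrable ?\<nu> (\<lambda>t. G' (p, t))" using ip by (simp add: square_integrable_def)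
    from L2_cauchy_schwarz(2)[OF es this]
    show "(g' p)\<^sup>2 \<le> (\<integral>t. (e t)\<^sup>2 \<partial>?\<nu>) * (\<integral>t. (G' (p, t))\<^sup>2 \<partial>?\<nu>)" unfolding g'_def .
  qed
  have "square_integrable \<mu> g'"
    unfolding square_integrable_def
  proof
    have "integrable \<mu> (\<lambda>p. (\<integral>t. (e t)\<^sup>2 \<partial>?\<nu>) * (\<integral>t. (G' (p, t))\<^sup>2 \<partial>?\<nu>))"
      using P.integrable_fst'[OF i2] by simp
    then show "integrable \<mu> (\<lambda>p. (norm (g' p))\<^sup>2)"
    proof (rule Bochner_Integration.integrable_bound)
      show "AE p in \<mu>. norm ((norm (g' p))\<^sup>2) \<le> norm ((\<integral>t. (e t)\<^sup>2 \<partial>?\<nu>) * (\<integral>t. (G' (p, t))\<^sup>2 \<partial>?\<nu>))"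
        using le by eventually_elim (simp add: abs_le_iff)
    qed measurable
  qed measurable
  moreover have "AE p in \<mu>. time_coeff T g m p = g' p"
    using P.AE_pair[OF ae]
  proof eventually_elim
    case (elim p)
    have "AE t in lebesgue. t \<in> {0<..<T} \<longrightarrow> G (p, t) = G' (p, t)"
      using elim by (subst (asm) AE_lebesgue_on_iff) auto
    then have "time_coeff T g m p = (\<integral>t. indicator {0<..<T} t *\<^sub>R (e t * G' (p, t)) \<partial>lebesgue)"
      unfolding time_coeff_def set_lebesgue_integral_def
      by (intro complete_integral_cong_AE(1)[OF complete_lebesgue], eventually_elim) (auto simp: G_def e_def indicator_def)
    also have "\<dots> = g' p" unfolding g'_def by (subst integral_restrict_space) auto
    finally show ?case .
  qed
  ultimately show thesis by (rule that)
qed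

subsection \<open>Coefficients of the frozen nonlinearity\<close>

text \<open>The integral of a bounded function over \<open>[0, T]\<close>, as a function of the parameter \<open>x\<close>, is bounded; it
is the restriction of a Borel function because the integrand extended by zero is jointly Borel.\<close>

lemma parametric_time_integral:
  fixes \<Omega> :: "'a::euclidean_space set" and k :: "'a \<Rightarrow> real \<Rightarrow> real"
  assumes m: "(\<lambda>(x, t). indicator (\<Omega> \<times> {0..T}) (x, t) * k x t) \<in> borel_measurable borel" and T: "T > 0"
    and b: "\<And>x t. x \<in> \<Omega> \<Longrightarrow> t \<in> {0..T} \<Longrightarrow> \<bar>k x t\<bar> \<le> C" and C: "C \<ge> 0"
  obtains K where "K \<in> borel_measurable borel" "\<And>x. \<bar>K x\<bar> \<le> C * T"
    "\<And>x. x \<in> \<Omega> \<Longrightarrow> (LINT t:{0..T}|lebesgue. k x t) = K x"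
proof -
  define k' where "k' x t = indicator (\<Omega> \<times> {0..T}) (x, t) * k x t" for x t
  have m'[measurable]: "(\<lambda>(x, t). k' x t) \<in> borel_measurable (borel \<Otimes>\<^sub>M borel)"
    using m unfolding k'_def borel_prod .
  define K where "K x = (\<integral>t. k' x t \<partial>lborel)" for x
  have "K \<in> borel_measurable borel" unfolding K_def by measurable
  moreover have "\<bar>K x\<bar> \<le> C * T" for x
  proof -
    have bb: "\<bar>k' x t\<bar> \<le> C * indicator {0..T} t" for t
      using b[of x t] C by (auto simp: k'_def indicator_def)
    have i: "integrable lborel (\<lambda>t. C * indicator {0..T} t :: real)"
      using T by (intro integrable_mult_right integrable_real_indicator) auto
    have ik: "integrable lborel (k' x)"
    proof (rule Bochner_Integration.integrable_bound[OF i])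
      show "AE t in lborel. norm (k' x t) \<le> norm (C * indicator {0..T} t)"
        using bb by (intro AE_I2) (metis abs_ge_self order_trans real_norm_def)
    qed measurable
    have "\<bar>K x\<bar> \<le> (\<integral>t. \<bar>k' x t\<bar> \<partial>lborel)" unfolding K_def by (rule integral_abs_bound)
    also have "\<dots> \<le> (\<integral>t. C * indicator {0..T} t \<partial>lborel)" using ik i bb by (intro integral_mono) auto
    also have "\<dots> = C * T" using T by simp
    finally show ?thesis .
  qed
  moreover have "(LINT t:{0..T}|lebesgue. k x t) = K x" if "x \<in> \<Omega>" for x
  proof -
    have "(LINT t:{0..T}|lebesgue. k x t) = (\<integral>t. k' x t \<partial>lebesgue)"
      unfolding set_lebesgue_integral_def k'_def using that
      by (intro Bochner_Integration.integral_cong refl) (auto simp: indicator_def)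
    also have "\<dots> = K x" unfolding K_def by (rule integral_completion) measurable
    finally show ?thesis .
  qed
  ultimately show thesis by (rule that)
qed

text \<open>A Lebesgue measurable function is almost everywhere equal to a Borel function, which is then
truncated at the essential bound. By Fubini's theorem, for almost every \<open>x\<close> the change affects only a
null set of times.\<close>

lemma Linfty_bounded_version:
  fixes \<Omega> :: "'a::euclidean_space set" and \<alpha> :: "'a \<Rightarrow> real \<Rightarrow> real"
  assumes L: "Linfty_on (\<Omega> \<times> {0<..<T}) (\<lambda>(x, t). \<alpha> x t)" and \<Omega>: "open \<Omega>"
  obtains \<alpha>' K where "(\<lambda>(x, t). \<alpha>' x t) \<in> borel_measurable (borel \<Otimes>\<^sub>M borel)" "K \<ge> 0" "\<And>x t. \<bar>\<alpha>' x t\<bar> \<le> K"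
    "AE x in lborel. x \<in> \<Omega> \<longrightarrow> (AE t in lborel. t \<in> {0<..<T} \<longrightarrow> \<alpha> x t = \<alpha>' x t)"
proof -
  let ?S = "\<Omega> \<times> {0<..<T}"
  have S: "?S \<in> sets borel" using \<Omega> by (intro borel_open open_Times) auto
  then have SL: "?S \<in> sets lebesgue" by simp
  define a where "a p = indicator ?S p *\<^sub>R (case p of (x, t) \<Rightarrow> \<alpha> x t)" for p
  have am: "a \<in> borel_measurable lebesgue"
    using L SL unfolding Linfty_on_def a_def by (subst (asm) borel_measurable_restrict_space_iff) auto
  obtain K where K: "AE p in lebesgue_on ?S. \<bar>case p of (x, t) \<Rightarrow> \<alpha> x t\<bar> \<le> K"
    using L unfolding Linfty_on_def by blast
  obtain b where b[measurable]: "b \<in> borel_measurable lborel" and ab: "AE p in lborel. a p = b p"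
    using completion_ex_borel_measurable_real[OF am] by blast
  define \<alpha>' where "\<alpha>' x t = max (- \<bar>K\<bar>) (min \<bar>K\<bar> (b (x, t)))" for x t
  have "(\<lambda>(x, t). \<alpha>' x t) = (\<lambda>p. max (- \<bar>K\<bar>) (min \<bar>K\<bar> (b p)))" by (auto simp: \<alpha>'_def)
  moreover have "(\<lambda>p. max (- \<bar>K\<bar>) (min \<bar>K\<bar> (b p))) \<in> borel_measurable lborel" by measurable
  ultimately have "(\<lambda>(x, t). \<alpha>' x t) \<in> borel_measurable (borel \<Otimes>\<^sub>M borel)" by (simp add: borel_prod)
  moreover have "\<bar>\<alpha>' x t\<bar> \<le> \<bar>K\<bar>" for x t unfolding \<alpha>'_def by (simp add: abs_le_iff)
  moreover have "AE x in lborel. x \<in> \<Omega> \<longrightarrow> (AE t in lborel. t \<in> {0<..<T} \<longrightarrow> \<alpha> x t = \<alpha>' x t)"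
  proof -
    have "AE p in lebesgue. p \<in> ?S \<longrightarrow> \<bar>case p of (x, t) \<Rightarrow> \<alpha> x t\<bar> \<le> K"
      using K SL by (simp add: AE_lebesgue_on_iff)
    then have K': "AE p in lborel. p \<in> ?S \<longrightarrow> \<bar>case p of (x, t) \<Rightarrow> \<alpha> x t\<bar> \<le> K" by (simp add: AE_completion_iff)
    have "AE p in lborel. p \<in> ?S \<longrightarrow> (case p of (x, t) \<Rightarrow> \<alpha> x t = \<alpha>' x t)"
      using K' ab by eventually_elim (auto simp: a_def \<alpha>'_def abs_le_iff split: prod.splits)
    then have "AE p in lborel \<Otimes>\<^sub>M lborel. p \<in> ?S \<longrightarrow> (case p of (x, t) \<Rightarrow> \<alpha> x t = \<alpha>' x t)" unfolding lborel_prod .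
    from lborel_pair.AE_pair[OF this] show ?thesis by eventually_elim (auto elim: eventually_mono)
  qed
  ultimately show thesis by (intro that[of \<alpha>' "\<bar>K\<bar>"]) auto
qed

text \<open>The reflection \<open>t' \<mapsto> t - t'\<close> preserves null sets. The endpoints \<open>t' = 0\<close> and \<open>t' = t\<close>, at which \<open>t - t'\<close>
may fall outside the open interval, form a null set.\<close>

lemma convolution_version:
  fixes a a' :: "real \<Rightarrow> real"
  assumes ae: "AE s in lborel. s \<in> {0<..<T} \<longrightarrow> a s = a' s" and t: "t \<in> {0..T}"
  shows "(LINT t':{0..t}|lebesgue. a (t - t') * p t') = (LINT t':{0..t}|lebesgue. a' (t - t') * p t')"
proof -
  obtain Z where Z: "{s \<in> space lborel. \<not> (s \<in> {0<..<T} \<longrightarrow> a s = a' s)} \<subseteq> Z" "emeasure lborel Z = 0" "Z \<in> sets lborel"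
    using AE_E[OF ae] by blast
  have "Z \<in> null_sets lborel" using Z by (auto simp: null_sets_def)
  then have "AE s in lborel. s \<notin> Z" by (rule AE_not_in)
  then have "AE t' in lborel. t + (-1) * t' \<notin> Z" using Z(3) by (intro AE_borel_affine) auto
  moreover have "AE t' in lborel. t' \<noteq> 0" "AE t' in lborel. t' \<noteq> t" by (rule AE_lborel_singleton)+
  ultimately have "AE t' in lborel. t' \<in> {0..t} \<longrightarrow> a (t - t') = a' (t - t')"
  proof eventually_elim
    case (elim t')
    show ?case
    proof
      assume "t' \<in> {0..t}"
      then have "t - t' \<in> {0<..<T}" using elim t by auto
      moreover have "t - t' \<notin> Z" using elim(1) by simp
      ultimately have "t - t' \<notin> {s \<in> space lborel. \<not> (s \<in> {0<..<T} \<longrightarrow> a s = a' s)}" using Z(1) by blast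
      then show "a (t - t') = a' (t - t')" using \<open>t - t' \<in> {0<..<T}\<close> by simp
    qed
  qed
  then have "AE t' in lebesgue. t' \<in> {0..t} \<longrightarrow> a (t - t') = a' (t - t')" by (rule AE_completion)
  then show ?thesis unfolding set_lebesgue_integral_def
    by (intro complete_integral_cong_AE(1)[OF complete_lebesgue], eventually_elim) (auto simp: indicator_def)
qed

text \<open>With the continuous representatives of \<open>\<Phi>\<close> the argument of \<open>c\<close> and \<open>f\<close> is a continuous function \<open>e\<close> of
\<open>(x, t)\<close>, bounded on the closure of \<open>\<Omega>\<close> times \<open>[0, T]\<close>. So \<open>1/c\<close> is bounded by \<open>1/\<kappa>\<close>, \<open>f\<close> is bounded along
\<open>e\<close> by compactness, and the memory kernel is replaced by a bounded Borel version. Then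
\<open>parametric_time_integral\<close> applies to all three families of coefficients. The exceptional null set
consists of the points where \<open>\<Phi>\<close> differs from its representative or the kernel from its version.\<close>

lemma frozen_coefficients:
  fixes \<Omega> :: "'a::euclidean_space set" and c f \<alpha> :: "'a \<Rightarrow> real \<Rightarrow> real" and \<Phi> :: "nat \<Rightarrow> 'a \<Rightarrow> real"
  assumes op: "open \<Omega>" and bd: "bounded \<Omega>" and T: "T > 0"
    and c: "continuous_on (closure (\<Omega> \<times> UNIV)) (\<lambda>(x, \<sigma>). c x \<sigma>)"
    and f: "continuous_on (closure (\<Omega> \<times> UNIV)) (\<lambda>(x, \<sigma>). f x \<sigma>)"
    and \<kappa>: "\<kappa> > 0" and c\<kappa>: "\<And>x \<sigma>. x \<in> closure \<Omega> \<Longrightarrow> c x \<sigma> \<ge> \<kappa>"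
    and \<alpha>: "Linfty_on (\<Omega> \<times> {0<..<T}) (\<lambda>(x, t). \<alpha> x t)"
    and s: "s > real DIM('a) / 2 + 1" and \<Phi>: "\<And>j. j \<le> N \<Longrightarrow> \<Phi> j \<in> Hs \<Omega> s"
  obtains A F C where "\<And>m n. A m n \<in> borel_measurable borel" "\<And>m. F m \<in> borel_measurable borel" "0 \<le> C"
    "\<And>m n x. m \<le> N \<Longrightarrow> n \<le> N \<Longrightarrow> \<bar>A m n x\<bar> \<le> C" "\<And>m x. m \<le> N \<Longrightarrow> \<bar>F m x\<bar> \<le> C"
    "AE x in lebesgue. x \<in> \<Omega> \<longrightarrow> (\<forall>m\<le>N. F_coeff T N c f \<Phi> m x = F m x \<and>
       (\<forall>n\<le>N. S_coeff T N c \<Phi> m n x + M_coeff T N c \<alpha> \<Phi> m n x = A m n x))"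
proof -
  have \<Omega>: "\<Omega> \<in> sets lebesgue" using op by auto
  have "\<forall>j. \<exists>w. j \<le> N \<longrightarrow> w \<in> Hs_extensions \<Omega> s (\<Phi> j)" using \<Phi> unfolding Hs_def by blast
  then obtain \<phi> where \<phi>: "\<And>j. j \<le> N \<Longrightarrow> \<phi> j \<in> Hs_extensions \<Omega> s (\<Phi> j)" by metis
  have \<phi>H: "\<phi> j \<in> Hs_whole s" if "j \<le> N" for j using \<phi>[OF that] by (simp add: Hs_extensions_def)
  define e where "e x t = (\<Sum>j\<le>N. sob_rep (\<phi> j) x * Psi T j t)" for x t
  have ae\<Phi>: "AE x in lebesgue. \<forall>j. x \<in> \<Omega> \<longrightarrow> j \<le> N \<longrightarrow> \<Phi> j x = sob_rep (\<phi> j) x"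
    unfolding AE_all_countable
  proof
    fix j
    show "AE x in lebesgue. x \<in> \<Omega> \<longrightarrow> j \<le> N \<longrightarrow> \<Phi> j x = sob_rep (\<phi> j) x"
    proof (cases "j \<le> N")
      case True
      show ?thesis using Hs_extension_AE_sob_rep[OF s \<phi>[OF True] \<Omega>] by eventually_elim simp
    qed simp
  qed
  have ec: "continuous_on S (\<lambda>p. e (fst p) (snd p))" for S
    unfolding e_def
    by (intro continuous_intros continuous_on_compose2[OF continuous_sob_rep[OF s \<phi>H]] continuous_on_compose2[OF continuous_on_Psi[of UNIV]]) auto
  have pairc: "continuous_on (\<Omega> \<times> UNIV) (\<lambda>p. g (fst p) (e (fst p) (snd p)))"
    if g: "continuous_on (closure (\<Omega> \<times> UNIV)) (\<lambda>(x, \<sigma>). g x \<sigma>)" for g :: "'a \<Rightarrow> real \<Rightarrow> real"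
  proof -
    have "continuous_on (\<Omega> \<times> UNIV) (\<lambda>p. (fst p, e (fst p) (snd p)))" by (intro continuous_intros ec)
    moreover have "(\<lambda>p. (fst p, e (fst p) (snd p))) ` (\<Omega> \<times> UNIV) \<subseteq> closure (\<Omega> \<times> UNIV)"
      using closure_subset[of "\<Omega> \<times> (UNIV :: real set)"] by auto
    ultimately have "continuous_on (\<Omega> \<times> UNIV) (\<lambda>p. (\<lambda>(x, \<sigma>). g x \<sigma>) (fst p, e (fst p) (snd p)))"
      by (rule continuous_on_compose2[OF g])
    then show ?thesis by simp
  qed
  define q where "q x t = c x (e x t)" for x t
  have qc: "continuous_on (\<Omega> \<times> UNIV) (\<lambda>p. q (fst p) (snd p))" unfolding q_def by (rule pairc[OF c])
  have q\<kappa>: "q x t \<ge> \<kappa>" if "x \<in> \<Omega>" for x t unfolding q_def using that closure_subset[of \<Omega>] by (intro c\<kappa>) auto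
  have qinv: "\<bar>inverse (q x t)\<bar> \<le> 1 / \<kappa>" if "x \<in> \<Omega>" for x t
    using q\<kappa>[OF that, of t] \<kappa> by (simp add: abs_inverse inverse_eq_divide frac_le)
  let ?D = "\<Omega> \<times> {0..T}"
  have D: "?D \<in> sets borel" unfolding borel_prod[symmetric] using op by (intro pair_measureI) auto
  have DU: "?D \<subseteq> \<Omega> \<times> UNIV" by auto
  have qiD: "continuous_on ?D (\<lambda>p. inverse (q (fst p) (snd p)))"
  proof (intro continuous_on_inverse continuous_on_subset[OF qc DU] ballI)
    fix p assume "p \<in> ?D"
    then show "q (fst p) (snd p) \<noteq> 0" using q\<kappa>[of "fst p" "snd p"] \<kappa> by auto
  qed
  have meas: "(\<lambda>(x, t). indicator ?D (x, t) * k x t) \<in> borel_measurable borel"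
    if k: "continuous_on ?D (\<lambda>p. k (fst p) (snd p))" for k :: "'a \<Rightarrow> real \<Rightarrow> real"
  proof -
    have "(\<lambda>p. indicator ?D p *\<^sub>R k (fst p) (snd p)) \<in> borel_measurable borel"
      by (rule borel_measurable_continuous_on_indicator[OF D k])
    then show ?thesis by (simp add: case_prod_unfold)
  qed
  have pc: "continuous_on S (\<lambda>p::'a \<times> real. h (snd p))" if "continuous_on UNIV h" for h :: "real \<Rightarrow> real" and S
    by (rule continuous_on_compose2[OF that]) (auto intro: continuous_intros)
  have expc: "continuous_on UNIV (\<lambda>t::real. exp (-2 * t))" by (intro continuous_intros)
  obtain E0 where E0: "E0 \<ge> 0" "\<And>t. t \<in> {0..T} \<Longrightarrow> \<bar>exp (-2 * t)\<bar> \<le> E0" using bounded_on_interval[OF expc] by blast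
  have "\<forall>n. \<exists>B. B \<ge> 0 \<and> (\<forall>t\<in>{0..T}. \<bar>Psi T n t\<bar> \<le> B)" using bounded_on_interval[OF continuous_on_Psi] by metis
  then obtain PB where PB: "\<And>n. PB n \<ge> 0" "\<And>n t. t \<in> {0..T} \<Longrightarrow> \<bar>Psi T n t\<bar> \<le> PB n" by metis
  have "\<forall>n. \<exists>B. B \<ge> 0 \<and> (\<forall>t\<in>{0..T}. \<bar>deriv (Psi T n) t\<bar> \<le> B)" using bounded_on_interval[OF continuous_on_deriv_Psi] by metis
  then obtain DB where DB: "\<And>n. DB n \<ge> 0" "\<And>n t. t \<in> {0..T} \<Longrightarrow> \<bar>deriv (Psi T n) t\<bar> \<le> DB n" by metis
  have te: "time_expansion T N \<Phi> x t = e x t" if "\<forall>j\<le>N. \<Phi> j x = sob_rep (\<phi> j) x" for x t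
    unfolding time_expansion_def e_def using that by (intro sum.cong) auto
  have good: "AE x in lebesgue. x \<in> \<Omega> \<longrightarrow> (\<forall>t. time_expansion T N \<Phi> x t = e x t)"
    using ae\<Phi> by eventually_elim (use te in blast)

  \<comment> \<open>the coefficients \<open>S\<close>\<close>
  have exKS: "\<exists>K. K \<in> borel_measurable borel \<and> (\<forall>x. \<bar>K x\<bar> \<le> E0 * DB n * PB m * (1 / \<kappa>) * T) \<and>
      (\<forall>x\<in>\<Omega>. (LINT t:{0..T}|lebesgue. exp (-2 * t) * deriv (Psi T n) t * Psi T m t * inverse (q x t)) = K x)" for m n
  proof (rule parametric_time_integral[of \<Omega> T "\<lambda>x t. exp (-2 * t) * deriv (Psi T n) t * Psi T m t * inverse (q x t)" "E0 * DB n * PB m * (1 / \<kappa>)"])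
    show "(\<lambda>(x, t). indicator ?D (x, t) * (exp (-2 * t) * deriv (Psi T n) t * Psi T m t * inverse (q x t))) \<in> borel_measurable borel"
      by (rule meas) (intro continuous_on_mult pc expc continuous_on_deriv_Psi continuous_on_Psi qiD)
    show "\<bar>exp (-2 * t) * deriv (Psi T n) t * Psi T m t * inverse (q x t)\<bar> \<le> E0 * DB n * PB m * (1 / \<kappa>)" if "x \<in> \<Omega>" "t \<in> {0..T}" for x t
      unfolding abs_mult using E0 DB PB qinv that by (intro mult_mono mult_nonneg_nonneg) auto
    show "0 \<le> E0 * DB n * PB m * (1 / \<kappa>)" using E0(1) DB(1) PB(1) \<kappa> by (intro mult_nonneg_nonneg) auto
  qed (use T in blast)+
  define KS where "KS m n = (SOME K. K \<in> borel_measurable borel \<and> (\<forall>x. \<bar>K x\<bar> \<le> E0 * DB n * PB m * (1 / \<kappa>) * T) \<and>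
      (\<forall>x\<in>\<Omega>. (LINT t:{0..T}|lebesgue. exp (-2 * t) * deriv (Psi T n) t * Psi T m t * inverse (q x t)) = K x))" for m n
  note KS' = someI_ex[OF exKS, folded KS_def]
  note KS = conjunct1[OF KS'] conjunct1[OF conjunct2[OF KS'], rule_format] conjunct2[OF conjunct2[OF KS'], rule_format]

  \<comment> \<open>the coefficients \<open>F\<close>: bounds of \<open>e\<close>, and of \<open>f\<close> on the compact set of its arguments\<close>
  have "compact (closure \<Omega> \<times> {0..T})" using bd by (intro compact_Times) (simp_all add: compact_closure)
  then have "compact ((\<lambda>p. e (fst p) (snd p)) ` (closure \<Omega> \<times> {0..T}))" by (rule compact_continuous_image[OF ec])
  then have "bounded ((\<lambda>p. e (fst p) (snd p)) ` (closure \<Omega> \<times> {0..T}))" by (rule compact_imp_bounded)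
  then obtain EB where EB: "\<forall>y\<in>(\<lambda>p. e (fst p) (snd p)) ` (closure \<Omega> \<times> {0..T}). norm y \<le> EB" unfolding bounded_iff by blast
  have eB: "e x t \<in> {-EB..EB}" if "x \<in> closure \<Omega>" "t \<in> {0..T}" for x t
    using EB[rule_format, of "e x t"] that by (force simp: abs_le_iff)
  have "compact (closure \<Omega> \<times> {-EB..EB})" using bd by (intro compact_Times) (simp_all add: compact_closure)
  moreover have "continuous_on (closure \<Omega> \<times> {-EB..EB}) (\<lambda>(x, \<sigma>). f x \<sigma>)"
    by (rule continuous_on_subset[OF f]) (auto simp: closure_Times)
  ultimately have "compact ((\<lambda>(x, \<sigma>). f x \<sigma>) ` (closure \<Omega> \<times> {-EB..EB}))" by (intro compact_continuous_image)
  then have "bounded ((\<lambda>(x, \<sigma>). f x \<sigma>) ` (closure \<Omega> \<times> {-EB..EB}))" by (rule compact_imp_bounded)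
  then obtain FB where FB: "\<forall>y\<in>(\<lambda>(x, \<sigma>). f x \<sigma>) ` (closure \<Omega> \<times> {-EB..EB}). norm y \<le> FB" unfolding bounded_iff by blast
  have fB: "\<bar>f x (e x t)\<bar> \<le> \<bar>FB\<bar>" if "x \<in> \<Omega>" "t \<in> {0..T}" for x t
  proof -
    have "x \<in> closure \<Omega>" using that closure_subset by blast
    then have "(x, e x t) \<in> closure \<Omega> \<times> {-EB..EB}" using eB that by blast
    then have "norm (f x (e x t)) \<le> FB" using FB by force
    then show ?thesis by simp
  qed
  have fcD: "continuous_on ?D (\<lambda>p. f (fst p) (e (fst p) (snd p)))" by (rule continuous_on_subset[OF pairc[OF f] DU])
  have exKF: "\<exists>K. K \<in> borel_measurable borel \<and> (\<forall>x. \<bar>K x\<bar> \<le> E0 * \<bar>FB\<bar> * PB m * (1 / \<kappa>) * T) \<and>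
      (\<forall>x\<in>\<Omega>. (LINT t:{0..T}|lebesgue. exp (-2 * t) * f x (e x t) * Psi T m t * inverse (q x t)) = K x)" for m
  proof (rule parametric_time_integral[of \<Omega> T "\<lambda>x t. exp (-2 * t) * f x (e x t) * Psi T m t * inverse (q x t)" "E0 * \<bar>FB\<bar> * PB m * (1 / \<kappa>)"])
    show "(\<lambda>(x, t). indicator ?D (x, t) * (exp (-2 * t) * f x (e x t) * Psi T m t * inverse (q x t))) \<in> borel_measurable borel"
      by (rule meas) (intro continuous_on_mult pc expc fcD continuous_on_Psi qiD)
    show "\<bar>exp (-2 * t) * f x (e x t) * Psi T m t * inverse (q x t)\<bar> \<le> E0 * \<bar>FB\<bar> * PB m * (1 / \<kappa>)" if "x \<in> \<Omega>" "t \<in> {0..T}" for x t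
      unfolding abs_mult using E0 fB PB qinv that by (intro mult_mono mult_nonneg_nonneg) auto
    show "0 \<le> E0 * \<bar>FB\<bar> * PB m * (1 / \<kappa>)" using E0(1) PB(1) \<kappa> by (intro mult_nonneg_nonneg) auto
  qed (use T in blast)+
  define KF where "KF m = (SOME K. K \<in> borel_measurable borel \<and> (\<forall>x. \<bar>K x\<bar> \<le> E0 * \<bar>FB\<bar> * PB m * (1 / \<kappa>) * T) \<and>
      (\<forall>x\<in>\<Omega>. (LINT t:{0..T}|lebesgue. exp (-2 * t) * f x (e x t) * Psi T m t * inverse (q x t)) = K x))" for m
  note KF' = someI_ex[OF exKF, folded KF_def]
  note KF = conjunct1[OF KF'] conjunct1[OF conjunct2[OF KF'], rule_format] conjunct2[OF conjunct2[OF KF'], rule_format]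

  \<comment> \<open>the coefficients \<open>M\<close>, with inner integral \<open>I n x t\<close> over the memory\<close>
  obtain \<alpha>' K0 where \<alpha>'m[measurable]: "(\<lambda>(x, t). \<alpha>' x t) \<in> borel_measurable (borel \<Otimes>\<^sub>M borel)" and K0: "K0 \<ge> 0"
    and \<alpha>'b: "\<And>x t. \<bar>\<alpha>' x t\<bar> \<le> K0"
    and \<alpha>'ae: "AE x in lborel. x \<in> \<Omega> \<longrightarrow> (AE t in lborel. t \<in> {0<..<T} \<longrightarrow> \<alpha> x t = \<alpha>' x t)"
    using Linfty_bounded_version[OF \<alpha> op] by blast
  define I where "I n x t = (\<integral>t'. (if 0 \<le> t' \<and> t' \<le> t then \<alpha>' x (t - t') * Psi T n t' else 0) \<partial>lborel)" for n x t
  have Pm[measurable]: "Psi T n \<in> borel_measurable borel" for n by (rule borel_measurable_continuous_onI[OF continuous_on_Psi])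
  have Im[measurable]: "(\<lambda>(x, t). I n x t) \<in> borel_measurable (borel \<Otimes>\<^sub>M borel)" for n
    unfolding I_def by measurable
  have Ib: "\<bar>I n x t\<bar> \<le> K0 * PB n * T" if t: "t \<in> {0..T}" for n x t
  proof -
    let ?g = "\<lambda>t'. if 0 \<le> t' \<and> t' \<le> t then \<alpha>' x (t - t') * Psi T n t' else 0"
    have gb: "\<bar>?g t'\<bar> \<le> K0 * PB n * indicator {0..T} t'" for t'
      using t \<alpha>'b[of x "t - t'"] PB(2)[of t' n] K0 PB(1)[of n]
      by (auto simp: abs_mult indicator_def intro!: mult_mono)
    have i: "integrable lborel (\<lambda>t'. K0 * PB n * indicator {0..T} t' :: real)"
      using T by (intro integrable_mult_right integrable_real_indicator) auto
    have gi: "integrable lborel ?g"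
    proof (rule Bochner_Integration.integrable_bound[OF i])
      show "AE t' in lborel. norm (?g t') \<le> norm (K0 * PB n * indicator {0..T} t')"
        using gb by (intro AE_I2) (metis abs_ge_self order_trans real_norm_def)
    qed measurable
    have "\<bar>I n x t\<bar> \<le> (\<integral>t'. \<bar>?g t'\<bar> \<partial>lborel)" unfolding I_def by (rule integral_abs_bound)
    also have "\<dots> \<le> (\<integral>t'. K0 * PB n * indicator {0..T} t' \<partial>lborel)" using gi i gb by (intro integral_mono) auto
    also have "\<dots> = K0 * PB n * T" using T by simp
    finally show ?thesis .
  qed
  have exKM: "\<exists>K. K \<in> borel_measurable borel \<and> (\<forall>x. \<bar>K x\<bar> \<le> E0 * PB m * (1 / \<kappa>) * (K0 * PB n * T) * T) \<and>
      (\<forall>x\<in>\<Omega>. (LINT t:{0..T}|lebesgue. exp (-2 * t) * Psi T m t * inverse (q x t) * I n x t) = K x)" for m n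
  proof (rule parametric_time_integral[of \<Omega> T "\<lambda>x t. exp (-2 * t) * Psi T m t * inverse (q x t) * I n x t" "E0 * PB m * (1 / \<kappa>) * (K0 * PB n * T)"])
    have 1: "(\<lambda>(x, t). indicator ?D (x, t) * (exp (-2 * t) * Psi T m t * inverse (q x t))) \<in> borel_measurable borel"
      by (rule meas) (intro continuous_on_mult pc expc continuous_on_Psi qiD)
    have 2: "(\<lambda>(x, t). I n x t) \<in> borel_measurable borel" using Im[of n] by (simp only: borel_prod)
    have "(\<lambda>p. (case p of (x, t) \<Rightarrow> indicator ?D (x, t) * (exp (-2 * t) * Psi T m t * inverse (q x t))) * (case p of (x, t) \<Rightarrow> I n x t)) \<in> borel_measurable borel"
      by (rule borel_measurable_times[OF 1 2])
    then show "(\<lambda>(x, t). indicator ?D (x, t) * (exp (-2 * t) * Psi T m t * inverse (q x t) * I n x t)) \<in> borel_measurable borel"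
      by (simp only: case_prod_unfold mult.assoc)
    show "\<bar>exp (-2 * t) * Psi T m t * inverse (q x t) * I n x t\<bar> \<le> E0 * PB m * (1 / \<kappa>) * (K0 * PB n * T)" if "x \<in> \<Omega>" "t \<in> {0..T}" for x t
      unfolding abs_mult using E0 PB qinv Ib K0 T \<kappa> that by (intro mult_mono mult_nonneg_nonneg) auto
    show "0 \<le> E0 * PB m * (1 / \<kappa>) * (K0 * PB n * T)" using E0(1) PB(1) \<kappa> K0 T by (intro mult_nonneg_nonneg) auto
  qed (use T in blast)+
  define KM where "KM m n = (SOME K. K \<in> borel_measurable borel \<and> (\<forall>x. \<bar>K x\<bar> \<le> E0 * PB m * (1 / \<kappa>) * (K0 * PB n * T) * T) \<and>
      (\<forall>x\<in>\<Omega>. (LINT t:{0..T}|lebesgue. exp (-2 * t) * Psi T m t * inverse (q x t) * I n x t) = K x))" for m n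
  note KM' = someI_ex[OF exKM, folded KM_def]
  note KM = conjunct1[OF KM'] conjunct1[OF conjunct2[OF KM'], rule_format] conjunct2[OF conjunct2[OF KM'], rule_format]
  have inner: "(LINT t':{0..t}|lebesgue. \<alpha> x (t - t') * Psi T n t') = I n x t"
    if x: "AE t in lborel. t \<in> {0<..<T} \<longrightarrow> \<alpha> x t = \<alpha>' x t" and t: "t \<in> {0..T}" for n x t
  proof -
    have "(LINT t':{0..t}|lebesgue. \<alpha> x (t - t') * Psi T n t') = (LINT t':{0..t}|lebesgue. \<alpha>' x (t - t') * Psi T n t')"
      by (rule convolution_version[OF x t])
    also have "\<dots> = (\<integral>t'. (if 0 \<le> t' \<and> t' \<le> t then \<alpha>' x (t - t') * Psi T n t' else 0) \<partial>lebesgue)"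
      unfolding set_lebesgue_integral_def by (intro Bochner_Integration.integral_cong refl) (auto simp: indicator_def)
    also have "\<dots> = I n x t" unfolding I_def by (rule integral_completion) measurable
    finally show ?thesis .
  qed

  define A where "A m n x = KS m n x + KM m n x" for m n x
  define C where "C = (\<Sum>m\<le>N. \<Sum>n\<le>N. E0 * DB n * PB m * (1 / \<kappa>) * T + E0 * PB m * (1 / \<kappa>) * (K0 * PB n * T) * T)
     + (\<Sum>m\<le>N. E0 * \<bar>FB\<bar> * PB m * (1 / \<kappa>) * T)"
  have nn1: "0 \<le> E0 * DB n * PB m * (1 / \<kappa>) * T + E0 * PB m * (1 / \<kappa>) * (K0 * PB n * T) * T" for m n
    using E0(1) DB(1) PB(1) \<kappa> K0 T by (intro add_nonneg_nonneg mult_nonneg_nonneg) auto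
  have nn2: "0 \<le> E0 * \<bar>FB\<bar> * PB m * (1 / \<kappa>) * T" for m
    using E0(1) PB(1) \<kappa> T by (intro mult_nonneg_nonneg) auto
  have nnS: "0 \<le> (\<Sum>m\<le>N. \<Sum>n\<le>N. E0 * DB n * PB m * (1 / \<kappa>) * T + E0 * PB m * (1 / \<kappa>) * (K0 * PB n * T) * T)"
    by (intro sum_nonneg nn1)
  show thesis
  proof (rule that[of A KF C])
    show "A m n \<in> borel_measurable borel" for m n unfolding A_def by (intro borel_measurable_add KS(1) KM(1))
    show "KF m \<in> borel_measurable borel" for m by (rule KF(1))
    show "0 \<le> C" unfolding C_def by (intro add_nonneg_nonneg sum_nonneg nn1 nn2)
    show "\<bar>A m n x\<bar> \<le> C" if "m \<le> N" "n \<le> N" for m n x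
    proof -
      have "\<bar>A m n x\<bar> \<le> \<bar>KS m n x\<bar> + \<bar>KM m n x\<bar>" unfolding A_def by (rule abs_triangle_ineq)
      also have "\<dots> \<le> E0 * DB n * PB m * (1 / \<kappa>) * T + E0 * PB m * (1 / \<kappa>) * (K0 * PB n * T) * T" by (intro add_mono KS KM)
      also have "\<dots> \<le> (\<Sum>n\<le>N. E0 * DB n * PB m * (1 / \<kappa>) * T + E0 * PB m * (1 / \<kappa>) * (K0 * PB n * T) * T)"
        using that nn1 by (intro member_le_sum) auto
      also have "\<dots> \<le> (\<Sum>m\<le>N. \<Sum>n\<le>N. E0 * DB n * PB m * (1 / \<kappa>) * T + E0 * PB m * (1 / \<kappa>) * (K0 * PB n * T) * T)"
        using that by (intro member_le_sum[of m "{..N}" "\<lambda>m. \<Sum>n\<le>N. E0 * DB n * PB m * (1 / \<kappa>) * T + E0 * PB m * (1 / \<kappa>) * (K0 * PB n * T) * T"] sum_nonneg nn1) auto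
      also have "\<dots> \<le> C" unfolding C_def using sum_nonneg[of "{..N}", OF nn2] by simp
      finally show ?thesis .
    qed
    show "\<bar>KF m x\<bar> \<le> C" if "m \<le> N" for m x
    proof -
      have "\<bar>KF m x\<bar> \<le> E0 * \<bar>FB\<bar> * PB m * (1 / \<kappa>) * T" by (rule KF)
      also have "\<dots> \<le> (\<Sum>m\<le>N. E0 * \<bar>FB\<bar> * PB m * (1 / \<kappa>) * T)" using that nn2 by (intro member_le_sum) auto
      also have "\<dots> \<le> C" unfolding C_def using nnS by (simp only: le_add_same_cancel2)
      finally show ?thesis .
    qed
    show "AE x in lebesgue. x \<in> \<Omega> \<longrightarrow> (\<forall>m\<le>N. F_coeff T N c f \<Phi> m x = KF m x \<and>
       (\<forall>n\<le>N. S_coeff T N c \<Phi> m n x + M_coeff T N c \<alpha> \<Phi> m n x = A m n x))"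
      using good AE_completion[OF \<alpha>'ae]
    proof eventually_elim
      case (elim x)
      show ?case
      proof (intro impI allI conjI)
        assume x: "x \<in> \<Omega>"
        have ex: "time_expansion T N \<Phi> x t = e x t" for t using elim(1) x by blast
        fix m assume "m \<le> N"
        show "F_coeff T N c f \<Phi> m x = KF m x"
          unfolding F_coeff_def ex KF(3)[OF x, symmetric] q_def by (simp add: divide_inverse mult_ac)
        fix n assume "n \<le> N"
        have 1: "S_coeff T N c \<Phi> m n x = KS m n x"
          unfolding S_coeff_def ex KS(3)[OF x, symmetric] q_def by (simp add: divide_inverse)
        have ax: "AE t in lborel. t \<in> {0<..<T} \<longrightarrow> \<alpha> x t = \<alpha>' x t" using elim(2) x by blast
        have 2: "M_coeff T N c \<alpha> \<Phi> m n x = KM m n x"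
          unfolding M_coeff_def ex KM(3)[OF x, symmetric] set_lebesgue_integral_def[of _ "{0..T}"]
        proof (intro Bochner_Integration.integral_cong refl)
          fix t
          show "indicator {0..T} t *\<^sub>R (exp (-2 * t) * Psi T m t / c x (e x t) * (LINT t':{0..t}|lebesgue. \<alpha> x (t - t') * Psi T n t')) =
            indicator {0..T} t *\<^sub>R (exp (-2 * t) * Psi T m t * inverse (q x t) * I n x t)"
            using inner[OF ax, of t n] by (cases "t \<in> {0..T}") (auto simp: q_def divide_inverse)
        qed
        show "S_coeff T N c \<Phi> m n x + M_coeff T N c \<alpha> \<Phi> m n x = A m n x" by (simp add: 1 2 A_def)
      qed
    qed
  qed
qed

section \<open>Hausdorff measure\<close>

text \<open>The contribution of one set to a covering sum. The empty set costs nothing, even for \<open>n = 0\<close>, where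
\<open>diameter {} ^ 0 = 1\<close>.\<close>

definition cover_cost :: "nat \<Rightarrow> 'a::metric_space set \<Rightarrow> ennreal" where
  "cover_cost n C = (if C = {} then 0 else ennreal (diameter C ^ n))"

lemma hausdorff_pre_alt:
  "hausdorff_pre n \<delta> A = Inf {(\<Sum>i. cover_cost n (C i)) | C.
     A \<subseteq> (\<Union>i::nat. C i) \<and> (\<forall>i. bounded (C i) \<and> diameter (C i) \<le> \<delta>)}"
  unfolding hausdorff_pre_def cover_cost_def ..

lemma hausdorff_pre_le:
  assumes "A \<subseteq> (\<Union>i::nat. C i)" "\<And>i. bounded (C i)" "\<And>i. diameter (C i) \<le> \<delta>"
  shows "hausdorff_pre n \<delta> A \<le> (\<Sum>i. cover_cost n (C i))"
  unfolding hausdorff_pre_alt using assms by (intro Inf_lower) auto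

lemma hausdorff_pre_mono: "A \<subseteq> B \<Longrightarrow> hausdorff_pre n \<delta> A \<le> hausdorff_pre n \<delta> B"
  unfolding hausdorff_pre_alt by (intro Inf_superset_mono) auto

lemma hausdorff_pre_antimono: "\<delta> \<le> \<delta>' \<Longrightarrow> hausdorff_pre n \<delta>' A \<le> hausdorff_pre n \<delta> A"
  unfolding hausdorff_pre_alt by (intro Inf_superset_mono) (blast intro: order_trans)

lemma hausdorff_pre_empty: "\<delta> > 0 \<Longrightarrow> hausdorff_pre n \<delta> {} = 0"
  using hausdorff_pre_le[of "{}" "\<lambda>_. {}" \<delta> n] by (simp add: cover_cost_def diameter_def)

text \<open>Covers of the single sets that are optimal up to \<open>e * (1/2)\<^sup>i\<^sup>+\<^sup>1\<close> combine to a cover of the union.\<close>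

lemma hausdorff_pre_subadditive:
  "hausdorff_pre n \<delta> (\<Union>i::nat. A i) \<le> (\<Sum>i. hausdorff_pre n \<delta> (A i))"
proof (rule ennreal_le_epsilon)
  fix e :: real assume e: "0 < e" and fin: "(\<Sum>i. hausdorff_pre n \<delta> (A i)) < top"
  have "\<exists>C. A i \<subseteq> (\<Union>j::nat. C j) \<and> (\<forall>j. bounded (C j) \<and> diameter (C j) \<le> \<delta>) \<and>
      (\<Sum>j. cover_cost n (C j)) < hausdorff_pre n \<delta> (A i) + ennreal e * ennreal ((1/2)^Suc i)" for i
  proof -
    have "hausdorff_pre n \<delta> (A i) \<le> (\<Sum>i. hausdorff_pre n \<delta> (A i))"
      using sum_le_suminf[of "\<lambda>i. hausdorff_pre n \<delta> (A i)" "{i}"] by simp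
    then have f: "hausdorff_pre n \<delta> (A i) < top" using fin by simp
    have "ennreal e * ennreal ((1/2)^Suc i) \<noteq> 0" using e by simp
    then have "0 < ennreal e * ennreal ((1/2)^Suc i)" unfolding zero_less_iff_neq_zero .
    then have "hausdorff_pre n \<delta> (A i) + 0 < hausdorff_pre n \<delta> (A i) + ennreal e * ennreal ((1/2)^Suc i)"
      using f by (simp only: ennreal_add_left_cancel_less infinity_ennreal_def less_top[symmetric] simp_thms)
    then have "Inf {(\<Sum>j. cover_cost n (C j)) | C. A i \<subseteq> (\<Union>j::nat. C j) \<and> (\<forall>j. bounded (C j) \<and> diameter (C j) \<le> \<delta>)}
      < hausdorff_pre n \<delta> (A i) + ennreal e * ennreal ((1/2)^Suc i)" by (simp add: hausdorff_pre_alt)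
    then show ?thesis unfolding Inf_less_iff by blast
  qed
  then obtain C where C: "\<And>i. A i \<subseteq> (\<Union>j::nat. C i j)" "\<And>i j. bounded (C i j)" "\<And>i j. diameter (C i j) \<le> \<delta>"
    "\<And>i. (\<Sum>j. cover_cost n (C i j)) < hausdorff_pre n \<delta> (A i) + ennreal e * ennreal ((1/2)^Suc i)"
    by metis
  define D where "D k = C (fst (prod_decode k)) (snd (prod_decode k))" for k
  have "(\<Union>i. A i) \<subseteq> (\<Union>k. D k)"
  proof
    fix x assume "x \<in> (\<Union>i. A i)"
    then obtain i j where "x \<in> C i j" using C(1) by blast
    then have "x \<in> D (prod_encode (i, j))" by (simp add: D_def)
    then show "x \<in> (\<Union>k. D k)" by blast
  qed
  then have "hausdorff_pre n \<delta> (\<Union>i. A i) \<le> (\<Sum>k. cover_cost n (D k))"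
    by (rule hausdorff_pre_le) (auto simp: D_def C)
  also have "\<dots> = (\<Sum>i. \<Sum>j. cover_cost n (C i j))"
    using suminf_ennreal_2dimen[of "\<lambda>i. \<Sum>j. cover_cost n (C i j)" "\<lambda>p. cover_cost n (C (fst p) (snd p))"]
    by (simp add: D_def comp_def)
  also have "\<dots> \<le> (\<Sum>i. hausdorff_pre n \<delta> (A i) + ennreal e * ennreal ((1/2)^Suc i))"
    using C(4) by (intro suminf_le) (auto intro: less_imp_le)
  also have "\<dots> = (\<Sum>i. hausdorff_pre n \<delta> (A i)) + (\<Sum>i. ennreal e * ennreal ((1/2)^Suc i))"
    by (intro suminf_add[symmetric]) auto
  also have "(\<Sum>i. ennreal e * ennreal ((1/2)^Suc i)) = ennreal e"
  proof -
    have "(\<Sum>i. ennreal ((1/2)^Suc i)) = ennreal 1"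
      by (rule suminf_ennreal_eq[OF _ power_half_series]) simp
    then show ?thesis by (simp only: ennreal_suminf_cmult ennreal_1 mult_1_right)
  qed
  finally show "hausdorff_pre n \<delta> (\<Union>i. A i) \<le> (\<Sum>i. hausdorff_pre n \<delta> (A i)) + ennreal e" .
qed

text \<open>A set of diameter less than the distance of \<open>A\<close> and \<open>B\<close> meets at most one of them, so every cover of
the union splits into a cover of \<open>A\<close> and one of \<open>B\<close>.\<close>

lemma hausdorff_pre_separated:
  assumes sep: "\<And>a b. a \<in> A \<Longrightarrow> b \<in> B \<Longrightarrow> \<eta> \<le> dist a b" and "0 < \<delta>" "\<delta> < \<eta>"
  shows "hausdorff_pre n \<delta> A + hausdorff_pre n \<delta> B \<le> hausdorff_pre n \<delta> (A \<union> B)"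
  unfolding hausdorff_pre_alt[of n \<delta> "A \<union> B"]
proof (intro Inf_greatest, clarify)
  fix C :: "nat \<Rightarrow> 'a set"
  assume C: "A \<union> B \<subseteq> (\<Union>i. C i)" "\<forall>i. bounded (C i) \<and> diameter (C i) \<le> \<delta>"
  define CA where "CA i = (if C i \<inter> A = {} then {} else C i)" for i
  define CB where "CB i = (if C i \<inter> B = {} then {} else C i)" for i
  have d0: "diameter ({}::'a set) \<le> \<delta>" using assms by (simp add: diameter_def)
  have "hausdorff_pre n \<delta> A \<le> (\<Sum>i. cover_cost n (CA i))"
    using C d0 by (intro hausdorff_pre_le) (fastforce simp: CA_def)+
  moreover have "hausdorff_pre n \<delta> B \<le> (\<Sum>i. cover_cost n (CB i))"
    using C d0 by (intro hausdorff_pre_le) (fastforce simp: CB_def)+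
  ultimately have "hausdorff_pre n \<delta> A + hausdorff_pre n \<delta> B \<le> (\<Sum>i. cover_cost n (CA i)) + (\<Sum>i. cover_cost n (CB i))"
    by (rule add_mono)
  also have "\<dots> = (\<Sum>i. cover_cost n (CA i) + cover_cost n (CB i))" by (intro suminf_add) auto
  also have "\<dots> \<le> (\<Sum>i. cover_cost n (C i))"
  proof (intro suminf_le allI)
    fix i
    have "C i \<inter> A = {} \<or> C i \<inter> B = {}"
    proof (rule ccontr)
      assume "\<not> ?thesis"
      then obtain a b where ab: "a \<in> C i" "a \<in> A" "b \<in> C i" "b \<in> B" by blast
      then have "dist a b \<le> diameter (C i)" using C(2) by (intro diameter_bounded_bound) auto
      then show False using sep[OF ab(2,4)] C(2) assms(3) by (meson less_le_not_le order_trans)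
    qed
    then show "cover_cost n (CA i) + cover_cost n (CB i) \<le> cover_cost n (C i)"
      by (auto simp: CA_def CB_def cover_cost_def)
  qed auto
  finally show "hausdorff_pre n \<delta> A + hausdorff_pre n \<delta> B \<le> (\<Sum>i. cover_cost n (C i))" .
qed

text \<open>The supremum over all \<open>\<delta>\<close> is that of an increasing sequence; for such sequences suprema commute with
sums. Starting below \<open>\<eta>\<close> makes \<open>hausdorff_pre_separated\<close> applicable to every member.\<close>

lemma hausdorff_SUP_seq:
  assumes "\<eta> > 0"
  shows "(SUP \<delta>\<in>{0<..}. hausdorff_pre n \<delta> A) = (SUP i. hausdorff_pre n (\<eta> / real (Suc i)) A)"
proof (rule antisym)
  show "(SUP \<delta>\<in>{0<..}. hausdorff_pre n \<delta> A) \<le> (SUP i. hausdorff_pre n (\<eta> / real (Suc i)) A)"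
  proof (rule SUP_least)
    fix \<delta> :: real assume "\<delta> \<in> {0<..}"
    then have "\<delta> / \<eta> > 0" using assms by simp
    then obtain i where "inverse (real (Suc i)) < \<delta> / \<eta>" using reals_Archimedean by blast
    then have "\<eta> / real (Suc i) \<le> \<delta>" using assms by (simp add: field_simps)
    from hausdorff_pre_antimono[OF this]
    show "hausdorff_pre n \<delta> A \<le> (SUP i. hausdorff_pre n (\<eta> / real (Suc i)) A)"
      by (intro SUP_upper2[of i]) auto
  qed
  show "(SUP i. hausdorff_pre n (\<eta> / real (Suc i)) A) \<le> (SUP \<delta>\<in>{0<..}. hausdorff_pre n \<delta> A)"
    using assms by (intro SUP_least SUP_upper) auto
qed

lemma hausdorff_outer_separated:
  assumes sep: "\<And>a b. a \<in> A \<Longrightarrow> b \<in> B \<Longrightarrow> \<eta> \<le> dist a b" and "0 < \<eta>"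
  shows "hausdorff_outer n A + hausdorff_outer n B \<le> hausdorff_outer n (A \<union> B)"
proof -
  let ?P = "\<lambda>A i. hausdorff_pre n (\<eta> / 2 / real (Suc i)) A"
  have mono: "incseq (?P A)" for A
    using assms(2) by (intro incseq_SucI hausdorff_pre_antimono) (simp add: frac_le)
  have "(SUP i. ?P A i) + (SUP i. ?P B i) = (SUP i. ?P A i + ?P B i)"
    by (intro ennreal_SUP_add[symmetric] mono)
  also have "\<dots> \<le> (SUP i. ?P (A \<union> B) i)"
  proof (intro SUP_mono' hausdorff_pre_separated sep)
    fix i
    have "\<eta> / 2 / real (Suc i) \<le> \<eta> / 2 / 1" using assms(2) by (intro divide_left_mono) auto
    then show "\<eta> / 2 / real (Suc i) < \<eta>" by (rule le_less_trans) (use assms(2) in simp)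
  qed (use assms in auto)
  finally show ?thesis
    unfolding hausdorff_outer_def using assms(2)
    by (simp only: hausdorff_SUP_seq[of "\<eta>/2" n] half_gt_zero distrib_left[symmetric]) (intro mult_left_mono; simp)
qed

lemma outer_measure_space_hausdorff:
  "outer_measure_space (Pow UNIV) (hausdorff_outer n :: 'a::metric_space set \<Rightarrow> ennreal)"
  unfolding outer_measure_space_def
proof (intro conjI)
  show "positive (Pow UNIV) (hausdorff_outer n :: 'a set \<Rightarrow> ennreal)"
    by (simp add: positive_def hausdorff_outer_def hausdorff_pre_empty cong: SUP_cong_simp)
  show "increasing (Pow UNIV) (hausdorff_outer n :: 'a set \<Rightarrow> ennreal)"
    unfolding increasing_def hausdorff_outer_def
    by (auto intro!: mult_left_mono SUP_mono' hausdorff_pre_mono)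
  show "countably_subadditive (Pow UNIV) (hausdorff_outer n :: 'a set \<Rightarrow> ennreal)"
    unfolding countably_subadditive_def
  proof (intro allI impI)
    fix A :: "nat \<Rightarrow> 'a set"
    let ?S = "\<lambda>A. SUP \<delta>\<in>{0<..}. hausdorff_pre n \<delta> A"
    have "?S (\<Union>i. A i) \<le> (\<Sum>i. ?S (A i))"
    proof (rule SUP_least)
      fix \<delta> :: real assume d: "\<delta> \<in> {0<..}"
      have "hausdorff_pre n \<delta> (\<Union>i. A i) \<le> (\<Sum>i. hausdorff_pre n \<delta> (A i))" by (rule hausdorff_pre_subadditive)
      also have "\<dots> \<le> (\<Sum>i. ?S (A i))" using d by (intro suminf_le SUP_upper) auto
      finally show "hausdorff_pre n \<delta> (\<Union>i. A i) \<le> (\<Sum>i. ?S (A i))" .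
    qed
    then show "hausdorff_outer n (\<Union>i. A i) \<le> (\<Sum>i. hausdorff_outer n (A i))"
      unfolding hausdorff_outer_def ennreal_suminf_cmult by (intro mult_left_mono) auto
  qed
qed

lemma outer_measure_space_facts:
  assumes "outer_measure_space (Pow UNIV) f"
  shows "f {} = 0" "A \<subseteq> B \<Longrightarrow> f A \<le> f B" "f (\<Union>i::nat. S i) \<le> (\<Sum>i. f (S i))" "f (A \<union> B) \<le> f A + f B"
proof -
  show e: "f {} = 0" and m: "\<And>A B. A \<subseteq> B \<Longrightarrow> f A \<le> f B"
    using assms by (auto simp: outer_measure_space_def positive_def increasing_def)
  have cs: "\<And>A. disjoint_family A \<Longrightarrow> f (\<Union>i::nat. A i) \<le> (\<Sum>i. f (A i))"
    using assms by (auto simp: outer_measure_space_def countably_subadditive_def)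
  show S: "f (\<Union>i::nat. S i) \<le> (\<Sum>i. f (S i))" for S
  proof -
    have "f (\<Union>i. S i) = f (\<Union>i. disjointed S i)" by (simp add: UN_disjointed_eq)
    also have "\<dots> \<le> (\<Sum>i. f (disjointed S i))" by (intro cs disjoint_family_disjointed)
    also have "\<dots> \<le> (\<Sum>i. f (S i))" by (intro suminf_le m disjointed_subset) auto
    finally show ?thesis .
  qed
  have "f (\<Union>i. binaryset A B i) \<le> (\<Sum>i. f (binaryset A B i))" by (rule S)
  also have "\<dots> = f A + f B" by (rule suminf_binaryset_eq[of f, OF e])
  finally show "f (A \<union> B) \<le> f A + f B" by (simp add: UN_binaryset_eq)
qed

text \<open>Caratheodory's criterion. An outer measure that is additive on sets at positive distance measures
closed sets: \<open>X - F\<close> is exhausted by the sets \<open>E n\<close> of points at distance at least \<open>1 / (n + 1)\<close> from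
\<open>F\<close>, on which additivity holds. The missing parts \<open>R k\<close> are shells around \<open>F\<close>; shells with indices of the same
parity are separated, so the measures of all shells sum up to at most \<open>2 * f X\<close> and the tail of this
series is small.\<close>

lemma metric_outer_measure_closed:
  fixes f :: "'a::metric_space set \<Rightarrow> ennreal"
  assumes om: "outer_measure_space (Pow UNIV) f"
    and sep: "\<And>A B \<eta>. 0 < \<eta> \<Longrightarrow> (\<And>a b. a \<in> A \<Longrightarrow> b \<in> B \<Longrightarrow> \<eta> \<le> dist a b) \<Longrightarrow> f A + f B \<le> f (A \<union> B)"
    and F: "closed F"
  shows "F \<in> lambda_system UNIV (Pow UNIV) f"
proof -
  note f = outer_measure_space_facts[OF om]
  have main: "f (F \<inter> X) + f (X - F) \<le> f X" if fin: "f X < top" and ne: "F \<noteq> {}" for X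
  proof -
    define g where "g x = infdist x F" for x
    define R where "R k = {x\<in>X. 1 / real (k + 2) \<le> g x \<and> g x < 1 / real (k + 1)}" for k
    define E where "E n = {x\<in>X. 1 / real (n + 1) \<le> g x}" for n
    have gl: "g x \<le> g y + dist x y" for x y unfolding g_def by (rule infdist_triangle)
    \<comment> \<open>\<open>p = 0\<close> and \<open>p = 1\<close> give the shells of even and of odd index\<close>
    have half: "(\<Sum>j<m. f (R (2 * j + p))) \<le> f (\<Union>j<m. R (2 * j + p))" for m p
    proof (induction m)
      case (Suc m)
      have "f (\<Union>j<m. R (2 * j + p)) + f (R (2 * m + p)) \<le> f ((\<Union>j<m. R (2 * j + p)) \<union> R (2 * m + p))"
      proof (cases "m = 0")
        case False
        have pos: "1 / real (2 * m + p) - 1 / real (2 * m + p + 1) > 0" using False frac_less2[of 1 1 "real (2 * m + p)" "real (2 * m + p + 1)"] by simp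
        show ?thesis
        proof (rule sep[OF pos])
          fix a b assume "a \<in> (\<Union>j<m. R (2 * j + p))" and b: "b \<in> R (2 * m + p)"
          then obtain j where j: "j < m" "a \<in> R (2 * j + p)" by auto
          have "1 / real (2 * m + p) \<le> 1 / real (2 * j + p + 2)" using j by (intro frac_le) auto
          then have "1 / real (2 * m + p) \<le> g a" using j(2) unfolding R_def by auto
          moreover have "g b < 1 / real (2 * m + p + 1)" using b unfolding R_def by auto
          ultimately show "1 / real (2 * m + p) - 1 / real (2 * m + p + 1) \<le> dist a b" using gl[of a b] by linarith
        qed
      qed (simp add: f)
      also have "(\<Union>j<m. R (2 * j + p)) \<union> R (2 * m + p) = (\<Union>j<Suc m. R (2 * j + p))"
        by (auto simp: less_Suc_eq)
      finally show ?case using Suc by (auto intro: order_trans add_right_mono)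
    qed (simp add: f)
    have RX: "f (\<Union>j<m. R (2 * j + p)) \<le> f X" for m p by (intro f(2)) (auto simp: R_def)
    have part: "(\<Sum>k<m. f (R k)) \<le> 2 * f X" for m
    proof -
      have "(\<Sum>k<m. f (R k)) \<le> (\<Sum>k<2*m. f (R k))" by (intro sum_mono2) auto
      also have "\<dots> = (\<Sum>j<m. f (R (2 * j + 0))) + (\<Sum>j<m. f (R (2 * j + 1)))"
        by (induction m) (auto simp: algebra_simps)
      also have "\<dots> \<le> f X + f X" using half RX by (intro add_mono) (blast intro: order_trans)+
      finally show ?thesis by (simp add: mult_2)
    qed
    have sumf: "(\<Sum>k. f (R k)) \<le> 2 * f X" by (intro suminf_le_const) (auto intro: part)
    have twofin: "2 * f X < top" using fin by (simp add: ennreal_mult_less_top)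
    define r where "r k = enn2real (f (R k))" for k
    have fr: "f (R k) = ennreal (r k)" for k
    proof -
      have "f (R k) \<le> f X" by (intro f(2)) (auto simp: R_def)
      then show ?thesis unfolding r_def using fin by (simp add: le_less_trans)
    qed
    have r0: "r k \<ge> 0" for k by (simp add: r_def)
    have "summable r"
    proof (rule summable_suminf_not_top)
      show "(\<Sum>k. ennreal (r k)) \<noteq> top" unfolding fr[symmetric] using sumf twofin by (auto simp: top_unique)
    qed (rule r0)
    show ?thesis
    proof (rule ennreal_le_epsilon)
      fix e :: real assume e: "0 < e"
      obtain n where n: "norm (\<Sum>k. r (k + n)) < e"
        using suminf_exist_split[OF e \<open>summable r\<close>] by blast
      have tail: "(\<Sum>k. f (R (k + n))) \<le> ennreal e"
        unfolding fr using r0 n \<open>summable r\<close>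
        by (subst suminf_ennreal2) (auto simp: summable_iff_shift intro!: ennreal_leI)
      have "X - F \<subseteq> E n \<union> (\<Union>k. R (k + n))"
      proof
        fix x assume x: "x \<in> X - F"
        then have g0: "g x > 0" unfolding g_def using F ne
          by (metis DiffD2 in_closed_iff_infdist_zero infdist_nonneg less_eq_real_def)
        show "x \<in> E n \<union> (\<Union>k. R (k + n))"
        proof (cases "x \<in> E n")
          case False
          then have gn: "g x < 1 / real (n + 1)" using x by (auto simp: E_def)
          obtain m where m: "inverse (real (Suc m)) < g x" using reals_Archimedean[OF g0] by blast
          \<comment> \<open>the shell of \<open>x\<close> is found from the first threshold that its distance reaches\<close>
          define l where "l = (LEAST l. 1 / real (l + 1) \<le> g x)"
          have ex: "1 / real (m + 1) \<le> g x" using m by (simp add: inverse_eq_divide add.commute)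
          have l: "1 / real (l + 1) \<le> g x" unfolding l_def by (rule LeastI[of "\<lambda>l. 1 / real (l + 1) \<le> g x" m, OF ex])
          have ln: "n < l"
          proof (rule ccontr)
            assume "\<not> n < l"
            then have "1 / real (n + 1) \<le> 1 / real (l + 1)" by (intro frac_le) auto
            then show False using l gn by linarith
          qed
          have "\<not> 1 / real ((l - 1) + 1) \<le> g x"
            using not_less_Least[of "l - 1" "\<lambda>l. 1 / real (l + 1) \<le> g x"] ln unfolding l_def[symmetric] by auto
          then have "x \<in> R (l - 1)" using ln l x unfolding R_def by (auto simp: algebra_simps)
          moreover have "l - 1 = (l - 1 - n) + n" using ln by simp
          ultimately show ?thesis by (metis UNIV_I UN_I UnI2)
        qed simp
      qed
      then have "f (X - F) \<le> f (E n \<union> (\<Union>k. R (k + n)))" by (rule f(2))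
      also have "\<dots> \<le> f (E n) + f (\<Union>k. R (k + n))" by (rule f(4))
      also have "\<dots> \<le> f (E n) + (\<Sum>k. f (R (k + n)))" by (intro add_left_mono f(3))
      also have "\<dots> \<le> f (E n) + ennreal e" by (intro add_left_mono tail)
      finally have 1: "f (F \<inter> X) + f (X - F) \<le> f (F \<inter> X) + f (E n) + ennreal e"
        by (simp add: add_left_mono add.assoc)
      have "f (F \<inter> X) + f (E n) \<le> f ((F \<inter> X) \<union> E n)"
      proof (rule sep[of "1 / real (n + 1)"])
        fix a b assume a: "a \<in> F \<inter> X" and b: "b \<in> E n"
        have "g b \<le> dist b a" unfolding g_def using a by (intro infdist_le) auto
        then show "1 / real (n + 1) \<le> dist a b" using b by (auto simp: E_def dist_commute)
      qed simp
      also have "\<dots> \<le> f X" by (intro f(2)) (auto simp: E_def)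
      finally show "f (F \<inter> X) + f (X - F) \<le> f X + ennreal e"
        using 1 by (meson add_right_mono order_trans)
    qed
  qed
  have "f (F \<inter> X) + f ((UNIV - F) \<inter> X) = f X" for X
  proof (rule antisym)
    have eq: "(UNIV - F) \<inter> X = X - F" by auto
    show "f (F \<inter> X) + f ((UNIV - F) \<inter> X) \<le> f X"
      unfolding eq
    proof (cases "F = {} \<or> f X = top")
      case True then show "f (F \<inter> X) + f (X - F) \<le> f X" by (auto simp: f)
    next
      case False then show "f (F \<inter> X) + f (X - F) \<le> f X" using main by (simp add: top.not_eq_extremum)
    qed
    have "f X = f ((F \<inter> X) \<union> ((UNIV - F) \<inter> X))" by (intro arg_cong[where f=f]) auto
    also have "\<dots> \<le> f (F \<inter> X) + f ((UNIV - F) \<inter> X)" by (rule f(4))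
    finally show "f X \<le> f (F \<inter> X) + f ((UNIV - F) \<inter> X)" .
  qed
  then show ?thesis by (auto simp: lambda_system_def)
qed

lemma measure_space_lambda_hausdorff:
  "measure_space UNIV (lambda_system UNIV (Pow UNIV) (hausdorff_outer n)) (hausdorff_outer n :: 'a::metric_space set \<Rightarrow> ennreal)"
proof -
  interpret sigma_algebra UNIV "Pow UNIV :: 'a set set" by (rule sigma_algebra_Pow)
  show ?thesis by (rule caratheodory_lemma[OF outer_measure_space_hausdorff])
qed

lemma space_surface_measure [simp]: "space surface_measure = UNIV"
  unfolding surface_measure_def by (simp add: space_measure_of_conv)

lemma sets_surface_measure:
  "sets (surface_measure :: 'a::euclidean_space measure) = lambda_system UNIV (Pow UNIV) (hausdorff_outer (DIM('a) - 1))"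
proof -
  have "sigma_algebra UNIV (lambda_system UNIV (Pow UNIV) (hausdorff_outer (DIM('a) - 1) :: 'a set \<Rightarrow> ennreal))"
    using measure_space_lambda_hausdorff by (auto simp: measure_space_def)
  then show ?thesis unfolding surface_measure_def by (rule sigma_algebra.sets_measure_of_eq)
qed

lemma emeasure_surface_measure:
  assumes "A \<in> sets (surface_measure :: 'a::euclidean_space measure)"
  shows "emeasure (surface_measure :: 'a measure) A = hausdorff_outer (DIM('a) - 1) A"
proof -
  have "measure_space UNIV (lambda_system UNIV (Pow UNIV) (hausdorff_outer (DIM('a) - 1))) (hausdorff_outer (DIM('a) - 1) :: 'a set \<Rightarrow> ennreal)"
    by (rule measure_space_lambda_hausdorff)
  moreover have "A \<in> lambda_system UNIV (Pow UNIV) (hausdorff_outer (DIM('a) - 1))"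
    using assms by (simp only: sets_surface_measure)
  ultimately show ?thesis unfolding surface_measure_def measure_space_def
    by (intro emeasure_measure_of_sigma; simp only: simp_thms)
qed

lemma borel_subset_surface_measure:
  "sets borel \<subseteq> sets (surface_measure :: 'a::euclidean_space measure)"
proof -
  have "sets (borel :: 'a measure) = sigma_sets UNIV (Collect closed)"
    by (simp add: borel_eq_closed)
  also have "\<dots> \<subseteq> sets (surface_measure :: 'a measure)"
  proof -
    have "Collect closed \<subseteq> sets (surface_measure :: 'a measure)"
    proof
      fix F :: "'a set" assume "F \<in> Collect closed"
      then show "F \<in> sets surface_measure" unfolding sets_surface_measure
        by (intro metric_outer_measure_closed[OF outer_measure_space_hausdorff hausdorff_outer_separated]; simp)
    qed
    then have "sigma_sets (space surface_measure) (Collect closed) \<subseteq> sets (surface_measure :: 'a measure)"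
      by (rule sets.sigma_sets_subset)
    then show ?thesis by simp
  qed
  finally show ?thesis .
qed

lemma borel_measurable_surface_measure:
  "f \<in> borel_measurable borel \<Longrightarrow> f \<in> borel_measurable (surface_measure :: 'a::euclidean_space measure)"
  using borel_subset_surface_measure by (auto simp: measurable_def)

lemma complete_surface_measure: "complete_measure (surface_measure :: 'a::euclidean_space measure)"
proof
  fix A B :: "'a set"
  assume B: "B \<subseteq> A" and A: "A \<in> null_sets surface_measure"
  let ?f = "hausdorff_outer (DIM('a) - 1) :: 'a set \<Rightarrow> ennreal"
  note f = outer_measure_space_facts[OF outer_measure_space_hausdorff[where n="DIM('a) - 1" and 'a='a]]
  have "?f A = 0" using A by (auto simp: null_sets_def emeasure_surface_measure)
  then have B0: "?f (B \<inter> X) = 0" for X using f(2)[of "B \<inter> X" A] B by auto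
  have "?f (B \<inter> X) + ?f ((UNIV - B) \<inter> X) = ?f X" for X
  proof (rule antisym)
    show "?f (B \<inter> X) + ?f ((UNIV - B) \<inter> X) \<le> ?f X" unfolding B0 add_0 by (rule f(2)) auto
    have "?f X = ?f ((B \<inter> X) \<union> ((UNIV - B) \<inter> X))" by (intro arg_cong[where f="?f"]) auto
    also have "\<dots> \<le> ?f (B \<inter> X) + ?f ((UNIV - B) \<inter> X)" by (rule f(4))
    finally show "?f X \<le> ?f (B \<inter> X) + ?f ((UNIV - B) \<inter> X)" .
  qed
  then show "B \<in> sets surface_measure" by (auto simp: sets_surface_measure lambda_system_def)
qed

text \<open>Each ball of radius \<open>\<delta>\<close> has diameter at most \<open>2 * \<delta>\<close>, so the covering sums are at most \<open>2\<^sup>n * K\<close>,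
uniformly in \<open>\<delta>\<close>.\<close>

lemma hausdorff_outer_finite:
  fixes A :: "'a::euclidean_space set"
  assumes cov: "\<And>\<delta>. 0 < \<delta> \<Longrightarrow> \<delta> \<le> \<delta>0 \<Longrightarrow> \<exists>P. finite P \<and> A \<subseteq> (\<Union>p\<in>P. cball p \<delta>) \<and> real (card P) * \<delta> ^ n \<le> K"
    and d0: "\<delta>0 > 0"
  shows "hausdorff_outer n A < top"
proof -
  have pre: "hausdorff_pre n (2 * \<delta>) A \<le> ennreal (2 ^ n * K)" if \<delta>: "0 < \<delta>" "\<delta> \<le> \<delta>0" for \<delta>
  proof -
    obtain P where P: "finite P" "A \<subseteq> (\<Union>p\<in>P. cball p \<delta>)" "real (card P) * \<delta> ^ n \<le> K"
      using cov[OF \<delta>] by blast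
    obtain b where b: "bij_betw b {0..<card P} P" using ex_bij_betw_nat_finite[OF P(1)] by blast
    define C where "C i = (if i < card P then cball (b i) \<delta> else {})" for i
    have bd1: "bounded (C i)" for i by (simp add: C_def)
    have bd2: "diameter (C i) \<le> 2 * \<delta>" for i
      using \<delta> by (cases "i < card P") (simp_all add: C_def diameter_cball)
    have cc: "cover_cost n (C i) \<le> ennreal ((2 * \<delta>) ^ n)" for i
    proof (cases "C i = {}")
      case False
      have "diameter (C i) ^ n \<le> (2 * \<delta>) ^ n" by (intro power_mono bd2 diameter_ge_0 bd1)
      from ennreal_leI[OF this] show ?thesis using False by (simp only: cover_cost_def if_False)
    qed (simp add: cover_cost_def)
    have "A \<subseteq> (\<Union>i. C i)"
    proof
      fix x assume "x \<in> A"
      then obtain p where p: "p \<in> P" "x \<in> cball p \<delta>" using P(2) by blast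
      then obtain i where "i < card P" "b i = p" using b unfolding bij_betw_def by force
      then show "x \<in> (\<Union>i. C i)" using p by (auto simp: C_def intro!: exI[of _ i])
    qed
    then have "hausdorff_pre n (2 * \<delta>) A \<le> (\<Sum>i. cover_cost n (C i))"
      using bd1 bd2 by (intro hausdorff_pre_le) auto
    also have "\<dots> = (\<Sum>i<card P. cover_cost n (C i))"
      by (intro suminf_finite) (auto simp: C_def cover_cost_def)
    also have "\<dots> \<le> (\<Sum>i<card P. ennreal ((2 * \<delta>) ^ n))"
      by (intro sum_mono cc)
    also have "\<dots> = ennreal (real (card P) * (2 * \<delta>) ^ n)"
      using \<delta> by (simp add: ennreal_mult ennreal_of_nat_eq_real_of_nat)
    also have "\<dots> = ennreal (2 ^ n * (real (card P) * \<delta> ^ n))" by (simp add: power_mult_distrib mult_ac)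
    also have "\<dots> \<le> ennreal (2 ^ n * K)" using P(3) by (intro ennreal_leI mult_left_mono) auto
    finally show ?thesis .
  qed
  have "(SUP \<delta>\<in>{0<..}. hausdorff_pre n \<delta> A) \<le> ennreal (2 ^ n * K)"
  proof (rule SUP_least)
    fix \<delta> :: real assume "\<delta> \<in> {0<..}"
    then have "hausdorff_pre n \<delta> A \<le> hausdorff_pre n (2 * min (\<delta> / 2) \<delta>0) A" by (intro hausdorff_pre_antimono) auto
    also have "\<dots> \<le> ennreal (2 ^ n * K)" using \<open>\<delta> \<in> {0<..}\<close> d0 by (intro pre) auto
    finally show "hausdorff_pre n \<delta> A \<le> ennreal (2 ^ n * K)" .
  qed
  then have "(SUP \<delta>\<in>{0<..}. hausdorff_pre n \<delta> A) < top" by (simp add: le_less_trans)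
  then show ?thesis unfolding hausdorff_outer_def by (simp add: ennreal_mult_less_top)
qed

section \<open>The boundary of a smooth domain\<close>

text \<open>The local defining function of a chart: it increases with unit speed in the direction \<open>e\<close>, is
negative inside the domain, and vanishes on its boundary.\<close>

definition chart_fun :: "'a::euclidean_space \<Rightarrow> ('a \<Rightarrow> real) \<Rightarrow> 'a \<Rightarrow> real" where
  "chart_fun e \<gamma> x = x \<bullet> e - \<gamma> (x - (x \<bullet> e) *\<^sub>R e)"

lemma linear_Basis_expand:
  fixes f :: "'a::euclidean_space \<Rightarrow> 'b::real_vector"
  assumes "linear f" shows "f v = (\<Sum>b\<in>Basis. (v \<bullet> b) *\<^sub>R f b)"
proof -
  have "f v = f (\<Sum>b\<in>Basis. (v \<bullet> b) *\<^sub>R b)" by (simp add: euclidean_representation)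
  also have "\<dots> = (\<Sum>b\<in>Basis. (v \<bullet> b) *\<^sub>R f b)" using assms by (simp add: linear_sum linear_scale)
  finally show ?thesis .
qed

lemma continuous_on_frechet_derivative:
  fixes \<gamma> :: "'a::euclidean_space \<Rightarrow> real"
  assumes "smooth \<gamma>"
  shows "continuous_on UNIV (\<lambda>x. frechet_derivative \<gamma> (at x) v)"
proof -
  have "linear (frechet_derivative \<gamma> (at x))" for x
    using smooth_derivative(1)[OF assms] has_derivative_linear by blast
  then have eq: "(\<lambda>x. frechet_derivative \<gamma> (at x) v) = (\<lambda>x. \<Sum>b\<in>Basis. (v \<bullet> b) *\<^sub>R frechet_derivative \<gamma> (at x) b)"
    using linear_Basis_expand by blast
  show ?thesis unfolding eq by (intro continuous_intros smooth_derivative(2)[OF assms])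
qed

context
  fixes e :: "'a::euclidean_space" and \<gamma> :: "'a \<Rightarrow> real"
  assumes e: "norm e = 1" and \<gamma>: "smooth \<gamma>"
begin

lemma chart_fun_derivative:
  "(chart_fun e \<gamma> has_derivative (\<lambda>h. h \<bullet> e - frechet_derivative \<gamma> (at (x - (x \<bullet> e) *\<^sub>R e)) (h - (h \<bullet> e) *\<^sub>R e))) (at x)"
proof -
  have 1: "(\<gamma> has_derivative frechet_derivative \<gamma> (at (x - (x \<bullet> e) *\<^sub>R e))) (at (x - (x \<bullet> e) *\<^sub>R e))"
    using smooth_derivative(1)[OF \<gamma>] by blast
  have 2: "((\<lambda>x. x - (x \<bullet> e) *\<^sub>R e) has_derivative (\<lambda>h. h - (h \<bullet> e) *\<^sub>R e)) (at x)"
    by (auto intro!: derivative_eq_intros)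
  have "((\<lambda>x. x \<bullet> e - \<gamma> (x - (x \<bullet> e) *\<^sub>R e)) has_derivative (\<lambda>h. h \<bullet> e - frechet_derivative \<gamma> (at (x - (x \<bullet> e) *\<^sub>R e)) (h - (h \<bullet> e) *\<^sub>R e))) (at x)"
    by (intro has_derivative_diff has_derivative_inner_left has_derivative_ident has_derivative_compose[OF 2 1])
  then show ?thesis by (simp add: chart_fun_def[abs_def])
qed

lemma chart_fun_frechet:
  "frechet_derivative (chart_fun e \<gamma>) (at x) = (\<lambda>h. h \<bullet> e - frechet_derivative \<gamma> (at (x - (x \<bullet> e) *\<^sub>R e)) (h - (h \<bullet> e) *\<^sub>R e))"
  using frechet_derivative_at[OF chart_fun_derivative] by simp

lemma chart_fun_derivative_grad:
  "(chart_fun e \<gamma> has_derivative (\<lambda>h. h \<bullet> grad (chart_fun e \<gamma>) x)) (at x)"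
proof -
  have d: "(chart_fun e \<gamma> has_derivative frechet_derivative (chart_fun e \<gamma>) (at x)) (at x)"
    using chart_fun_derivative unfolding chart_fun_frechet .
  have "frechet_derivative (chart_fun e \<gamma>) (at x) = (\<lambda>h. h \<bullet> grad (chart_fun e \<gamma>) x)"
  proof
    fix h
    show "frechet_derivative (chart_fun e \<gamma>) (at x) h = h \<bullet> grad (chart_fun e \<gamma>) x"
      unfolding grad_def inner_sum_right
      by (subst linear_Basis_expand[OF has_derivative_linear[OF d]]) (simp add: mult.commute)
  qed
  with d show ?thesis by simp
qed

lemma chart_fun_translate: "chart_fun e \<gamma> (x + t *\<^sub>R e) = chart_fun e \<gamma> x + t"
proof -
  have "e \<bullet> e = 1" using e by (simp add: dot_square_norm)
  then have proj: "(x + t *\<^sub>R e) - ((x + t *\<^sub>R e) \<bullet> e) *\<^sub>R e = x - (x \<bullet> e) *\<^sub>R e"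
    by (simp add: algebra_simps)
  show ?thesis unfolding chart_fun_def proj using \<open>e \<bullet> e = 1\<close> by (simp add: inner_add_left)
qed

text \<open>In particular the gradient never vanishes.\<close>

lemma grad_chart_fun_dir: "e \<bullet> grad (chart_fun e \<gamma>) x = 1"
proof -
  have "e \<bullet> e = 1" using e by (simp add: dot_square_norm)
  have "e \<bullet> grad (chart_fun e \<gamma>) x = frechet_derivative (chart_fun e \<gamma>) (at x) e"
    using frechet_derivative_at[OF chart_fun_derivative_grad, of x] by metis
  also have "\<dots> = 1 - frechet_derivative \<gamma> (at (x - (x \<bullet> e) *\<^sub>R e)) 0"
    unfolding chart_fun_frechet using \<open>e \<bullet> e = 1\<close> by simp
  also have "frechet_derivative \<gamma> (at (x - (x \<bullet> e) *\<^sub>R e)) 0 = 0"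
    using smooth_derivative(1)[OF \<gamma>] has_derivative_linear linear_0 by blast
  finally show ?thesis by simp
qed

lemma continuous_on_chart_fun: "continuous_on S (chart_fun e \<gamma>)"
  by (intro continuous_at_imp_continuous_on ballI has_derivative_continuous[OF chart_fun_derivative])

lemma continuous_on_grad_chart_fun: "continuous_on S (grad (chart_fun e \<gamma>))"
proof -
  have "continuous_on S (\<lambda>x. frechet_derivative \<gamma> (at (x - (x \<bullet> e) *\<^sub>R e)) v)" for v
    by (rule continuous_on_compose2[OF continuous_on_frechet_derivative[OF \<gamma>]]) (auto intro!: continuous_intros)
  note this[continuous_intros]
  show ?thesis unfolding grad_def[abs_def] chart_fun_frechet by (intro continuous_intros)
qed

lemma chart_fun_lipschitz:
  assumes "bounded S" "convex S"
  obtains L where "L > 0" "\<And>x y. x \<in> S \<Longrightarrow> y \<in> S \<Longrightarrow> \<bar>chart_fun e \<gamma> x - chart_fun e \<gamma> y\<bar> \<le> L * norm (x - y)"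
proof -
  have "compact (grad (chart_fun e \<gamma>) ` closure S)"
    using assms by (intro compact_continuous_image continuous_on_grad_chart_fun) (simp add: compact_closure)
  then have "bounded (grad (chart_fun e \<gamma>) ` closure S)" by (rule compact_imp_bounded)
  then obtain B where "\<forall>y\<in>grad (chart_fun e \<gamma>) ` closure S. norm y \<le> B" unfolding bounded_iff by blast
  then have B: "norm (grad (chart_fun e \<gamma>) x) \<le> B" if "x \<in> S" for x using that closure_subset by blast
  have "norm (chart_fun e \<gamma> x - chart_fun e \<gamma> y) \<le> (\<bar>B\<bar> + 1) * norm (x - y)" if "x \<in> S" "y \<in> S" for x y
  proof (rule differentiable_bound[OF assms(2)])
    show "(chart_fun e \<gamma> has_derivative (\<lambda>h. h \<bullet> grad (chart_fun e \<gamma>) x)) (at x within S)" for x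
      using chart_fun_derivative_grad by (rule has_derivative_at_withinI)
    show "onorm (\<lambda>h. h \<bullet> grad (chart_fun e \<gamma>) x) \<le> \<bar>B\<bar> + 1" if "x \<in> S" for x
    proof (rule onorm_le)
      fix h
      have "norm (h \<bullet> grad (chart_fun e \<gamma>) x) \<le> norm h * norm (grad (chart_fun e \<gamma>) x)"
        by (simp add: Cauchy_Schwarz_ineq2)
      also have "\<dots> \<le> norm h * (\<bar>B\<bar> + 1)" using B[OF that] by (intro mult_left_mono) auto
      finally show "norm (h \<bullet> grad (chart_fun e \<gamma>) x) \<le> (\<bar>B\<bar> + 1) * norm h" by (simp add: mult.commute)
    qed
  qed (use that in auto)
  then show thesis using that[of "\<bar>B\<bar> + 1"] by (simp add: real_norm_def)
qed

end

lemma graph_chart_iff: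
  "graph_chart \<Omega> p r e \<gamma> \<longleftrightarrow> r > 0 \<and> norm e = 1 \<and> smooth \<gamma> \<and> (\<forall>x\<in>ball p r. x \<in> \<Omega> \<longleftrightarrow> chart_fun e \<gamma> x < 0)"
  unfolding graph_chart_def chart_fun_def by simp

lemma frontier_chart_fun_0:
  assumes c: "graph_chart \<Omega> p r e \<gamma>" and q: "q \<in> frontier \<Omega>" "q \<in> ball p r" and op: "open \<Omega>"
  shows "chart_fun e \<gamma> q = 0"
proof -
  have e: "norm e = 1" and g: "smooth \<gamma>" and iff: "\<And>x. x \<in> ball p r \<Longrightarrow> x \<in> \<Omega> \<longleftrightarrow> chart_fun e \<gamma> x < 0"
    using c by (auto simp: graph_chart_iff)
  have nq: "q \<notin> \<Omega>" using q op by (simp add: frontier_def interior_open)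
  then have "chart_fun e \<gamma> q \<ge> 0" using iff[OF q(2)] by simp
  moreover have "\<not> chart_fun e \<gamma> q > 0"
  proof
    assume pos: "chart_fun e \<gamma> q > 0"
    have "open ({x. chart_fun e \<gamma> x > 0} \<inter> ball p r)"
      using continuous_on_chart_fun[OF e g, of UNIV] by (intro open_Int open_Collect_less) auto
    moreover have "q \<in> {x. chart_fun e \<gamma> x > 0} \<inter> ball p r" using pos q by simp
    moreover have "q \<in> closure \<Omega>" using q by (simp add: frontier_def)
    ultimately have "\<Omega> \<inter> ({x. chart_fun e \<gamma> x > 0} \<inter> ball p r) \<noteq> {}"
      by (metis closure_iff_nhds_not_empty Int_commute order_refl)
    then show False using iff by force
  qed
  ultimately show ?thesis by simp
qed

text \<open>For unit vectors \<open>u\<close> and \<open>v\<close> with \<open>c = u \<bullet> v\<close>, the vector \<open>v - u\<close> has inner product \<open>c - 1\<close> with \<open>u\<close> and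
\<open>1 - c\<close> with \<open>v\<close>. If \<open>c < 1\<close> these signs contradict the hypothesis.\<close>

lemma halfspace_parallel:
  fixes a b :: "'a::real_inner"
  assumes a: "a \<noteq> 0" and b: "b \<noteq> 0" and h: "\<And>v. v \<bullet> a < 0 \<Longrightarrow> v \<bullet> b \<le> 0"
  shows "sgn a = sgn b"
proof -
  define u v where "u = sgn a" and "v = sgn b"
  have nu: "norm u = 1" "norm v = 1" using a b by (auto simp: u_def v_def norm_sgn)
  have uv: "x \<bullet> v \<le> 0" if "x \<bullet> u < 0" for x
  proof -
    have "x \<bullet> a < 0" using that a by (simp add: u_def sgn_div_norm divide_less_0_iff mult_less_0_iff)
    then have "x \<bullet> b \<le> 0" by (rule h)
    then show ?thesis by (simp add: v_def sgn_div_norm mult_nonneg_nonpos)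
  qed
  have uu: "u \<bullet> u = 1" "v \<bullet> v = 1" using nu by (auto simp: dot_square_norm)
  define c where "c = u \<bullet> v"
  \<comment> \<open>the vector \<open>v - u\<close>, split into its components along and orthogonal to \<open>u\<close>\<close>
  have "((c - 1) *\<^sub>R u + (v - c *\<^sub>R u)) \<bullet> u = c - 1"
    using uu by (simp add: inner_simps c_def inner_commute)
  moreover have "((c - 1) *\<^sub>R u + (v - c *\<^sub>R u)) \<bullet> v = 1 - c"
    using uu by (simp add: inner_simps c_def algebra_simps)
  ultimately have "c - 1 < 0 \<Longrightarrow> 1 - c \<le> 0" using uv by metis
  then have c1: "c \<ge> 1" by linarith
  have "(norm (u - v))\<^sup>2 = 2 - 2 * c"
    using uu by (simp add: power2_norm_eq_inner inner_simps c_def inner_commute)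
  then have "(norm (u - v))\<^sup>2 \<le> 0" using c1 by simp
  then show ?thesis by (simp add: u_def v_def)
qed

lemma directional_sign:
  fixes \<rho> :: "'a::euclidean_space \<Rightarrow> real"
  assumes d: "(\<rho> has_derivative (\<lambda>h. h \<bullet> G)) (at p)" and p: "\<rho> p = 0" and r: "r > 0"
  shows "v \<bullet> G < 0 \<Longrightarrow> \<exists>t0>0. \<forall>t. 0 < t \<and> t < t0 \<longrightarrow> p + t *\<^sub>R v \<in> ball p r \<and> \<rho> (p + t *\<^sub>R v) < 0"
    and "v \<bullet> G > 0 \<Longrightarrow> \<exists>t0>0. \<forall>t. 0 < t \<and> t < t0 \<longrightarrow> p + t *\<^sub>R v \<in> ball p r \<and> \<rho> (p + t *\<^sub>R v) > 0"
proof -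
  have "((\<lambda>t. \<rho> (p + t *\<^sub>R v)) has_derivative (\<lambda>s. (s *\<^sub>R v) \<bullet> G)) (at 0)"
  proof -
    have c: "((\<lambda>t. p + t *\<^sub>R v) has_derivative (\<lambda>s. s *\<^sub>R v)) (at 0)" by (auto intro!: derivative_eq_intros)
    have d': "(\<rho> has_derivative (\<lambda>h. h \<bullet> G)) (at (p + 0 *\<^sub>R v))" using d by simp
    show ?thesis by (rule has_derivative_compose[OF c d'])
  qed
  then have D: "((\<lambda>t. \<rho> (p + t *\<^sub>R v)) has_real_derivative (v \<bullet> G)) (at 0)"
    by (simp add: has_field_derivative_def mult_commute_abs)
  define t1 where "t1 = r / (norm v + 1)"
  have t1: "t1 > 0" using r by (simp add: t1_def add_nonneg_pos)
  have ball: "p + t *\<^sub>R v \<in> ball p r" if "0 < t" "t < t1" for t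
  proof -
    have "t * norm v \<le> t * (norm v + 1)" using that by (intro mult_left_mono) auto
    also have "\<dots> < t1 * (norm v + 1)" using that by (intro mult_strict_right_mono) (auto simp: add_nonneg_pos)
    also have "\<dots> = r" by (simp add: t1_def add_nonneg_eq_0_iff)
    finally show ?thesis using that by (simp add: dist_norm)
  qed
  { assume "v \<bullet> G < 0"
    from DERIV_neg_dec_right[OF D this] obtain t2 where "t2 > 0" "\<forall>h>0. h < t2 \<longrightarrow> \<rho> (p + (0 + h) *\<^sub>R v) < \<rho> (p + 0 *\<^sub>R v)" by blast
    then show "\<exists>t0>0. \<forall>t. 0 < t \<and> t < t0 \<longrightarrow> p + t *\<^sub>R v \<in> ball p r \<and> \<rho> (p + t *\<^sub>R v) < 0"
      using t1 ball p by (intro exI[of _ "min t1 t2"]) auto }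
  { assume "v \<bullet> G > 0"
    from DERIV_pos_inc_right[OF D this] obtain t2 where "t2 > 0" "\<forall>h>0. h < t2 \<longrightarrow> \<rho> (p + 0 *\<^sub>R v) < \<rho> (p + (0 + h) *\<^sub>R v)" by blast
    then show "\<exists>t0>0. \<forall>t. 0 < t \<and> t < t0 \<longrightarrow> p + t *\<^sub>R v \<in> ball p r \<and> \<rho> (p + t *\<^sub>R v) > 0"
      using t1 ball p by (intro exI[of _ "min t1 t2"]) auto }
qed

text \<open>Whether a short step from \<open>p\<close> in direction \<open>v\<close> enters \<open>\<Omega>\<close> is decided by the sign of the inner product
of \<open>v\<close> with the gradient of either defining function. So the gradients have the same negative half
space and the same direction, and the outward normal is well defined.\<close>

lemma chart_normal_unique:
  assumes c1: "graph_chart \<Omega> p r1 e1 \<gamma>1" and c2: "graph_chart \<Omega> p r2 e2 \<gamma>2"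
    and p: "p \<in> frontier \<Omega>" and op: "open \<Omega>"
  shows "sgn (grad (chart_fun e1 \<gamma>1) p) = sgn (grad (chart_fun e2 \<gamma>2) p)"
proof (rule halfspace_parallel)
  have e1: "norm e1 = 1" "smooth \<gamma>1" "r1 > 0" and i1: "\<And>x. x \<in> ball p r1 \<Longrightarrow> x \<in> \<Omega> \<longleftrightarrow> chart_fun e1 \<gamma>1 x < 0"
    using c1 by (auto simp: graph_chart_iff)
  have e2: "norm e2 = 1" "smooth \<gamma>2" "r2 > 0" and i2: "\<And>x. x \<in> ball p r2 \<Longrightarrow> x \<in> \<Omega> \<longleftrightarrow> chart_fun e2 \<gamma>2 x < 0"
    using c2 by (auto simp: graph_chart_iff)
  show "grad (chart_fun e1 \<gamma>1) p \<noteq> 0" using grad_chart_fun_dir[OF e1(1,2), of p] by auto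
  show "grad (chart_fun e2 \<gamma>2) p \<noteq> 0" using grad_chart_fun_dir[OF e2(1,2), of p] by auto
  have z: "chart_fun e1 \<gamma>1 p = 0" "chart_fun e2 \<gamma>2 p = 0"
    using frontier_chart_fun_0[OF c1 p _ op] frontier_chart_fun_0[OF c2 p _ op] e1 e2 by auto
  fix v assume v: "v \<bullet> grad (chart_fun e1 \<gamma>1) p < 0"
  show "v \<bullet> grad (chart_fun e2 \<gamma>2) p \<le> 0"
  proof (rule ccontr)
    assume "\<not> ?thesis"
    then have v2: "v \<bullet> grad (chart_fun e2 \<gamma>2) p > 0" by simp
    obtain s1 where s1: "s1 > 0" "\<And>t. 0 < t \<and> t < s1 \<Longrightarrow> p + t *\<^sub>R v \<in> ball p r1 \<and> chart_fun e1 \<gamma>1 (p + t *\<^sub>R v) < 0"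
      using directional_sign(1)[OF chart_fun_derivative_grad[OF e1(1,2)] z(1) e1(3) v] by blast
    obtain s2 where s2: "s2 > 0" "\<And>t. 0 < t \<and> t < s2 \<Longrightarrow> p + t *\<^sub>R v \<in> ball p r2 \<and> chart_fun e2 \<gamma>2 (p + t *\<^sub>R v) > 0"
      using directional_sign(2)[OF chart_fun_derivative_grad[OF e2(1,2)] z(2) e2(3) v2] by blast
    define t where "t = min s1 s2 / 2"
    have "0 < t \<and> t < s1" "0 < t \<and> t < s2" using s1(1) s2(1) by (auto simp: t_def)
    then show False using s1(2)[of t] s2(2)[of t] i1[of "p + t *\<^sub>R v"] i2[of "p + t *\<^sub>R v"] by auto
  qed
qed

lemma outward_normal_eq:
  assumes c: "graph_chart \<Omega> p r e \<gamma>" and p: "p \<in> frontier \<Omega>" and op: "open \<Omega>"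
  shows "outward_normal \<Omega> p = sgn (grad (chart_fun e \<gamma>) p)"
  unfolding outward_normal_def chart_fun_def[symmetric, abs_def]
proof (rule the_equality)
  show "\<exists>r' e' \<gamma>'. graph_chart \<Omega> p r' e' \<gamma>' \<and> sgn (grad (chart_fun e \<gamma>) p) = sgn (grad (\<lambda>x. chart_fun e' \<gamma>' x) p)"
    using c by blast
  fix n assume "\<exists>r' e' \<gamma>'. graph_chart \<Omega> p r' e' \<gamma>' \<and> n = sgn (grad (\<lambda>x. chart_fun e' \<gamma>' x) p)"
  then show "n = sgn (grad (chart_fun e \<gamma>) p)" using chart_normal_unique[OF _ c p op] by auto
qed

text \<open>A chart at \<open>p\<close> is, with a smaller radius, a chart at every nearby boundary point; so the normal near
\<open>p\<close> is the normalized gradient of a single smooth function.\<close>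

lemma continuous_on_outward_normal:
  assumes "smooth_bounded_domain \<Omega>"
  shows "continuous_on (frontier \<Omega>) (outward_normal \<Omega>)"
  unfolding continuous_on_eq_continuous_within
proof
  have op: "open \<Omega>" using assms by (simp add: smooth_bounded_domain_def)
  fix p assume p: "p \<in> frontier \<Omega>"
  then obtain r e \<gamma> where c: "graph_chart \<Omega> p r e \<gamma>" using assms p unfolding smooth_bounded_domain_def by blast
  then have e: "norm e = 1" "smooth \<gamma>" "r > 0" by (auto simp: graph_chart_iff)
  have eq: "outward_normal \<Omega> q = sgn (grad (chart_fun e \<gamma>) q)" if q: "q \<in> frontier \<Omega>" "dist q p < r" for q
  proof (rule outward_normal_eq[OF _ q(1) op])
    have "ball q (r - dist q p) \<subseteq> ball p r"
    proof
      fix x assume "x \<in> ball q (r - dist q p)"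
      then show "x \<in> ball p r" using dist_triangle[of p x q] by (simp add: dist_commute)
    qed
    then show "graph_chart \<Omega> q (r - dist q p) e \<gamma>" using c q by (auto simp: graph_chart_iff)
  qed
  have nz: "grad (chart_fun e \<gamma>) x \<noteq> 0" for x using grad_chart_fun_dir[OF e(1,2), of x] by auto
  have "continuous_on (frontier \<Omega>) (\<lambda>q. sgn (grad (chart_fun e \<gamma>) q))"
    using nz by (intro continuous_on_sgn continuous_on_grad_chart_fun e) auto
  then have "continuous (at p within frontier \<Omega>) (\<lambda>q. sgn (grad (chart_fun e \<gamma>) q))"
    using p by (simp add: continuous_on_eq_continuous_within)
  then show "continuous (at p within frontier \<Omega>) (outward_normal \<Omega>)"
    by (rule continuous_transform_within[OF _ e(3) p]) (simp add: eq)
qed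

lemma Gamma_borel:
  assumes dom: "smooth_bounded_domain \<Omega>" and H: "continuous_on (closure \<Omega>) H"
  shows "Gamma_minus \<Omega> H \<in> sets borel" "Gamma_plus \<Omega> H \<in> sets borel"
proof -
  have c: "continuous_on (frontier \<Omega>) (\<lambda>p. H p \<bullet> outward_normal \<Omega> p)"
    by (intro continuous_intros continuous_on_outward_normal[OF dom] continuous_on_subset[OF H])
       (auto simp: frontier_def)
  have "closed (frontier \<Omega> \<inter> (\<lambda>p. H p \<bullet> outward_normal \<Omega> p) -` {..0})"
    by (rule continuous_closed_preimage[OF c]) auto
  moreover have "Gamma_minus \<Omega> H = frontier \<Omega> \<inter> (\<lambda>p. H p \<bullet> outward_normal \<Omega> p) -` {..0}"
    by (auto simp: Gamma_minus_def)
  ultimately show m: "Gamma_minus \<Omega> H \<in> sets borel" by auto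
  have "Gamma_plus \<Omega> H = frontier \<Omega> - Gamma_minus \<Omega> H" by (auto simp: Gamma_minus_def Gamma_plus_def)
  moreover have "frontier \<Omega> \<in> sets borel" by auto
  ultimately show "Gamma_plus \<Omega> H \<in> sets borel" using m by auto
qed

subsection \<open>The boundary has finite surface measure\<close>

text \<open>The translates of the tube by multiples of \<open>3 * \<eta>\<close> in the direction \<open>e\<close> are disjoint, since a
translation by \<open>t\<close> raises the defining function by \<open>t\<close>, and about \<open>1 / (3 * \<eta>)\<close> of them fit into a fixed
ball. Comparison of volumes gives the bound without any integration over the graph.\<close>

lemma graph_tube_measure:
  fixes e :: "'a::euclidean_space"
  assumes e: "norm e = 1" and \<gamma>: "smooth \<gamma>" and R: "R > 0"
  shows "\<exists>K>0. \<forall>\<eta>. 0 < \<eta> \<and> \<eta> \<le> 1 \<longrightarrow> measure lborel (cball p R \<inter> {x. \<bar>chart_fun e \<gamma> x\<bar> \<le> \<eta>}) \<le> K * \<eta>"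
proof -
  define V where "V = measure lborel (cball p (R + 4))"
  have V0: "V > 0" unfolding V_def using R by (simp add: content_cball_pos)
  have "measure lborel (cball p R \<inter> {x. \<bar>chart_fun e \<gamma> x\<bar> \<le> \<eta>}) \<le> 3 * V * \<eta>" if \<eta>: "0 < \<eta>" "\<eta> \<le> 1" for \<eta>
  proof -
    define S where "S = cball p R \<inter> {x. \<bar>chart_fun e \<gamma> x\<bar> \<le> \<eta>}"
    have "closed {x. \<bar>chart_fun e \<gamma> x\<bar> \<le> \<eta>}"
      by (intro closed_Collect_le continuous_intros continuous_on_chart_fun e \<gamma>)
    then have Sc: "closed S" unfolding S_def by (intro closed_Int) auto
    have Sb: "bounded S" unfolding S_def by (intro bounded_Int) auto
    \<comment> \<open>the number of translates; the total shift is at most \<open>1 + 3 * \<eta> \<le> 4\<close>, whence the radius \<open>R + 4\<close>\<close>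
    define n where "n = nat \<lceil>1 / (3 * \<eta>)\<rceil>"
    have n1: "1 / (3 * \<eta>) \<le> real n" unfolding n_def by (rule real_nat_ceiling_ge)
    have n2: "real n \<le> 1 / (3 * \<eta>) + 1"
    proof -
      have "0 \<le> 1 / (3 * \<eta>)" using \<eta> by simp
      then have "real n = of_int \<lceil>1 / (3 * \<eta>)\<rceil>" by (simp add: n_def)
      then show ?thesis using ceiling_correct[of "1 / (3 * \<eta>)"] by linarith
    qed
    define T where "T k = (\<lambda>x. (real k * (3 * \<eta>)) *\<^sub>R e + x) ` S" for k :: nat
    have Tc: "closed (T k)" for k unfolding T_def using Sc by (rule closed_translation)
    have Tb: "bounded (T k)" for k unfolding T_def using Sb by (rule bounded_translation)
    have Tf: "T k \<in> fmeasurable lborel" for k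
      using Tc[of k] emeasure_bounded_finite[OF Tb[of k]] by (auto simp: fmeasurable_def)
    have Tm: "measure lborel (T k) = measure lborel S" for k
      unfolding T_def using measure_translation[of "(real k * (3 * \<eta>)) *\<^sub>R e" S] Sc
      by (simp add: measure_completion closed_translation)
    have Tval: "real k * (3 * \<eta>) - \<eta> \<le> chart_fun e \<gamma> y \<and> chart_fun e \<gamma> y \<le> real k * (3 * \<eta>) + \<eta>" if "y \<in> T k" for y k
      using that chart_fun_translate[OF e \<gamma>] unfolding T_def S_def by (auto simp: add.commute abs_le_iff)
    have disj: "disjoint_family_on T {..<n}"
      unfolding disjoint_family_on_def
    proof (intro ballI impI)
      have *: "T i \<inter> T j = {}" if "i < j" for i j
      proof (rule ccontr)
        assume "T i \<inter> T j \<noteq> {}"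
        then obtain y where y: "y \<in> T i" "y \<in> T j" by blast
        have "real j * (3 * \<eta>) - \<eta> \<le> real i * (3 * \<eta>) + \<eta>"
          using Tval[OF y(2), THEN conjunct1] Tval[OF y(1), THEN conjunct2] by (rule order_trans)
        moreover have "(real i + 1) * (3 * \<eta>) \<le> real j * (3 * \<eta>)" using that \<eta> by (intro mult_right_mono) auto
        ultimately show False using \<eta> by (simp add: algebra_simps)
      qed
      fix i j :: nat assume "i \<noteq> j"
      then show "T i \<inter> T j = {}" using *[of i j] *[of j i] by (cases "i < j") auto
    qed
    have sub: "(\<Union>k<n. T k) \<subseteq> cball p (R + 4)"
    proof
      fix y assume "y \<in> (\<Union>k<n. T k)"
      then obtain k x where k: "k < n" and x: "x \<in> S" and y: "y = (real k * (3 * \<eta>)) *\<^sub>R e + x" by (auto simp: T_def)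
      have "real k * (3 * \<eta>) \<le> real n * (3 * \<eta>)" using k \<eta> by (intro mult_right_mono) auto
      also have "\<dots> \<le> (1 / (3 * \<eta>) + 1) * (3 * \<eta>)" using n2 \<eta> by (intro mult_right_mono) auto
      also have "\<dots> = 1 + 3 * \<eta>" using \<eta> by (simp add: field_simps)
      finally have 1: "real k * (3 * \<eta>) \<le> 4" using \<eta> by linarith
      have "norm (y - p) = norm ((real k * (3 * \<eta>)) *\<^sub>R e + (x - p))" unfolding y by (simp add: algebra_simps)
      also have "\<dots> \<le> norm ((real k * (3 * \<eta>)) *\<^sub>R e) + norm (x - p)" by (rule norm_triangle_ineq)
      also have "norm ((real k * (3 * \<eta>)) *\<^sub>R e) = real k * (3 * \<eta>)" using e \<eta> by simp
      finally have "norm (y - p) \<le> 4 + R" using 1 x by (auto simp: S_def dist_norm norm_minus_commute)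
      then show "y \<in> cball p (R + 4)" by (simp add: dist_norm norm_minus_commute)
    qed
    have "real n * measure lborel S = (\<Sum>k<n. measure lborel (T k))" by (simp add: Tm)
    also have "\<dots> = measure lborel (\<Union>k<n. T k)"
      using disj fmeasurableD[OF Tf] fmeasurableD2[OF Tf] by (intro measure_finite_Union[symmetric]) auto
    also have "\<dots> \<le> V"
      unfolding V_def using sub Tf emeasure_bounded_finite[OF bounded_cball, of p "R + 4"]
      by (intro measure_mono_fmeasurable) (auto simp: fmeasurable_def)
    finally have "real n * measure lborel S \<le> V" .
    moreover have "1 / (3 * \<eta>) * measure lborel S \<le> real n * measure lborel S"
      using n1 by (intro mult_right_mono) auto
    ultimately have "1 / (3 * \<eta>) * measure lborel S \<le> V" by linarith
    then show ?thesis using \<eta> by (simp add: S_def field_simps)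
  qed
  then show ?thesis using V0 by (intro exI[of _ "3 * V"]) auto
qed

text \<open>A separated set of maximal cardinality is a net, for otherwise an uncovered point could be added.\<close>

lemma finite_separated_cover:
  fixes A :: "'a::euclidean_space set"
  assumes \<delta>: "\<delta> > 0" and N: "\<And>P. finite P \<Longrightarrow> P \<subseteq> A \<Longrightarrow> (\<forall>x\<in>P. \<forall>y\<in>P. x \<noteq> y \<longrightarrow> \<delta> \<le> dist x y) \<Longrightarrow> real (card P) \<le> N"
  shows "\<exists>P. finite P \<and> A \<subseteq> (\<Union>p\<in>P. cball p \<delta>) \<and> real (card P) \<le> N"
proof -
  let ?Q = "\<lambda>P. finite P \<and> P \<subseteq> A \<and> (\<forall>x\<in>P. \<forall>y\<in>P. x \<noteq> y \<longrightarrow> \<delta> \<le> dist x y)"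
  have ex: "?Q {}" by simp
  have bd: "\<forall>P. ?Q P \<longrightarrow> card P < nat \<lceil>N\<rceil> + 1"
  proof (intro allI impI)
    fix P assume "?Q P"
    then have "real (card P) \<le> N" using N by blast
    then show "card P < nat \<lceil>N\<rceil> + 1" by linarith
  qed
  have "\<exists>P. ?Q P \<and> (\<forall>P'. ?Q P' \<longrightarrow> card P' \<le> card P)"
    by (rule ex_has_greatest_nat[of ?Q "{}" card, OF ex bd])
  then obtain P where PP: "?Q P \<and> (\<forall>P'. ?Q P' \<longrightarrow> card P' \<le> card P)" ..
  note P = PP[THEN conjunct1] and mx = PP[THEN conjunct2, rule_format]
  have "A \<subseteq> (\<Union>p\<in>P. cball p \<delta>)"
  proof (rule ccontr)
    assume "\<not> ?thesis"
    then obtain a where a: "a \<in> A" "\<And>p. p \<in> P \<Longrightarrow> \<delta> < dist p a" by force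
    then have "a \<notin> P" using \<delta> by fastforce
    moreover have "?Q (insert a P)" using P a by (force simp: dist_commute)
    ultimately show False using mx[of "insert a P"] P by auto
  qed
  then show ?thesis using P N by blast
qed

text \<open>Balls of radius \<open>h = \<delta> / 2\<close> around the points of a \<open>\<delta>\<close>-separated subset of the boundary are disjoint and,
since the defining function has Lipschitz constant \<open>L\<close>, lie in the tube of width \<open>L * h\<close>, whose
volume is at most \<open>K * L * h\<close>. So there are at most \<open>N = O(\<delta> powr (1 - d))\<close> such points, which is what
\<open>hausdorff_outer_finite\<close> asks for.\<close>

lemma local_boundary_hausdorff_finite:
  fixes \<Omega> :: "'a::euclidean_space set"
  assumes c: "graph_chart \<Omega> p r e \<gamma>" and op: "open \<Omega>"
  shows "hausdorff_outer (DIM('a) - 1) (frontier \<Omega> \<inter> ball p (r / 2)) < top"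
proof -
  have e: "norm e = 1" "smooth \<gamma>" "r > 0" using c by (auto simp: graph_chart_iff)
  define A where "A = frontier \<Omega> \<inter> ball p (r / 2)"
  obtain L where L: "L > 0" "\<And>x y. x \<in> cball p r \<Longrightarrow> y \<in> cball p r \<Longrightarrow> \<bar>chart_fun e \<gamma> x - chart_fun e \<gamma> y\<bar> \<le> L * norm (x - y)"
    using chart_fun_lipschitz[OF e(1,2), of "cball p r"] by auto
  obtain K where K: "K > 0" "\<And>\<eta>. 0 < \<eta> \<Longrightarrow> \<eta> \<le> 1 \<Longrightarrow> measure lborel (cball p r \<inter> {x. \<bar>chart_fun e \<gamma> x\<bar> \<le> \<eta>}) \<le> K * \<eta>"
    using graph_tube_measure[OF e] by blast
  let ?d = "DIM('a)"
  define \<omega> where "\<omega> = unit_ball_vol (real ?d)"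
  have \<omega>: "\<omega> > 0" unfolding \<omega>_def by simp
  define \<delta>0 where "\<delta>0 = min (r / 2) (1 / L)"
  have "\<exists>P. finite P \<and> A \<subseteq> (\<Union>q\<in>P. cball q \<delta>) \<and> real (card P) * \<delta> ^ (?d - 1) \<le> 2 ^ (?d - 1) * K * L / \<omega>"
    if \<delta>: "0 < \<delta>" "\<delta> \<le> \<delta>0" for \<delta>
  proof -
    define h where "h = \<delta> / 2"
    have h: "h > 0" "h \<le> r / 2" "L * h \<le> 1" using \<delta> L(1) unfolding h_def \<delta>0_def by (auto simp: field_simps)
    define N where "N = K * (L * h) / (\<omega> * h ^ ?d)"
    have "real (card P) \<le> N" if P: "finite P" "P \<subseteq> A" "\<forall>x\<in>P. \<forall>y\<in>P. x \<noteq> y \<longrightarrow> \<delta> \<le> dist x y" for P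
    proof -
      have sub: "(\<Union>q\<in>P. ball q h) \<subseteq> cball p r \<inter> {x. \<bar>chart_fun e \<gamma> x\<bar> \<le> L * h}"
      proof
        fix x assume "x \<in> (\<Union>q\<in>P. ball q h)"
        then obtain q where q: "q \<in> A" "dist q x < h" using P(2) by auto
        have qp: "dist p q < r / 2" "q \<in> frontier \<Omega>" using q by (auto simp: A_def)
        have x: "x \<in> cball p r" using dist_triangle[of p x q] qp q h by simp
        have "chart_fun e \<gamma> q = 0" using qp e(3) by (intro frontier_chart_fun_0[OF c _ _ op]) auto
        moreover have "\<bar>chart_fun e \<gamma> x - chart_fun e \<gamma> q\<bar> \<le> L * norm (x - q)" using x qp e(3) by (intro L) auto
        moreover have "L * norm (x - q) \<le> L * h" using q L(1) by (intro mult_left_mono) (auto simp: dist_norm norm_minus_commute)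
        ultimately show "x \<in> cball p r \<inter> {x. \<bar>chart_fun e \<gamma> x\<bar> \<le> L * h}" using x by auto
      qed
      have fb: "ball q h \<in> fmeasurable lborel" for q :: 'a
        using emeasure_bounded_finite[OF bounded_ball] by (auto simp: fmeasurable_def)
      have cl: "closed (cball p r \<inter> {x. \<bar>chart_fun e \<gamma> x\<bar> \<le> L * h})"
        by (intro closed_Int closed_Collect_le continuous_intros continuous_on_chart_fun e) auto
      have "bounded (cball p r \<inter> {x. \<bar>chart_fun e \<gamma> x\<bar> \<le> L * h})" by (intro bounded_Int) auto
      then have fm: "cball p r \<inter> {x. \<bar>chart_fun e \<gamma> x\<bar> \<le> L * h} \<in> fmeasurable lborel"
        using cl emeasure_bounded_finite by (auto simp: fmeasurable_def)
      have "disjoint_family_on (\<lambda>q. ball q h) P"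
        unfolding disjoint_family_on_def
      proof (intro ballI impI)
        fix x y assume "x \<in> P" "y \<in> P" "x \<noteq> y"
        then have "2 * h \<le> dist x y" using P(3) by (simp add: h_def)
        then show "ball x h \<inter> ball y h = {}" using dist_triangle_less_add by (fastforce simp: dist_commute)
      qed
      then have "measure lborel (\<Union>q\<in>P. ball q h) = (\<Sum>q\<in>P. measure lborel (ball q h))"
        using P(1) fmeasurableD[OF fb] fmeasurableD2[OF fb] by (intro measure_finite_Union) auto
      also have "\<dots> = real (card P) * (\<omega> * h ^ ?d)"
        using h by (simp add: content_ball \<omega>_def)
      finally have "real (card P) * (\<omega> * h ^ ?d) = measure lborel (\<Union>q\<in>P. ball q h)" by simp
      also have "\<dots> \<le> measure lborel (cball p r \<inter> {x. \<bar>chart_fun e \<gamma> x\<bar> \<le> L * h})"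
        using sub fm by (intro measure_mono_fmeasurable) (auto intro!: borel_open open_UN)
      also have "\<dots> \<le> K * (L * h)" using h L(1) by (intro K) auto
      finally show ?thesis using \<omega> h by (simp add: N_def field_simps)
    qed
    from finite_separated_cover[OF \<delta>(1) this]
    obtain P where P: "finite P" "A \<subseteq> (\<Union>q\<in>P. cball q \<delta>)" "real (card P) \<le> N" by blast
    have dd: "h ^ ?d = h * h ^ (?d - 1)" by (metis DIM_positive power_eq_if not_less_zero)
    have "real (card P) * \<delta> ^ (?d - 1) \<le> N * \<delta> ^ (?d - 1)" using P \<delta> by (intro mult_right_mono) auto
    also have "N * \<delta> ^ (?d - 1) = N * (2 ^ (?d - 1) * h ^ (?d - 1))"
      by (simp add: h_def power_mult_distrib[symmetric])
    also have "N * (2 ^ (?d - 1) * h ^ (?d - 1)) = 2 ^ (?d - 1) * K * L / \<omega>"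
      unfolding N_def dd using h \<omega> by (simp add: field_simps)
    finally have "real (card P) * \<delta> ^ (?d - 1) \<le> 2 ^ (?d - 1) * K * L / \<omega>" .
    then show ?thesis using P(1,2) by (intro exI[of _ P] conjI)
  qed
  moreover have "\<delta>0 > 0" using e(3) L(1) by (simp add: \<delta>0_def)
  ultimately show ?thesis unfolding A_def[symmetric] by (rule hausdorff_outer_finite)
qed

lemma frontier_surface_measure_finite:
  fixes \<Omega> :: "'a::euclidean_space set"
  assumes dom: "smooth_bounded_domain \<Omega>"
  shows "emeasure surface_measure (frontier \<Omega>) < top"
proof -
  have op: "open \<Omega>" and bd: "bounded \<Omega>" using dom by (auto simp: smooth_bounded_domain_def)
  have ch: "\<exists>r. r > 0 \<and> hausdorff_outer (DIM('a) - 1) (frontier \<Omega> \<inter> ball p (r / 2)) < top" if pf: "p \<in> frontier \<Omega>" for p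
  proof -
    obtain r e \<gamma> where c: "graph_chart \<Omega> p r e \<gamma>" using dom pf unfolding smooth_bounded_domain_def by blast
    then have "r > 0" by (simp add: graph_chart_iff)
    then show ?thesis using local_boundary_hausdorff_finite[OF c op] by blast
  qed
  then obtain r where r: "\<And>p. p \<in> frontier \<Omega> \<Longrightarrow> r p > 0"
    "\<And>p. p \<in> frontier \<Omega> \<Longrightarrow> hausdorff_outer (DIM('a) - 1) (frontier \<Omega> \<inter> ball p (r p / 2)) < top" by metis
  have "compact (frontier \<Omega>)" using bd by (rule compact_frontier_bounded)
  then obtain D where D: "D \<subseteq> frontier \<Omega>" "finite D" "frontier \<Omega> \<subseteq> (\<Union>p\<in>D. ball p (r p / 2))"
    using compactE_image[of "frontier \<Omega>" "frontier \<Omega>" "\<lambda>p. ball p (r p / 2)"] r(1) by force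
  have "emeasure surface_measure (frontier \<Omega>) \<le> emeasure surface_measure (\<Union>p\<in>D. frontier \<Omega> \<inter> ball p (r p / 2))"
  proof (rule emeasure_mono)
    have "(\<Union>p\<in>D. frontier \<Omega> \<inter> ball p (r p / 2)) \<in> sets borel"
      using D(2) by (intro sets.finite_UN sets.Int) auto
    then show "(\<Union>p\<in>D. frontier \<Omega> \<inter> ball p (r p / 2)) \<in> sets surface_measure"
      using borel_subset_surface_measure by (rule set_mp[rotated])
  qed (use D(3) in blast)
  also have "\<dots> \<le> (\<Sum>p\<in>D. emeasure surface_measure (frontier \<Omega> \<inter> ball p (r p / 2)))"
    using D(2) borel_subset_surface_measure by (intro emeasure_subadditive_finite) auto
  also have "\<dots> < top"
  proof (subst ennreal_sum_less_top[OF D(2)], intro ballI)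
    fix p assume p: "p \<in> D"
    have "frontier \<Omega> \<inter> ball p (r p / 2) \<in> sets surface_measure"
      using borel_subset_surface_measure by auto
    then show "emeasure surface_measure (frontier \<Omega> \<inter> ball p (r p / 2)) < top"
      using r(2)[of p] p D(1) by (subst emeasure_surface_measure) auto
  qed
  finally show ?thesis .
qed

section \<open>Existence and uniqueness of the minimizer\<close>

lemma complete_measure_restrict_space:
  assumes M: "complete_measure M" and A: "A \<in> sets M"
  shows "complete_measure (restrict_space M A)"
proof
  interpret complete_measure M by fact
  fix X Y assume Y: "Y \<subseteq> X" and X: "X \<in> null_sets (restrict_space M A)"
  then have XA: "X \<subseteq> A" "X \<in> null_sets M" using A by (auto simp: null_sets_restrict_space)
  then have "Y \<in> sets M" using Y by (intro complete)
  then show "Y \<in> sets (restrict_space M A)" using A XA Y by (auto simp: sets_restrict_space_iff)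
qed

text \<open>The measure space on which the boundary integrals live. Completeness is needed because the
temporal coefficients of the data are only almost everywhere equal to measurable functions.\<close>

lemma restrict_surface_measure:
  fixes \<Omega> \<Gamma> :: "'a::euclidean_space set"
  assumes dom: "smooth_bounded_domain \<Omega>" and \<Gamma>: "\<Gamma> \<in> sets borel" "\<Gamma> \<subseteq> frontier \<Omega>"
  shows "\<Gamma> \<in> sets surface_measure" "finite_measure (restrict_space surface_measure \<Gamma>)"
    "complete_measure (restrict_space surface_measure \<Gamma>)"
proof -
  show G: "\<Gamma> \<in> sets surface_measure" using \<Gamma>(1) borel_subset_surface_measure by blast
  show "complete_measure (restrict_space surface_measure \<Gamma>)"
    by (rule complete_measure_restrict_space[OF complete_surface_measure G])
  have "frontier \<Omega> \<in> sets surface_measure" using borel_subset_surface_measure by (rule set_mp) simp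
  then have "emeasure surface_measure \<Gamma> \<le> emeasure surface_measure (frontier \<Omega>)" using \<Gamma>(2) by (intro emeasure_mono)
  also have "\<dots> < top" by (rule frontier_surface_measure_finite[OF dom])
  finally show "finite_measure (restrict_space surface_measure \<Gamma>)"
    using G by (intro finite_measureI) (simp add: emeasure_restrict_space space_restrict_space)
qed

lemma time_coeff_boundary_square_integrable:
  fixes \<Omega> \<Gamma> :: "'a::euclidean_space set"
  assumes dom: "smooth_bounded_domain \<Omega>" and \<Gamma>: "\<Gamma> \<in> sets borel" "\<Gamma> \<subseteq> frontier \<Omega>" and T: "T > 0"
    and g: "boundary_data \<Gamma> T g"
  shows "square_integrable (restrict_space surface_measure \<Gamma>) (\<lambda>p. - time_coeff T g m p)"
proof -
  let ?\<mu> = "restrict_space surface_measure \<Gamma>"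
  note R = restrict_surface_measure[OF dom \<Gamma>]
  obtain g' where g': "square_integrable ?\<mu> g'" "AE p in ?\<mu>. time_coeff T g m p = g' p"
    using time_coeff_square_integrable[OF R(2) T g[unfolded boundary_data_def]] by blast
  have ae: "AE p in ?\<mu>. - g' p = - time_coeff T g m p" using g'(2) by eventually_elim simp
  have s: "square_integrable ?\<mu> (\<lambda>p. - g' p)" using g'(1) by (simp add: square_integrable_def)
  then have m: "(\<lambda>p. - time_coeff T g m p) \<in> borel_measurable ?\<mu>"
    by (intro complete_measurable_cong_AE[OF R(3) _ ae]) (auto simp: square_integrable_def)
  show ?thesis
    using s square_integrable_cong_AE[OF _ m ae] by (auto simp: square_integrable_def)
qed

lemma midpoint_square_sum:
  fixes W V :: "nat \<Rightarrow> 'a::euclidean_space \<Rightarrow> real"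
  assumes "\<And>m. m \<le> N \<Longrightarrow> W m \<in> Hs_whole s" "\<And>m. m \<le> N \<Longrightarrow> V m \<in> Hs_whole s"
  shows "(\<Sum>m\<le>N. (Hs_whole_norm s (\<lambda>x. (W m x + V m x) / 2))\<^sup>2) + 1/4 * (\<Sum>m\<le>N. Hs_dist2 s (W m) (V m)) =
    ((\<Sum>m\<le>N. (Hs_whole_norm s (W m))\<^sup>2) + (\<Sum>m\<le>N. (Hs_whole_norm s (V m))\<^sup>2)) / 2"
proof -
  have "(\<Sum>m\<le>N. (Hs_whole_norm s (\<lambda>x. (W m x + V m x) / 2))\<^sup>2 + 1/4 * Hs_dist2 s (W m) (V m)) =
    (\<Sum>m\<le>N. ((Hs_whole_norm s (W m))\<^sup>2 + (Hs_whole_norm s (V m))\<^sup>2) / 2)"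
    using assms by (intro sum.cong refl Hs_whole_parallelogram) auto
  then show ?thesis by (simp only: sum.distrib sum_distrib_left sum_divide_distrib[symmetric])
qed

lemma Hs_whole_vec_complete:
  fixes X :: "nat \<Rightarrow> nat \<Rightarrow> 'a::euclidean_space \<Rightarrow> real"
  assumes s: "s \<ge> 0" and X: "\<And>n m. m \<le> N \<Longrightarrow> X n m \<in> Hs_whole s"
    and cau: "\<forall>e>0. \<exists>K. \<forall>i\<ge>K. \<forall>j\<ge>K. (\<Sum>m\<le>N. Hs_dist2 s (X i m) (X j m)) < e"
  obtains u where "\<And>m. m \<le> N \<Longrightarrow> u m \<in> Hs_whole s" "(\<lambda>n. \<Sum>m\<le>N. Hs_dist2 s (X n m) (u m)) \<longlonglongrightarrow> 0"
proof -
  have "\<forall>m. \<exists>u. m \<le> N \<longrightarrow> u \<in> Hs_whole s \<and> (\<lambda>n. Hs_dist2 s (X n m) u) \<longlonglongrightarrow> 0"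
  proof
    fix m
    show "\<exists>u. m \<le> N \<longrightarrow> u \<in> Hs_whole s \<and> (\<lambda>n. Hs_dist2 s (X n m) u) \<longlonglongrightarrow> 0"
    proof (cases "m \<le> N")
      case True
      have le: "Hs_dist2 s (X i m) (X j m) \<le> (\<Sum>m\<le>N. Hs_dist2 s (X i m) (X j m))" for i j
        using True by (intro member_le_sum[of m "{..N}" "\<lambda>m. Hs_dist2 s (X i m) (X j m)"]) (auto simp: Hs_dist2_def)
      have "\<forall>e>0. \<exists>K. \<forall>i\<ge>K. \<forall>j\<ge>K. Hs_dist2 s (X i m) (X j m) < e"
        using cau le by (meson le_less_trans)
      from Hs_whole_complete[OF s X[OF True] this] show ?thesis by metis
    qed simp
  qed
  then obtain u where u: "\<And>m. m \<le> N \<Longrightarrow> u m \<in> Hs_whole s \<and> (\<lambda>n. Hs_dist2 s (X n m) (u m)) \<longlonglongrightarrow> 0" by metis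
  have "(\<lambda>n. \<Sum>m\<le>N. Hs_dist2 s (X n m) (u m)) \<longlonglongrightarrow> (\<Sum>m\<le>N. 0)" using u by (intro tendsto_sum) auto
  then show thesis using u by (intro that[of u]) auto
qed

lemma Hs_dist2_component_tendsto:
  fixes X :: "nat \<Rightarrow> nat \<Rightarrow> 'a::euclidean_space \<Rightarrow> real"
  assumes lim: "(\<lambda>n. \<Sum>m\<le>N. Hs_dist2 s (X n m) (u m)) \<longlonglongrightarrow> 0" and m: "m \<le> N"
  shows "(\<lambda>n. Hs_dist2 s (X n m) (u m)) \<longlonglongrightarrow> 0"
proof (rule tendsto_sandwich[OF _ _ tendsto_const lim])
  show "\<forall>\<^sub>F n in sequentially. 0 \<le> Hs_dist2 s (X n m) (u m)" by (simp add: Hs_dist2_def)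
  show "\<forall>\<^sub>F n in sequentially. Hs_dist2 s (X n m) (u m) \<le> (\<Sum>m\<le>N. Hs_dist2 s (X n m) (u m))"
    using m by (intro always_eventually allI member_le_sum[of m "{..N}" "\<lambda>m. Hs_dist2 s (X n m) (u m)" for n]) (auto simp: Hs_dist2_def)
qed

lemma Hs_zero: "(\<lambda>x::'a::euclidean_space. 0) \<in> Hs_whole s" "Hs_whole_norm s (\<lambda>x::'a. 0) = 0"
proof -
  have sq: "square_integrable lborel (\<lambda>x::'a. 0::real)" by (simp add: square_integrable_def)
  have ae: "AE \<xi> in lborel. bessel s (\<lambda>x::'a. 0) \<xi> = 0" using bessel_lincomb_AE[OF sq sq, of s 0 0] by simp
  have m: "bessel s (\<lambda>x::'a. 0) \<in> borel_measurable lborel" using bessel_measurable[OF sq] by simp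
  have z: "square_integrable lborel (\<lambda>\<xi>::'a. 0::complex)" by (simp add: square_integrable_def)
  have "square_integrable lborel (bessel s (\<lambda>x::'a. 0))"
    using z square_integrable_cong_AE[OF m _ ae] by (simp add: square_integrable_def)
  then show "(\<lambda>x::'a. 0) \<in> Hs_whole s" using sq by (simp add: Hs_whole_iff)
  have "(Hs_whole_norm s (\<lambda>x::'a. 0))\<^sup>2 = (\<integral>\<xi>. (norm (bessel s (\<lambda>x::'a. 0) \<xi>))\<^sup>2 \<partial>lborel)" by (rule Hs_whole_norm_sq)
  also have "\<dots> = integral\<^sup>L lborel (\<lambda>\<xi>::'a. 0)" using ae m by (intro integral_cong_AE) auto
  finally show "Hs_whole_norm s (\<lambda>x::'a. 0) = 0" by simp
qed

theorem proposition4p1: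
  fixes \<Omega> :: "'a::euclidean_space set"
    and T \<mu>\<^sub>0 \<kappa>\<^sub>0 s M lam \<epsilon> :: real and N :: nat
    and H :: "'a \<Rightarrow> 'a" and phi_star :: "'a \<Rightarrow> real"
    and c f \<alpha> g h :: "'a \<Rightarrow> real \<Rightarrow> real"
    and \<Phi> :: "nat \<Rightarrow> 'a \<Rightarrow> real"
  assumes "smooth_bounded_domain \<Omega>"
    and "T > 0"
    and "C1_closure \<Omega> H"
    and "C2_closure \<Omega> phi_star"
    and "\<mu>\<^sub>0 > 0"
    and "\<And>x. x \<in> closure \<Omega> \<Longrightarrow> H x \<bullet> grad_closure \<Omega> phi_star x \<ge> \<mu>\<^sub>0"
    and "boundary_data (Gamma_minus \<Omega> H) T g"
    and "boundary_data (Gamma_plus \<Omega> H) T h"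
    and "C1_closure (\<Omega> \<times> UNIV) (\<lambda>(x, \<sigma>). c x \<sigma>)"
    and "C1_closure (\<Omega> \<times> UNIV) (\<lambda>(x, \<sigma>). f x \<sigma>)"
    and "\<kappa>\<^sub>0 > 0"
    and "\<And>x \<sigma>. x \<in> closure \<Omega> \<Longrightarrow> c x \<sigma> \<ge> \<kappa>\<^sub>0"
    and "Linfty_on (\<Omega> \<times> {0<..<T}) (\<lambda>(x, t). \<alpha> x t)"
    and "s > real DIM('a) / 2 + 1"
    and "M > 0"
    and "\<Phi> \<in> Hs_ball \<Omega> s N M"
    and "lam > 0"
    and "\<epsilon> > 0"
  shows "\<exists>U. is_arg_min (J_functional \<Omega> T N s H phi_star c f \<alpha> g h \<Phi> lam \<epsilon>) (\<lambda>U. U \<in> Hs_ball \<Omega> s N M) U \<and>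
    (\<forall>V. is_arg_min (J_functional \<Omega> T N s H phi_star c f \<alpha> g h \<Phi> lam \<epsilon>) (\<lambda>U. U \<in> Hs_ball \<Omega> s N M) V \<longrightarrow>
      (\<forall>m\<le>N. AE x in lebesgue_on \<Omega>. V m x = U m x))"
proof -
  note dom = assms(1) and T = assms(2) and s = assms(14) and M0 = assms(15) and \<epsilon> = assms(18)
  have op: "open \<Omega>" and bd: "bounded \<Omega>" using dom by (auto simp: smooth_bounded_domain_def)
  have \<Omega>: "\<Omega> \<in> sets lebesgue" using op by auto
  have Hc: "continuous_on (closure \<Omega>) H" and \<phi>c: "continuous_on (closure \<Omega>) phi_star"
    and cc: "continuous_on (closure (\<Omega> \<times> UNIV)) (\<lambda>(x, \<sigma>). c x \<sigma>)"
    and fc: "continuous_on (closure (\<Omega> \<times> UNIV)) (\<lambda>(x, \<sigma>). f x \<sigma>)"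
    using assms(3,4,9,10) by (simp_all add: C1_closure_def C2_closure_def)
  have s0: "s \<ge> 0" using s by (smt (verit) divide_nonneg_nonneg of_nat_0_le_iff)
  have comp: "compact (closure \<Omega>)" using bd by (simp add: compact_closure)
  have \<Phi>: "\<Phi> j \<in> Hs \<Omega> s" if "j \<le> N" for j using assms(16) that by (auto simp: Hs_ball_def Hs_vec_def)

  obtain A F C where Am: "\<And>m n. A m n \<in> borel_measurable borel" and Fm: "\<And>m. F m \<in> borel_measurable borel" and C0: "0 \<le> C"
    and Ab: "\<And>m n x. m \<le> N \<Longrightarrow> n \<le> N \<Longrightarrow> \<bar>A m n x\<bar> \<le> C" and Fb: "\<And>m x. m \<le> N \<Longrightarrow> \<bar>F m x\<bar> \<le> C"
    and coeff: "AE x in lebesgue. x \<in> \<Omega> \<longrightarrow> (\<forall>m\<le>N. F_coeff T N c f \<Phi> m x = F m x \<and>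
       (\<forall>n\<le>N. S_coeff T N c \<Phi> m n x + M_coeff T N c \<alpha> \<Phi> m n x = A m n x))"
  proof -
    show thesis
    proof (rule frozen_coefficients[where \<Omega>=\<Omega> and c=c and f=f and \<alpha>=\<alpha> and \<Phi>=\<Phi> and N=N, OF op bd T cc fc assms(11) _ assms(13) s])
      show "\<kappa>\<^sub>0 \<le> c x \<sigma>" if "x \<in> closure \<Omega>" for x \<sigma> using that by (rule assms(12))
      show "\<Phi> j \<in> Hs \<Omega> s" if "j \<le> N" for j using that by (rule \<Phi>)
    qed (fact that)
  qed

  have "bounded (H ` closure \<Omega>)" using comp Hc by (intro compact_imp_bounded compact_continuous_image)
  then obtain HB where "\<forall>y\<in>H ` closure \<Omega>. norm y \<le> HB" unfolding bounded_iff by blast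
  then have HB: "norm (H x) \<le> \<bar>HB\<bar>" if "x \<in> closure \<Omega>" for x using that by force
  define \<omega> where "\<omega> x = exp (2 * lam * phi_star x)" for x
  have \<omega>c: "continuous_on (closure \<Omega>) \<omega>" unfolding \<omega>_def by (intro continuous_intros \<phi>c)
  have "bounded (\<omega> ` closure \<Omega>)" using comp \<omega>c by (intro compact_imp_bounded compact_continuous_image)
  then obtain WB where WB: "\<forall>y\<in>\<omega> ` closure \<Omega>. norm y \<le> WB" unfolding bounded_iff by blast
  have \<omega>b: "0 \<le> \<omega> x \<and> \<omega> x \<le> WB" if "x \<in> closure \<Omega>" for x
  proof -
    have "norm (\<omega> x) \<le> WB" using WB that by blast
    moreover have "0 \<le> \<omega> x" by (simp add: \<omega>_def)
    ultimately show ?thesis by simp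
  qed

  let ?L = "lebesgue_on \<Omega>"
  let ?Gm = "Gamma_minus \<Omega> H" and ?Gp = "Gamma_plus \<Omega> H"
  have \<Gamma>b: "?Gm \<in> sets borel" "?Gp \<in> sets borel" by (rule Gamma_borel[OF dom Hc])+
  have \<Gamma>f: "?Gm \<subseteq> frontier \<Omega>" "?Gp \<subseteq> frontier \<Omega>" by (auto simp: Gamma_minus_def Gamma_plus_def)
  have fcl: "frontier \<Omega> \<subseteq> closure \<Omega>" by (simp add: frontier_def)
  let ?Sm = "restrict_space surface_measure ?Gm" and ?Sp = "restrict_space surface_measure ?Gp"
  have finL: "finite_measure ?L"
    by (rule finite_measure_lebesgue_on[OF bounded_set_imp_lmeasurable[OF bd \<Omega>]])
  note Rm = restrict_surface_measure[OF dom \<Gamma>b(1) \<Gamma>f(1)] and Rp = restrict_surface_measure[OF dom \<Gamma>b(2) \<Gamma>f(2)]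
  have lm: "p \<in> borel_measurable ?L" if "p \<in> borel_measurable borel" for p :: "'a \<Rightarrow> real"
    by (intro measurable_restrict_space1 measurable_completion) (use that in simp)
  have sm: "p \<in> borel_measurable (restrict_space surface_measure G)" if "p \<in> borel_measurable borel" for p :: "'a \<Rightarrow> real" and G
    by (intro measurable_restrict_space1 borel_measurable_surface_measure that)
  have \<omega>m: "\<omega> \<in> borel_measurable ?L"
    using continuous_on_subset[OF \<omega>c closure_subset] \<Omega> by (rule continuous_imp_measurable_on_sets_lebesgue)
  have \<omega>s: "\<omega> \<in> borel_measurable (restrict_space surface_measure G)" if G: "G \<in> sets borel" "G \<subseteq> frontier \<Omega>" for G
  proof -
    have "(\<lambda>x. indicator (frontier \<Omega>) x *\<^sub>R \<omega> x) \<in> borel_measurable borel"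
      by (rule borel_measurable_continuous_on_indicator[OF _ continuous_on_subset[OF \<omega>c fcl]]) simp
    then have "(\<lambda>x. indicator (frontier \<Omega>) x *\<^sub>R \<omega> x) \<in> borel_measurable (restrict_space surface_measure G)" by (rule sm)
    then show ?thesis
      by (rule measurable_cong[THEN iffD1, rotated]) (use G in \<open>auto simp: space_restrict_space indicator_def\<close>)
  qed
  have Fs: "square_integrable ?L (F m)" if "m \<le> N" for m
    unfolding square_integrable_def
  proof
    interpret finite_measure ?L by (rule finL)
    show 1: "F m \<in> borel_measurable ?L" by (rule lm[OF Fm])
    show "integrable ?L (\<lambda>x. (norm (F m x))\<^sup>2)"
    proof (rule integrable_const_bound[of _ "C\<^sup>2"])
      show "AE x in ?L. norm ((norm (F m x))\<^sup>2) \<le> C\<^sup>2"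
        using Fb[OF that] C0 by (intro AE_I2) (simp add: abs_le_square_iff[symmetric])
    qed (use 1 in measurable)
  qed
  \<comment> \<open>the data enter with a minus sign, since \<open>quad_functional\<close> adds them\<close>
  define gm where "gm m p = - time_coeff T g m p" for m p
  define hm where "hm m p = - time_coeff T h m p" for m p
  have gs: "square_integrable ?Sm (gm m)" for m unfolding gm_def
    by (rule time_coeff_boundary_square_integrable[OF dom \<Gamma>b(1) \<Gamma>f(1) T assms(7)])
  have hs: "square_integrable ?Sp (hm m)" for m unfolding hm_def
    by (rule time_coeff_boundary_square_integrable[OF dom \<Gamma>b(2) \<Gamma>f(2) T assms(8)])

  \<comment> \<open>the linear parts of the expressions under the squares, in terms of a whole-space tuple\<close>
  define l where "l W m x = H x \<bullet> sob_grad (W m) x + (\<Sum>n\<le>N. A m n x * sob_rep (W n) x)" for W m x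
  define b where "b W m p = sob_rep (W m) p" for W :: "nat \<Rightarrow> 'a \<Rightarrow> real" and m p
  \<comment> \<open>the admissible whole-space tuples; components with index above \<open>N\<close> are arbitrary\<close>
  define K :: "(nat \<Rightarrow> 'a \<Rightarrow> real) set" where "K = {W. (\<forall>m\<le>N. W m \<in> Hs_whole s) \<and> (\<Sum>m\<le>N. (Hs_whole_norm s (W m))\<^sup>2) \<le> M\<^sup>2}"
  have KH: "W m \<in> Hs_whole s" if "W \<in> K" "m \<le> N" for W m using that by (simp add: K_def)
  have KM: "Hs_whole_norm s (W m) \<le> M" if "W \<in> K" "m \<le> N" for W m
  proof -
    have "(Hs_whole_norm s (W m))\<^sup>2 \<le> (\<Sum>m\<le>N. (Hs_whole_norm s (W m))\<^sup>2)"
      using that(2) by (intro member_le_sum[of m "{..N}" "\<lambda>m. (Hs_whole_norm s (W m))\<^sup>2"]) auto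
    also have "\<dots> \<le> M\<^sup>2" using that(1) by (simp add: K_def)
    finally have "(Hs_whole_norm s (W m))\<^sup>2 \<le> M\<^sup>2" .
    from power2_le_imp_le[OF this] M0 show ?thesis by simp
  qed
  define cS where "cS = sob_const s TYPE('a) * M"
  have sc0: "0 \<le> sob_const s TYPE('a)" unfolding sob_const_def using fconst_pos[where 'a='a] by (simp add: less_imp_le)
  have repb: "\<bar>sob_rep (W m) x\<bar> \<le> cS" and gradb: "norm (sob_grad (W m) x) \<le> cS" if "W \<in> K" "m \<le> N" for W m x
  proof -
    have le: "sob_const s TYPE('a) * Hs_whole_norm s (W m) \<le> cS" unfolding cS_def using KM[OF that] sc0 by (rule mult_left_mono)
    show "\<bar>sob_rep (W m) x\<bar> \<le> cS" using sob_rep_bound[OF s KH[OF that], of x] le by linarith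
    show "norm (sob_grad (W m) x) \<le> cS" using sob_grad_bound[OF s KH[OF that], of x] le by linarith
  qed
  have cS0: "0 \<le> cS" unfolding cS_def using sc0 M0 by simp
  define cL where "cL = \<bar>HB\<bar> * cS + (\<Sum>n\<le>N. C * cS)"
  have bm: "b W m \<in> borel_measurable borel" if "W \<in> K" "m \<le> N" for W m
    unfolding b_def by (rule borel_measurable_continuous_onI[OF continuous_sob_rep[OF s KH[OF that]]])
  have bS: "b W m \<in> borel_measurable (restrict_space surface_measure G)" if "W \<in> K" "m \<le> N" for W m G
    by (rule sm[OF bm[OF that]])
  have bB: "\<bar>b W m x\<bar> \<le> cS" if "W \<in> K" "m \<le> N" for W m x unfolding b_def by (rule repb[OF that])
  have lmeas: "l W m \<in> borel_measurable ?L" if W: "W \<in> K" and m: "m \<le> N" for W m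
    unfolding l_def
  proof (intro borel_measurable_add borel_measurable_sum borel_measurable_times)
    have "continuous_on \<Omega> (\<lambda>x. H x \<bullet> sob_grad (W m) x)"
      using continuous_on_subset[OF Hc closure_subset] continuous_on_subset[OF continuous_sob_grad[OF s KH[OF W m]]]
      by (intro continuous_on_inner) auto
    then show "(\<lambda>x. H x \<bullet> sob_grad (W m) x) \<in> borel_measurable ?L"
      using \<Omega> by (rule continuous_imp_measurable_on_sets_lebesgue)
    show "A m n \<in> borel_measurable ?L" for n by (rule lm[OF Am])
    show "(\<lambda>x. sob_rep (W n) x) \<in> borel_measurable ?L" if "n \<in> {..N}" for n
      using bm[OF W, of n] that unfolding b_def by (intro lm) auto
  qed
  have lbound: "\<bar>l W m x\<bar> \<le> cL" if W: "W \<in> K" and m: "m \<le> N" and x: "x \<in> \<Omega>" for W m x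
  proof -
    have "\<bar>H x \<bullet> sob_grad (W m) x\<bar> \<le> norm (H x) * norm (sob_grad (W m) x)" by (rule Cauchy_Schwarz_ineq2)
    also have "\<dots> \<le> \<bar>HB\<bar> * cS" using x closure_subset gradb[OF W m] by (intro mult_mono HB) auto
    finally have 1: "\<bar>H x \<bullet> sob_grad (W m) x\<bar> \<le> \<bar>HB\<bar> * cS" .
    have "\<bar>\<Sum>n\<le>N. A m n x * sob_rep (W n) x\<bar> \<le> (\<Sum>n\<le>N. \<bar>A m n x * sob_rep (W n) x\<bar>)" by (rule sum_abs)
    also have "\<dots> \<le> (\<Sum>n\<le>N. C * cS)"
      unfolding abs_mult using Ab[OF m] repb[OF W] C0 by (intro sum_mono mult_mono) auto
    finally have 2: "\<bar>\<Sum>n\<le>N. A m n x * sob_rep (W n) x\<bar> \<le> (\<Sum>n\<le>N. C * cS)" .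
    show ?thesis unfolding l_def cL_def using 1 2 by linarith
  qed
  define E where "E W = quad_functional ?L \<omega> N F (l W) + lam\<^sup>2 * quad_functional ?Sm \<omega> N gm (b W)
      + lam\<^sup>2 * quad_functional ?Sp \<omega> N hm (b W)" for W
  have spL: "space ?L = \<Omega>" and spm: "space ?Sm = ?Gm" and spp: "space ?Sp = ?Gp"
    by (simp_all add: space_restrict_space)
  have wL: "0 \<le> \<omega> x \<and> \<omega> x \<le> WB" if "x \<in> space ?L" for x using that closure_subset unfolding spL by (intro \<omega>b) auto
  have wm: "0 \<le> \<omega> x \<and> \<omega> x \<le> WB" if "x \<in> space ?Sm" for x using that \<Gamma>f(1) fcl unfolding spm by (intro \<omega>b) auto
  have wp: "0 \<le> \<omega> x \<and> \<omega> x \<le> WB" if "x \<in> space ?Sp" for x using that \<Gamma>f(2) fcl unfolding spp by (intro \<omega>b) auto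
  note QL = quad_nonneg[OF finL \<omega>m wL Fs] quad_midpoint[OF finL \<omega>m wL Fs] quad_tendsto[OF finL \<omega>m wL Fs]
  note Qm = quad_nonneg[OF Rm(2) \<omega>s[OF \<Gamma>b(1) \<Gamma>f(1)] wm gs] quad_midpoint[OF Rm(2) \<omega>s[OF \<Gamma>b(1) \<Gamma>f(1)] wm gs] quad_tendsto[OF Rm(2) \<omega>s[OF \<Gamma>b(1) \<Gamma>f(1)] wm gs]
  note Qp = quad_nonneg[OF Rp(2) \<omega>s[OF \<Gamma>b(2) \<Gamma>f(2)] wp hs] quad_midpoint[OF Rp(2) \<omega>s[OF \<Gamma>b(2) \<Gamma>f(2)] wp hs] quad_tendsto[OF Rp(2) \<omega>s[OF \<Gamma>b(2) \<Gamma>f(2)] wp hs]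
  have E0: "0 \<le> E W" for W unfolding E_def by (intro add_nonneg_nonneg mult_nonneg_nonneg QL(1) Qm(1) Qp(1)) auto

  let ?mid = "\<lambda>W V m x. (W m x + V m x) / 2 :: real"
  have lin: "sob_rep (?mid W V m) x = (sob_rep (W m) x + sob_rep (V m) x) / 2"
    "sob_grad (?mid W V m) x = (1/2) *\<^sub>R (sob_grad (W m) x + sob_grad (V m) x)"
    if "W \<in> K" "V \<in> K" "m \<le> N" for W V m x
    using sob_lincomb[OF s KH[OF that(1,3)] KH[OF that(2,3)], of "1/2" "1/2" x]
    by (simp_all add: add_divide_distrib scaleR_add_right)
  have lmid: "l (?mid W V) m x = (l W m x + l V m x) / 2" if "W \<in> K" "V \<in> K" "m \<le> N" for W V m x
  proof -
    have "(\<Sum>n\<le>N. A m n x * sob_rep (?mid W V n) x) = (\<Sum>n\<le>N. (A m n x * sob_rep (W n) x + A m n x * sob_rep (V n) x) / 2)"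
      by (intro sum.cong refl) (simp add: lin(1)[OF that(1,2)] distrib_left)
    also have "\<dots> = ((\<Sum>n\<le>N. A m n x * sob_rep (W n) x) + (\<Sum>n\<le>N. A m n x * sob_rep (V n) x)) / 2"
      by (simp only: sum_divide_distrib[symmetric] sum.distrib)
    finally show ?thesis unfolding l_def lin(2)[OF that]
      by (simp add: inner_add_right add_divide_distrib)
  qed
  have bmid: "b (?mid W V) m x = (b W m x + b V m x) / 2" if "W \<in> K" "V \<in> K" "m \<le> N" for W V m x
    unfolding b_def by (rule lin(1)[OF that])
  have qcong: "quad_functional R \<omega> N k a = quad_functional R \<omega> N k a'" if "\<And>m x. m \<le> N \<Longrightarrow> a m x = a' m x"
    for R :: "'a measure" and k a a'
    unfolding quad_functional_def using that by (intro Bochner_Integration.integral_cong refl arg_cong2[where f="(*)"] sum.cong) auto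
  have Emid: "E (?mid W V) \<le> (E W + E V) / 2" if WV: "W \<in> K" "V \<in> K" for W V
  proof -
    have 1: "quad_functional ?L \<omega> N F (l (?mid W V)) \<le> (quad_functional ?L \<omega> N F (l W) + quad_functional ?L \<omega> N F (l V)) / 2"
    proof -
      have "quad_functional ?L \<omega> N F (l (?mid W V)) = quad_functional ?L \<omega> N F (\<lambda>m x. (l W m x + l V m x) / 2)"
        by (rule qcong) (rule lmid[OF WV])
      also have "\<dots> \<le> (quad_functional ?L \<omega> N F (l W) + quad_functional ?L \<omega> N F (l V)) / 2"
        by (rule QL(2)[where C=cL and C'=cL]) (use lmeas lbound WV in \<open>auto simp: spL\<close>)
      finally show ?thesis .
    qed
    have 2: "quad_functional ?Sm \<omega> N gm (b (?mid W V)) \<le> (quad_functional ?Sm \<omega> N gm (b W) + quad_functional ?Sm \<omega> N gm (b V)) / 2"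
    proof -
      have "quad_functional ?Sm \<omega> N gm (b (?mid W V)) = quad_functional ?Sm \<omega> N gm (\<lambda>m x. (b W m x + b V m x) / 2)"
        by (rule qcong) (rule bmid[OF WV])
      also have "\<dots> \<le> (quad_functional ?Sm \<omega> N gm (b W) + quad_functional ?Sm \<omega> N gm (b V)) / 2"
        by (rule Qm(2)[where C=cS and C'=cS]) (use bS bB WV in \<open>auto\<close>)
      finally show ?thesis .
    qed
    have 3: "quad_functional ?Sp \<omega> N hm (b (?mid W V)) \<le> (quad_functional ?Sp \<omega> N hm (b W) + quad_functional ?Sp \<omega> N hm (b V)) / 2"
    proof -
      have "quad_functional ?Sp \<omega> N hm (b (?mid W V)) = quad_functional ?Sp \<omega> N hm (\<lambda>m x. (b W m x + b V m x) / 2)"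
        by (rule qcong) (rule bmid[OF WV])
      also have "\<dots> \<le> (quad_functional ?Sp \<omega> N hm (b W) + quad_functional ?Sp \<omega> N hm (b V)) / 2"
        by (rule Qp(2)[where C=cS and C'=cS]) (use bS bB WV in \<open>auto\<close>)
      finally show ?thesis .
    qed
    have "lam\<^sup>2 * quad_functional ?Sm \<omega> N gm (b (?mid W V)) \<le> lam\<^sup>2 * ((quad_functional ?Sm \<omega> N gm (b W) + quad_functional ?Sm \<omega> N gm (b V)) / 2)"
      "lam\<^sup>2 * quad_functional ?Sp \<omega> N hm (b (?mid W V)) \<le> lam\<^sup>2 * ((quad_functional ?Sp \<omega> N hm (b W) + quad_functional ?Sp \<omega> N hm (b V)) / 2)"
      using 2 3 by (intro mult_left_mono; simp)+
    with 1 show ?thesis unfolding E_def by (simp add: distrib_left add_divide_distrib)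
  qed
  have Elim: "(\<lambda>n. E (X n)) \<longlonglongrightarrow> E u"
    if X: "\<And>n::nat. X n \<in> K" and u: "u \<in> K" and d: "(\<lambda>n. \<Sum>m\<le>N. Hs_dist2 s (X n m) (u m)) \<longlonglongrightarrow> 0" for X u
  proof -
    have st: "(\<lambda>n. sob_rep (X n m) x) \<longlonglongrightarrow> sob_rep (u m) x" "(\<lambda>n. sob_grad (X n m) x) \<longlonglongrightarrow> sob_grad (u m) x" if m: "m \<le> N" for m x
      using sob_tendsto[OF s KH[OF X m] KH[OF u m] Hs_dist2_component_tendsto[OF d m]] by auto
    have lt: "(\<lambda>n. l (X n) m x) \<longlonglongrightarrow> l u m x" if m: "m \<le> N" for m x
      unfolding l_def by (intro tendsto_add tendsto_inner tendsto_const st(2)[OF m] tendsto_sum tendsto_mult st(1)) auto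
    have bt: "(\<lambda>n. b (X n) m x) \<longlonglongrightarrow> b u m x" if m: "m \<le> N" for m x unfolding b_def by (rule st(1)[OF m])
    have "(\<lambda>n. quad_functional ?L \<omega> N F (l (X n))) \<longlonglongrightarrow> quad_functional ?L \<omega> N F (l u)"
      by (rule QL(3)[where C=cL]) (use lmeas lbound X u lt in \<open>auto simp: spL\<close>)
    moreover have "(\<lambda>n. quad_functional ?Sm \<omega> N gm (b (X n))) \<longlonglongrightarrow> quad_functional ?Sm \<omega> N gm (b u)"
      by (rule Qm(3)[where C=cS]) (use bS bB X u bt in auto)
    moreover have "(\<lambda>n. quad_functional ?Sp \<omega> N hm (b (X n))) \<longlonglongrightarrow> quad_functional ?Sp \<omega> N hm (b u)"
      by (rule Qp(3)[where C=cS]) (use bS bB X u bt in auto)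
    ultimately show ?thesis unfolding E_def by (intro tendsto_intros)
  qed

  \<comment> \<open>the integrals in \<open>J\<close> depend on \<open>U\<close> only through an arbitrary extension \<open>W\<close>\<close>
  let ?J = "J_functional \<Omega> T N s H phi_star c f \<alpha> g h \<Phi> lam \<epsilon>"
  have J_eq: "?J U = E W + \<epsilon> * (Hs_vec_norm \<Omega> s N U)\<^sup>2" if W: "\<And>m. m \<le> N \<Longrightarrow> W m \<in> Hs_extensions \<Omega> s (U m)" for U W
  proof -
    have aeW: "AE x in lebesgue. \<forall>m. m \<le> N \<longrightarrow> x \<in> \<Omega> \<longrightarrow> U m x = sob_rep (W m) x \<and> weak_grad \<Omega> (U m) x = sob_grad (W m) x"
      unfolding AE_all_countable
    proof
      fix m
      show "AE x in lebesgue. m \<le> N \<longrightarrow> x \<in> \<Omega> \<longrightarrow> U m x = sob_rep (W m) x \<and> weak_grad \<Omega> (U m) x = sob_grad (W m) x"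
      proof (cases "m \<le> N")
        case True
        show ?thesis using Hs_extension_AE_sob_rep[OF s W[OF True] \<Omega>] weak_grad_AE_sob_grad[OF s W[OF True] op]
          by eventually_elim simp
      qed simp
    qed
    have 1: "(LINT x:\<Omega>|lebesgue. exp (2 * lam * phi_star x) *
        (\<Sum>m\<le>N. (H x \<bullet> weak_grad \<Omega> (U m) x + frozen T N c f \<alpha> \<Phi> U m x)\<^sup>2)) = quad_functional ?L \<omega> N F (l W)"
    proof -
      have "(LINT x:\<Omega>|lebesgue. exp (2 * lam * phi_star x) *
        (\<Sum>m\<le>N. (H x \<bullet> weak_grad \<Omega> (U m) x + frozen T N c f \<alpha> \<Phi> U m x)\<^sup>2)) =
        (\<integral>x. indicator \<Omega> x *\<^sub>R (\<omega> x * (\<Sum>m\<le>N. (l W m x + F m x)\<^sup>2)) \<partial>lebesgue)"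
        unfolding set_lebesgue_integral_def
      proof (rule complete_integral_cong_AE(1)[OF complete_lebesgue])
        show "AE x in lebesgue. indicator \<Omega> x *\<^sub>R (exp (2 * lam * phi_star x) *
          (\<Sum>m\<le>N. (H x \<bullet> weak_grad \<Omega> (U m) x + frozen T N c f \<alpha> \<Phi> U m x)\<^sup>2)) = indicator \<Omega> x *\<^sub>R (\<omega> x * (\<Sum>m\<le>N. (l W m x + F m x)\<^sup>2))"
          using aeW coeff
        proof eventually_elim
          case (elim x)
          show ?case
          proof (cases "x \<in> \<Omega>")
            case True
            have "H x \<bullet> weak_grad \<Omega> (U m) x + frozen T N c f \<alpha> \<Phi> U m x = l W m x + F m x" if m: "m \<le> N" for m
            proof -
              have "(\<Sum>n\<le>N. (S_coeff T N c \<Phi> m n x + M_coeff T N c \<alpha> \<Phi> m n x) * U n x) = (\<Sum>n\<le>N. A m n x * sob_rep (W n) x)"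
                using elim True m by (intro sum.cong refl) auto
              then show ?thesis unfolding frozen_def l_def using elim True m by simp
            qed
            then have "(\<Sum>m\<le>N. (H x \<bullet> weak_grad \<Omega> (U m) x + frozen T N c f \<alpha> \<Phi> U m x)\<^sup>2) = (\<Sum>m\<le>N. (l W m x + F m x)\<^sup>2)"
              by (intro sum.cong refl) auto
            then show ?thesis by (simp add: \<omega>_def)
          qed simp
        qed
      qed
      also have "\<dots> = quad_functional ?L \<omega> N F (l W)"
        unfolding quad_functional_def using \<Omega> by (subst integral_restrict_space) auto
      finally show ?thesis .
    qed
    have bv: "(LINT p:G|surface_measure. exp (2 * lam * phi_star p) *
        (\<Sum>m\<le>N. (boundary_value \<Omega> (U m) p - time_coeff T gg m p)\<^sup>2)) = quad_functional (restrict_space surface_measure G) \<omega> N (\<lambda>m p. - time_coeff T gg m p) (b W)"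
      if G: "G \<in> sets borel" "G \<subseteq> frontier \<Omega>" for G gg
    proof -
      have Gs: "G \<inter> space surface_measure \<in> sets surface_measure" using G(1) borel_subset_surface_measure by auto
      have "(LINT p:G|surface_measure. exp (2 * lam * phi_star p) * (\<Sum>m\<le>N. (boundary_value \<Omega> (U m) p - time_coeff T gg m p)\<^sup>2)) =
        (\<integral>p. indicator G p *\<^sub>R (\<omega> p * (\<Sum>m\<le>N. (b W m p + - time_coeff T gg m p)\<^sup>2)) \<partial>surface_measure)"
        unfolding set_lebesgue_integral_def
      proof (intro Bochner_Integration.integral_cong refl)
        fix p
        show "indicator G p *\<^sub>R (exp (2 * lam * phi_star p) * (\<Sum>m\<le>N. (boundary_value \<Omega> (U m) p - time_coeff T gg m p)\<^sup>2)) =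
          indicator G p *\<^sub>R (\<omega> p * (\<Sum>m\<le>N. (b W m p + - time_coeff T gg m p)\<^sup>2))"
        proof (cases "p \<in> G")
          case True
          then have "p \<in> closure \<Omega>" using G(2) fcl by blast
          then have "(\<Sum>m\<le>N. (boundary_value \<Omega> (U m) p - time_coeff T gg m p)\<^sup>2) = (\<Sum>m\<le>N. (b W m p + - time_coeff T gg m p)\<^sup>2)"
            using boundary_value_eq_sob_rep[OF s W op] by (intro sum.cong refl) (simp add: b_def)
          then show ?thesis by (simp add: \<omega>_def)
        qed simp
      qed
      also have "\<dots> = quad_functional (restrict_space surface_measure G) \<omega> N (\<lambda>m p. - time_coeff T gg m p) (b W)"
        unfolding quad_functional_def using Gs by (subst integral_restrict_space) auto
      finally show ?thesis .
    qed
    show ?thesis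
      unfolding J_functional_def E_def 1 bv[OF \<Gamma>b(1) \<Gamma>f(1)] bv[OF \<Gamma>b(2) \<Gamma>f(2)] gm_def hm_def ..
  qed

  define n2 where "n2 W = (\<Sum>m\<le>N. (Hs_whole_norm s (W m))\<^sup>2)" for W :: "nat \<Rightarrow> 'a \<Rightarrow> real"
  define D where "D W V = (\<Sum>m\<le>N. Hs_dist2 s (W m) (V m))" for W V :: "nat \<Rightarrow> 'a \<Rightarrow> real"
  have par: "n2 (?mid W V) + 1/4 * D W V = (n2 W + n2 V) / 2" if "W \<in> K" "V \<in> K" for W V
    unfolding n2_def D_def by (rule midpoint_square_sum) (use KH that in auto)
  have D0: "0 \<le> D W V" for W V unfolding D_def by (intro sum_nonneg) (simp add: Hs_dist2_def)
  have Kn2: "n2 W \<le> M\<^sup>2" if "W \<in> K" for W using that by (simp add: K_def n2_def)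
  have avg: "x \<le> r" if "x + 1/4 * d = (a + b) / 2" "0 \<le> d" "a \<le> r" "b \<le> r" for x d a b r :: real using that by (simp add: field_simps)
  have Kmid: "?mid W V \<in> K" if "W \<in> K" "V \<in> K" for W V
  proof -
    have "n2 (?mid W V) \<le> M\<^sup>2"
      by (rule avg[OF par[OF that] D0 Kn2[OF that(1)] Kn2[OF that(2)]])
    moreover have "?mid W V m \<in> Hs_whole s" if "m \<le> N" for m
      using Hs_whole_mid KH \<open>W \<in> K\<close> \<open>V \<in> K\<close> that by blast
    ultimately show ?thesis by (simp add: K_def n2_def)
  qed
  define G where "G W = E W + \<epsilon> * n2 W" for W
  have Gconv: "G (?mid W V) + \<epsilon> / 4 * D W V \<le> (G W + G V) / 2" if "W \<in> K" "V \<in> K" for W V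
  proof -
    have "\<epsilon> * (n2 (?mid W V) + 1/4 * D W V) = \<epsilon> * ((n2 W + n2 V) / 2)" using par[OF that] by simp
    then show ?thesis using Emid[OF that] unfolding G_def by (simp add: distrib_left add_divide_distrib)
  qed
  obtain W0 where W0: "W0 \<in> K" "\<And>V. V \<in> K \<Longrightarrow> G W0 \<le> G V"
  proof (rule midpoint_convex_has_minimizer[of K G ?mid "\<epsilon> / 4" D])
    have "(\<lambda>m x. 0) \<in> K" using Hs_zero[where 'a='a] by (simp add: K_def)
    then show "K \<noteq> {}" by blast
    show "0 \<le> G W" if "W \<in> K" for W
      unfolding G_def n2_def using E0 \<epsilon> by (intro add_nonneg_nonneg mult_nonneg_nonneg sum_nonneg) auto
    show "\<exists>u\<in>K. (\<lambda>n. D (X n) u) \<longlonglongrightarrow> 0"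
      if X: "\<And>n::nat. X n \<in> K" and c: "\<forall>e>0. \<exists>N. \<forall>m\<ge>N. \<forall>n\<ge>N. D (X m) (X n) < e" for X
    proof -
      obtain u where u: "\<And>m. m \<le> N \<Longrightarrow> u m \<in> Hs_whole s" "(\<lambda>n. D (X n) u) \<longlonglongrightarrow> 0"
        using Hs_whole_vec_complete[OF s0 KH[OF X] c[unfolded D_def]] unfolding D_def by blast
      have "(\<lambda>n. n2 (X n)) \<longlonglongrightarrow> n2 u"
        unfolding n2_def using u(2)[unfolded D_def]
        by (intro tendsto_sum Hs_whole_norm_tendsto KH[OF X] u(1) Hs_dist2_component_tendsto) auto
      then have "n2 u \<le> M\<^sup>2" by (rule LIMSEQ_le_const2) (use Kn2 X in blast)
      then have "u \<in> K" using u(1) by (simp add: K_def n2_def)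
      then show ?thesis using u(2) by blast
    qed
    show "(\<lambda>n. G (X n)) \<longlonglongrightarrow> G u" if X: "\<And>n::nat. X n \<in> K" and u: "u \<in> K" and d: "(\<lambda>n. D (X n) u) \<longlonglongrightarrow> 0" for X u
    proof -
      have "(\<lambda>n. n2 (X n)) \<longlonglongrightarrow> n2 u"
        unfolding n2_def using d[unfolded D_def]
        by (intro tendsto_sum Hs_whole_norm_tendsto KH[OF X] KH[OF u] Hs_dist2_component_tendsto) auto
      then show ?thesis unfolding G_def by (intro tendsto_add tendsto_mult tendsto_const Elim[OF X u d[unfolded D_def]])
    qed
  qed (use Kmid Gconv \<epsilon> in auto)

  \<comment> \<open>norm-attaining extensions turn values of \<open>J\<close> into values of \<open>G\<close>\<close>
  have attained: "\<exists>W\<in>K. (\<forall>m\<le>N. W m \<in> Hs_extensions \<Omega> s (V m)) \<and> G W = ?J V" if V: "V \<in> Hs_ball \<Omega> s N M" for V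
  proof -
    have VH: "V m \<in> Hs \<Omega> s" if "m \<le> N" for m using V that by (auto simp: Hs_ball_def Hs_vec_def)
    have "\<forall>m. \<exists>w. m \<le> N \<longrightarrow> w \<in> Hs_extensions \<Omega> s (V m) \<and> Hs_norm \<Omega> s (V m) = Hs_whole_norm s w"
      using Hs_norm_attained[OF s VH \<Omega>] by metis
    then obtain W where W: "\<And>m. m \<le> N \<Longrightarrow> W m \<in> Hs_extensions \<Omega> s (V m)" "\<And>m. m \<le> N \<Longrightarrow> Hs_norm \<Omega> s (V m) = Hs_whole_norm s (W m)"
      by metis
    have nV: "(Hs_vec_norm \<Omega> s N V)\<^sup>2 = n2 W" unfolding Hs_vec_norm_def n2_def using W(2) by (simp add: sum_nonneg)
    have "0 \<le> Hs_vec_norm \<Omega> s N V" unfolding Hs_vec_norm_def by (simp add: sum_nonneg)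
    moreover have "Hs_vec_norm \<Omega> s N V \<le> M" using V by (simp add: Hs_ball_def)
    ultimately have "n2 W \<le> M\<^sup>2" unfolding nV[symmetric] by (intro power_mono)
    then have "W \<in> K" using W(1) by (auto simp: K_def n2_def Hs_extensions_def)
    then show ?thesis using W(1) J_eq[of W V] nV unfolding G_def by auto
  qed
  have selfext: "W m \<in> Hs_extensions \<Omega> s (W m)" if "W \<in> K" "m \<le> N" for W m using KH[OF that] by (simp add: Hs_extensions_def)
  have le: "Hs_vec_norm \<Omega> s N W \<le> sqrt (n2 W)" if "W \<in> K" for W
    unfolding Hs_vec_norm_def n2_def
    by (intro real_sqrt_le_mono sum_mono power_mono Hs_norm_le[OF selfext[OF that]]) auto
  have W0ball: "W0 \<in> Hs_ball \<Omega> s N M"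
  proof -
    have "sqrt (n2 W0) \<le> sqrt (M\<^sup>2)" using Kn2[OF W0(1)] by (rule real_sqrt_le_mono)
    then have "Hs_vec_norm \<Omega> s N W0 \<le> M" using le[OF W0(1)] M0 by simp
    moreover have "W0 m \<in> Hs \<Omega> s" if "m \<le> N" for m using selfext[OF W0(1) that] unfolding Hs_def by blast
    ultimately show ?thesis by (simp add: Hs_ball_def Hs_vec_def)
  qed
  \<comment> \<open>\<open>W0\<close> extends itself, but need not have the least norm among its extensions\<close>
  have JW0: "?J W0 \<le> G W0"
  proof -
    have "0 \<le> Hs_vec_norm \<Omega> s N W0" unfolding Hs_vec_norm_def by (simp add: sum_nonneg)
    then have "(Hs_vec_norm \<Omega> s N W0)\<^sup>2 \<le> (sqrt (n2 W0))\<^sup>2" using le[OF W0(1)] by (intro power_mono)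
    also have "\<dots> = n2 W0" by (simp add: n2_def sum_nonneg)
    finally show ?thesis using J_eq[of W0 W0, OF selfext[OF W0(1)]] \<epsilon> by (simp add: G_def)
  qed
  have low: "G W0 \<le> ?J V" if V: "V \<in> Hs_ball \<Omega> s N M" for V
    using attained[OF V] W0(2) by metis
  have min: "is_arg_min ?J (\<lambda>U. U \<in> Hs_ball \<Omega> s N M) W0"
    unfolding is_arg_min_def using W0ball JW0 low by (meson le_less_trans not_le)
  show ?thesis
  proof (intro exI[of _ W0] conjI min allI impI)
    fix V m assume V: "is_arg_min ?J (\<lambda>U. U \<in> Hs_ball \<Omega> s N M) V" and m: "m \<le> N"
    have Vb: "V \<in> Hs_ball \<Omega> s N M" using V by (simp add: is_arg_min_def)
    have JV: "?J V \<le> ?J W0" using V W0ball unfolding is_arg_min_def by (meson not_le)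
    obtain W where W: "W \<in> K" "\<forall>m\<le>N. W m \<in> Hs_extensions \<Omega> s (V m)" "G W = ?J V" using attained[OF Vb] by blast
    \<comment> \<open>the midpoint of two minimizers cannot be better, so the convexity gap \<open>D W W0\<close> vanishes\<close>
    have "G W0 \<le> G (?mid W W0)" by (rule W0(2)[OF Kmid[OF W(1) W0(1)]])
    have gap: "d \<le> 0" if "g0 \<le> gm" "gm + d \<le> (gW + g0) / 2" "gW \<le> g0" for g0 gm gW d :: real using that by (simp add: field_simps)
    have "G W \<le> G W0" using W(3) JV JW0 by linarith
    from gap[OF \<open>G W0 \<le> G (?mid W W0)\<close> Gconv[OF W(1) W0(1)] this]
    have "\<epsilon> / 4 * D W W0 \<le> 0" .
    then have "D W W0 \<le> 0" using \<epsilon> by (simp add: mult_le_0_iff)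
    moreover have "Hs_dist2 s (W m) (W0 m) \<le> D W W0"
      unfolding D_def using m by (intro member_le_sum[of m "{..N}" "\<lambda>m. Hs_dist2 s (W m) (W0 m)"]) (auto simp: Hs_dist2_def)
    moreover have "0 \<le> Hs_dist2 s (W m) (W0 m)" by (simp add: Hs_dist2_def)
    ultimately have d0: "Hs_dist2 s (W m) (W0 m) = 0" by linarith
    have req: "sob_rep (W m) x = sob_rep (W0 m) x" for x
      using sob_dist_bound(1)[OF s KH[OF W(1) m] KH[OF W0(1) m], of x] unfolding d0 by simp
    have "AE x in lebesgue. x \<in> \<Omega> \<longrightarrow> V m x = W0 m x"
      using Hs_extension_AE_sob_rep[OF s W(2)[rule_format, OF m] \<Omega>] Hs_extension_AE_sob_rep[OF s selfext[OF W0(1) m] \<Omega>]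
      by eventually_elim (simp add: req)
    then show "AE x in lebesgue_on \<Omega>. V m x = W0 m x" by (simp add: AE_lebesgue_on_iff[OF \<Omega>])
  qed
qed

end
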